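(* Under assumptions (i)–(vii) of the context, the evolution family $(\mathbf{V}(t,s))_{t\ge s\ge0}$ is honest in $\mathcal{E}$ if and only if, for any $u\in\mathcal{E}_+$, $$\lim_{n\to\infty}\int_s^t\|\mathbf{B}(\tau)\mathbf{V}_n(\tau,s)u\|_{\mathcal{E}}\,\mathrm{d}\tau=0\qquad\forall t\ge s\ge 0.$$
   Context: $\mathcal{E}$ is a real ordered Banach space with (closed) positive cone $\mathcal{E}_+$ that is generating, $\mathcal{E}=\mathcal{E}_+-\mathcal{E}_+$, and on which the norm is additive: $\|u+v\|=\|u\|+\|v\|$ for $u,v\in\mathcal{E}_+$. An evolution family in $\mathcal{E}$ is a family $(\mathbf{U}(t,s))_{t\ge s\ge 0}$ of bounded linear operators on $\mathcal{E}$ such that (a) for each $u\in\mathcal{E}$ the map $(t,s)\mapsto\mathbf{U}(t,s)u$ is continuous on $t\ge s\ge 0$; (b) $\mathbf{U}(t,s)=\mathbf{U}(t,r)\mathbf{U}(r,s)$ and $\mathbf{U}(t,t)=\mathbf{I}$ for $t\ge r\ge s$; (c) $\|\mathbf{U}(t,s)\|\le Ce^{\beta(t-s)}$ for $t\ge s$, for some constants $C,\beta>0$. Assumptions: $(\mathbf{U}(t,s))_{t\ge s\ge0}$ is a given evolution family in $\mathcal{E}$ and $(\mathbf{B}(t))_{t\ge 0}$ is a family of (possibly unbounded) linear operators $\mathbf{B}(t):\mathscr{D}(\mathbf{B}(t))\subset\mathcal{E}\to\mathcal{E}$ such that: (i) $\mathbf{U}(t,s)u\in\mathcal{E}_+$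 for $u\in\mathcal{E}_+$, $t\ge s\ge 0$; (ii) $\|\mathbf{U}(t,s)u\|_{\mathcal{E}}\le\|u\|_{\mathcal{E}}$ for $u\in\mathcal{E}_+$, $t\ge s\ge 0$; (iii) $\mathbf{B}(t)u\in\mathcal{E}_+$ for $u\in\mathscr{D}(\mathbf{B}(t))\cap\mathcal{E}_+$, $t\ge 0$; (iv) for any $u\in\mathcal{E}$ and $s\ge 0$, $\mathbf{U}(t,s)u\in\mathscr{D}(\mathbf{B}(t))$ for a.e. $t\ge s$ and the mapping $t\in[s,\infty)\mapsto\mathbf{B}(t)\mathbf{U}(t,s)u$ is measurable; moreover, for any $t\ge s\ge 0$ and $u\in\mathcal{E}_+$, $\int_s^t\|\mathbf{B}(\tau)\mathbf{U}(\tau,s)u\|_{\mathcal{E}}\,\mathrm{d}\tau\le\|u\|_{\mathcal{E}}-\|\mathbf{U}(t,s)u\|_{\mathcal{E}}$; (v) with $\Delta=\{(t,s):0\le s\le t<\infty\}$ and $\mathfrak{X}=L^1(\mathbb{R}_+,\mathcal{E})$, for any $f\in\mathfrak{X}$ the mapping $(t,s)\in\Delta\mapsto\mathbf{B}(t)\mathbf{U}(t,s)f(s)\in\mathcal{E}$ is well-defined for almost every $(t,s)\in\Delta$ and is measurable; (vi) for any $t\ge0$, $\mathbf{B}(t)$ is "increasingly closed": if $(u_n)_n\subset\mathscr{D}(\mathbf{B}(t))\cap\mathcal{E}_+$ is increasing with $\lim_nu_n=u\in\mathcal{E}_+$ and $\sup_n\|\mathbf{B}(t)u_n\|_{\mathcal{E}}<\infty$,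 then $u\in\mathscr{D}(\mathbf{B}(t))$ and $\lim_n\mathbf{B}(t)u_n=\mathbf{B}(t)u$; (vii) with $\Delta_2=\{(t,s,r):0\le r\le s\le t<\infty\}$, for any $f\in L^1(\Delta,\mathcal{E})$ the mapping $(t,s,r)\in\Delta_2\mapsto\mathbf{B}(t)\mathbf{U}(t,s)f(s,r)\in\mathcal{E}$ is measurable. Set $\mathbf{V}_0(t,s)=\mathbf{U}(t,s)$, $\mathbf{V}_{n+1}(t,s)u=\int_s^t\mathbf{V}_n(t,r)\mathbf{B}(r)\mathbf{U}(r,s)u\,\mathrm{d}r$, and $\mathbf{V}(t,s)u=\sum_{n=0}^\infty\mathbf{V}_n(t,s)u$ for $t\ge s\ge 0$, $u\in\mathcal{E}$; $(\mathbf{V}(t,s))_{t\ge s\ge 0}$ is an evolution family with $\|\mathbf{V}(t,s)u\|\le\|u\|$ for $u\in\mathcal{E}_+$. Under (i)–(vii), for $u\in\mathcal{E}_+$ one has $\mathbf{V}_n(t,s)u\in\mathscr{D}(\mathbf{B}(t))$ for a.e. $t\ge s$. Definition of honesty. $\mathfrak{X}$ has norm $\|f\|_{\mathfrak{X}}=\int_0^\infty\|f(s)\|_{\mathcal{E}}\,\mathrm{d}s$ and positive cone $\mathfrak{X}_+=\{f\in\mathfrak{X}:f(s)\in\mathcal{E}_+\text{ a.e.}\}$; $\mathbf{\Psi}$ is the positive bounded linear functional on $\mathfrak{X}$ with $\langle\mathbf{\Psi},f\rangle=\|f\|_{\mathfrak{X}}$ for $f\in\mathfrak{X}_+$. For $n\ge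 0$ let $[\mathcal{T}_n(t)f](s)=\mathbf{V}_n(s,s-t)f(s-t)$ if $s\ge t$ and $0$ if $0\le s<t$, and $[\mathcal{T}(t)f](s)=\mathbf{V}(s,s-t)f(s-t)$ if $s\ge t$ and $0$ if $0\le s<t$. $(\mathcal{T}_0(t))_{t\ge0}$ and $(\mathcal{T}(t))_{t\ge0}$ are $C_0$-semigroups on $\mathfrak{X}$ with generators $\mathcal{Z}$ and $\mathcal{G}$ respectively; $\mathscr{D}(\mathcal{Z})\subset\mathscr{D}(\mathcal{G})$, and $\widehat{\mathfrak{B}}f=\mathcal{G}f-\mathcal{Z}f$ for $f\in\mathscr{D}(\widehat{\mathfrak{B}})=\mathscr{D}(\mathcal{Z})$. For $f\in\mathscr{D}(\mathcal{Z})$ put $\mathfrak{a}(f)=-\langle\mathbf{\Psi},\mathcal{Z}f+\widehat{\mathfrak{B}}f\rangle$. For $f\in\mathscr{D}(\mathcal{G})$ the limit $\widehat{\mathfrak{a}}(f)=\lim_{t\to0^+}\frac1t\sum_{n=0}^\infty\mathfrak{a}\big(\int_0^t\mathcal{T}_n(s)f\,\mathrm{d}s\big)$ exists (known). The semigroup $(\mathcal{T}(t))_{t\ge0}$ is honest if $\|\mathcal{T}(t)f\|_{\mathfrak{X}}=\|f\|_{\mathfrak{X}}-\widehat{\mathfrak{a}}\big(\int_0^t\mathcal{T}(s)f\,\mathrm{d}s\big)$ for all $f\in\mathfrak{X}_+$ and $t\ge0$. The evolution family $(\mathbf{V}(t,s))_{t\ge s\ge0}$ is honest in $\mathcal{E}$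 if $(\mathcal{T}(t))_{t\ge0}$ is honest in $\mathfrak{X}$. *)

theory Defs
  imports "HOL-Analysis.Analysis"
begin

section \<open>Bochner integration without separability\<close>

text \<open>
  The library's \<open>integrable\<close> and \<open>lebesgue_integral\<close> are restricted to second countable spaces.
  The state space need not be separable, so Bochner's notions are given here for arbitrary
  normed spaces. Measurability is strong measurability: approximation almost everywhere by
  simple functions.
\<close>

definition strongly_measurable :: "'s measure \<Rightarrow> ('s \<Rightarrow> 'b::real_normed_vector) \<Rightarrow> bool" where
  "strongly_measurable M f \<longleftrightarrow>
     (\<exists>\<phi>. (\<forall>i::nat. simple_function M (\<phi> i)) \<and> (AE x in M. (\<lambda>i. \<phi> i x) \<longlonglongrightarrow> f x))"

definition bochner_integrable :: "'s measure \<Rightarrow> ('s \<Rightarrow> 'b::real_normed_vector) \<Rightarrow> bool" where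
  "bochner_integrable M f \<longleftrightarrow>
     strongly_measurable M f \<and> (\<integral>\<^sup>+x. ennreal (norm (f x)) \<partial>M) < \<infinity>"

definition bochner_integral :: "'s measure \<Rightarrow> ('s \<Rightarrow> 'b::real_normed_vector) \<Rightarrow> 'b" where
  "bochner_integral M f =
     (if bochner_integrable M f
      then THE y. \<exists>\<phi>. (\<forall>i::nat. Bochner_Integration.simple_bochner_integrable M (\<phi> i)) \<and>
                      (\<lambda>i. \<integral>\<^sup>+x. ennreal (norm (f x - \<phi> i x)) \<partial>M) \<longlonglongrightarrow> 0 \<and>
                      (\<lambda>i. Bochner_Integration.simple_bochner_integral M (\<phi> i)) \<longlonglongrightarrow> y
      else 0)"

lemma strongly_measurable_zero: "strongly_measurable M (\<lambda>x. 0)"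
  unfolding strongly_measurable_def by (rule exI[of _ "\<lambda>i x. 0"]) auto

lemma strongly_measurable_add:
  assumes "strongly_measurable M f" "strongly_measurable M g"
  shows "strongly_measurable M (\<lambda>x. f x + g x)"
proof -
  obtain \<phi> where \<phi>: "\<And>i::nat. simple_function M (\<phi> i)" "AE x in M. (\<lambda>i. \<phi> i x) \<longlonglongrightarrow> f x"
    using assms(1) unfolding strongly_measurable_def by auto
  obtain \<psi> where \<psi>: "\<And>i::nat. simple_function M (\<psi> i)" "AE x in M. (\<lambda>i. \<psi> i x) \<longlonglongrightarrow> g x"
    using assms(2) unfolding strongly_measurable_def by auto
  have "simple_function M (\<lambda>x. \<phi> i x + \<psi> i x)" for i
    using \<phi>(1) \<psi>(1) by (rule simple_function_compose2)
  moreover have "AE x in M. (\<lambda>i. \<phi> i x + \<psi> i x) \<longlonglongrightarrow> f x + g x"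
    using \<phi>(2) \<psi>(2) by eventually_elim (rule tendsto_add)
  ultimately show ?thesis
    unfolding strongly_measurable_def by (intro exI[of _ "\<lambda>i x. \<phi> i x + \<psi> i x"]) auto
qed

lemma strongly_measurable_scaleR:
  assumes "strongly_measurable M f"
  shows "strongly_measurable M (\<lambda>x. c *\<^sub>R f x)"
proof -
  obtain \<phi> where \<phi>: "\<And>i::nat. simple_function M (\<phi> i)" "AE x in M. (\<lambda>i. \<phi> i x) \<longlonglongrightarrow> f x"
    using assms unfolding strongly_measurable_def by auto
  have "AE x in M. (\<lambda>i. c *\<^sub>R \<phi> i x) \<longlonglongrightarrow> c *\<^sub>R f x"
    using \<phi>(2) by eventually_elim (intro tendsto_intros)
  then show ?thesis
    using \<phi>(1) unfolding strongly_measurable_def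
    by (intro exI[of _ "\<lambda>i x. c *\<^sub>R \<phi> i x"]) (auto intro: simple_function_compose1)
qed

lemma (in complete_measure) strongly_measurable_norm:
  fixes f :: "'a \<Rightarrow> 'b::real_normed_vector"
  assumes "strongly_measurable M f"
  shows "(\<lambda>x. norm (f x)) \<in> borel_measurable M"
proof -
  obtain \<phi> where \<phi>: "\<And>i::nat. simple_function M (\<phi> i)" "AE x in M. (\<lambda>i. \<phi> i x) \<longlonglongrightarrow> f x"
    using assms unfolding strongly_measurable_def by auto
  define h where "h x = lim (\<lambda>i. norm (\<phi> i x))" for x
  have h: "h \<in> borel_measurable M"
    unfolding h_def
    by (intro borel_measurable_lim_metric borel_measurable_simple_function)
      (rule simple_function_compose1[OF \<phi>(1)])
  have ae: "AE x in M. h x = norm (f x)"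
    using \<phi>(2) unfolding h_def by eventually_elim (intro limI tendsto_norm)
  show ?thesis
  proof (rule measurableI)
    fix A :: "real set" assume A: "A \<in> sets borel"
    show "(\<lambda>x. norm (f x)) -` A \<inter> space M \<in> sets M"
    proof (rule in_sets_AE)
      show "AE x in M. x \<in> h -` A \<inter> space M \<longleftrightarrow> x \<in> (\<lambda>x. norm (f x)) -` A \<inter> space M"
        using ae by eventually_elim auto
    qed (use h A in auto)
  qed auto
qed


section \<open>The space \<open>L\<^sup>1(\<real>\<^sub>+, E)\<close>\<close>

abbreviation halfline :: "real measure" where
  "halfline \<equiv> lebesgue_on {0..}"

interpretation halfline: complete_measure halfline
proof
  fix A B :: "real set" assume "B \<subseteq> A" "A \<in> null_sets halfline"
  then show "B \<in> sets halfline"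
    using completion.complete2[of B A lborel]
    by (auto simp: null_sets_restrict_space sets_restrict_space_iff)
qed

definition L1_eq :: "(real \<Rightarrow> 'b::real_normed_vector) \<Rightarrow> (real \<Rightarrow> 'b) \<Rightarrow> bool" where
  "L1_eq f g \<longleftrightarrow>
     bochner_integrable halfline f \<and> bochner_integrable halfline g \<and> (AE s in halfline. f s = g s)"

quotient_type (overloaded) 'b L1 = "real \<Rightarrow> 'b::real_normed_vector" / partial: L1_eq
proof (rule part_equivpI)
  show "\<exists>f::real \<Rightarrow> 'b. L1_eq f f"
    by (rule exI[of _ "\<lambda>s. 0"])
      (auto simp: L1_eq_def bochner_integrable_def strongly_measurable_zero)
  show "symp (L1_eq :: (real \<Rightarrow> 'b) \<Rightarrow> _)"
    by (rule sympI) (simp add: L1_eq_def eq_commute)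
  show "transp (L1_eq :: (real \<Rightarrow> 'b) \<Rightarrow> _)"
  proof (rule transpI)
    fix f g h :: "real \<Rightarrow> 'b"
    assume *: "L1_eq f g" "L1_eq g h"
    then have "AE s in halfline. f s = g s" "AE s in halfline. g s = h s"
      by (simp_all only: L1_eq_def)
    then have "AE s in halfline. f s = h s"
      by eventually_elim simp
    with * show "L1_eq f h"
      by (simp only: L1_eq_def)
  qed
qed

lemma bochner_integrable_halfline_norm:
  "bochner_integrable halfline f \<Longrightarrow> integrable halfline (\<lambda>s. norm (f s))"
  by (intro integrableI_bounded)
    (auto simp: bochner_integrable_def intro: halfline.strongly_measurable_norm)

lemma bochner_integrable_halfline_add:
  assumes "bochner_integrable halfline f" "bochner_integrable halfline g"
  shows "bochner_integrable halfline (\<lambda>s. f s + g s)"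
proof -
  have "(\<integral>\<^sup>+s. ennreal (norm (f s + g s)) \<partial>halfline)
      \<le> (\<integral>\<^sup>+s. ennreal (norm (f s)) + ennreal (norm (g s)) \<partial>halfline)"
    by (intro nn_integral_mono) (simp flip: ennreal_plus add: norm_triangle_ineq)
  also have "\<dots> = (\<integral>\<^sup>+s. ennreal (norm (f s)) \<partial>halfline) + (\<integral>\<^sup>+s. ennreal (norm (g s)) \<partial>halfline)"
    using assms
    by (intro nn_integral_add measurable_compose[OF _ measurable_ennreal]
        halfline.strongly_measurable_norm) (auto simp: bochner_integrable_def)
  also have "\<dots> < \<infinity>"
    using assms by (simp add: bochner_integrable_def)
  finally show ?thesis
    using assms by (simp add: bochner_integrable_def strongly_measurable_add)
qed

lemma bochner_integrable_halfline_scaleR: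
  assumes "bochner_integrable halfline f"
  shows "bochner_integrable halfline (\<lambda>s. c *\<^sub>R f s)"
proof -
  have "(\<integral>\<^sup>+s. ennreal (norm (c *\<^sub>R f s)) \<partial>halfline)
      = ennreal \<bar>c\<bar> * (\<integral>\<^sup>+s. ennreal (norm (f s)) \<partial>halfline)"
    using assms
    by (subst nn_integral_cmult[symmetric]) 
      (auto simp: ennreal_mult bochner_integrable_def
        intro!: measurable_compose[OF _ measurable_ennreal] halfline.strongly_measurable_norm)
  then show ?thesis
    using assms
    by (simp add: bochner_integrable_def strongly_measurable_scaleR ennreal_mult_less_top)
qed

instantiation L1 :: (real_normed_vector) real_normed_vector
begin

lift_definition zero_L1 :: "'a L1" is "\<lambda>s. 0"
  by (auto simp: L1_eq_def bochner_integrable_def strongly_measurable_zero)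

lift_definition plus_L1 :: "'a L1 \<Rightarrow> 'a L1 \<Rightarrow> 'a L1" is "\<lambda>f g s. f s + g s"
proof -
  fix f f' g g' :: "real \<Rightarrow> 'a"
  assume *: "L1_eq f f'" "L1_eq g g'"
  then have "AE s in halfline. f s = f' s" "AE s in halfline. g s = g' s"
    by (simp_all only: L1_eq_def)
  then have "AE s in halfline. f s + g s = f' s + g' s"
    by eventually_elim simp
  with * show "L1_eq (\<lambda>s. f s + g s) (\<lambda>s. f' s + g' s)"
    by (simp only: L1_eq_def bochner_integrable_halfline_add)
qed

lift_definition scaleR_L1 :: "real \<Rightarrow> 'a L1 \<Rightarrow> 'a L1" is "\<lambda>c f s. c *\<^sub>R f s"
proof -
  fix c and f f' :: "real \<Rightarrow> 'a"
  assume *: "L1_eq f f'"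
  then have "AE s in halfline. f s = f' s"
    by (simp only: L1_eq_def)
  then have "AE s in halfline. c *\<^sub>R f s = c *\<^sub>R f' s"
    by eventually_elim simp
  with * show "L1_eq (\<lambda>s. c *\<^sub>R f s) (\<lambda>s. c *\<^sub>R f' s)"
    by (simp only: L1_eq_def bochner_integrable_halfline_scaleR)
qed

lift_definition norm_L1 :: "'a L1 \<Rightarrow> real" is "\<lambda>f. \<integral>s. norm (f s) \<partial>halfline"
proof -
  fix f f' :: "real \<Rightarrow> 'a"
  assume *: "L1_eq f f'"
  then have "AE s in halfline. f s = f' s"
    by (simp only: L1_eq_def)
  then have "AE s in halfline. norm (f s) = norm (f' s)"
    by eventually_elim simp
  with * show "(\<integral>s. norm (f s) \<partial>halfline) = (\<integral>s. norm (f' s) \<partial>halfline)"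
    unfolding L1_eq_def bochner_integrable_def
    by (intro integral_cong_AE halfline.strongly_measurable_norm) auto
qed

definition uminus_L1 :: "'a L1 \<Rightarrow> 'a L1" where "uminus_L1 f = (- 1) *\<^sub>R f"

definition minus_L1 :: "'a L1 \<Rightarrow> 'a L1 \<Rightarrow> 'a L1" where "minus_L1 f g = f + - g"

definition sgn_L1 :: "'a L1 \<Rightarrow> 'a L1" where "sgn_L1 f = inverse (norm f) *\<^sub>R f"

definition dist_L1 :: "'a L1 \<Rightarrow> 'a L1 \<Rightarrow> real" where "dist_L1 f g = norm (f - g)"

definition uniformity_L1 :: "('a L1 \<times> 'a L1) filter" where
  "uniformity_L1 = (INF e\<in>{0<..}. principal {(f, g). dist f g < e})"

definition open_L1 :: "'a L1 set \<Rightarrow> bool" where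
  "open_L1 S \<longleftrightarrow> (\<forall>f\<in>S. \<forall>\<^sub>F (f', g) in uniformity. f' = f \<longrightarrow> g \<in> S)"

instance
proof
  fix f g h :: "'a L1" and a b :: real and S :: "'a L1 set"
  show "f + g + h = f + (g + h)"
    by transfer (auto simp: L1_eq_def add.assoc bochner_integrable_halfline_add)
  show "f + g = g + f"
    by transfer (auto simp: L1_eq_def add.commute bochner_integrable_halfline_add)
  show "0 + f = f"
    by transfer (auto simp: L1_eq_def bochner_integrable_halfline_add)
  show "- f + f = 0"
    unfolding uminus_L1_def
    by transfer (auto simp: L1_eq_def bochner_integrable_def strongly_measurable_zero)
  show "f - g = f + - g" by (rule minus_L1_def)
  show "a *\<^sub>R (f + g) = a *\<^sub>R f + a *\<^sub>R g"
    by transfer (auto simp: L1_eq_def scaleR_add_right bochner_integrable_halfline_add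
        bochner_integrable_halfline_scaleR)
  show "(a + b) *\<^sub>R f = a *\<^sub>R f + b *\<^sub>R f"
    by transfer (auto simp: L1_eq_def scaleR_add_left bochner_integrable_halfline_add
        bochner_integrable_halfline_scaleR)
  show "a *\<^sub>R b *\<^sub>R f = (a * b) *\<^sub>R f"
    by transfer (auto simp: L1_eq_def bochner_integrable_halfline_scaleR)
  show "1 *\<^sub>R f = f"
    by transfer (auto simp: L1_eq_def)
  show "dist f g = norm (f - g)" by (rule dist_L1_def)
  show "sgn f = inverse (norm f) *\<^sub>R f" by (rule sgn_L1_def)
  show "(uniformity :: ('a L1 \<times> 'a L1) filter) = (INF e\<in>{0<..}. principal {(f, g). dist f g < e})"
    by (rule uniformity_L1_def)
  show "open S \<longleftrightarrow> (\<forall>f\<in>S. \<forall>\<^sub>F (f', g) in uniformity. f' = f \<longrightarrow> g \<in> S)"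
    by (rule open_L1_def)
  show "norm f = 0 \<longleftrightarrow> f = 0"
    by transfer (auto simp: L1_eq_def bochner_integrable_def strongly_measurable_zero
        integral_nonneg_eq_0_iff_AE[OF bochner_integrable_halfline_norm])
  show "norm (f + g) \<le> norm f + norm g"
  proof transfer
    fix f g :: "real \<Rightarrow> 'a" assume "L1_eq f f" "L1_eq g g"
    then have fg: "bochner_integrable halfline f" "bochner_integrable halfline g"
      by (auto simp: L1_eq_def)
    have "(\<integral>s. norm (f s + g s) \<partial>halfline) \<le> (\<integral>s. norm (f s) + norm (g s) \<partial>halfline)"
      using fg by (intro integral_mono bochner_integrable_halfline_norm
          bochner_integrable_halfline_add Bochner_Integration.integrable_add norm_triangle_ineq)
    also have "\<dots> = (\<integral>s. norm (f s) \<partial>halfline) + (\<integral>s. norm (g s) \<partial>halfline)"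
      using fg by (intro Bochner_Integration.integral_add bochner_integrable_halfline_norm)
    finally show "(\<integral>s. norm (f s + g s) \<partial>halfline)
        \<le> (\<integral>s. norm (f s) \<partial>halfline) + (\<integral>s. norm (g s) \<partial>halfline)" .
  qed
  show "norm (a *\<^sub>R f) = \<bar>a\<bar> * norm f"
    by transfer simp
qed

end

definition L1_cone :: "'a::{real_normed_vector, ordered_real_vector} L1 set" where
  "L1_cone = {f. AE s in halfline. 0 \<le> rep_L1 f s}"

text \<open>The bounded functional that coincides with the norm on the cone; it is unique when the
  cone of the state space is generating.\<close>

definition norm_functional :: "'a::{real_normed_vector, ordered_real_vector} L1 \<Rightarrow> real" where
  "norm_functional = (THE \<Psi>. bounded_linear \<Psi> \<and> (\<forall>f\<in>L1_cone. \<Psi> f = norm f))"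


section \<open>Evolution families and semigroups\<close>

definition evolution_family :: "(real \<Rightarrow> real \<Rightarrow> 'a::real_normed_vector \<Rightarrow> 'a) \<Rightarrow> bool" where
  "evolution_family U \<longleftrightarrow>
     (\<forall>t s. 0 \<le> s \<and> s \<le> t \<longrightarrow> bounded_linear (U t s)) \<and>
     (\<forall>u. continuous_on {(t, s). 0 \<le> s \<and> s \<le> t} (\<lambda>(t, s). U t s u)) \<and>
     (\<forall>t r s. 0 \<le> s \<and> s \<le> r \<and> r \<le> t \<longrightarrow> U t s = U t r \<circ> U r s) \<and>
     (\<forall>t\<ge>0. U t t = id) \<and>
     (\<exists>C>0. \<exists>\<beta>>0. \<forall>t s. 0 \<le> s \<and> s \<le> t \<longrightarrow> onorm (U t s) \<le> C * exp (\<beta> * (t - s)))"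

text \<open>The domain of the generator is the set of all \<open>f\<close> for which this limit exists. The partially
  defined maps \<open>gen_Z\<close>, \<open>B_hat\<close>, \<open>fun_a\<close> and \<open>a_hat\<close> below are likewise total functions that are
  meaningful on their mathematical domains; honesty only evaluates them there.\<close>

definition generator :: "(real \<Rightarrow> 'b::real_normed_vector \<Rightarrow> 'b) \<Rightarrow> 'b \<Rightarrow> 'b" where
  "generator T f = Lim (at_right 0) (\<lambda>t. (T t f - f) /\<^sub>R t)"

text \<open>An unbounded operator is represented by a total function together with its domain; here
  \<open>B t\<close> is only evaluated at points that lie in its domain for almost every \<open>t\<close>.\<close>

primrec dyson ::
  "(real \<Rightarrow> real \<Rightarrow> 'a \<Rightarrow> 'a) \<Rightarrow> (real \<Rightarrow> 'a \<Rightarrow> 'a) \<Rightarrow> nat \<Rightarrow> real \<Rightarrow> real \<Rightarrow> 'a \<Rightarrow> 'a::real_normed_vector"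
where
  "dyson U B 0 = U"
| "dyson U B (Suc n) =
     (\<lambda>t s u. bochner_integral (lebesgue_on {s..t}) (\<lambda>r. dyson U B n t r (B r (U r s u))))"

definition dyson_sum ::
  "(real \<Rightarrow> real \<Rightarrow> 'a \<Rightarrow> 'a) \<Rightarrow> (real \<Rightarrow> 'a \<Rightarrow> 'a) \<Rightarrow> real \<Rightarrow> real \<Rightarrow> 'a \<Rightarrow> 'a::real_normed_vector"
where
  "dyson_sum U B t s u = (\<Sum>n. dyson U B n t s u)"

definition lift_L1 ::
  "(real \<Rightarrow> real \<Rightarrow> 'a \<Rightarrow> 'a) \<Rightarrow> real \<Rightarrow> 'a L1 \<Rightarrow> 'a::real_normed_vector L1" where
  "lift_L1 W t f = abs_L1 (\<lambda>s. if t \<le> s then W s (s - t) (rep_L1 f (s - t)) else 0)"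


section \<open>Honesty\<close>

context
  fixes U :: "real \<Rightarrow> real \<Rightarrow> 'a \<Rightarrow> 'a::{banach, ordered_real_vector}"
    and B :: "real \<Rightarrow> 'a \<Rightarrow> 'a"
begin

definition T_n :: "nat \<Rightarrow> real \<Rightarrow> 'a L1 \<Rightarrow> 'a L1" where
  "T_n n = lift_L1 (dyson U B n)"

definition T_sum :: "real \<Rightarrow> 'a L1 \<Rightarrow> 'a L1" where
  "T_sum = lift_L1 (dyson_sum U B)"

definition gen_Z :: "'a L1 \<Rightarrow> 'a L1" where
  "gen_Z = generator (T_n 0)"

definition B_hat :: "'a L1 \<Rightarrow> 'a L1" where
  "B_hat f = generator T_sum f - gen_Z f"

definition fun_a :: "'a L1 \<Rightarrow> real" where
  "fun_a f = - norm_functional (gen_Z f + B_hat f)"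

text \<open>The \<open>L\<^sup>1\<close>-valued integrands here and in the definition of honesty are norm continuous
  functions of time, for which the Henstock--Kurzweil integral of the library agrees with the
  Bochner and Riemann integrals.\<close>

definition a_hat :: "'a L1 \<Rightarrow> real" where
  "a_hat f = Lim (at_right 0) (\<lambda>t. (1 / t) * (\<Sum>n. fun_a (integral {0..t} (\<lambda>s. T_n n s f))))"

definition honest_semigroup :: bool where
  "honest_semigroup \<longleftrightarrow>
     (\<forall>f\<in>L1_cone. \<forall>t\<ge>0. norm (T_sum t f) = norm f - a_hat (integral {0..t} (\<lambda>s. T_sum s f)))"

definition honest_evolution_family :: bool where
  "honest_evolution_family \<longleftrightarrow> honest_semigroup"

end

end

theory Submission
  imports Defs
begin

text \<open>
  The evolution family lifts to semigroups on \<open>X = L\<^sup>1(\<real>\<^sub>+, E)\<close>: let \<open>T\<^sub>n\<close> be the lift of the \<open>n\<close>-th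
  Dyson--Phillips term \<open>V\<^sub>n\<close>, and \<open>T\<close> that of the sum. The norm is additive on the cone of \<open>X\<close> too, and
  extends from there to a linear functional \<open>psi\<close>, so mass can be balanced exactly.

  For \<open>g\<close> in the cone of \<open>X\<close> and \<open>h \<ge> 0\<close> put \<open>\<phi>\<^sub>m = \<integral>\<^sub>0\<^sup>h T\<^sub>m(s) g ds\<close>. By induction on \<open>m\<close>,
  \<open>\<phi>\<^sub>m\<close> is in the domain of the generator of \<open>T\<^sub>0\<close>, \<open>T\<^sub>1(k) \<phi>\<^sub>m / k\<close> tends to a positive \<open>w\<^sub>m\<close>
  as \<open>k\<close> tends to \<open>0\<close>, and \<open>(T\<^sub>0(k) \<phi>\<^sub>m - \<phi>\<^sub>m) / k\<close> tends to \<open>T\<^sub>m(h) g - T\<^sub>m(0) g - w\<close>, where \<open>w\<close>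
  is the previous \<open>w\<^sub>m\<close> (\<open>Phi_domain\<close>). Applying \<open>psi\<close>, the series that defines the functional \<open>a_hat\<close>
  telescopes to \<open>\<parallel>g\<parallel> - \<parallel>T(h) g\<parallel> - \<beta>\<^sub>h(g)\<close>, where \<open>\<beta>\<^sub>h(g)\<close> is the limit of the decreasing sequence
  \<open>\<parallel>w\<^sub>m\<parallel>\<close>. The functionals satisfy \<open>\<beta>(h + k, g) = \<beta>(h, g) + \<beta>(k, T(h) g)\<close>. Hence for
  \<open>g = \<integral>\<^sub>0\<^sup>t T(s) f ds\<close> the quotient \<open>\<beta>\<^sub>h(g) / h\<close> tends to \<open>\<beta>\<^sub>t(f)\<close> as \<open>h\<close> tends to \<open>0\<close>, and
  \<open>a_hat g = \<parallel>f\<parallel> - \<parallel>T(t) f\<parallel> - \<beta>\<^sub>t(f)\<close>: honesty means that every \<open>\<beta>\<^sub>t\<close> vanishes on the cone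
  (\<open>honest_iff_beta\<close>).

  On the other hand \<open>\<parallel>w\<^sub>n\<parallel>\<close> is the integral over \<open>r\<close> of \<open>cint n (r + h) r (g r)\<close>, where
  \<open>cint n t s u = \<integral>\<^sub>s\<^sup>t \<parallel>B(\<tau>) V\<^sub>n(\<tau>, s) u\<parallel> d\<tau>\<close> (\<open>norm_BPhi_eq_cint\<close>). These numbers decrease with \<open>n\<close>
  and are at most \<open>\<parallel>u\<parallel> - \<parallel>U(t, s) u\<parallel>\<close>. If all of them tend to \<open>0\<close>, dominated convergence gives \<open>\<beta> = 0\<close>.
  Conversely, if \<open>\<beta> = 0\<close> they tend to \<open>0\<close> for almost every starting time \<open>r\<close>; this is used for the functions
  \<open>r \<mapsto> V\<^sub>j(r, s) u\<close>, and the composition law transfers it to the starting time \<open>s\<close>, because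
  \<open>cint 0 r s u \<le> \<parallel>u\<parallel> - \<parallel>U(r, s) u\<parallel>\<close> is small for \<open>r\<close> close to \<open>s\<close> (\<open>cint_tendsto_0\<close>).

  The analytic core is the identification of \<open>w\<^sub>m\<close>. If \<open>(\<phi> - T\<^sub>0(k) \<phi>) / k\<close> tends to \<open>\<zeta>\<close>, then
  \<open>\<phi>(x) = \<integral>\<^sub>0\<^sup>x U(x, q) \<zeta>(q) dq\<close> (\<open>generator_resolvent\<close>). For positive \<open>\<zeta>\<close> such an integral lies in
  \<open>D(x)\<close> for almost every \<open>x\<close>, since it is an increasing limit of sums to which \<open>B(x)\<close> applies
  (\<open>B_conv\<close>). Finally \<open>V\<^sub>1(x, x - k) \<phi>(x - k)\<close> is compared with the integral of \<open>U(x, q) B(q) \<phi>(q)\<close> over the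
  last step (\<open>step\<close>). The difference is bounded by the mass that the source loses under \<open>U\<close> within
  time \<open>k\<close>, and this is \<open>o(k)\<close> in the mean over \<open>x\<close> (\<open>err_mean_tendsto_0\<close>).
\<close>

section \<open>Strongly measurable functions\<close>

definition strongly_borel :: "'s measure => ('s => 'b::metric_space) => bool" where
 "strongly_borel M f \<longleftrightarrow> f \<in> borel_measurable M \<and> (\<exists>C. countable C \<and> f ` space M \<subseteq> closure C)"

lemma strongly_borel_measurable: "strongly_borel M f ==> f \<in> borel_measurable M"
 by (simp add: strongly_borel_def)

lemma strongly_borel_limit:
 fixes f :: "nat => 's => 'b::metric_space"
 assumes f: "\<And>i. strongly_borel M (f i)" and lim: "\<And>x. x \<in> space M ==> (\<lambda>i. f i x) \<longlonglongrightarrow> g x"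
 shows "strongly_borel M g"
proof -
 have "\<forall>i. \<exists>C. countable C \<and> f i ` space M \<subseteq> closure C"
  using f by (auto simp: strongly_borel_def)
 then obtain C where C: "\<And>i. countable (C i)" "\<And>i. f i ` space M \<subseteq> closure (C i)"
  by metis
 have "g x \<in> closure (\<Union>i. C i)" if "x \<in> space M" for x
 proof (rule Lim_in_closed_set[OF _ _ _ lim[OF that]])
  show "\<forall>\<^sub>F i in sequentially. f i x \<in> closure (\<Union>i. C i)"
   using C(2) that closure_mono[of "C _" "\<Union>i. C i"] by (intro always_eventually) blast
 qed auto
 then show ?thesis
  unfolding strongly_borel_def using C(1) borel_measurable_LIMSEQ_metric[OF strongly_borel_measurable[OF f] lim]
  by (intro conjI exI[of _ "\<Union>i. C i"]) auto
qed

lemma strongly_borel_simple: "simple_function M f ==> strongly_borel M f"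
 unfolding strongly_borel_def
proof (intro conjI exI)
 assume f: "simple_function M f"
 show "f \<in> borel_measurable M"
  by (rule measurable_compose[OF measurable_simple_function[OF f]]) simp
 show "countable (f ` space M)"
  using f by (intro countable_finite) (simp add: simple_function_def)
 show "f ` space M \<subseteq> closure (f ` space M)"
  by (rule closure_subset)
qed

lemma strongly_borel_compose:
 "strongly_borel M f ==> h \<in> measurable N M ==> strongly_borel N (\<lambda>x. f (h x))"
 unfolding strongly_borel_def
proof (elim conjE exE, intro conjI exI)
 fix C assume *: "f \<in> borel_measurable M" "countable C" "f ` space M \<subseteq> closure C" "h \<in> measurable N M"
 show "(\<lambda>x. f (h x)) \<in> borel_measurable N"
  by (rule measurable_compose[OF *(4,1)])
 show "(\<lambda>x. f (h x)) ` space N \<subseteq> closure C"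
  using *(3) measurable_space[OF *(4)] by (intro image_subsetI) (simp add: image_subset_iff)
qed

lemma strongly_borel_continuous:
 fixes f :: "'s::second_countable_topology => 'b::metric_space"
 assumes "continuous_on UNIV f"
 shows "strongly_borel borel f"
proof -
 obtain Q :: "'s set" where Q: "countable Q" "\<And>X. open X ==> X ~= {} ==> \<exists>d\<in>Q. d \<in> X"
  using countable_dense_exists by metis
 have "closure Q = UNIV"
  using Q(2)[of "- closure Q"] closure_subset[of Q] by auto
 then have "range f \<subseteq> closure (f ` Q)"
  using continuous_image_closure_subset[OF assms, of Q] by simp
 then show ?thesis
  using assms Q(1) unfolding strongly_borel_def
  by (auto intro!: borel_measurable_continuous_onI exI[of _ "f ` Q"])
qed

lemma simple_function_bounded_nat:
 assumes meas_k: "k \<in> measurable M (count_space (UNIV::nat set))" and k_le: "\<And>x. k x <= n"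
 shows "simple_function M (\<lambda>x. e (k x))"
proof -
 have 1: "finite (k ` space M)"
  using k_le by (intro finite_subset[of "k ` space M" "{..n}"]) blast+
 have 2: "k -` {i} \<inter> space M \<in> sets M" for i
  by (rule measurable_sets[OF meas_k]) simp
 have 3: "simple_function M k"
  unfolding simple_function_def using 1 2 by blast
 show ?thesis
  using simple_function_compose1[OF 3, of e] .
qed

text \<open>Among the first \<open>n\<close> members of a dense sequence starting with \<open>0\<close>, the \<open>n\<close>-th
 approximation picks one closest to the value of the function; as \<open>0\<close> competes, its norm
 is at most twice that of the function.\<close>

lemma strongly_borel_approx:
 fixes f :: "'s => 'b::real_normed_vector"
 assumes "strongly_borel M f"
 obtains \<phi> where "\<And>i::nat. simple_function M (\<phi> i)" "\<And>x. x \<in> space M ==> (\<lambda>i. \<phi> i x) \<longlonglongrightarrow> f x"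
  "\<And>i x. norm (\<phi> i x) <= 2 * norm (f x)"
proof -
 obtain C where C: "countable C" "f ` space M \<subseteq> closure C" and [measurable]: "f \<in> borel_measurable M"
  using assms by (auto simp: strongly_borel_def)
 define d where "d = from_nat_into (insert 0 C)"
 define e where "e n = (case n of 0 => 0 | Suc n => d n)" for n
 have range_d: "range d = insert 0 C"
  unfolding d_def using C(1) by (intro range_from_nat_into) auto
 define best where "best n x i \<longleftrightarrow> i <= n \<and> (\<forall>j\<le>n. dist (f x) (e i) <= dist (f x) (e j))" for n x i
 define k where "k n x = (LEAST i. best n x i)" for n x
 have ex: "\<exists>i. best n x i" for n x
 proof -
  have "finite {..n}" "{..n} ~= {}" by auto
  then obtain i where "i \<in> {..n}" "\<And>j. j \<in> {..n} ==> dist (f x) (e i) <= dist (f x) (e j)"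
   using ex_min_if_finite[of "(\<lambda>i. dist (f x) (e i)) ` {..n}"]
   by (auto simp: not_less)
  then show ?thesis by (auto simp: best_def)
 qed
 have best: "best n x (k n x)" for n x
  unfolding k_def using ex by (rule LeastI_ex)
 have k_le: "k n x <= n" and k_min: "j <= n ==> dist (f x) (e (k n x)) <= dist (f x) (e j)" for n x j
  using best[of n x] by (auto simp: best_def)
 have meas_k[measurable]: "k n \<in> measurable M (count_space UNIV)" for n
 proof -
  have [measurable]: "(\<lambda>x. dist (f x) (e i)) \<in> borel_measurable M" for i
   by (intro measurable_compose[OF \<open>f \<in> borel_measurable M\<close>] borel_measurable_continuous_onI
     continuous_intros)
  have "Measurable.pred M (\<lambda>x. \<forall>j\<in>{..n}. dist (f x) (e i) <= dist (f x) (e j))" for i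
   by (intro pred_intros_finite) auto
  then have "Measurable.pred M (\<lambda>x. best n x i)" for i
   unfolding best_def by (auto simp: atMost_def intro!: pred_intros_logic)
  then show ?thesis
   unfolding k_def by (rule measurable_Least)
 qed
 have simple_k: "simple_function M (\<lambda>x. e (k n x))" for n
  by (rule simple_function_bounded_nat[OF meas_k k_le])
 have lim_k: "(\<lambda>n. e (k n x)) \<longlonglongrightarrow> f x" if x: "x \<in> space M" for x
 proof (rule LIMSEQ_I)
  fix r :: real assume "0 < r"
  then obtain c where "c \<in> C" "dist c (f x) < r"
   using C(2) x closure_approachable[of "f x" C] by blast
  then obtain m where "d m = c" using range_d by (metis insertCI rangeE)
  then have *: "dist (f x) (e (Suc m)) < r"
   using \<open>dist c (f x) < r\<close> by (simp add: e_def dist_commute)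
  have "norm (e (k n x) - f x) < r" if "n \<ge> Suc m" for n
   using k_min[OF that, of x] * by (simp add: dist_norm norm_minus_commute)
  then show "\<exists>no. \<forall>n\<ge>no. norm (e (k n x) - f x) < r" by blast
 qed
 have norm_k: "norm (e (k n x)) <= 2 * norm (f x)" for n x
 proof -
  have "dist (f x) (e (k n x)) <= norm (f x)"
   using k_min[of 0 n x] by (simp add: e_def)
  then show ?thesis
   using norm_triangle_ineq2[of "e (k n x)" "f x"] by (simp add: dist_norm norm_minus_commute)
 qed
 show ?thesis
  by (rule that[of "\<lambda>n x. e (k n x)"]) (fact simple_k lim_k norm_k)+
qed

lemma strongly_borel_add:
 fixes f g :: "'s => 'b::real_normed_vector"
 assumes "strongly_borel M f" "strongly_borel M g"
 shows "strongly_borel M (\<lambda>x. f x + g x)"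
proof -
 obtain \<phi> where \<phi>: "\<And>i::nat. simple_function M (\<phi> i)" "\<And>x. x \<in> space M ==> (\<lambda>i. \<phi> i x) \<longlonglongrightarrow> f x"
  "\<And>i x. norm (\<phi> i x) <= 2 * norm (f x)"
  by (rule strongly_borel_approx[OF assms(1)]) (rule that)
 obtain \<psi> where \<psi>: "\<And>i::nat. simple_function M (\<psi> i)" "\<And>x. x \<in> space M ==> (\<lambda>i. \<psi> i x) \<longlonglongrightarrow> g x"
  "\<And>i x. norm (\<psi> i x) <= 2 * norm (g x)"
  by (rule strongly_borel_approx[OF assms(2)]) (rule that)
 show ?thesis
 proof (rule strongly_borel_limit)
  show "strongly_borel M (\<lambda>x. \<phi> i x + \<psi> i x)" for i
   by (rule strongly_borel_simple) (rule simple_function_compose2[OF \<phi>(1) \<psi>(1)])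
  show "(\<lambda>i. \<phi> i x + \<psi> i x) \<longlonglongrightarrow> f x + g x" if "x \<in> space M" for x
   by (rule tendsto_add[OF \<phi>(2)[OF that] \<psi>(2)[OF that]])
 qed
qed

text \<open>Approximating \<open>f\<close> by simple functions reduces the claim to finitely many fixed vectors at a time; continuity of \<open>W x\<close> passes to the limit.\<close>

lemma strongly_borel_operator:
 fixes f :: "'s => 'b::real_normed_vector" and W :: "'s => 'b => 'c::metric_space"
 assumes f: "strongly_borel M f" and W: "\<And>v. strongly_borel M (\<lambda>x. W x v)"
  and cont: "\<And>x. x \<in> space M ==> continuous_on UNIV (W x)"
 shows "strongly_borel M (\<lambda>x. W x (f x))"
proof -
 obtain \<phi> where \<phi>: "\<And>i::nat. simple_function M (\<phi> i)" "\<And>x. x \<in> space M ==> (\<lambda>i. \<phi> i x) \<longlonglongrightarrow> f x"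
  "\<And>i x. norm (\<phi> i x) <= 2 * norm (f x)"
  by (rule strongly_borel_approx[OF f]) (rule that)
 have "strongly_borel M (\<lambda>x. W x (\<phi> i x))" for i
  unfolding strongly_borel_def
 proof
  have fin: "finite (\<phi> i ` space M)" using \<phi>(1) by (simp add: simple_function_def)
  show "(\<lambda>x. W x (\<phi> i x)) \<in> borel_measurable M"
  proof (rule measurable_compose_countable'[where f="\<lambda>v x. W x v" and I="\<phi> i ` space M"])
   show "\<phi> i \<in> measurable M (count_space (\<phi> i ` space M))"
    using fin \<phi>(1)[of i] by (auto simp: measurable_count_space_eq2 simple_function_def)
  qed (use W fin in \<open>auto simp: strongly_borel_def intro: countable_finite\<close>)
  have "\<forall>v. \<exists>C. countable C \<and> (\<lambda>x. W x v) ` space M \<subseteq> closure C"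
   using W by (auto simp: strongly_borel_def)
  then obtain C where C: "\<And>v. countable (C v)" "\<And>v. (\<lambda>x. W x v) ` space M \<subseteq> closure (C v)"
   by metis
  let ?C = "\<Union>v\<in>\<phi> i ` space M. C v"
  have "W x (\<phi> i x) \<in> closure ?C" if "x \<in> space M" for x
   using C(2)[of "\<phi> i x"] that closure_mono[of "C (\<phi> i x)" ?C] by blast
  then show "\<exists>C. countable C \<and> (\<lambda>x. W x (\<phi> i x)) ` space M \<subseteq> closure C"
   using C(1) by (intro exI[of _ ?C] conjI countable_UN countable_finite[OF fin]) auto
 qed
 note meas = this
 show ?thesis
 proof (rule strongly_borel_limit[where f="\<lambda>i x. W x (\<phi> i x)"])
  show "strongly_borel M (\<lambda>x. W x (\<phi> i x))" for i
   by (rule meas)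
  show "(\<lambda>i. W x (\<phi> i x)) \<longlonglongrightarrow> W x (f x)" if "x \<in> space M" for x
   by (rule continuous_on_tendsto_compose[OF cont[OF that] \<phi>(2)[OF that]]) auto
 qed
qed

lemma strongly_borel_const: "strongly_borel M (\<lambda>x. c)"
 by (rule strongly_borel_simple) simp

lemma strongly_borel_linear:
 fixes f :: "'s => 'b::real_normed_vector" and T :: "'b => 'c::metric_space"
 assumes "strongly_borel M f" "continuous_on UNIV T"
 shows "strongly_borel M (\<lambda>x. T (f x))"
 using strongly_borel_operator[OF assms(1), of "\<lambda>x. T"] assms(2) by (simp add: strongly_borel_const)

lemma strongly_borel_diff:
 fixes f g :: "'s => 'b::real_normed_vector"
 assumes "strongly_borel M f" "strongly_borel M g"
 shows "strongly_borel M (\<lambda>x. f x - g x)"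
 using strongly_borel_add[OF assms(1) strongly_borel_linear[OF assms(2), of uminus]]
 by (simp add: continuous_on_minus)

lemma strongly_borel_norm:
 assumes "strongly_borel M f"
 shows "(\<lambda>x. norm (f x)) \<in> borel_measurable M"
 by (rule measurable_compose[OF strongly_borel_measurable[OF assms] borel_measurable_continuous_onI])
  (rule continuous_on_norm_id)

lemma strongly_borel_If:
 assumes "strongly_borel M f" "strongly_borel M g" "{x\<in>space M. P x} \<in> sets M"
 shows "strongly_borel M (\<lambda>x. if P x then f x else g x)"
proof -
 obtain C where C: "countable C" "f ` space M \<subseteq> closure C"
  using assms(1) unfolding strongly_borel_def by blast
 obtain C' where C': "countable C'" "g ` space M \<subseteq> closure C'"
  using assms(2) unfolding strongly_borel_def by blast
 have "(\<lambda>x. if P x then f x else g x) ` space M \<subseteq> closure (C \<union> C')"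
  unfolding closure_Un using C(2) C'(2) by (intro image_subsetI) (simp add: image_subset_iff)
 moreover have "countable (C \<union> C')"
  using C(1) C'(1) by blast
 moreover have "(\<lambda>x. if P x then f x else g x) \<in> borel_measurable M"
  by (rule measurable_If[OF strongly_borel_measurable[OF assms(1)] strongly_borel_measurable[OF assms(2)] assms(3)])
 ultimately show ?thesis
  unfolding strongly_borel_def by blast
qed

lemma complete_measure_lebesgue_on:
 assumes "S \<in> sets lebesgue"
 shows "complete_measure (lebesgue_on S)"
proof
 fix A B :: "'a set" assume *: "B \<subseteq> A" "A \<in> null_sets (lebesgue_on S)"
 have "B \<subseteq> S"
  using * null_setsD2[OF *(2)] sets.sets_into_space[of A "lebesgue_on S"] by (auto simp: space_restrict_space)
 have "A \<in> null_sets lebesgue"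
  using * assms by (auto simp: null_sets_restrict_space)
 then have "B \<in> sets lebesgue"
  using completion.complete2[of B A lborel] *(1) by auto
 then show "B \<in> sets (lebesgue_on S)"
  using assms \<open>B \<subseteq> S\<close> by (auto simp: sets_restrict_space_iff)
qed

lemma AE_lebesgue_on_iff:
 assumes "S \<in> sets lebesgue"
 shows "(AE x in lebesgue_on S. P x) \<longleftrightarrow> (AE x in lborel. x \<in> S --> P x)"
 using assms by (simp add: AE_restrict_space_iff AE_completion_iff)

lemma nn_integral_lebesgue_on:
 assumes "S \<in> sets lebesgue"
 shows "(\<integral>\<^sup>+x. f x \<partial>lebesgue_on S) = (\<integral>\<^sup>+x. f x * indicator S x \<partial>lborel)"
 using assms by (simp add: nn_integral_restrict_space nn_integral_completion)

lemma simple_function_lebesgue_on: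
 assumes "simple_function borel \<phi>"
 shows "simple_function (lebesgue_on S) \<phi>"
proof -
 have fin: "finite (range \<phi>)" and meas: "\<phi> -` {y} \<in> sets borel" for y
 proof -
  show "finite (range \<phi>)" using assms by (simp add: simple_function_def)
  show "\<phi> -` {y} \<in> sets borel"
   using measurable_sets[OF measurable_simple_function[OF assms], of "{y}"] by simp
 qed
 show ?thesis
  unfolding simple_function_def
 proof (intro conjI ballI)
  show "finite (\<phi> ` space (lebesgue_on S))"
   by (rule finite_subset[OF _ fin]) auto
  fix y
  have "\<phi> -` {y} \<inter> space (lebesgue_on S) = S \<inter> \<phi> -` {y}"
   by (auto simp: space_restrict_space)
  then show "\<phi> -` {y} \<inter> space (lebesgue_on S) \<in> sets (lebesgue_on S)"
   using meas[of y] by (simp add: sets_restrict_space)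
 qed
qed

lemma strongly_borel_imp_strongly_measurable:
 fixes g :: "'s::euclidean_space => 'b::real_normed_vector"
 assumes "strongly_borel borel g" "AE x in lebesgue_on S. f x = g x"
 shows "strongly_measurable (lebesgue_on S) f"
proof -
 obtain \<phi> where \<phi>: "\<And>i::nat. simple_function borel (\<phi> i)" "\<And>x. x \<in> space borel ==> (\<lambda>i. \<phi> i x) \<longlonglongrightarrow> g x"
  "\<And>i x. norm (\<phi> i x) <= 2 * norm (g x)"
  by (rule strongly_borel_approx[OF assms(1)]) (rule that)
 have "AE x in lebesgue_on S. (\<lambda>i. \<phi> i x) \<longlonglongrightarrow> f x"
  using assms(2) by eventually_elim (use \<phi>(2) in simp)
 then show ?thesis
  unfolding strongly_measurable_def using simple_function_lebesgue_on[OF \<phi>(1)] by blast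
qed

lemma strongly_borel_zero_outside:
 assumes "strongly_borel borel f" "A \<in> sets borel"
 shows "strongly_borel borel (\<lambda>x. if x \<in> A then f x else 0)"
proof (rule strongly_borel_If[OF assms(1) strongly_borel_const])
 show "{x \<in> space borel. x \<in> A} \<in> sets borel" using assms(2) by simp
qed

text \<open>On the complement of a Borel null set, a strongly Lebesgue measurable function is the
 everywhere limit of Borel simple functions.\<close>

lemma strongly_measurable_borel_version:
 fixes f :: "'s::euclidean_space => 'b::real_normed_vector"
 assumes f: "strongly_measurable (lebesgue_on S) f" and S: "S \<in> sets borel"
 obtains g where "strongly_borel borel g" "\<And>x. x \<notin> S ==> g x = 0"
  "AE x in lborel. x \<in> S --> f x = g x"
proof -
 have S': "S \<in> sets lebesgue" using S by simp
 obtain \<phi> where \<phi>: "\<And>i::nat. simple_function (lebesgue_on S) (\<phi> i)"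
   "AE x in lebesgue_on S. (\<lambda>i. \<phi> i x) \<longlonglongrightarrow> f x"
  using f unfolding strongly_measurable_def by blast
 have "\<exists>\<psi>. simple_function lborel \<psi> \<and> (AE x in lborel. (if x \<in> S then \<phi> i x else 0) = \<psi> x)" for i
 proof (rule completion_ex_simple_function)
  show "simple_function lebesgue (\<lambda>x. if x \<in> S then \<phi> i x else 0)"
   unfolding simple_function_def
  proof (intro conjI ballI)
   have "finite (\<phi> i ` S)"
    using \<phi>(1)[of i] by (simp add: simple_function_def space_restrict_space)
   moreover have "(\<lambda>x. if x \<in> S then \<phi> i x else 0) ` space lebesgue \<subseteq> insert 0 (\<phi> i ` S)"
    by (rule image_subsetI) simp
   ultimately show "finite ((\<lambda>x. if x \<in> S then \<phi> i x else 0) ` space lebesgue)"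
    by (meson finite_insert finite_subset)
   fix y
   have "S \<inter> \<phi> i -` {y} \<in> sets (lebesgue_on S)"
    using measurable_sets[OF measurable_simple_function[OF \<phi>(1)[of i]], of "{y}"]
    by (simp add: space_restrict_space Int_commute)
   then have *: "S \<inter> \<phi> i -` {y} \<in> sets lebesgue"
    using S' by (simp add: sets_restrict_space_iff)
   have "(\<lambda>x. if x \<in> S then \<phi> i x else 0) -` {y} \<inter> space lebesgue
     = (S \<inter> \<phi> i -` {y}) \<union> (if y = 0 then - S else {})"
    by (auto split: if_splits)
   also have "\<dots> \<in> sets lebesgue"
    using * S' by (auto simp: Compl_in_sets_lebesgue)
   finally show "(\<lambda>x. if x \<in> S then \<phi> i x else 0) -` {y} \<inter> space lebesgue \<in> sets lebesgue" .
  qed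
 qed
 then have ex: "\<forall>i. \<exists>\<psi>. simple_function lborel \<psi> \<and> (AE x in lborel. (if x \<in> S then \<phi> i x else 0) = \<psi> x)"
  by (rule allI)
 obtain \<psi> where "\<forall>i. simple_function lborel (\<psi> i) \<and> (AE x in lborel. (if x \<in> S then \<phi> i x else 0) = \<psi> i x)"
  using choice[OF ex] by (rule exE)
 then have \<psi>: "\<And>i. simple_function lborel (\<psi> i)"
   "\<And>i. AE x in lborel. (if x \<in> S then \<phi> i x else 0) = \<psi> i x"
  by simp_all
 have "AE x in lborel. \<forall>i. (if x \<in> S then \<phi> i x else 0) = \<psi> i x"
  using \<psi>(2) by (simp add: AE_all_countable)
 moreover have "AE x in lborel. x \<in> S --> (\<lambda>i. \<phi> i x) \<longlonglongrightarrow> f x"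
  using \<phi>(2) S' by (simp add: AE_lebesgue_on_iff)
 ultimately have "AE x in lborel. x \<in> S --> (\<lambda>i. \<psi> i x) \<longlonglongrightarrow> f x"
  by eventually_elim auto
 then obtain N where N: "N \<in> null_sets lborel" "\<And>x. x \<notin> N ==> x \<in> S ==> (\<lambda>i. \<psi> i x) \<longlonglongrightarrow> f x"
  by (auto elim!: AE_E3)
 let ?A = "S - N"
 have A: "?A \<in> sets borel" using S N(1) by (auto simp: null_sets_def)
 show thesis
 proof (rule that[of "\<lambda>x. if x \<in> ?A then f x else 0"])
  show "strongly_borel borel (\<lambda>x. if x \<in> ?A then f x else 0)"
  proof (rule strongly_borel_limit[where f="\<lambda>i x. if x \<in> ?A then \<psi> i x else 0"])
   have "simple_function borel (\<psi> i)" for i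
    using \<psi>(1)[of i] by (simp add: simple_function_def)
   then show "strongly_borel borel (\<lambda>x. if x \<in> ?A then \<psi> i x else 0)" for i
    by (intro strongly_borel_zero_outside[OF _ A] strongly_borel_simple)
   show "(\<lambda>i. if x \<in> ?A then \<psi> i x else 0) \<longlonglongrightarrow> (if x \<in> ?A then f x else 0)" for x
    using N(2)[of x] by auto
  qed
  have "AE x in lborel. x \<notin> N" using N(1) by (rule AE_not_in)
  then show "AE x in lborel. x \<in> S --> f x = (if x \<in> ?A then f x else 0)"
   by eventually_elim auto
 qed auto
qed

text \<open>Being measurable everywhere, and not only after a change on a null set, such functions can be translated and composed with operators pointwise.\<close>

definition bochner_borel :: "(real => 'b::real_normed_vector) => bool" where
 "bochner_borel f \<longleftrightarrow> strongly_borel borel f \<and> (\<integral>\<^sup>+x. ennreal (norm (f x)) \<partial>lborel) < \<infinity>"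

lemma bochner_borel_imp_bochner_integrable:
 assumes g: "bochner_borel g" and f: "AE x in lborel. x \<in> S --> f x = g x" and S: "S \<in> sets lebesgue"
 shows "bochner_integrable (lebesgue_on S) f"
 unfolding bochner_integrable_def
proof
 have ae: "AE x in lebesgue_on S. f x = g x"
  using f S by (simp add: AE_lebesgue_on_iff)
 show "strongly_measurable (lebesgue_on S) f"
  using g ae by (auto simp: bochner_borel_def intro: strongly_borel_imp_strongly_measurable)
 have "(\<integral>\<^sup>+x. ennreal (norm (f x)) \<partial>lebesgue_on S) = (\<integral>\<^sup>+x. ennreal (norm (g x)) \<partial>lebesgue_on S)"
  by (rule nn_integral_cong_AE) (use ae in eventually_elim, simp)
 also have "\<dots> <= (\<integral>\<^sup>+x. ennreal (norm (g x)) \<partial>lborel)"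
  using S by (subst nn_integral_lebesgue_on) (auto intro!: nn_integral_mono simp: indicator_def)
 also have "\<dots> < \<infinity>" using g by (simp add: bochner_borel_def)
 finally show "(\<integral>\<^sup>+x. ennreal (norm (f x)) \<partial>lebesgue_on S) < \<infinity>" .
qed

lemma bochner_integrable_borel_version:
 assumes f: "bochner_integrable (lebesgue_on S) f" and S: "S \<in> sets borel"
 obtains g where "bochner_borel g" "\<And>x. x \<notin> S ==> g x = 0"
  "AE x in lborel. x \<in> S --> f x = g x"
  "(\<integral>\<^sup>+x. ennreal (norm (g x)) \<partial>lborel) = (\<integral>\<^sup>+x. ennreal (norm (f x)) \<partial>lebesgue_on S)"
proof -
 have sm: "strongly_measurable (lebesgue_on S) f"
  using f by (simp add: bochner_integrable_def)
 obtain g where g: "strongly_borel borel g" "\<And>x. x \<notin> S ==> g x = 0"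
   "AE x in lborel. x \<in> S --> f x = g x"
  by (rule strongly_measurable_borel_version[OF sm S]) (rule that)
 have S': "S \<in> sets lebesgue" using S by simp
 have *: "(\<integral>\<^sup>+x. ennreal (norm (g x)) \<partial>lborel) = (\<integral>\<^sup>+x. ennreal (norm (f x)) * indicator S x \<partial>lborel)"
  by (rule nn_integral_cong_AE, use g(3) in eventually_elim) (use g(2) in \<open>auto simp: indicator_def\<close>)
 then have "bochner_borel g"
  using f g(1) by (simp add: bochner_borel_def bochner_integrable_def nn_integral_lebesgue_on[OF S'])
 then show thesis
  using that[OF _ g(2,3)] * by (simp add: nn_integral_lebesgue_on[OF S'])
qed

section \<open>Bochner integrals over intervals are Henstock--Kurzweil integrals\<close>

lemma has_integral_indicator_interval:
 assumes "A \<in> sets lebesgue"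
 shows "(indicat_real A has_integral measure lebesgue (A \<inter> {a..b})) {a..b::real}"
proof -
 have "A \<inter> {a..b} \<in> lmeasurable"
  using assms by (intro bounded_set_imp_lmeasurable bounded_Int sets.Int) simp_all
 then have "(indicat_real (A \<inter> {a..b}) has_integral measure lebesgue (A \<inter> {a..b})) UNIV"
  by (simp add: lmeasurable_iff_has_integral)
 moreover have "indicat_real (A \<inter> {a..b}) = (\<lambda>x. if x \<in> {a..b} then indicat_real A x else 0)"
  by (auto simp: indicator_def)
 ultimately show ?thesis
  using has_integral_restrict_UNIV by metis
qed

lemma has_integral_simple_bochner_integral:
 assumes "Bochner_Integration.simple_bochner_integrable (lebesgue_on {a..b::real}) \<phi>"
 shows "(\<phi> has_integral Bochner_Integration.simple_bochner_integral (lebesgue_on {a..b}) \<phi>) {a..b}"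
proof -
 have sf: "simple_function (lebesgue_on {a..b}) \<phi>"
  using assms by (auto elim: simple_bochner_integrable.cases)
 have fin: "finite (\<phi> ` {a..b})"
  using sf by (simp add: simple_function_def space_restrict_space)
 define A where "A y = {x\<in>{a..b}. \<phi> x = y}" for y
 have A: "A y \<in> sets lebesgue" for y
 proof -
  have "\<phi> -` {y} \<inter> space (lebesgue_on {a..b}) \<in> sets (lebesgue_on {a..b})"
   by (rule measurable_sets[OF measurable_simple_function[OF sf]]) simp
  moreover have "\<phi> -` {y} \<inter> space (lebesgue_on {a..b}) = A y"
   by (auto simp: A_def space_restrict_space)
  ultimately show ?thesis
   by (simp add: sets_restrict_space_iff)
 qed
 have int: "((\<lambda>x. \<Sum>y\<in>\<phi> ` {a..b}. indicat_real (A y) x *\<^sub>R y) has_integral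
   (\<Sum>y\<in>\<phi> ` {a..b}. measure lebesgue (A y \<inter> {a..b}) *\<^sub>R y)) {a..b}"
  by (intro has_integral_sum fin has_integral_scaleR_left has_integral_indicator_interval A)
 have pt: "(\<Sum>y\<in>\<phi> ` {a..b}. indicat_real (A y) x *\<^sub>R y) = \<phi> x" if "x \<in> {a..b}" for x
 proof -
  have "(\<Sum>y\<in>\<phi> ` {a..b}. indicat_real (A y) x *\<^sub>R y) = (\<Sum>y\<in>\<phi> ` {a..b}. if \<phi> x = y then y else 0)"
   using that by (intro sum.cong) (auto simp: A_def)
  then show ?thesis
   using that fin by simp
 qed
 have meas: "measure lebesgue (A y \<inter> {a..b}) = measure (lebesgue_on {a..b}) {x \<in> space (lebesgue_on {a..b}). \<phi> x = y}" for y
 proof -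
  have "{x \<in> space (lebesgue_on {a..b}). \<phi> x = y} = A y" "A y \<inter> {a..b} = A y" "A y \<subseteq> {a..b}"
   by (auto simp: A_def space_restrict_space)
  then show ?thesis
   by (simp add: measure_restrict_space)
 qed
 have sp: "space (lebesgue_on {a..b}) = {a..b}"
  by (simp add: space_restrict_space)
 show ?thesis
  unfolding Bochner_Integration.simple_bochner_integral_def
  using has_integral_eq[OF pt int] unfolding meas sp .
qed

text \<open>If \<open>f\<close> is dominated up to \<open>n i\<close> by integrable functions, and the integrals of the
 \<open>n i\<close> tend to \<open>0\<close>, then Riemann sums of \<open>f\<close> follow those of the approximants.\<close>

lemma has_integral_L1_limit:
 fixes f :: "real => 'b::banach" and n :: "nat => real => real"
 assumes \<phi>: "\<And>i. (\<phi> i has_integral y i) {a..b}" and n: "\<And>i. (n i has_integral e i) {a..b}"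
  and le: "\<And>i x. x \<in> {a..b} ==> norm (f x - \<phi> i x) <= n i x" and e: "e \<longlonglongrightarrow> 0"
 shows "\<exists>z. (f has_integral z) {a..b} \<and> y \<longlonglongrightarrow> z"
proof -
 have dist_y: "norm (y i - y j) <= e i + e j" for i j
 proof -
  have "norm (integral {a..b} (\<lambda>x. \<phi> i x - \<phi> j x)) <= integral {a..b} (\<lambda>x. n i x + n j x)"
  proof (rule integral_norm_bound_integral)
   show "(\<lambda>x. \<phi> i x - \<phi> j x) integrable_on {a..b}" "(\<lambda>x. n i x + n j x) integrable_on {a..b}"
    using \<phi> n by (auto intro!: integrable_diff integrable_add)
   fix x assume "x \<in> {a..b}"
   then show "norm (\<phi> i x - \<phi> j x) <= n i x + n j x"
    using le[of x i] le[of x j] norm_triangle_ineq4[of "f x - \<phi> j x" "f x - \<phi> i x"] by simp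
  qed
  then show ?thesis
   using has_integral_diff[OF \<phi>[of i] \<phi>[of j]] has_integral_add[OF n[of i] n[of j]]
   by (simp add: integral_unique)
 qed
 have "Cauchy y"
 proof (rule metric_CauchyI)
  fix r :: real assume "0 < r"
  then obtain N where N: "\<And>i. i \<ge> N ==> \<bar>e i\<bar> < r / 2"
   using LIMSEQ_D[OF e, of "r/2"] by auto
  have "dist (y i) (y j) < r" if "i \<ge> N" "j \<ge> N" for i j
   using dist_y[of i j] N[OF that(1)] N[OF that(2)] by (simp add: dist_norm abs_less_iff)
  then show "\<exists>M. \<forall>m\<ge>M. \<forall>n\<ge>M. dist (y m) (y n) < r" by blast
 qed
 then obtain z where z: "y \<longlonglongrightarrow> z"
  using Cauchy_convergent_iff convergent_def by blast
 have "(f has_integral z) {a..b}"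
  unfolding has_integral_real
 proof (intro allI impI)
  fix r :: real assume r: "0 < r"
  obtain N1 where N1: "\<And>i. i \<ge> N1 ==> \<bar>e i\<bar> < r / 4"
   using LIMSEQ_D[OF e, of "r/4"] r by auto
  obtain N2 where N2: "\<And>i. i \<ge> N2 ==> norm (y i - z) < r / 4"
   using LIMSEQ_D[OF z, of "r/4"] r by auto
  define i where "i = max N1 N2"
  have ei: "e i < r / 4" and yi: "norm (y i - z) < r / 4"
   using N1[of i] N2[of i] by (auto simp: i_def abs_less_iff)
  obtain \<gamma>1 where \<gamma>1: "gauge \<gamma>1" "\<And>\<D>. \<D> tagged_division_of {a..b} ==> \<gamma>1 fine \<D> ==>
    norm ((\<Sum>(x,k)\<in>\<D>. measure lborel k *\<^sub>R \<phi> i x) - y i) < r / 4"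
   using \<phi>[of i] r unfolding has_integral_real by (meson divide_pos_pos zero_less_numeral)
  obtain \<gamma>2 where \<gamma>2: "gauge \<gamma>2" "\<And>\<D>. \<D> tagged_division_of {a..b} ==> \<gamma>2 fine \<D> ==>
    norm ((\<Sum>(x,k)\<in>\<D>. measure lborel k *\<^sub>R n i x) - e i) < r / 4"
   using n[of i] r unfolding has_integral_real by (meson divide_pos_pos zero_less_numeral)
  show "\<exists>\<gamma>. gauge \<gamma> \<and> (\<forall>\<D>. \<D> tagged_division_of {a..b} \<and> \<gamma> fine \<D> -->
    norm ((\<Sum>(x,k)\<in>\<D>. measure lborel k *\<^sub>R f x) - z) < r)"
  proof (intro exI[of _ "\<lambda>x. \<gamma>1 x \<inter> \<gamma>2 x"] conjI allI impI)
   show "gauge (\<lambda>x. \<gamma>1 x \<inter> \<gamma>2 x)" using \<gamma>1(1) \<gamma>2(1) by (rule gauge_Int)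
   fix \<D> assume D: "\<D> tagged_division_of {a..b} \<and> (\<lambda>x. \<gamma>1 x \<inter> \<gamma>2 x) fine \<D>"
   then have 1: "norm ((\<Sum>(x,k)\<in>\<D>. measure lborel k *\<^sub>R \<phi> i x) - y i) < r / 4"
    and 2: "norm ((\<Sum>(x,k)\<in>\<D>. measure lborel k *\<^sub>R n i x) - e i) < r / 4"
    using \<gamma>1(2) \<gamma>2(2) by (auto simp: fine_Int)
   have "norm ((\<Sum>(x,k)\<in>\<D>. measure lborel k *\<^sub>R f x) - (\<Sum>(x,k)\<in>\<D>. measure lborel k *\<^sub>R \<phi> i x))
     = norm (\<Sum>(x,k)\<in>\<D>. measure lborel k *\<^sub>R (f x - \<phi> i x))"
    by (simp add: sum_subtractf[symmetric] split_def scaleR_diff_right)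
   also have "\<dots> <= (\<Sum>(x,k)\<in>\<D>. measure lborel k *\<^sub>R n i x)"
   proof (rule sum_norm_le)
    fix p assume p: "p \<in> \<D>"
    obtain x k where pk: "p = (x, k)" by (cases p)
    then have "x \<in> {a..b}"
     using p D tagged_division_ofD(2,3)[of \<D> "{a..b}" x k] by auto
    then show "norm (case p of (x,k) => measure lborel k *\<^sub>R (f x - \<phi> i x)) <= (case p of (x,k) => measure lborel k *\<^sub>R n i x)"
     using le[of x i] pk by (simp add: mult_left_mono)
   qed
   also have "\<dots> < e i + r / 4"
    using order.strict_trans1[OF abs_ge_self 2[unfolded real_norm_def]] by linarith
   finally have 3: "norm ((\<Sum>(x,k)\<in>\<D>. measure lborel k *\<^sub>R f x) - (\<Sum>(x,k)\<in>\<D>. measure lborel k *\<^sub>R \<phi> i x)) < r / 2"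
    using ei by simp
   have "(\<Sum>(x,k)\<in>\<D>. measure lborel k *\<^sub>R f x) - z =
     ((\<Sum>(x,k)\<in>\<D>. measure lborel k *\<^sub>R f x) - (\<Sum>(x,k)\<in>\<D>. measure lborel k *\<^sub>R \<phi> i x)) +
     (((\<Sum>(x,k)\<in>\<D>. measure lborel k *\<^sub>R \<phi> i x) - y i) + (y i - z))"
    by simp
   moreover have "norm (p + (q + s)) <= norm p + (norm q + norm s)" for p q s :: 'b
    by (intro order_trans[OF norm_triangle_ineq add_left_mono] norm_triangle_ineq)
   ultimately have "norm ((\<Sum>(x,k)\<in>\<D>. measure lborel k *\<^sub>R f x) - z) \<le>
     norm ((\<Sum>(x,k)\<in>\<D>. measure lborel k *\<^sub>R f x) - (\<Sum>(x,k)\<in>\<D>. measure lborel k *\<^sub>R \<phi> i x)) +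
     (norm ((\<Sum>(x,k)\<in>\<D>. measure lborel k *\<^sub>R \<phi> i x) - y i) + norm (y i - z))"
    by (simp only:)
   then show "norm ((\<Sum>(x,k)\<in>\<D>. measure lborel k *\<^sub>R f x) - z) < r"
    using 1 3 yi by linarith
  qed
 qed
 with z show ?thesis by blast
qed

lemma has_integral_bochner_approx:
 fixes f :: "real => 'b::banach"
 assumes f: "strongly_measurable (lebesgue_on {a..b}) f"
  and \<phi>: "\<And>i. Bochner_Integration.simple_bochner_integrable (lebesgue_on {a..b}) (\<phi> i)"
  and lim: "(\<lambda>i. \<integral>\<^sup>+x. ennreal (norm (f x - \<phi> i x)) \<partial>lebesgue_on {a..b}) \<longlonglongrightarrow> 0"
 shows "\<exists>z. (f has_integral z) {a..b} \<and>
  (\<lambda>i. Bochner_Integration.simple_bochner_integral (lebesgue_on {a..b}) (\<phi> i)) \<longlonglongrightarrow> z"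
proof -
 let ?M = "lebesgue_on {a..b}"
 interpret complete_measure ?M by (rule complete_measure_lebesgue_on) simp
 have meas: "(\<lambda>x. norm (f x - \<phi> i x)) \<in> borel_measurable ?M" for i
 proof -
  have "strongly_measurable ?M (\<phi> i)"
   using \<phi>[of i] unfolding strongly_measurable_def
   by (intro exI[of _ "\<lambda>j. \<phi> i"]) (auto elim: simple_bochner_integrable.cases)
  from strongly_measurable_norm[OF strongly_measurable_add[OF f strongly_measurable_scaleR[OF this, of "-1"]]]
  show ?thesis by simp
 qed
 have "\<forall>\<^sub>F i in sequentially. (\<integral>\<^sup>+x. ennreal (norm (f x - \<phi> i x)) \<partial>?M) < \<infinity>"
  using lim by (rule order_tendstoD) simp
 then obtain N where N: "\<And>i. i \<ge> N ==> (\<integral>\<^sup>+x. ennreal (norm (f x - \<phi> i x)) \<partial>?M) < \<infinity>"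
  by (auto simp: eventually_sequentially)
 have int: "integrable ?M (\<lambda>x. norm (f x - \<phi> (i + N) x))" for i
  using N[of "i + N"] meas by (intro integrableI_bounded) auto
 have "\<exists>z. (f has_integral z) {a..b} \<and>
  (\<lambda>i. Bochner_Integration.simple_bochner_integral ?M (\<phi> (i + N))) \<longlonglongrightarrow> z"
 proof (rule has_integral_L1_limit)
  show "(\<phi> (i + N) has_integral Bochner_Integration.simple_bochner_integral ?M (\<phi> (i + N))) {a..b}" for i
   by (rule has_integral_simple_bochner_integral[OF \<phi>])
  show "((\<lambda>x. norm (f x - \<phi> (i + N) x)) has_integral (\<integral>x. norm (f x - \<phi> (i + N) x) \<partial>?M)) {a..b}" for i
   by (rule has_integral_integral_lebesgue_on[OF int]) simp
  have "(\<lambda>i. enn2real (\<integral>\<^sup>+x. ennreal (norm (f x - \<phi> (i + N) x)) \<partial>?M)) \<longlonglongrightarrow> enn2real 0"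
   using LIMSEQ_ignore_initial_segment[OF lim, of N] by (intro tendsto_enn2real) simp_all
  then show "(\<lambda>i. \<integral>x. norm (f x - \<phi> (i + N) x) \<partial>?M) \<longlonglongrightarrow> 0"
   using meas by (simp add: integral_eq_nn_integral)
 qed simp
 then obtain z where z: "(f has_integral z) {a..b}"
   "(\<lambda>i. Bochner_Integration.simple_bochner_integral ?M (\<phi> (i + N))) \<longlonglongrightarrow> z"
  by (elim exE conjE)
 show ?thesis
  using z(1) LIMSEQ_offset[where f="\<lambda>i. Bochner_Integration.simple_bochner_integral ?M (\<phi> i)", OF z(2)]
  by (intro exI[of _ z] conjI)
qed

lemma bochner_integrable_approx:
 assumes "bochner_integrable (lebesgue_on {a..b::real}) f"
 obtains \<phi> where "\<And>i::nat. Bochner_Integration.simple_bochner_integrable (lebesgue_on {a..b}) (\<phi> i)"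
  "(\<lambda>i. \<integral>\<^sup>+x. ennreal (norm (f x - \<phi> i x)) \<partial>lebesgue_on {a..b}) \<longlonglongrightarrow> 0"
proof -
 let ?M = "lebesgue_on {a..b}"
 obtain g where g: "bochner_borel g" "\<And>x. x \<notin> {a..b} ==> g x = 0" "AE x in lborel. x \<in> {a..b} --> f x = g x"
   "(\<integral>\<^sup>+x. ennreal (norm (g x)) \<partial>lborel) = (\<integral>\<^sup>+x. ennreal (norm (f x)) \<partial>?M)"
  by (rule bochner_integrable_borel_version[OF assms]) (simp, rule that)
 have sb: "strongly_borel borel g" and fin: "(\<integral>\<^sup>+x. ennreal (norm (g x)) \<partial>lborel) < \<infinity>"
  using g(1) by (auto simp: bochner_borel_def)
 obtain \<phi> where \<phi>: "\<And>i::nat. simple_function borel (\<phi> i)" "\<And>x. x \<in> space borel ==> (\<lambda>i. \<phi> i x) \<longlonglongrightarrow> g x"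
  "\<And>i x. norm (\<phi> i x) <= 2 * norm (g x)"
  by (rule strongly_borel_approx[OF sb]) (rule that)
 have sfM: "simple_function ?M (\<phi> i)" for i
  by (rule simple_function_lebesgue_on[OF \<phi>(1)])
 have [measurable]: "(\<lambda>x. norm (g x)) \<in> borel_measurable borel"
  by (rule strongly_borel_norm[OF sb])
 have [measurable]: "(\<lambda>x. norm (g x - \<phi> i x)) \<in> borel_measurable borel" for i
  by (intro strongly_borel_norm strongly_borel_diff sb strongly_borel_simple \<phi>(1))
 have "(\<lambda>i. \<integral>\<^sup>+x. ennreal (norm (g x - \<phi> i x)) \<partial>lborel) \<longlonglongrightarrow> (\<integral>\<^sup>+(x::real). 0 \<partial>lborel)"
 proof (rule nn_integral_dominated_convergence[where w="\<lambda>x. 3 * ennreal (norm (g x))" and u'="\<lambda>x. 0"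
    and u="\<lambda>i x. ennreal (norm (g x - \<phi> i x))"])
  show "(\<integral>\<^sup>+x. 3 * ennreal (norm (g x)) \<partial>lborel) < \<infinity>"
   using fin by (simp add: nn_integral_cmult ennreal_mult_less_top)
  show "AE x in lborel. ennreal (norm (g x - \<phi> j x)) <= 3 * ennreal (norm (g x))" for j
  proof (rule AE_I2)
   fix x
   have "norm (g x - \<phi> j x) <= 3 * norm (g x)"
    using norm_triangle_ineq4[of "g x" "\<phi> j x"] \<phi>(3)[of j x] by simp
   then show "ennreal (norm (g x - \<phi> j x)) <= 3 * ennreal (norm (g x))"
    by (simp add: ennreal_mult'[symmetric] ennreal_numeral[symmetric] del: ennreal_numeral)
  qed
  show "AE x in lborel. (\<lambda>i. ennreal (norm (g x - \<phi> i x))) \<longlonglongrightarrow> 0"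
  proof (rule AE_I2)
   fix x
   have "(\<lambda>i. norm (g x - \<phi> i x)) \<longlonglongrightarrow> norm (g x - g x)"
    by (intro tendsto_intros \<phi>(2)) simp
   then show "(\<lambda>i. ennreal (norm (g x - \<phi> i x))) \<longlonglongrightarrow> 0"
    using tendsto_ennrealI by fastforce
  qed
 qed auto
 then have lim: "(\<lambda>i. \<integral>\<^sup>+x. ennreal (norm (g x - \<phi> i x)) \<partial>lborel) \<longlonglongrightarrow> 0" by simp
 show thesis
 proof (rule that)
  show "Bochner_Integration.simple_bochner_integrable ?M (\<phi> i)" for i
  proof (rule simple_bochner_integrable.intros[OF sfM])
   have "emeasure ?M {y \<in> space ?M. \<phi> i y ~= 0} <= emeasure ?M (space ?M)"
    by (rule emeasure_space)
   also have "\<dots> < \<infinity>"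
    by (simp add: emeasure_restrict_space space_restrict_space emeasure_lborel_Icc_eq)
   finally show "emeasure ?M {y \<in> space ?M. \<phi> i y ~= 0} ~= \<infinity>" by simp
  qed
  show "(\<lambda>i. \<integral>\<^sup>+x. ennreal (norm (f x - \<phi> i x)) \<partial>?M) \<longlonglongrightarrow> 0"
  proof (rule tendsto_sandwich[OF _ _ tendsto_const lim])
   have "(\<integral>\<^sup>+x. ennreal (norm (f x - \<phi> i x)) \<partial>?M) <= (\<integral>\<^sup>+x. ennreal (norm (g x - \<phi> i x)) \<partial>lborel)" for i
   proof -
    have "(\<integral>\<^sup>+x. ennreal (norm (f x - \<phi> i x)) \<partial>?M)
      = (\<integral>\<^sup>+x. ennreal (norm (f x - \<phi> i x)) * indicator {a..b} x \<partial>lborel)"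
     by (rule nn_integral_lebesgue_on) simp
    also have "\<dots> <= (\<integral>\<^sup>+x. ennreal (norm (g x - \<phi> i x)) \<partial>lborel)"
     by (rule nn_integral_mono_AE, use g(3) in eventually_elim) (auto simp: indicator_def)
    finally show ?thesis .
   qed
   then show "\<forall>\<^sub>F i in sequentially. (\<integral>\<^sup>+x. ennreal (norm (f x - \<phi> i x)) \<partial>?M) <= (\<integral>\<^sup>+x. ennreal (norm (g x - \<phi> i x)) \<partial>lborel)"
    by simp
  qed simp
 qed
qed

theorem has_integral_bochner_integral:
 fixes f :: "real => 'b::banach"
 assumes f: "bochner_integrable (lebesgue_on {a..b}) f"
 shows "(f has_integral bochner_integral (lebesgue_on {a..b}) f) {a..b}"
proof -
 let ?M = "lebesgue_on {a..b}"
 define Q where "Q \<phi> y \<longleftrightarrow> (\<forall>i::nat. Bochner_Integration.simple_bochner_integrable ?M (\<phi> i)) \<and>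
   (\<lambda>i. \<integral>\<^sup>+x. ennreal (norm (f x - \<phi> i x)) \<partial>?M) \<longlonglongrightarrow> 0 \<and>
   (\<lambda>i. Bochner_Integration.simple_bochner_integral ?M (\<phi> i)) \<longlonglongrightarrow> y" for \<phi> y
 have sm: "strongly_measurable ?M f" using f by (simp add: bochner_integrable_def)
 have Q: "(f has_integral y) {a..b}" if "Q \<phi> y" for \<phi> y
 proof -
  have \<phi>: "\<And>i. Bochner_Integration.simple_bochner_integrable ?M (\<phi> i)"
    "(\<lambda>i. \<integral>\<^sup>+x. ennreal (norm (f x - \<phi> i x)) \<partial>?M) \<longlonglongrightarrow> 0"
    "(\<lambda>i. Bochner_Integration.simple_bochner_integral ?M (\<phi> i)) \<longlonglongrightarrow> y"
   using that unfolding Q_def by blast+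
  obtain z where z: "(f has_integral z) {a..b}" "(\<lambda>i. Bochner_Integration.simple_bochner_integral ?M (\<phi> i)) \<longlonglongrightarrow> z"
   using has_integral_bochner_approx[OF sm \<phi>(1,2)] by (elim exE conjE)
  show ?thesis
   using z(1) LIMSEQ_unique[OF z(2) \<phi>(3)] by simp
 qed
 obtain \<phi> where \<phi>: "\<And>i::nat. Bochner_Integration.simple_bochner_integrable ?M (\<phi> i)"
   "(\<lambda>i. \<integral>\<^sup>+x. ennreal (norm (f x - \<phi> i x)) \<partial>?M) \<longlonglongrightarrow> 0"
  by (rule bochner_integrable_approx[OF f]) (rule that)
 obtain z where "(\<lambda>i. Bochner_Integration.simple_bochner_integral ?M (\<phi> i)) \<longlonglongrightarrow> z"
  using has_integral_bochner_approx[OF sm \<phi>] by (elim exE conjE)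
 with \<phi> have z: "Q \<phi> z" unfolding Q_def by (intro conjI allI)
 have "bochner_integral ?M f = (THE y. \<exists>\<phi>. Q \<phi> y)"
  using f by (simp add: bochner_integral_def Q_def)
 also have "\<dots> = z"
 proof (rule the_equality)
  show "\<exists>\<phi>. Q \<phi> z" using z by (rule exI[of _ \<phi>])
  show "y = z" if "\<exists>\<phi>. Q \<phi> y" for y
  proof -
   from that obtain \<phi>1 where "Q \<phi>1 y" by (elim exE)
   from has_integral_unique[OF Q[OF this] Q[OF z]] show ?thesis .
  qed
 qed
 finally show ?thesis using Q[OF z] by simp
qed

section \<open>Bochner integrable functions on the line\<close>

text \<open>The Henstock--Kurzweil integral does not see null sets, whatever the values of the function there.\<close>

lemma has_integral_AE_iff:
 fixes f g :: "real => 'b::real_normed_vector"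
 assumes "AE x in lborel. x \<in> S --> f x = g x"
 shows "(f has_integral y) S \<longleftrightarrow> (g has_integral y) S"
proof -
 obtain N where N: "N \<in> null_sets lborel" "{x\<in>space lborel. \<not> (x \<in> S --> f x = g x)} \<subseteq> N"
  using AE_E[OF assms] by (metis (no_types, lifting) null_setsI)
 have "negligible N"
  using N(1) by (simp add: negligible_iff_null_sets null_sets_completionI)
 moreover have "f x = g x" if "x \<in> S - N" for x
  using N(2) that by auto
 ultimately show ?thesis
  by (intro has_integral_spike_eq) auto
qed

lemma integral_AE_cong:
 fixes f g :: "real => 'b::real_normed_vector"
 assumes "AE x in lborel. x \<in> S --> f x = g x"
 shows "integral S f = integral S g" "f integrable_on S \<longleftrightarrow> g integrable_on S"
 using has_integral_AE_iff[OF assms] unfolding integral_def integrable_on_def by simp_all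

lemma bochner_borelD:
 assumes "bochner_borel f"
 shows "strongly_borel borel f" "(\<integral>\<^sup>+x. ennreal (norm (f x)) \<partial>lborel) < \<infinity>"
  "(\<lambda>x. norm (f x)) \<in> borel_measurable borel" "integrable lborel (\<lambda>x. norm (f x))"
proof -
 show "strongly_borel borel f" "(\<integral>\<^sup>+x. ennreal (norm (f x)) \<partial>lborel) < \<infinity>"
  using assms by (auto simp: bochner_borel_def)
 then show "(\<lambda>x. norm (f x)) \<in> borel_measurable borel"
  by (intro strongly_borel_norm)
 then show "integrable lborel (\<lambda>x. norm (f x))"
  using \<open>(\<integral>\<^sup>+x. ennreal (norm (f x)) \<partial>lborel) < \<infinity>\<close> by (intro integrableI_bounded) simp_all
qed

lemma bochner_borel_integrable_on:
 fixes f :: "real => 'b::banach"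
 assumes f: "bochner_borel f"
 shows "f integrable_on {a..b}"
  and "bochner_integral (lebesgue_on {a..b}) f = integral {a..b} f"
  and "(\<lambda>x. norm (f x)) integrable_on {a..b}"
  and "integral {a..b} (\<lambda>x. norm (f x)) = (\<integral>x. norm (f x) * indicator {a..b} x \<partial>lborel)"
  and "ennreal (integral {a..b} (\<lambda>x. norm (f x))) = (\<integral>\<^sup>+x. ennreal (norm (f x)) * indicator {a..b} x \<partial>lborel)"
proof -
 have "bochner_integrable (lebesgue_on {a..b}) f"
  by (rule bochner_borel_imp_bochner_integrable[OF f]) auto
 from has_integral_bochner_integral[OF this]
 show "f integrable_on {a..b}" "bochner_integral (lebesgue_on {a..b}) f = integral {a..b} f"
  by (auto simp: integrable_on_def integral_unique)
 have int: "integrable lborel (\<lambda>x. norm (f x) * indicator {a..b} x)"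
  by (rule integrable_real_mult_indicator) (use bochner_borelD[OF f] in simp_all)
 have hi: "((\<lambda>x. norm (f x)) has_integral (\<integral>x. norm (f x) * indicator {a..b} x \<partial>lborel)) {a..b}"
 proof -
  have "(\<lambda>x. norm (f x) * indicator {a..b} x) = (\<lambda>x. if x \<in> {a..b} then norm (f x) else 0)"
   by (auto simp: indicator_def)
  then show ?thesis
   using has_integral_integral_lborel[OF int] has_integral_restrict_UNIV[of "{a..b}" "\<lambda>x. norm (f x)"]
   by simp
 qed
 then show "(\<lambda>x. norm (f x)) integrable_on {a..b}"
  "integral {a..b} (\<lambda>x. norm (f x)) = (\<integral>x. norm (f x) * indicator {a..b} x \<partial>lborel)"
  by (auto simp: integrable_on_def integral_unique)
 then show "ennreal (integral {a..b} (\<lambda>x. norm (f x))) = (\<integral>\<^sup>+x. ennreal (norm (f x)) * indicator {a..b} x \<partial>lborel)"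
  using nn_integral_eq_integral[OF int] by (simp add: ennreal_mult' ennreal_indicator)
qed

lemma bochner_borel_add:
 fixes f g :: "real => 'b::real_normed_vector"
 assumes "bochner_borel f" "bochner_borel g"
 shows "bochner_borel (\<lambda>x. f x + g x)"
 unfolding bochner_borel_def
proof
 show "strongly_borel borel (\<lambda>x. f x + g x)"
  using assms by (intro strongly_borel_add bochner_borelD)
 have [measurable]: "(\<lambda>x. norm (f x)) \<in> borel_measurable borel" "(\<lambda>x. norm (g x)) \<in> borel_measurable borel"
  by (rule bochner_borelD(3)[OF assms(1)], rule bochner_borelD(3)[OF assms(2)])
 have "(\<integral>\<^sup>+x. ennreal (norm (f x + g x)) \<partial>lborel) <= (\<integral>\<^sup>+x. ennreal (norm (f x)) + ennreal (norm (g x)) \<partial>lborel)"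
  by (intro nn_integral_mono) (simp flip: ennreal_plus add: norm_triangle_ineq)
 also have "\<dots> = (\<integral>\<^sup>+x. ennreal (norm (f x)) \<partial>lborel) + (\<integral>\<^sup>+x. ennreal (norm (g x)) \<partial>lborel)"
  by (intro nn_integral_add) simp_all
 also have "\<dots> < \<infinity>" using bochner_borelD(2)[OF assms(1)] bochner_borelD(2)[OF assms(2)] by simp
 finally show "(\<integral>\<^sup>+x. ennreal (norm (f x + g x)) \<partial>lborel) < \<infinity>" .
qed

lemma bochner_borel_dominated:
 fixes f :: "real => 'b::real_normed_vector" and g :: "real => 'c::real_normed_vector"
 assumes "bochner_borel g" "strongly_borel borel f" "\<And>x. norm (f x) <= C * norm (g x)"
 shows "bochner_borel f"
 unfolding bochner_borel_def
proof
 have [measurable]: "(\<lambda>x. norm (g x)) \<in> borel_measurable borel"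
  by (rule bochner_borelD(3)[OF assms(1)])
 have "(\<integral>\<^sup>+x. ennreal (norm (f x)) \<partial>lborel) <= (\<integral>\<^sup>+x. ennreal \<bar>C\<bar> * ennreal (norm (g x)) \<partial>lborel)"
 proof (rule nn_integral_mono)
  fix x
  have "norm (f x) <= \<bar>C\<bar> * norm (g x)"
   by (rule order_trans[OF assms(3) mult_right_mono[OF abs_ge_self norm_ge_zero]])
  then show "ennreal (norm (f x)) <= ennreal \<bar>C\<bar> * ennreal (norm (g x))"
   by (simp flip: ennreal_mult')
 qed
 also have "\<dots> = ennreal \<bar>C\<bar> * (\<integral>\<^sup>+x. ennreal (norm (g x)) \<partial>lborel)"
  by (rule nn_integral_cmult) simp
 also have "\<dots> < \<infinity>"
  using bochner_borelD(2)[OF assms(1)] by (simp add: ennreal_mult_less_top)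
 finally show "(\<integral>\<^sup>+x. ennreal (norm (f x)) \<partial>lborel) < \<infinity>" .
qed (rule assms(2))

lemma bochner_borel_linear:
 assumes "bochner_borel f" "bounded_linear T"
 shows "bochner_borel (\<lambda>x. T (f x))"
proof -
 obtain K where K: "\<And>x. norm (T x) <= norm x * K"
  using bounded_linear.bounded[OF assms(2)] by blast
 show ?thesis
 proof (rule bochner_borel_dominated[OF assms(1)])
  show "strongly_borel borel (\<lambda>x. T (f x))"
   by (rule strongly_borel_linear[OF bochner_borelD(1)[OF assms(1)] linear_continuous_on[OF assms(2)]])
  show "norm (T (f x)) <= K * norm (f x)" for x
   using K[of "f x"] by (simp add: mult.commute)
 qed
qed

lemma bochner_borel_diff:
 fixes f g :: "real => 'b::real_normed_vector"
 assumes "bochner_borel f" "bochner_borel g"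
 shows "bochner_borel (\<lambda>x. f x - g x)"
 using bochner_borel_add[OF assms(1) bochner_borel_linear[OF assms(2) bounded_linear_minus[OF bounded_linear_ident]]]
 by simp

lemma bochner_borel_restrict:
 assumes "bochner_borel f" "A \<in> sets borel"
 shows "bochner_borel (\<lambda>x. if x \<in> A then f x else 0)"
proof (rule bochner_borel_dominated[OF assms(1)])
 show "strongly_borel borel (\<lambda>x. if x \<in> A then f x else 0)"
  by (rule strongly_borel_zero_outside[OF bochner_borelD(1)[OF assms(1)] assms(2)])
 show "norm (if x \<in> A then f x else 0) <= 1 * norm (f x)" for x
  by simp
qed

lemma bochner_borel_operator:
 fixes f :: "real => 'b::real_normed_vector" and W :: "real => 'b => 'c::real_normed_vector"
 assumes f: "bochner_borel f" and W: "\<And>v. strongly_borel borel (\<lambda>x. W x v)"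
  and lin: "\<And>x. linear (W x)" and bound: "\<And>x v. norm (W x v) <= C * norm v"
 shows "bochner_borel (\<lambda>x. W x (f x))"
proof (rule bochner_borel_dominated[OF f])
 have "bounded_linear (W x)" for x
  using lin[of x] bound[of x] by (intro bounded_linear_intro[of _ C]) (auto simp: linear_add linear_scale mult.commute)
 then show "strongly_borel borel (\<lambda>x. W x (f x))"
  by (rule strongly_borel_operator[OF bochner_borelD(1)[OF f] W linear_continuous_on])
qed (rule bound)

lemma bochner_borel_translate:
 assumes "bochner_borel f"
 shows "bochner_borel (\<lambda>x. f (x - t))"
  "(\<integral>\<^sup>+x. ennreal (norm (f (x - t))) \<partial>lborel) = (\<integral>\<^sup>+x. ennreal (norm (f x)) \<partial>lborel)"
proof -
 have [measurable]: "(\<lambda>x. norm (f x)) \<in> borel_measurable borel"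
  by (rule bochner_borelD(3)[OF assms])
 have "(\<integral>\<^sup>+x. ennreal (norm (f (x - t))) \<partial>lborel) = (\<integral>\<^sup>+x. ennreal (norm (f (t + x - t))) \<partial>lborel)"
  using nn_integral_real_affine[of "\<lambda>x. ennreal (norm (f (x - t)))" 1 t] by simp
 then show eq: "(\<integral>\<^sup>+x. ennreal (norm (f (x - t))) \<partial>lborel) = (\<integral>\<^sup>+x. ennreal (norm (f x)) \<partial>lborel)"
  by simp
 have "strongly_borel borel (\<lambda>x. f (x - t))"
  by (rule strongly_borel_compose[OF bochner_borelD(1)[OF assms], of "\<lambda>x. x - t"]) simp
 then show "bochner_borel (\<lambda>x. f (x - t))"
  unfolding bochner_borel_def eq using bochner_borelD(2)[OF assms] by simp
qed

lemma bochner_borel_continuous: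
 fixes f :: "real => 'b::real_normed_vector"
 assumes "continuous_on {a..b} f"
 shows "bochner_borel (\<lambda>x. if x \<in> {a..b} then f x else 0)"
proof (cases "a <= b")
 case True
 define g where "g x = f (max a (min b x))" for x
 have "continuous_on UNIV g"
  unfolding g_def using True
  by (intro continuous_on_compose2[OF assms] continuous_intros) auto
 then have g: "strongly_borel borel g" by (rule strongly_borel_continuous)
 have "compact (f ` {a..b})"
  by (intro compact_continuous_image assms compact_Icc)
 then obtain K where K: "\<And>x. x \<in> {a..b} ==> norm (f x) <= K"
  by (meson bounded_iff compact_imp_bounded imageI)
 have eq: "(if x \<in> {a..b} then f x else 0) = (if x \<in> {a..b} then g x else 0)" for x
  by (auto simp: g_def)
 show ?thesis
  unfolding bochner_borel_def
 proof
  show "strongly_borel borel (\<lambda>x. if x \<in> {a..b} then f x else 0)"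
   unfolding eq by (intro strongly_borel_zero_outside g) simp
  have "(\<integral>\<^sup>+x. ennreal (norm (if x \<in> {a..b} then f x else 0)) \<partial>lborel) <= (\<integral>\<^sup>+x. ennreal K * indicator {a..b} x \<partial>lborel)"
   by (intro nn_integral_mono) (auto simp: indicator_def intro!: ennreal_leI K)
  also have "\<dots> < \<infinity>"
   by (simp add: nn_integral_cmult emeasure_lborel_Icc_eq ennreal_mult_less_top)
  finally show "(\<integral>\<^sup>+x. ennreal (norm (if x \<in> {a..b} then f x else 0)) \<partial>lborel) < \<infinity>" .
 qed
next
 case False
 then have "(\<lambda>x. if x \<in> {a..b} then f x else 0) = (\<lambda>x. 0)" by auto
 then show ?thesis by (simp add: bochner_borel_def strongly_borel_const)
qed

section \<open>Ordered Banach spaces with a norm additive on a generating cone\<close>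

lemma cone_suminf:
 fixes f :: "nat => 'a::{banach, ordered_real_vector}"
 assumes "closed {u::'a. 0 <= u}" "summable f" "\<And>k. 0 <= f k"
 shows "0 <= (\<Sum>k. f k)"
 using closed_sequentially[OF assms(1), of "\<lambda>n. \<Sum>k<n. f k" "\<Sum>k. f k"] summable_LIMSEQ[OF assms(2)]
 by (simp add: sum_nonneg assms(3))

text \<open>Summing up successive corrections turns an approximate decomposition with control of the norms
 into an exact one.\<close>

lemma decomposition_of_approximations:
 fixes u :: "'a::{banach, ordered_real_vector}"
 assumes closed: "closed {u::'a. 0 <= u}" and K: "0 < K" "\<And>(u::'a) \<epsilon>. 0 < \<epsilon> ==>
   \<exists>v w. 0 <= v \<and> 0 <= w \<and> norm v <= K * norm u \<and> norm w <= K * norm u \<and> norm (u - (v - w)) < \<epsilon>"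
 shows "\<exists>v w. 0 <= v \<and> 0 <= w \<and> u = v - w \<and> norm v <= (2 * K) * norm u \<and> norm w <= (2 * K) * norm u"
proof (cases "u = 0")
 case True
 then show ?thesis by (intro exI[of _ 0]) auto
next
 case False
 define e where "e k = norm u * (1/2) ^ k" for k :: nat
 have e: "0 < e k" for k using False by (simp add: e_def)
 define P where "P x k p \<longleftrightarrow> 0 <= fst p \<and> 0 <= snd p \<and> norm (fst p) <= K * norm x \<and> norm (snd p) <= K * norm (x::'a) \<and>
   norm (x - (fst p - snd p)) < e (Suc k)" for x k p
 define p where "p x k = (SOME q. P x k q)" for x k
 have "P x k (p x k)" for x k
 proof -
  obtain v w where "0 <= v" "0 <= w" "norm v <= K * norm x" "norm w <= K * norm x" "norm (x - (v - w)) < e (Suc k)"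
   using K(2)[OF e[of "Suc k"], of x] by blast
  then have "P x k (v, w)" by (simp add: P_def)
  then show ?thesis unfolding p_def by (rule someI)
 qed
 then have p: "0 <= fst (p x k)" "0 <= snd (p x k)"
   "norm (fst (p x k)) <= K * norm x" "norm (snd (p x k)) <= K * norm (x::'a)"
   "norm (x - (fst (p x k) - snd (p x k))) < e (Suc k)" for x k
  unfolding P_def by blast+
 define y where "y = rec_nat u (\<lambda>k x. x - (fst (p x k) - snd (p x k)))"
 have y0: "y 0 = u" and yS: "y (Suc k) = y k - (fst (p (y k) k) - snd (p (y k) k))" for k
  by (simp_all add: y_def)
 have y_le: "norm (y k) <= e k" for k
  by (cases k) (use p(5) in \<open>auto simp: y0 yS e_def intro: less_imp_le\<close>)
 define v where "v k = fst (p (y k) k)" for k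
 define w where "w k = snd (p (y k) k)" for k
 have vw0: "0 <= v k" "0 <= w k" for k by (auto simp: v_def w_def p)
 have vw_le: "norm (v k) <= K * e k" "norm (w k) <= K * e k" for k
  using p(3,4)[of "y k" k] mult_left_mono[OF y_le[of k], of K] K(1) by (auto simp: v_def w_def intro: order_trans)
 have "(\<lambda>k. K * e k) sums (K * (norm u * 2))"
  unfolding e_def using geometric_sums[of "1/2::real"] by (intro sums_mult) simp
 then have Ke: "summable (\<lambda>k. K * e k)" "(\<Sum>k. K * e k) = 2 * K * norm u"
  by (auto simp: sums_iff)
 have sv: "summable (\<lambda>k. norm (v k))" and sw: "summable (\<lambda>k. norm (w k))"
  using vw_le by (auto intro!: summable_comparison_test[OF _ Ke(1)])
 have bv: "norm (\<Sum>k. v k) <= 2 * K * norm u"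
  using summable_norm[OF sv] suminf_le[OF vw_le(1) sv Ke(1)] Ke(2) by simp
 have bw: "norm (\<Sum>k. w k) <= 2 * K * norm u"
  using summable_norm[OF sw] suminf_le[OF vw_le(2) sw Ke(1)] Ke(2) by simp
 have sum_y: "(\<Sum>k<n. v k - w k) = u - y n" for n
  by (induction n) (auto simp: y0 yS v_def w_def)
 have "e \<longlonglongrightarrow> norm u * 0"
  unfolding e_def by (intro tendsto_intros LIMSEQ_power_zero) simp
 then have "y \<longlonglongrightarrow> 0"
  using y_le by (intro Lim_null_comparison[of y e]) (simp_all add: always_eventually)
 then have "(\<lambda>n. \<Sum>k<n. v k - w k) \<longlonglongrightarrow> u - 0"
  unfolding sum_y by (intro tendsto_intros)
 then have "(\<lambda>k. v k - w k) sums u" by (simp add: sums_def)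
 then have "u = (\<Sum>k. v k) - (\<Sum>k. w k)"
  using suminf_diff[OF summable_norm_cancel[OF sv] summable_norm_cancel[OF sw]] by (simp add: sums_iff)
 then show ?thesis
  using bv bw cone_suminf[OF closed summable_norm_cancel[OF sv] vw0(1)] cone_suminf[OF closed summable_norm_cancel[OF sw] vw0(2)]
  by blast
qed

locale additive_norm_cone =
 fixes E :: "'a::{banach, ordered_real_vector} itself"
 assumes cone_closed: "closed {u::'a. 0 <= u}"
  and cone_generating: "\<And>u::'a. \<exists>v w. 0 <= v \<and> 0 <= w \<and> u = v - w"
  and norm_additive: "\<And>u v::'a. 0 <= u ==> 0 <= v ==> norm (u + v) = norm u + norm v"
begin

lemma norm_mono_cone: "0 <= u ==> u <= v ==> norm u <= norm (v::'a)"
 using norm_additive[of u "v - u"] by simp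

lemma cone_limit:
 assumes "f \<longlonglongrightarrow> (u::'a)" "\<And>n. 0 <= f n"
 shows "0 <= u"
 using closed_sequentially[OF cone_closed, of f u] assms by simp

text \<open>The Krein--Smulian argument: by Baire's theorem the differences of cone elements of
 norm at most some \<open>n\<close> are dense in a ball, hence every vector is such a difference up to an
 arbitrarily small error and with norms controlled; summing up successive corrections removes
 the error.\<close>

lemma approx_decomposition:
 "\<exists>K>0. \<forall>u::'a. \<forall>\<epsilon>>0. \<exists>v w. 0 <= v \<and> 0 <= w \<and> norm v <= K * norm u \<and> norm w <= K * norm u \<and>
   norm (u - (v - w)) < \<epsilon>"
proof -
 define S where "S n = {v - w |v w. 0 <= v \<and> 0 <= w \<and> norm v <= real n \<and> norm (w::'a) <= real n}" for n :: nat
 have "\<exists>n. interior (closure (S n)) ~= {}"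
 proof (rule ccontr)
  assume *: "\<nexists>n. interior (closure (S n)) ~= {}"
  have "euclidean interior_of \<Union>(range (\<lambda>n. closure (S n))) = {}"
  proof (rule Baire_category_alt)
   show "completely_metrizable_space (euclidean::'a topology) \<or>
     locally_compact_space (euclidean::'a topology) \<and> regular_space (euclidean::'a topology)"
    using completely_metrizable_space_euclidean by blast
  qed (use * in \<open>auto simp: interior_of_def interior_def\<close>)
  moreover have "(u::'a) \<in> \<Union>(range (\<lambda>n. closure (S n)))" for u
  proof -
   obtain v w where "0 <= v" "0 <= w" "u = v - w"
    using cone_generating[of u] by blast
   moreover obtain n where "max (norm v) (norm w) <= real n"
    using real_arch_simple by blast
   ultimately have "u \<in> S n"
    unfolding S_def by auto
   then show ?thesis using closure_subset by fastforce
  qed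
  ultimately have "euclidean interior_of (UNIV :: 'a set) = {}"
   by (metis UNIV_eq_I)
  then show False
   using interior_of_topspace[of "euclidean :: 'a topology"] by simp
 qed
 then obtain n x r where r: "0 < r" "ball x r \<subseteq> closure (S n)"
  by (metis all_not_in_conv mem_interior)
 have *: "\<exists>v w. 0 <= v \<and> 0 <= w \<and> norm v <= real n \<and> norm w <= real n \<and> norm (y - (v - w)) < \<epsilon>"
  if y: "norm y < r" and \<epsilon>: "0 < \<epsilon>" for y :: 'a and \<epsilon> :: real
 proof -
  have "x + y \<in> closure (S n)" "x - y \<in> closure (S n)"
   using r(2) y by (auto simp: dist_norm subset_iff)
  then obtain a b where ab: "a \<in> S n" "b \<in> S n" "norm (a - (x + y)) < \<epsilon>" "norm (b - (x - y)) < \<epsilon>"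
   using \<epsilon> by (metis closure_approachable dist_norm)
  obtain v w where vw: "a = v - w" "0 <= v" "0 <= w" "norm v <= real n" "norm w <= real n"
   using ab(1) by (auto simp: S_def)
  obtain v' w' where vw': "b = v' - w'" "0 <= v'" "0 <= w'" "norm v' <= real n" "norm w' <= real n"
   using ab(2) by (auto simp: S_def)
  have "y - ((1/2) *\<^sub>R (v + w') - (1/2) *\<^sub>R (w + v')) = (1/2) *\<^sub>R ((b - (x - y)) - (a - (x + y)))"
   by (simp add: vw vw' algebra_simps flip: scaleR_add_left)
  then have "norm (y - ((1/2) *\<^sub>R (v + w') - (1/2) *\<^sub>R (w + v'))) <= (norm (b - (x - y)) + norm (a - (x + y))) / 2"
   using norm_triangle_ineq4[of "b - (x - y)" "a - (x + y)"] by simp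
  then have "norm (y - ((1/2) *\<^sub>R (v + w') - (1/2) *\<^sub>R (w + v'))) < \<epsilon>"
   using ab(3,4) by simp
  moreover have "norm ((1/2) *\<^sub>R (v + w')) <= real n" "norm ((1/2) *\<^sub>R (w + v')) <= real n"
   using norm_triangle_ineq[of v w'] norm_triangle_ineq[of w v'] vw vw' by auto
  ultimately show ?thesis
   using vw vw' by (intro exI[of _ "(1/2) *\<^sub>R (v + w')"] exI[of _ "(1/2) *\<^sub>R (w + v')"])
    (auto intro!: scaleR_nonneg_nonneg)
 qed
 define K where "K = 2 * (real n + 1) / r"
 have "0 < K" using r(1) by (simp add: K_def)
 moreover have "\<exists>v w. 0 <= v \<and> 0 <= w \<and> norm v <= K * norm u \<and> norm w <= K * norm u \<and> norm (u - (v - w)) < \<epsilon>"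
  if \<epsilon>: "0 < \<epsilon>" for u :: 'a and \<epsilon>
 proof (cases "u = 0")
  case True
  then show ?thesis using \<epsilon> by (intro exI[of _ 0]) auto
 next
  case False
  define c where "c = 2 * norm u / r"
  have c: "0 < c" using False r(1) by (simp add: c_def)
  have "norm ((1/c) *\<^sub>R u) < r"
   using False r(1) by (simp add: c_def field_simps)
  from *[OF this, of "\<epsilon> / c"] obtain v w where vw: "0 <= v" "0 <= w" "norm v <= real n" "norm w <= real n"
    "norm ((1/c) *\<^sub>R u - (v - w)) < \<epsilon> / c"
   using \<epsilon> c by auto
  have "u - (c *\<^sub>R v - c *\<^sub>R w) = c *\<^sub>R ((1/c) *\<^sub>R u - (v - w))"
   using c by (simp add: algebra_simps)
  then have "norm (u - (c *\<^sub>R v - c *\<^sub>R w)) < \<epsilon>"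
   using vw(5) c by (simp add: pos_less_divide_eq mult.commute)
  moreover have "c * norm v <= K * norm u" "c * norm w <= K * norm u"
  proof -
   have "c * real n <= K * norm u"
    using r(1) by (simp add: c_def K_def field_simps)
   then show "c * norm v <= K * norm u" "c * norm w <= K * norm u"
    using mult_left_mono[OF vw(3), of c] mult_left_mono[OF vw(4), of c] c by linarith+
  qed
  ultimately show ?thesis
   using c vw by (intro exI[of _ "c *\<^sub>R v"] exI[of _ "c *\<^sub>R w"]) (auto intro: scaleR_nonneg_nonneg)
 qed
 ultimately show ?thesis by blast
qed

lemma bounded_decomposition_ex:
 "\<exists>M>0. \<forall>u::'a. \<exists>v w. 0 <= v \<and> 0 <= w \<and> u = v - w \<and> norm v <= M * norm u \<and> norm w <= M * norm u"
proof -
 obtain K where K: "0 < K" "\<And>(u::'a) \<epsilon>. 0 < \<epsilon> ==> \<exists>v w. 0 <= v \<and> 0 <= w \<and> norm v <= K * norm u \<and> norm w <= K * norm u \<and>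
   norm (u - (v - w)) < \<epsilon>"
  using approx_decomposition by blast
 have "\<exists>v w. 0 <= v \<and> 0 <= w \<and> u = v - w \<and> norm v <= (2 * K) * norm u \<and> norm w <= (2 * K) * norm u" for u :: 'a
  by (rule decomposition_of_approximations[OF cone_closed K])
 then show ?thesis
  using K(1) by (intro exI[of _ "2 * K"]) auto
qed

definition dec_bound :: "'a itself => real" where
 "dec_bound T = (SOME M. 0 < M \<and> (\<forall>u::'a. \<exists>v w. 0 <= v \<and> 0 <= w \<and> u = v - w \<and> norm v <= M * norm u \<and> norm w <= M * norm u))"

lemma dec_bound: "0 < dec_bound E"
  "\<exists>v w. 0 <= v \<and> 0 <= w \<and> u = v - w \<and> norm v <= dec_bound E * norm u \<and> norm w <= dec_bound E * norm (u::'a)"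
 using someI_ex[OF bounded_decomposition_ex] unfolding dec_bound_def by blast+

lemma bounded_decomposition:
 obtains v w where "0 <= v" "0 <= w" "u = v - w" "norm v <= dec_bound E * norm u" "norm w <= dec_bound E * norm (u::'a)"
 using dec_bound(2)[of u] by blast

text \<open>Decompose a vector into positive parts with controlled norms.\<close>

lemma cone_contraction_bound:
 fixes T :: "'a => 'b::real_normed_vector"
 assumes "linear T" "\<And>u. 0 <= u ==> norm (T u) <= norm u"
 shows "norm (T u) <= 2 * dec_bound E * norm u"
proof -
 obtain v w where vw: "0 <= v" "0 <= w" "u = v - w" "norm v <= dec_bound E * norm u" "norm w <= dec_bound E * norm u"
  by (rule bounded_decomposition)
 have "norm (T u) <= norm (T v) + norm (T w)"
  unfolding vw(3) linear_diff[OF assms(1)] by (rule norm_triangle_ineq4)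
 also have "\<dots> <= norm v + norm w"
  using assms(2) vw by (intro add_mono) auto
 finally show ?thesis using vw by simp
qed

text \<open>The bounded functional extending the norm of the cone.\<close>

definition psi :: "'a => real" where
 "psi u = (THE c. \<exists>v w. 0 <= v \<and> 0 <= w \<and> u = v - w \<and> c = norm v - norm w)"

lemma psi_diff: 
 assumes "0 <= v" "0 <= w"
 shows "psi (v - w) = norm v - norm (w::'a)"
 unfolding psi_def
proof (rule the_equality)
 fix c assume "\<exists>v' w'. 0 <= v' \<and> 0 <= w' \<and> v - w = v' - w' \<and> c = norm v' - norm w'"
 then obtain v' w' where *: "0 <= v'" "0 <= w'" "v - w = v' - w'" "c = norm v' - norm w'" by blast
 then have "v + w' = v' + w" by (simp add: algebra_simps)
 then show "c = norm v - norm w"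
  using norm_additive[OF assms(1) *(2)] norm_additive[OF *(1) assms(2)] *(4) by simp
qed (use assms in blast)

lemma psi_cone: "0 <= u ==> psi u = norm u"
 using psi_diff[of u 0] by simp

lemma abs_psi_le: "\<bar>psi u\<bar> <= norm u"
proof -
 obtain v w where vw: "0 <= v" "0 <= w" "u = v - w" using cone_generating[of u] by blast
 then show ?thesis using psi_diff[OF vw(1,2)] norm_triangle_ineq3[of v w] by simp
qed

lemma bounded_linear_psi: "bounded_linear psi"
proof (rule bounded_linear_intro[of _ 1])
 fix u u' :: 'a and c :: real
 obtain v w where vw: "0 <= v" "0 <= w" "u = v - w" using cone_generating[of u] by blast
 obtain v' w' where vw': "0 <= v'" "0 <= w'" "u' = v' - w'" using cone_generating[of u'] by blast
 have "u + u' = (v + v') - (w + w')" using vw vw' by simp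
 then have "psi (u + u') = norm (v + v') - norm (w + w')"
  using psi_diff[of "v + v'" "w + w'"] vw(1,2) vw'(1,2) by (simp only: add_nonneg_nonneg)
 then show "psi (u + u') = psi u + psi u'"
  unfolding vw(3) vw'(3) psi_diff[OF vw(1,2)] psi_diff[OF vw'(1,2)]
  using norm_additive[OF vw(1) vw'(1)] norm_additive[OF vw(2) vw'(2)] by simp
 have pu: "psi u = norm v - norm w" using psi_diff[OF vw(1,2)] vw(3) by simp
 show "psi (c *\<^sub>R u) = c *\<^sub>R psi u"
 proof (cases "0 <= c")
  case True
  then have "psi (c *\<^sub>R v - c *\<^sub>R w) = norm (c *\<^sub>R v) - norm (c *\<^sub>R w)"
   using vw by (intro psi_diff scaleR_nonneg_nonneg)
  moreover have "c *\<^sub>R u = c *\<^sub>R v - c *\<^sub>R w" by (simp add: vw(3) scaleR_diff_right)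
  ultimately show ?thesis using True pu by (simp add: right_diff_distrib)
 next
  case False
  then have "psi ((- c) *\<^sub>R w - (- c) *\<^sub>R v) = norm ((- c) *\<^sub>R w) - norm ((- c) *\<^sub>R v)"
   using vw by (intro psi_diff scaleR_nonneg_nonneg) auto
  moreover have "c *\<^sub>R u = (- c) *\<^sub>R w - (- c) *\<^sub>R v" by (simp add: vw(3) scaleR_diff_right)
  ultimately have "psi (c *\<^sub>R u) = norm ((- c) *\<^sub>R w) - norm ((- c) *\<^sub>R v)" by (simp only:)
  then have "psi (c *\<^sub>R u) = (- c) * norm w - (- c) * norm v" using False by simp
  then show ?thesis unfolding pu by (simp add: right_diff_distrib)
 qed
 show "norm (psi u) <= norm u * 1" using abs_psi_le by simp
qed

lemma has_integral_cone:
 fixes f :: "real => 'a"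
 assumes f: "(f has_integral y) {a..b}" and pos: "\<And>x. x \<in> {a..b} ==> 0 <= f x"
 shows "0 <= y"
proof -
 have "y \<in> closure {u. 0 <= u}"
  unfolding closure_approachable
 proof (intro allI impI)
  fix e :: real assume "0 < e"
  then obtain \<gamma> where \<gamma>: "gauge \<gamma>" "\<And>\<D>. \<D> tagged_division_of {a..b} ==> \<gamma> fine \<D> ==>
    norm ((\<Sum>(x,k)\<in>\<D>. measure lborel k *\<^sub>R f x) - y) < e"
   using f unfolding has_integral_real by meson
  obtain \<D> where \<D>: "\<D> tagged_division_of {a..b}" "\<gamma> fine \<D>"
   using fine_division_exists_real[OF \<gamma>(1)] by blast
  have "0 <= (\<Sum>(x,k)\<in>\<D>. measure lborel k *\<^sub>R f x)"
  proof (rule sum_nonneg)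
   fix p assume p: "p \<in> \<D>"
   obtain x k where pk: "p = (x, k)" by (cases p)
   then have "x \<in> {a..b}"
    using p tagged_division_ofD(2,3)[OF \<D>(1), of x k] by auto
   then show "0 <= (case p of (x,k) => measure lborel k *\<^sub>R f x)"
    using pos pk by (simp add: scaleR_nonneg_nonneg)
  qed
  then show "\<exists>u\<in>{u. 0 <= u}. dist u y < e"
   using \<gamma>(2)[OF \<D>] by (auto simp: dist_norm)
 qed
 then show ?thesis using cone_closed by simp
qed

lemma integral_cone:
 fixes f :: "real => 'a"
 assumes "\<And>x. x \<in> {a..b} ==> 0 <= f x"
 shows "0 <= integral {a..b} f"
proof (cases "f integrable_on {a..b}")
 case True
 then show ?thesis using has_integral_cone assms by (blast dest: integrable_integral)
qed (simp add: not_integrable_integral)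

text \<open>On the cone the norm is the bounded linear functional \<open>psi\<close>, and bounded linear functionals commute with integrals.\<close>

lemma norm_integral_cone:
 fixes f :: "real => 'a"
 assumes f: "f integrable_on {a..b}" and pos: "\<And>x. x \<in> {a..b} ==> 0 <= f x"
 shows "norm (integral {a..b} f) = integral {a..b} (\<lambda>x. norm (f x))"
proof -
 have "norm (integral {a..b} f) = psi (integral {a..b} f)"
  using integral_cone[OF pos] by (simp add: psi_cone)
 also have "\<dots> = integral {a..b} (psi \<circ> f)"
  by (rule integral_linear[OF f bounded_linear_psi, symmetric])
 also have "\<dots> = integral {a..b} (\<lambda>x. norm (f x))"
  by (rule Henstock_Kurzweil_Integration.integral_cong) (simp add: psi_cone pos)
 finally show ?thesis .
qed

lemma cone_borel: "{u::'a. 0 <= u} \<in> sets borel"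
 using cone_closed by (rule borel_closed)

lemma bochner_borel_cone_version:
 fixes f :: "real => 'a"
 assumes f: "bochner_integrable (lebesgue_on S) f" and S: "S \<in> sets borel"
  and pos: "AE x in lborel. x \<in> S --> 0 <= f x"
 obtains g where "bochner_borel g" "\<And>x. x \<notin> S ==> g x = 0" "\<And>x. 0 <= g x"
  "AE x in lborel. x \<in> S --> f x = g x"
proof -
 obtain g where g: "bochner_borel g" "\<And>x. x \<notin> S ==> g x = 0" "AE x in lborel. x \<in> S --> f x = g x"
   "(\<integral>\<^sup>+x. ennreal (norm (g x)) \<partial>lborel) = (\<integral>\<^sup>+x. ennreal (norm (f x)) \<partial>lebesgue_on S)"
  by (rule bochner_integrable_borel_version[OF f S]) (rule that)
 have "g -` {u. 0 <= u} \<inter> space borel \<in> sets borel"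
  by (rule measurable_sets[OF strongly_borel_measurable[OF bochner_borelD(1)[OF g(1)]] cone_borel])
 then have A: "{x. 0 <= g x} \<in> sets borel" by (simp add: vimage_def)
 show thesis
 proof (rule that)
  show "bochner_borel (\<lambda>x. if x \<in> {x. 0 <= g x} then g x else 0)"
   by (rule bochner_borel_restrict[OF g(1) A])
  show "AE x in lborel. x \<in> S --> f x = (if x \<in> {x. 0 <= g x} then g x else 0)"
   using pos g(3) by eventually_elim auto
  show "(if x \<in> {x. 0 <= g x} then g x else 0) = 0" if "x \<notin> S" for x
   using g(2)[OF that] by simp
  show "0 <= (if x \<in> {x. 0 <= g x} then g x else 0)" for x
   by simp
 qed
qed

end

lemma norm_integral_le_bochner:
 fixes f :: "real => 'b::banach"
 assumes "bochner_borel f"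
 shows "norm (integral {a..b} f) <= integral {a..b} (\<lambda>x. norm (f x))"
 by (rule integral_norm_bound_integral) (use bochner_borel_integrable_on[OF assms] in auto)

lemma bochner_borel_operator_interval:
 fixes g :: "real => 'b::real_normed_vector" and W :: "real => 'b => 'c::real_normed_vector"
 assumes g: "bochner_borel g" and cont: "\<And>v. continuous_on {a..b} (\<lambda>r. W r v)"
  and lin: "\<And>r. r \<in> {a..b} ==> linear (W r)"
  and bound: "\<And>r v. r \<in> {a..b} ==> norm (W r v) <= C * norm v"
 shows "bochner_borel (\<lambda>r. if r \<in> {a..b} then W r (g r) else 0)"
proof (cases "a <= b")
 case True
 define W' where "W' r = W (max a (min b r))" for r
 have in_ab: "max a (min b r) \<in> {a..b}" for r using True by auto
 have "bochner_borel (\<lambda>r. W' r (g r))"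
 proof (rule bochner_borel_operator[OF g])
  show "strongly_borel borel (\<lambda>x. W' x v)" for v
   unfolding W'_def
  proof (rule strongly_borel_continuous)
   have "continuous_on UNIV (\<lambda>x. max a (min b x))" by (intro continuous_intros)
   then show "continuous_on UNIV (\<lambda>x. W (max a (min b x)) v)"
    by (rule continuous_on_compose2[OF cont]) (use in_ab in auto)
  qed
  show "linear (W' x)" for x unfolding W'_def by (rule lin[OF in_ab])
  show "norm (W' x v) <= C * norm v" for x v unfolding W'_def by (rule bound[OF in_ab])
 qed
 then have "bochner_borel (\<lambda>r. if r \<in> {a..b} then W' r (g r) else 0)"
  by (rule bochner_borel_restrict) simp
 moreover have "(\<lambda>r. if r \<in> {a..b} then W' r (g r) else 0) = (\<lambda>r. if r \<in> {a..b} then W r (g r) else 0)"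
  by (rule ext) (auto simp: W'_def max_def min_def)
 ultimately show ?thesis by simp
next
 case False
 then have "(\<lambda>r. if r \<in> {a..b} then W r (g r) else 0) = (\<lambda>x. 0)" by auto
 then show ?thesis by (simp add: bochner_borel_def strongly_borel_const)
qed

lemma bochner_borel_DCT:
 fixes F :: "nat => real => 'b::banach"
 assumes F: "\<And>k. bochner_borel (F k)" and F': "bochner_borel F'"
  and w[measurable]: "w \<in> borel_measurable borel" and w_fin: "(\<integral>\<^sup>+x. ennreal (w x) \<partial>lborel) < \<infinity>"
  and le: "\<And>k x. norm (F k x) <= w x" and lim: "AE x in lborel. (\<lambda>k. F k x) \<longlonglongrightarrow> F' x"
 shows "(\<lambda>k. \<integral>\<^sup>+x. ennreal (norm (F k x - F' x)) \<partial>lborel) \<longlonglongrightarrow> 0"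
  and "(\<lambda>k. integral {a..b} (F k)) \<longlonglongrightarrow> integral {a..b} F'"
proof -
 have w0: "0 <= w x" for x using le[of 0 x] norm_ge_zero order_trans by blast
 have [measurable]: "(\<lambda>x. norm (F k x - F' x)) \<in> borel_measurable borel" for k
  by (rule bochner_borelD(3)[OF bochner_borel_diff[OF F F']])
 have "(\<lambda>k. \<integral>\<^sup>+x. ennreal (norm (F k x - F' x)) \<partial>lborel) \<longlonglongrightarrow> (\<integral>\<^sup>+(x::real). 0 \<partial>lborel)"
 proof (rule nn_integral_dominated_convergence[where w="\<lambda>x. 2 * ennreal (w x)"])
  show "(\<integral>\<^sup>+x. 2 * ennreal (w x) \<partial>lborel) < \<infinity>"
   using w_fin by (simp add: nn_integral_cmult ennreal_mult_less_top)
  show "AE x in lborel. ennreal (norm (F j x - F' x)) <= 2 * ennreal (w x)" for j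
   using lim
  proof eventually_elim
   case (elim x)
   have "norm (F' x) <= w x"
    by (rule LIMSEQ_le_const2[OF tendsto_norm[OF elim]]) (use le in auto)
   then have "norm (F j x - F' x) <= 2 * w x"
    using norm_triangle_ineq4[of "F j x" "F' x"] le[of j x] by linarith
   then show ?case
    using w0[of x] by (simp add: ennreal_mult'[symmetric] ennreal_numeral[symmetric] ennreal_leI del: ennreal_numeral)
  qed
  show "AE x in lborel. (\<lambda>k. ennreal (norm (F k x - F' x))) \<longlonglongrightarrow> 0"
   using lim
  proof eventually_elim
   case (elim x)
   have "(\<lambda>k. norm (F k x - F' x)) \<longlonglongrightarrow> norm (F' x - F' x)"
    by (intro tendsto_intros elim)
   then have "(\<lambda>k. ennreal (norm (F k x - F' x))) \<longlonglongrightarrow> ennreal (norm (F' x - F' x))"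
    by (rule tendsto_ennrealI)
   then show ?case by simp
  qed
 qed measurable
 then show lim0: "(\<lambda>k. \<integral>\<^sup>+x. ennreal (norm (F k x - F' x)) \<partial>lborel) \<longlonglongrightarrow> 0" by simp
 have le': "norm (integral {a..b} (F k) - integral {a..b} F') <= enn2real (\<integral>\<^sup>+x. ennreal (norm (F k x - F' x)) \<partial>lborel)" for k
 proof -
  have D: "bochner_borel (\<lambda>x. F k x - F' x)" by (rule bochner_borel_diff[OF F F'])
  have "norm (integral {a..b} (F k) - integral {a..b} F') = norm (integral {a..b} (\<lambda>x. F k x - F' x))"
   using bochner_borel_integrable_on(1)[OF F] bochner_borel_integrable_on(1)[OF F']
   by (simp add: Henstock_Kurzweil_Integration.integral_diff)
  also have "\<dots> <= integral {a..b} (\<lambda>x. norm (F k x - F' x))"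
   by (rule norm_integral_le_bochner[OF D])
  finally have "ennreal (norm (integral {a..b} (F k) - integral {a..b} F')) <= ennreal (integral {a..b} (\<lambda>x. norm (F k x - F' x)))"
   by (rule ennreal_leI)
  also have "\<dots> <= (\<integral>\<^sup>+x. ennreal (norm (F k x - F' x)) \<partial>lborel)"
   unfolding bochner_borel_integrable_on(5)[OF D]
   by (intro nn_integral_mono) (simp add: indicator_def)
  finally have "enn2real (ennreal (norm (integral {a..b} (F k) - integral {a..b} F')))
    <= enn2real (\<integral>\<^sup>+x. ennreal (norm (F k x - F' x)) \<partial>lborel)"
   by (rule enn2real_mono) (use bochner_borelD(2)[OF D] in simp)
  then show ?thesis by simp
 qed
 have "(\<lambda>k. enn2real (\<integral>\<^sup>+x. ennreal (norm (F k x - F' x)) \<partial>lborel)) \<longlonglongrightarrow> enn2real 0"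
  using lim0 by (intro tendsto_enn2real) auto
 then have "(\<lambda>k. enn2real (\<integral>\<^sup>+x. ennreal (norm (F k x - F' x)) \<partial>lborel)) \<longlonglongrightarrow> 0" by simp
 then have "(\<lambda>k. integral {a..b} (F k) - integral {a..b} F') \<longlonglongrightarrow> 0"
  by (rule Lim_null_comparison[rotated]) (simp add: le')
 then show "(\<lambda>k. integral {a..b} (F k)) \<longlonglongrightarrow> integral {a..b} F'"
  by (simp add: LIM_zero_iff)
qed

abbreviation Tri :: "(real \<times> real) set" where
 "Tri \<equiv> {(t, s). 0 <= s \<and> s <= t}"

section \<open>The Dyson--Phillips terms\<close>

locale substochastic_perturbation = additive_norm_cone E
 for E :: "'a::{banach, ordered_real_vector} itself" +
 fixes U :: "real => real => 'a => 'a"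
  and B :: "real => 'a => 'a"
  and D :: "real => 'a set"
 assumes evol: "evolution_family U"
  and dom_subspace: "\<And>t. 0 <= t ==> subspace (D t)"
  and B_add: "\<And>t u v. 0 <= t ==> u \<in> D t ==> v \<in> D t ==> B t (u + v) = B t u + B t v"
  and B_scaleR: "\<And>t c u. 0 <= t ==> u \<in> D t ==> B t (c *\<^sub>R u) = c *\<^sub>R B t u"
  and U_pos: "\<And>t s u. 0 <= s ==> s <= t ==> 0 <= u ==> 0 <= U t s u"
  and U_contr: "\<And>t s u. 0 <= s ==> s <= t ==> 0 <= u ==> norm (U t s u) <= norm u"
  and B_pos: "\<And>t u. 0 <= t ==> u \<in> D t ==> 0 <= u ==> 0 <= B t u"
  and BU_dom: "\<And>s u. 0 <= s ==> AE t in lebesgue_on {s..}. U t s u \<in> D t"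
  and BU_meas: "\<And>s u. 0 <= s ==> strongly_measurable (lebesgue_on {s..}) (\<lambda>t. B t (U t s u))"
  and BU_bound: "\<And>t s u. 0 <= s ==> s <= t ==> 0 <= u ==>
    (\<integral>\<^sup>+\<tau>. ennreal (norm (B \<tau> (U \<tau> s u))) \<partial>lebesgue_on {s..t})
     <= ennreal (norm u - norm (U t s u))"
  and B_increasingly_closed: "\<And>t u x. 0 <= t ==> (\<And>n. u n \<in> D t) ==> (\<And>n. 0 <= u n) ==> incseq u ==>
    u \<longlonglongrightarrow> x ==> 0 <= x ==> bdd_above (range (\<lambda>n. norm (B t (u n)))) ==>
    x \<in> D t \<and> (\<lambda>n. B t (u n)) \<longlonglongrightarrow> B t x"
begin

abbreviation V :: "nat => real => real => 'a => 'a" where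
 "V \<equiv> dyson U B"

abbreviation CB :: real where "CB \<equiv> 2 * dec_bound E"

lemma B_diff: "0 <= t ==> u \<in> D t ==> v \<in> D t ==> B t (u - v) = B t u - B t v"
 using B_add[of t u "(-1) *\<^sub>R v"] B_scaleR[of t v "-1"] subspace_scale[OF dom_subspace, of t v "-1"]
 by simp

lemma evolution:
 "\<forall>t s. 0 <= s \<and> s <= t --> bounded_linear (U t s)"
 "\<forall>u. continuous_on Tri (\<lambda>(t, s). U t s u)"
 "\<forall>t r s. 0 <= s \<and> s <= r \<and> r <= t --> U t s = U t r \<circ> U r s"
 "\<forall>t\<ge>0. U t t = id"
 by (insert evol[unfolded evolution_family_def]) (elim conjE, assumption)+

lemma U_linear: "0 <= s ==> s <= t ==> linear (U t s)"
 using evolution(1) by (simp add: bounded_linear.linear)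

lemma U_compose: "0 <= s ==> s <= r ==> r <= t ==> U t s u = U t r (U r s u)"
 using evolution(3) by simp

lemma U_refl: "0 <= t ==> U t t u = u"
 using evolution(4) by simp

lemma U_cont: "continuous_on Tri (\<lambda>(t, s). U t s u)"
 using evolution(2) by simp

lemma U_bound: "0 <= s ==> s <= t ==> norm (U t s u) <= CB * norm u"
 by (rule cone_contraction_bound[OF U_linear U_contr])

lemma BU_dom': "0 <= s ==> AE r in lborel. s <= r --> U r s u \<in> D r"
 using BU_dom[of s u] by (simp add: AE_lebesgue_on_iff)

text \<open>\<open>version s T u g\<close> says that \<open>g\<close> is an everywhere measurable representative of
 \<open>r \<mapsto> B(r) U(r,s) u\<close> on the interval from \<open>s\<close> to \<open>T\<close>.\<close>

definition version :: "real => real => 'a => (real => 'a) => bool" where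
 "version s T u g \<longleftrightarrow> bochner_borel g \<and> (AE r in lborel. r \<in> {s..T} --> B r (U r s u) = g r)"

lemma version_cone:
 assumes s: "0 <= s" "s <= T" and u: "0 <= u"
 obtains g where "version s T u g" "\<And>r. 0 <= g r"
  "\<And>t. s <= t ==> t <= T ==> integral {s..t} (\<lambda>r. norm (g r)) + norm (U t s u) <= norm u"
proof -
 obtain h where h: "strongly_borel borel h" "\<And>x. x \<notin> {s..} ==> h x = 0"
   "AE r in lborel. r \<in> {s..} --> B r (U r s u) = h r"
  by (rule strongly_measurable_borel_version[OF BU_meas[OF s(1)]]) (simp, rule that)
 have sm: "strongly_measurable (lebesgue_on {s..T}) (\<lambda>r. B r (U r s u))"
 proof (rule strongly_borel_imp_strongly_measurable[OF h(1)])
  show "AE r in lebesgue_on {s..T}. B r (U r s u) = h r"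
   using h(3) by (simp add: AE_lebesgue_on_iff) (auto elim: eventually_mono)
 qed
 have int: "bochner_integrable (lebesgue_on {s..T}) (\<lambda>r. B r (U r s u))"
  unfolding bochner_integrable_def using sm le_less_trans[OF BU_bound[OF s u], of \<infinity>] by simp
 have pos: "AE r in lborel. r \<in> {s..T} --> 0 <= B r (U r s u)"
  using BU_dom'[OF s(1), of u]
 proof eventually_elim
  case (elim r)
  then show ?case
   using B_pos[of r "U r s u"] U_pos[OF s(1) _ u, of r] s(1) by auto
 qed
 obtain g where g: "bochner_borel g" "\<And>x. x \<notin> {s..T} ==> g x = 0" "\<And>x. 0 <= g x"
  "AE r in lborel. r \<in> {s..T} --> B r (U r s u) = g r"
  by (rule bochner_borel_cone_version[OF int _ pos]) (simp, rule that)
 show thesis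
 proof (rule that)
  show "version s T u g" using g by (simp add: version_def)
  show "0 <= g r" for r by (rule g(3))
  fix t assume t: "s <= t" "t <= T"
  have "ennreal (integral {s..t} (\<lambda>r. norm (g r))) = (\<integral>\<^sup>+r. ennreal (norm (g r)) * indicator {s..t} r \<partial>lborel)"
   by (rule bochner_borel_integrable_on(5)[OF g(1)])
  also have "\<dots> = (\<integral>\<^sup>+r. ennreal (norm (B r (U r s u))) * indicator {s..t} r \<partial>lborel)"
   by (rule nn_integral_cong_AE, use g(4) in eventually_elim) (use t in \<open>auto simp: indicator_def\<close>)
  also have "\<dots> <= ennreal (norm u - norm (U t s u))"
   using BU_bound[OF s(1) t(1) u] by (simp add: nn_integral_lebesgue_on)
  finally show "integral {s..t} (\<lambda>r. norm (g r)) + norm (U t s u) <= norm u"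
   using U_contr[OF s(1) t(1) u] by (simp add: ennreal_le_iff)
 qed
qed

lemma version_diff:
 assumes s: "0 <= s" and "version s T u g" "version s T v h"
 shows "version s T (u - v) (\<lambda>r. g r - h r)"
 unfolding version_def
proof
 show "bochner_borel (\<lambda>r. g r - h r)"
  using assms by (intro bochner_borel_diff) (auto simp: version_def)
 have "AE r in lborel. r \<in> {s..T} --> B r (U r s u) = g r" "AE r in lborel. r \<in> {s..T} --> B r (U r s v) = h r"
  using assms by (auto simp: version_def)
 then show "AE r in lborel. r \<in> {s..T} --> B r (U r s (u - v)) = g r - h r"
  using BU_dom'[OF s, of u] BU_dom'[OF s, of v]
 proof eventually_elim
  case (elim r)
  show ?case
  proof
   assume r: "r \<in> {s..T}"
   then have "U r s (u - v) = U r s u - U r s v"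
    using linear_diff[OF U_linear[OF s, of r]] by simp
   then show "B r (U r s (u - v)) = g r - h r"
    using elim r s B_diff[of r "U r s u" "U r s v"] by simp
  qed
 qed
qed

lemma version_scaleR:
 assumes s: "0 <= s" and "version s T u g"
 shows "version s T (c *\<^sub>R u) (\<lambda>r. c *\<^sub>R g r)"
 unfolding version_def
proof
 show "bochner_borel (\<lambda>r. c *\<^sub>R g r)"
  using assms by (intro bochner_borel_linear[OF _ bounded_linear_scaleR_right]) (auto simp: version_def)
 have "AE r in lborel. r \<in> {s..T} --> B r (U r s u) = g r"
  using assms by (auto simp: version_def)
 then show "AE r in lborel. r \<in> {s..T} --> B r (U r s (c *\<^sub>R u)) = c *\<^sub>R g r"
  using BU_dom'[OF s, of u]
 proof eventually_elim
  case (elim r)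
  show ?case
  proof
   assume r: "r \<in> {s..T}"
   then have "U r s (c *\<^sub>R u) = c *\<^sub>R U r s u"
    using linear_scale[OF U_linear[OF s, of r]] by simp
   then show "B r (U r s (c *\<^sub>R u)) = c *\<^sub>R g r"
    using elim r s B_scaleR[of r "U r s u" c] by simp
  qed
 qed
qed

lemma version_ex:
 assumes s: "0 <= s" "s <= T"
 obtains g where "version s T u g"
proof -
 obtain v w where vw: "0 <= v" "0 <= w" "u = v - w" using cone_generating[of u] by blast
 obtain g where g: "version s T v g" by (rule version_cone[OF s vw(1)])
 obtain h where h: "version s T w h" by (rule version_cone[OF s vw(2)])
 show thesis
  using that version_diff[OF s(1) g h] vw(3) by simp
qed

lemma version_mono:
 assumes "version s T u g" "s <= r" "t <= T" "0 <= s"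
 shows "version r t (U r s u) g"
 unfolding version_def
proof
 show "bochner_borel g" using assms by (simp add: version_def)
 have "AE q in lborel. q \<in> {s..T} --> B q (U q s u) = g q" using assms by (simp add: version_def)
 then show "AE q in lborel. q \<in> {r..t} --> B q (U q r (U r s u)) = g q"
 proof eventually_elim
  case (elim q)
  then show ?case
   using U_compose[of s r q u] assms by auto
 qed
qed

text \<open>The properties of \<open>V n\<close> that are carried through the induction on \<open>n\<close>.\<close>

definition regular :: "(real => real => 'a => 'a) => bool" where
 "regular W \<longleftrightarrow> (\<forall>t s. 0 <= s --> s <= t --> linear (W t s) \<and>
    (\<forall>u\<ge>0. 0 <= W t s u \<and> norm (W t s u) <= norm u)) \<and>
   (\<forall>u. continuous_on Tri (\<lambda>(t, s). W t s u))"

lemma regularD: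
 assumes "regular W" "0 <= s" "s <= t"
 shows "linear (W t s)" "0 <= u ==> 0 <= W t s u" "0 <= u ==> norm (W t s u) <= norm u"
  "norm (W t s u) <= CB * norm u" "bounded_linear (W t s)"
proof -
 show lin: "linear (W t s)" and "0 <= u ==> 0 <= W t s u" and c: "0 <= u ==> norm (W t s u) <= norm u" for u
  using assms unfolding regular_def by blast+
 show b: "norm (W t s u) <= CB * norm u" for u by (rule cone_contraction_bound[OF lin c])
 show "bounded_linear (W t s)"
  using b linear_add[OF lin] linear_scale[OF lin]
  by (intro bounded_linear_intro[of _ CB]) (auto simp: mult.commute)
qed

lemma regular_cont: "regular W ==> continuous_on Tri (\<lambda>(t, s). W t s u)"
 unfolding regular_def by blast

lemma regular_cont_comp:
 assumes "regular W" "continuous_on S f" "continuous_on S g" "\<And>x. x \<in> S ==> 0 <= g x \<and> g x <= f x"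
 shows "continuous_on S (\<lambda>x. W (f x) (g x) u)"
proof -
 have sub: "(\<lambda>x. (f x, g x)) ` S \<subseteq> Tri"
 proof (rule image_subsetI)
  fix x assume "x \<in> S"
  from assms(4)[OF this] show "(f x, g x) \<in> Tri" by blast
 qed
 show ?thesis
  using continuous_on_compose2[OF regular_cont[OF assms(1), of u] continuous_on_Pair[OF assms(2,3)] sub]
  by simp
qed

lemma regular_U: "regular U"
 unfolding regular_def by (intro conjI allI impI U_cont) (rule U_linear U_pos U_contr; assumption)+

lemma bochner_borel_regular:
 assumes W: "regular W" and "0 <= s" and g: "bochner_borel g"
 shows "bochner_borel (\<lambda>r. if r \<in> {s..t} then W t r (g r) else 0)"
  and "(\<lambda>r. W t r (g r)) integrable_on {s..t}"
proof -
 show b: "bochner_borel (\<lambda>r. if r \<in> {s..t} then W t r (g r) else 0)"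
 proof (rule bochner_borel_operator_interval[OF g, of s t "\<lambda>r. W t r" CB])
  show "continuous_on {s..t} (\<lambda>r. W t r v)" for v
   using \<open>0 <= s\<close> by (intro regular_cont_comp[OF W] continuous_intros) auto
  show "linear (W t r)" "norm (W t r v) <= CB * norm v" if "r \<in> {s..t}" for r v
   using that \<open>0 <= s\<close> by (auto intro: regularD[OF W])
 qed
 show "(\<lambda>r. W t r (g r)) integrable_on {s..t}"
  using bochner_borel_integrable_on(1)[OF b, of s t]
  by (rule integrable_eq) simp
qed

lemma V_Suc_eq:
 assumes "regular (V n)" "0 <= s" "t <= T" "version s T u g"
 shows "V (Suc n) t s u = integral {s..t} (\<lambda>r. V n t r (g r))"
proof -
 let ?h = "\<lambda>r. if r \<in> {s..t} then V n t r (g r) else 0"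
 have g: "bochner_borel g" "AE r in lborel. r \<in> {s..T} --> B r (U r s u) = g r"
  using assms(4) by (auto simp: version_def)
 have ae: "AE r in lborel. r \<in> {s..t} --> V n t r (B r (U r s u)) = ?h r"
  using g(2) by eventually_elim (use assms(3) in auto)
 have "bochner_integrable (lebesgue_on {s..t}) (\<lambda>r. V n t r (B r (U r s u)))"
  by (rule bochner_borel_imp_bochner_integrable[OF bochner_borel_regular(1)[OF assms(1,2) g(1), of t] ae]) simp
 from has_integral_bochner_integral[OF this]
 have "V (Suc n) t s u = integral {s..t} (\<lambda>r. V n t r (B r (U r s u)))"
  by (simp add: integral_unique)
 also have "\<dots> = integral {s..t} ?h"
  by (rule integral_AE_cong(1)[OF ae])
 also have "\<dots> = integral {s..t} (\<lambda>r. V n t r (g r))"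
  by (rule Henstock_Kurzweil_Integration.integral_cong) simp
 finally show ?thesis .
qed

lemma V_Suc_linear:
 assumes n: "regular (V n)" and s: "0 <= s" "s <= t"
 shows "linear (V (Suc n) t s)"
proof -
 have diff: "V (Suc n) t s (u - v) = V (Suc n) t s u - V (Suc n) t s v" for u v
 proof -
  obtain g where g: "version s t u g" by (rule version_ex[OF s])
  obtain h where h: "version s t v h" by (rule version_ex[OF s])
  have bg: "bochner_borel g" "bochner_borel h" using g h by (auto simp: version_def)
  have "V (Suc n) t s (u - v) = integral {s..t} (\<lambda>r. V n t r (g r - h r))"
   by (rule V_Suc_eq[OF n s(1) order_refl version_diff[OF s(1) g h]])
  also have "\<dots> = integral {s..t} (\<lambda>r. V n t r (g r) - V n t r (h r))"
   using s by (intro Henstock_Kurzweil_Integration.integral_cong linear_diff regularD[OF n]) auto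
  also have "\<dots> = integral {s..t} (\<lambda>r. V n t r (g r)) - integral {s..t} (\<lambda>r. V n t r (h r))"
   by (intro Henstock_Kurzweil_Integration.integral_diff bochner_borel_regular[OF n s(1)] bg)
  finally show ?thesis
   using V_Suc_eq[OF n s(1) order_refl g] V_Suc_eq[OF n s(1) order_refl h] by simp
 qed
 have scale: "V (Suc n) t s (c *\<^sub>R u) = c *\<^sub>R V (Suc n) t s u" for c u
 proof -
  obtain g where g: "version s t u g" by (rule version_ex[OF s])
  have "V (Suc n) t s (c *\<^sub>R u) = integral {s..t} (\<lambda>r. V n t r (c *\<^sub>R g r))"
   by (rule V_Suc_eq[OF n s(1) order_refl version_scaleR[OF s(1) g]])
  also have "\<dots> = integral {s..t} (\<lambda>r. c *\<^sub>R V n t r (g r))"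
   using s by (intro Henstock_Kurzweil_Integration.integral_cong linear_scale regularD[OF n]) auto
  finally show ?thesis
   using V_Suc_eq[OF n s(1) order_refl g] by simp
 qed
 show ?thesis
 proof (rule linearI)
  show "V (Suc n) t s (u + v) = V (Suc n) t s u + V (Suc n) t s v" for u v
   using diff[of u "(-1) *\<^sub>R v"] scale[of "-1" v] by simp
 qed (rule scale)
qed

text \<open>The mass that \<open>B\<close> picks up along \<open>U\<close> is at most the mass that \<open>U\<close> loses, and \<open>V n\<close> does not increase it.\<close>

lemma V_Suc_cone:
 assumes n: "regular (V n)" and s: "0 <= s" "s <= t" and u: "0 <= u"
 shows "0 <= V (Suc n) t s u" "norm (V (Suc n) t s u) + norm (U t s u) <= norm u"
proof -
 obtain g where g: "version s t u g" "\<And>r. 0 <= g r"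
  "\<And>t'. s <= t' ==> t' <= t ==> integral {s..t'} (\<lambda>r. norm (g r)) + norm (U t' s u) <= norm u"
  by (rule version_cone[OF s u]) (rule that)
 have bg: "bochner_borel g" using g by (auto simp: version_def)
 have eq: "V (Suc n) t s u = integral {s..t} (\<lambda>r. V n t r (g r))"
  by (rule V_Suc_eq[OF n s(1) order_refl g(1)])
 show "0 <= V (Suc n) t s u"
  unfolding eq using s g(2) by (intro integral_cone regularD[OF n]) auto
 have "norm (V (Suc n) t s u) <= integral {s..t} (\<lambda>r. norm (g r))"
  unfolding eq
  using s g(2) by (intro integral_norm_bound_integral bochner_borel_regular[OF n s(1) bg]
    bochner_borel_integrable_on[OF bg] regularD[OF n]) auto
 then show "norm (V (Suc n) t s u) + norm (U t s u) <= norm u"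
  using g(3)[OF s(2) order_refl] by simp
qed

text \<open>The composition law of the Dyson--Phillips terms: a Cauchy product in the order of perturbation.\<close>

definition composition :: "nat => bool" where
 "composition n \<longleftrightarrow> (\<forall>t r s u. 0 <= s --> s <= r --> r <= t -->
   V n t s u = (\<Sum>j\<le>n. V (n - j) t r (V j r s u)))"

text \<open>Splitting the integral that defines \<open>V (Suc n) t s\<close> at \<open>r\<close>: the part after \<open>r\<close> gives the term with \<open>j = 0\<close>, the part before \<open>r\<close> the others.\<close>

lemma V_Suc_composition:
 assumes reg: "\<And>k. k <= n ==> regular (V k)" and comp: "composition n"
 shows "composition (Suc n)"
 unfolding composition_def
proof (intro allI impI)
 fix t r s :: real and u :: 'a assume *: "0 <= s" "s <= r" "r <= t"
 have n: "regular (V n)" by (rule reg) simp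
 obtain g where g: "version s t u g" using * by (auto intro: version_ex[of s t u])
 have bg: "bochner_borel g" using g by (auto simp: version_def)
 have "V (Suc n) t s u = integral {s..t} (\<lambda>q. V n t q (g q))"
  by (rule V_Suc_eq[OF n *(1) order_refl g])
 also have "\<dots> = integral {s..r} (\<lambda>q. V n t q (g q)) + integral {r..t} (\<lambda>q. V n t q (g q))"
  using * by (intro Henstock_Kurzweil_Integration.integral_combine[symmetric] bochner_borel_regular[OF n *(1) bg]) auto
 also have "integral {r..t} (\<lambda>q. V n t q (g q)) = V (Suc n) t r (U r s u)"
  using * by (intro V_Suc_eq[OF n _ order_refl version_mono[OF g *(2) order_refl *(1)], symmetric]) auto
 also have "integral {s..r} (\<lambda>q. V n t q (g q)) = integral {s..r} (\<lambda>q. \<Sum>j\<le>n. V (n - j) t r (V j r q (g q)))"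
  using comp * unfolding composition_def by (intro Henstock_Kurzweil_Integration.integral_cong) auto
 also have "\<dots> = (\<Sum>j\<le>n. integral {s..r} (\<lambda>q. V (n - j) t r (V j r q (g q))))"
 proof (rule Henstock_Kurzweil_Integration.integral_sum)
  show "(\<lambda>q. V (n - j) t r (V j r q (g q))) integrable_on {s..r}" if "j \<in> {..n}" for j
   using integrable_linear[OF bochner_borel_regular(2)[OF reg[of j] *(1) bg, of r] regularD(5)[OF reg[of "n - j"], of r t]] that *
   by (simp add: o_def)
 qed simp
 also have "\<dots> = (\<Sum>j\<le>n. V (n - j) t r (V (Suc j) r s u))"
 proof (rule sum.cong)
  fix j assume j: "j \<in> {..n}"
  have "integral {s..r} (\<lambda>q. V (n - j) t r (V j r q (g q))) = V (n - j) t r (integral {s..r} (\<lambda>q. V j r q (g q)))"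
   using integral_linear[OF bochner_borel_regular(2)[OF reg[of j] *(1) bg, of r] regularD(5)[OF reg[of "n - j"], of r t]] j *
   by (simp add: o_def)
  also have "integral {s..r} (\<lambda>q. V j r q (g q)) = V (Suc j) r s u"
   using j * by (intro V_Suc_eq[OF reg[of j] *(1) _ g, symmetric]) auto
  finally show "integral {s..r} (\<lambda>q. V (n - j) t r (V j r q (g q))) = V (n - j) t r (V (Suc j) r s u)" .
 qed simp
 finally have "V (Suc n) t s u = V (Suc n) t r (V 0 r s u) + (\<Sum>j\<le>n. V (n - j) t r (V (Suc j) r s u))"
  by simp
 also have "\<dots> = (\<Sum>j\<le>Suc n. V (Suc n - j) t r (V j r s u))"
  by (simp only: sum.atMost_Suc_shift diff_Suc_Suc diff_zero)
 finally show "V (Suc n) t s u = (\<Sum>j\<le>Suc n. V (Suc n - j) t r (V j r s u))" .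
qed

end

lemma integral_restrict_subset:
 fixes f :: "real => 'b::banach"
 assumes "S \<subseteq> T"
 shows "integral T (\<lambda>x. if x \<in> S then f x else 0) = integral S f"
 unfolding integral_def integrable_on_def has_integral_restrict[OF assms] by simp

context substochastic_perturbation
begin

text \<open>The variation-of-constants integral: for \<open>W = U\<close> the solution with source \<open>f\<close> that vanishes at time \<open>y\<close>.\<close>

definition conv :: "(real => real => 'a => 'a) => real => (real => 'a) => real => 'a" where
 "conv W y f x = integral {y..x} (\<lambda>q. W x q (f q))"

lemma conv_tendsto:
 assumes W: "regular W" and f: "bochner_borel f" and x: "x \<longlonglongrightarrow> X" and y: "y \<longlonglongrightarrow> Y"
  and le: "\<And>k. 0 <= y k" "\<And>k. y k <= x k"
 shows "(\<lambda>k. conv W (y k) f (x k)) \<longlonglongrightarrow> conv W Y f X"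
proof -
 have Y: "0 <= Y" using LIMSEQ_le_const[OF y] le(1) by blast
 have YX: "Y <= X" using LIMSEQ_le[OF y x] le(2) by blast
 obtain T where T: "\<And>k. x k <= T"
  using Bseq_bdd_above[OF convergent_imp_Bseq[OF convergentI[OF x]]] unfolding bdd_above_def by blast
 have XT: "X <= T" by (rule LIMSEQ_le_const2[OF x]) (use T in blast)
 define F where "F k q = (if q \<in> {y k..x k} then W (x k) q (f q) else 0)" for k q
 define F' where "F' q = (if q \<in> {Y..X} then W X q (f q) else 0)" for q
 have F: "bochner_borel (F k)" for k
  unfolding F_def by (rule bochner_borel_regular(1)[OF W le(1) f])
 have F': "bochner_borel F'"
  unfolding F'_def by (rule bochner_borel_regular(1)[OF W Y f])
 have eq: "integral {0..T} (F k) = conv W (y k) f (x k)" for k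
  unfolding F_def conv_def using le T by (intro integral_restrict_subset) auto
 have eq': "integral {0..T} F' = conv W Y f X"
  unfolding F'_def conv_def using Y XT by (intro integral_restrict_subset) auto
 have CB: "0 <= CB" using dec_bound(1) by simp
 have "(\<lambda>k. integral {0..T} (F k)) \<longlonglongrightarrow> integral {0..T} F'"
 proof (rule bochner_borel_DCT(2)[OF F F', of "\<lambda>q. CB * norm (f q)"])
  show "(\<lambda>q. CB * norm (f q)) \<in> borel_measurable borel"
   using bochner_borelD(3)[OF f] by measurable
  have "(\<integral>\<^sup>+q. ennreal (CB * norm (f q)) \<partial>lborel) = ennreal CB * (\<integral>\<^sup>+q. ennreal (norm (f q)) \<partial>lborel)"
   using bochner_borelD(3)[OF f] CB by (subst nn_integral_cmult[symmetric]) (auto simp: ennreal_mult')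
  then show "(\<integral>\<^sup>+q. ennreal (CB * norm (f q)) \<partial>lborel) < \<infinity>"
   using bochner_borelD(2)[OF f] by (simp add: ennreal_mult_less_top)
  show "norm (F k q) <= CB * norm (f q)" for k q
  proof (cases "q \<in> {y k..x k}")
   case True
   then have "0 <= q" "q <= x k" using le(1)[of k] by auto
   then show ?thesis using True regularD(4)[OF W, of q "x k" "f q"] by (simp add: F_def)
  qed (use CB in \<open>simp add: F_def del: atLeastAtMost_iff\<close>)
  show "AE q in lborel. (\<lambda>k. F k q) \<longlonglongrightarrow> F' q"
   using AE_lborel_singleton[of X] AE_lborel_singleton[of Y]
  proof eventually_elim
   case (elim q)
   consider "q < Y" | "X < q" | "Y < q" "q < X" using elim by linarith
   then show ?case
   proof cases
    case 1
    have "\<forall>\<^sub>F k in sequentially. q < y k" using order_tendstoD(1)[OF y 1] .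
    then have "\<forall>\<^sub>F k in sequentially. F k q = F' q"
     by eventually_elim (use 1 in \<open>simp add: F_def F'_def\<close>)
    then show ?thesis by (rule tendsto_eventually)
   next
    case 2
    have "\<forall>\<^sub>F k in sequentially. x k < q" using order_tendstoD(2)[OF x 2] .
    then have "\<forall>\<^sub>F k in sequentially. F k q = F' q"
     by eventually_elim (use 2 in \<open>simp add: F_def F'_def\<close>)
    then show ?thesis by (rule tendsto_eventually)
   next
    case 3
    then have q: "0 <= q" using Y by simp
    have ev: "\<forall>\<^sub>F k in sequentially. y k < q \<and> q < x k"
     using order_tendstoD(2)[OF y 3(1)] order_tendstoD(1)[OF x 3(2)] by (rule eventually_conj)
    have "((\<lambda>k. (\<lambda>(t, s). W t s (f q)) (max (x k) q, q)) \<longlongrightarrow> (\<lambda>(t, s). W t s (f q)) (max X q, q)) sequentially"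
    proof (rule continuous_on_tendsto_compose[OF regular_cont[OF W]])
     show "(\<lambda>k. (max (x k) q, q)) \<longlonglongrightarrow> (max X q, q)"
      by (intro tendsto_intros x)
    qed (use q in auto)
    then have "(\<lambda>k. W (max (x k) q) q (f q)) \<longlonglongrightarrow> F' q"
     using 3 by (simp add: F'_def max_def)
    moreover have "\<forall>\<^sub>F k in sequentially. W (max (x k) q) q (f q) = F k q"
     using ev by eventually_elim (simp add: F_def max_def)
    ultimately show ?thesis by (rule Lim_transform_eventually)
   qed
  qed
 qed
 then show ?thesis unfolding eq eq' .
qed

text \<open>By the composition law a change of the initial time from \<open>s\<close> to \<open>s'\<close> only involves the terms over the short interval between them, and on the cone those of positive order are bounded by the mass that \<open>U\<close> loses there.\<close>

lemma V_Suc_increment: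
 assumes reg: "\<And>k. k <= n ==> regular (V k)" and comp: "composition (Suc n)"
  and s: "0 <= s" "s <= s'" "s' <= t" and u: "0 <= u"
 shows "norm (V (Suc n) t s u - V (Suc n) t s' u) <= (CB + real (Suc n)) * norm (U s' s u - u)"
proof -
 have n: "regular (V n)" by (rule reg) simp
 have s': "0 <= s'" using s by simp
 have lin: "linear (V (Suc n) t s')" by (rule V_Suc_linear[OF n s' s(3)])
 have "V (Suc n) t s u = (\<Sum>j\<le>Suc n. V (Suc n - j) t s' (V j s' s u))"
  using comp s unfolding composition_def by blast
 also have "\<dots> = V (Suc n) t s' (U s' s u) + (\<Sum>j\<le>n. V (n - j) t s' (V (Suc j) s' s u))"
  by (simp only: sum.atMost_Suc_shift diff_Suc_Suc diff_zero dyson.simps(1))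
 finally have "V (Suc n) t s u - V (Suc n) t s' u
   = V (Suc n) t s' (U s' s u - u) + (\<Sum>j\<le>n. V (n - j) t s' (V (Suc j) s' s u))"
  using linear_diff[OF lin, of "U s' s u" u] by simp
 also have "norm \<dots> <= CB * norm (U s' s u - u) + (\<Sum>j\<le>n. norm (U s' s u - u))"
 proof (intro norm_triangle_mono sum_norm_le)
  show "norm (V (Suc n) t s' (U s' s u - u)) <= CB * norm (U s' s u - u)"
   by (rule cone_contraction_bound[OF lin]) (use V_Suc_cone(2)[OF n s' s(3)] norm_ge_zero in \<open>smt (verit)\<close>)
  fix j assume "j \<in> {..n}"
  then have j: "regular (V j)" "regular (V (n - j))" by (auto intro: reg)
  have "norm (V (n - j) t s' (V (Suc j) s' s u)) <= norm (V (Suc j) s' s u)"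
   by (rule regularD(3)[OF j(2) s' s(3) V_Suc_cone(1)[OF j(1) s(1,2) u]])
  also have "\<dots> <= norm u - norm (U s' s u)"
   using V_Suc_cone(2)[OF j(1) s(1,2) u] by simp
  also have "\<dots> <= norm (U s' s u - u)"
   using norm_triangle_ineq2[of u "U s' s u"] by (simp add: norm_minus_commute)
  finally show "norm (V (n - j) t s' (V (Suc j) s' s u)) <= norm (U s' s u - u)" .
 qed
 finally show ?thesis by (simp add: algebra_simps)
qed

lemma U_diagonal_tendsto:
 assumes "a \<longlonglongrightarrow> s" "b \<longlonglongrightarrow> s" "\<And>k. 0 <= b k" "\<And>k. b k <= a k" 
 shows "(\<lambda>k. norm (U (a k) (b k) u - u)) \<longlonglongrightarrow> 0"
proof -
 have s: "0 <= s" using LIMSEQ_le_const[OF assms(2)] assms(3) by blast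
 have "((\<lambda>k. (\<lambda>(t, s). U t s u) (a k, b k)) \<longlongrightarrow> (\<lambda>(t, s). U t s u) (s, s)) sequentially"
  by (rule continuous_on_tendsto_compose[OF U_cont tendsto_Pair[OF assms(1,2)]])
   (use s assms(3,4) in \<open>auto\<close>)
 then have "(\<lambda>k. U (a k) (b k) u) \<longlonglongrightarrow> u" using U_refl[OF s] by simp
 then have "(\<lambda>k. norm (U (a k) (b k) u - u)) \<longlonglongrightarrow> norm (u - u)"
  by (intro tendsto_intros)
 then show ?thesis by simp
qed

lemma V_Suc_cont_cone:
 assumes reg: "\<And>k. k <= n ==> regular (V k)" and comp: "composition (Suc n)" and u: "0 <= u"
 shows "continuous_on Tri (\<lambda>(t, s). V (Suc n) t s u)"
proof (rule continuous_on_sequentiallyI)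
 have n: "regular (V n)" by (rule reg) simp
 fix z :: "nat => real \<times> real" and a assume z: "\<forall>k. z k \<in> Tri" "a \<in> Tri" "z \<longlonglongrightarrow> a"
 obtain t s where a: "a = (t, s)" by (cases a)
 define x where "x k = fst (z k)" for k
 define y where "y k = snd (z k)" for k
 have zk: "z k = (x k, y k)" for k by (simp add: x_def y_def)
 have yx: "0 <= y k" "y k <= x k" for k using z(1) by (auto simp: x_def y_def dest!: spec[of _ k])
 have st: "0 <= s" "s <= t" using z(2) a by auto
 have x: "x \<longlonglongrightarrow> t" and y: "y \<longlonglongrightarrow> s"
  using tendsto_fst[OF z(3)] tendsto_snd[OF z(3)] unfolding x_def[abs_def] y_def[abs_def] a by simp_all
 have "(\<lambda>k. V (Suc n) (x k) (y k) u) \<longlonglongrightarrow> V (Suc n) t s u"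
 proof (cases "s = t")
  case True
  have "V (Suc n) t s u = 0"
   using V_Suc_cone(2)[OF n st u] U_refl[of t u] st True by simp
  moreover have "(\<lambda>k. V (Suc n) (x k) (y k) u) \<longlonglongrightarrow> 0"
  proof (rule Lim_null_comparison)
   show "(\<lambda>k. norm (U (x k) (y k) u - u)) \<longlonglongrightarrow> 0"
    by (rule U_diagonal_tendsto[OF _ y yx]) (use x True in simp)
   have "norm (V (Suc n) (x k) (y k) u) <= norm (U (x k) (y k) u - u)" for k
    using V_Suc_cone(2)[OF n yx u, of k] norm_triangle_ineq2[of u "U (x k) (y k) u"]
    by (simp add: norm_minus_commute)
   then show "\<forall>\<^sub>F k in sequentially. norm (V (Suc n) (x k) (y k) u) <= norm (U (x k) (y k) u - u)"
    by (intro always_eventually allI)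
  qed
  ultimately show ?thesis by simp
 next
  case False
  then have lt: "s < t" using st by simp
  define x' where "x' k = max (x k) s" for k
  have x': "x' \<longlonglongrightarrow> t"
   unfolding x'_def[abs_def] using tendsto_max[OF x tendsto_const[of s]] lt by (simp add: max_def)
  have s_x': "s <= x' k" for k by (simp add: x'_def)
  obtain T where T: "\<And>k. x' k <= T"
   using Bseq_bdd_above[OF convergent_imp_Bseq[OF convergentI[OF x']]] unfolding bdd_above_def by blast
  have tT: "t <= T" by (rule LIMSEQ_le_const2[OF x']) (use T in blast)
  obtain g where g: "version s T u g" using st tT by (auto intro: version_ex[of s T u])
  have "(\<lambda>k. conv (V n) s g (x' k)) \<longlonglongrightarrow> conv (V n) s g t"
   by (rule conv_tendsto[OF n _ x' tendsto_const]) (use g st s_x' in \<open>auto simp: version_def\<close>)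
  moreover have "conv (V n) s g r = V (Suc n) r s u" if "r <= T" for r
   unfolding conv_def by (rule V_Suc_eq[OF n st(1) that g, symmetric])
  ultimately have 1: "(\<lambda>k. V (Suc n) (x' k) s u) \<longlonglongrightarrow> V (Suc n) t s u"
   using T tT by simp
  have 2: "(\<lambda>k. V (Suc n) (x k) (y k) u - V (Suc n) (x' k) s u) \<longlonglongrightarrow> 0"
  proof (rule Lim_null_comparison)
   have "(\<lambda>k. norm (U (max s (y k)) (min s (y k)) u - u)) \<longlonglongrightarrow> 0"
   proof (rule U_diagonal_tendsto)
    show "(\<lambda>k. max s (y k)) \<longlonglongrightarrow> s" using tendsto_max[OF tendsto_const[of s] y] by simp
    show "(\<lambda>k. min s (y k)) \<longlonglongrightarrow> s" using tendsto_min[OF tendsto_const[of s] y] by simp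
   qed (use st yx in \<open>auto simp: min_def max_def\<close>)
   then have "(\<lambda>k. (CB + real (Suc n)) * norm (U (max s (y k)) (min s (y k)) u - u)) \<longlonglongrightarrow> (CB + real (Suc n)) * 0"
    by (rule tendsto_mult_left)
   then show "(\<lambda>k. (CB + real (Suc n)) * norm (U (max s (y k)) (min s (y k)) u - u)) \<longlonglongrightarrow> 0" by simp
   have "\<forall>\<^sub>F k in sequentially. s < x k" using order_tendstoD(1)[OF x lt] .
   then show "\<forall>\<^sub>F k in sequentially. norm (V (Suc n) (x k) (y k) u - V (Suc n) (x' k) s u)
     <= (CB + real (Suc n)) * norm (U (max s (y k)) (min s (y k)) u - u)"
   proof eventually_elim
    case (elim k)
    then have xk: "x' k = x k" by (simp add: x'_def)
    show ?case
    proof (cases "s <= y k")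
     case True
     then show ?thesis
      using V_Suc_increment[OF reg comp st(1) True yx(2) u] xk
      by (simp add: max_def min_def norm_minus_commute)
    next
     case False
     then show ?thesis
      using V_Suc_increment[OF reg comp yx(1)[of k], of s "x k", OF _ _ _ u] xk elim
      by (simp add: max_def min_def)
    qed
   qed
  qed
  show ?thesis using tendsto_add[OF 1 2] by simp
 qed
 then show "(\<lambda>k. case z k of (t, s) => V (Suc n) t s u) \<longlonglongrightarrow> (case a of (t, s) => V (Suc n) t s u)"
  unfolding zk a by simp
qed

lemma V_regular_composition: "regular (V n) \<and> composition n"
proof (induction n rule: less_induct)
 case (less n)
 show ?case
 proof (cases n)
  case 0
  have "composition 0"
   unfolding composition_def
  proof (intro allI impI)
   fix t r s :: real and u :: 'a assume "0 <= s" "s <= r" "r <= t"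
   from U_compose[OF this, of u] show "V 0 t s u = (\<Sum>j\<le>0. V (0 - j) t r (V j r s u))"
    by (simp only: atMost_0 sum.insert sum.empty finite.emptyI empty_iff not_False_eq_True add_0_right
      dyson.simps(1) diff_zero)
  qed
  then show ?thesis using regular_U 0 by simp
 next
  case (Suc m)
  have reg: "regular (V k)" if "k <= m" for k using less[of k] that Suc by simp
  have m: "regular (V m)" by (rule reg) simp
  have comp: "composition (Suc m)"
   by (rule V_Suc_composition[OF reg]) (use less[of m] Suc in auto)
  have "regular (V (Suc m))"
   unfolding regular_def
  proof (intro conjI allI impI)
   fix t s :: real assume st: "0 <= s" "s <= t"
   show "linear (V (Suc m) t s)" by (rule V_Suc_linear[OF m st])
   fix u :: 'a assume u: "0 <= u"
   show "0 <= V (Suc m) t s u" by (rule V_Suc_cone(1)[OF m st u])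
   show "norm (V (Suc m) t s u) <= norm u"
    by (rule order_trans[OF _ V_Suc_cone(2)[OF m st u]]) simp
  next
   fix u :: 'a
   obtain v w where vw: "0 <= v" "0 <= w" "u = v - w" using cone_generating[of u] by blast
   have "continuous_on Tri (\<lambda>z. (case z of (t, s) => V (Suc m) t s v) - (case z of (t, s) => V (Suc m) t s w))"
    by (intro continuous_on_diff V_Suc_cont_cone[OF reg comp] vw)
   then show "continuous_on Tri (\<lambda>(t, s). V (Suc m) t s u)"
   proof (rule continuous_on_eq)
    fix z assume "z \<in> Tri"
    then obtain t s where z: "z = (t, s)" "0 <= s" "s <= t" by auto
    have "V (Suc m) t s (v - w) = V (Suc m) t s v - V (Suc m) t s w"
     by (rule linear_diff[OF V_Suc_linear[OF m z(2,3)]])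
    then show "(case z of (t, s) => V (Suc m) t s v) - (case z of (t, s) => V (Suc m) t s w) =
      (case z of (t, s) => V (Suc m) t s u)"
     using z(1) vw(3) by simp
   qed
  qed
  then show ?thesis using comp Suc by simp
 qed
qed

lemma regular_V: "regular (V n)"
 using V_regular_composition by simp

lemma V_compose:
 "0 <= s ==> s <= r ==> r <= t ==> V n t s u = (\<Sum>j\<le>n. V (n - j) t r (V j r s u))"
 using V_regular_composition[of n] unfolding composition_def by simp

lemmas V_linear = regularD(1)[OF regular_V]
 and V_pos = regularD(2)[OF regular_V]
 and V_contr = regularD(3)[OF regular_V]
 and V_bound = regularD(4)[OF regular_V]
 and V_bounded_linear = regularD(5)[OF regular_V]

section \<open>The sum of the Dyson--Phillips terms\<close>

abbreviation S :: "nat => real => real => 'a => 'a" where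
 "S N t s u \<equiv> \<Sum>n\<le>N. V n t s u"

abbreviation VV :: "real => real => 'a => 'a" where
 "VV \<equiv> dyson_sum U B"

lemma V_norm_sum_le:
 assumes "0 <= s" "s <= t" "0 <= u"
 shows "(\<Sum>n\<le>N. norm (V n t s u)) <= norm u"
 using assms
proof (induction N arbitrary: s u)
 case 0
 then show ?case using U_contr by simp
next
 case (Suc N)
 obtain g where g: "version s t u g" "\<And>r. 0 <= g r"
  "\<And>t'. s <= t' ==> t' <= t ==> integral {s..t'} (\<lambda>r. norm (g r)) + norm (U t' s u) <= norm u"
  by (rule version_cone[OF Suc.prems]) (rule that)
 have bg: "bochner_borel g" using g by (auto simp: version_def)
 have eq: "norm (V (Suc n) t s u) <= integral {s..t} (\<lambda>r. norm (V n t r (g r)))" for n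
 proof -
  have "norm (V (Suc n) t s u) = integral {s..t} (\<lambda>r. norm (V n t r (g r)))"
   unfolding V_Suc_eq[OF regular_V Suc.prems(1) order_refl g(1)]
   using Suc.prems g(2)
   by (intro norm_integral_cone bochner_borel_regular[OF regular_V Suc.prems(1) bg] V_pos) auto
  then show ?thesis by simp
 qed
 have int: "(\<lambda>r. norm (V n t r (g r))) integrable_on {s..t}" for n
  using bochner_borel_integrable_on(3)[OF bochner_borel_regular(1)[OF regular_V[of n] Suc.prems(1) bg, of t], of s t]
  by (rule integrable_eq) simp
 have "(\<Sum>n\<le>Suc N. norm (V n t s u)) = norm (U t s u) + (\<Sum>n\<le>N. norm (V (Suc n) t s u))"
  by (simp only: sum.atMost_Suc_shift dyson.simps(1))
 also have "\<dots> <= norm (U t s u) + (\<Sum>n\<le>N. integral {s..t} (\<lambda>r. norm (V n t r (g r))))"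
  by (intro add_left_mono sum_mono eq)
 also have "\<dots> = norm (U t s u) + integral {s..t} (\<lambda>r. \<Sum>n\<le>N. norm (V n t r (g r)))"
  using int by (subst Henstock_Kurzweil_Integration.integral_sum) auto
 also have "\<dots> <= norm (U t s u) + integral {s..t} (\<lambda>r. norm (g r))"
  using Suc.prems g(2)
  by (intro add_left_mono integral_le integrable_sum int bochner_borel_integrable_on[OF bg] Suc.IH) auto
 finally show ?case using g(3)[OF Suc.prems(2) order_refl] by simp
qed

lemma V_summable_norm: 
 assumes "0 <= s" "s <= t"
 shows "summable (\<lambda>n. norm (V n t s u))"
proof -
 obtain v w where vw: "0 <= v" "0 <= w" "u = v - w" using cone_generating[of u] by blast
 have cone: "summable (\<lambda>n. norm (V n t s v))" if "0 <= v" for v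
  using V_norm_sum_le[OF assms that]
  by (intro bounded_imp_summable[of _ "norm v"]) auto
 have "summable (\<lambda>n. norm (V n t s v) + norm (V n t s w))"
  by (intro summable_add cone vw)
 then show ?thesis
 proof (rule summable_comparison_test'[where N=0])
  fix n
  have "norm (V n t s v - V n t s w) <= norm (V n t s v) + norm (V n t s w)"
   by (rule norm_triangle_ineq4)
  then show "norm (norm (V n t s u)) <= norm (V n t s v) + norm (V n t s w)"
   unfolding vw(3) linear_diff[OF V_linear[OF assms]] by (simp only: real_norm_def abs_norm_cancel)
 qed
qed

lemma V_sums:
 assumes "0 <= s" "s <= t"
 shows "(\<lambda>n. V n t s u) sums VV t s u"
 unfolding dyson_sum_def by (rule summable_sums[OF summable_norm_cancel[OF V_summable_norm[OF assms]]])

lemma S_tendsto: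
 assumes "0 <= s" "s <= t"
 shows "(\<lambda>N. S N t s u) \<longlonglongrightarrow> VV t s u"
 using V_sums[OF assms] unfolding sums_def_le .

lemma regular_S: "regular (S N)"
 unfolding regular_def
proof (intro conjI allI impI)
 fix t s :: real assume st: "0 <= s" "s <= t"
 show "linear (S N t s)"
  by (rule linear_compose_sum) (use V_linear[OF st] in auto)
 fix u :: 'a assume u: "0 <= u"
 show "0 <= S N t s u" by (intro sum_nonneg V_pos st u)
 show "norm (S N t s u) <= norm u"
  by (rule order_trans[OF norm_sum V_norm_sum_le[OF st u]])
next
 fix u
 have "continuous_on Tri (\<lambda>z. \<Sum>n\<le>N. (case z of (t, s) => V n t s u))"
  by (intro continuous_on_sum regular_cont[OF regular_V])
 then show "continuous_on Tri (\<lambda>(t, s). S N t s u)"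
  by (rule continuous_on_eq) auto
qed

lemma S_minus_U:
 assumes "0 <= s" "s <= t" "0 <= u"
 shows "norm (S N t s u - U t s u) <= norm u - norm (U t s u)"
proof (cases N)
 case 0
 then show ?thesis using U_contr[OF assms] by simp
next
 case (Suc M)
 have "S N t s u - U t s u = (\<Sum>n\<le>M. V (Suc n) t s u)"
  by (simp only: Suc sum.atMost_Suc_shift dyson.simps(1) add_diff_cancel_left')
 also have "norm \<dots> <= (\<Sum>n\<le>M. norm (V (Suc n) t s u))"
  by (rule norm_sum)
 also have "\<dots> <= norm u - norm (U t s u)"
  using V_norm_sum_le[OF assms, of N]
  by (simp only: Suc sum.atMost_Suc_shift dyson.simps(1))
 finally show ?thesis .
qed

lemma VV_linear: "0 <= s ==> s <= t ==> linear (VV t s)"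
proof (rule linearI)
 assume st: "0 <= s" "s <= t"
 show "VV t s (u + v) = VV t s u + VV t s v" for u v
 proof (rule LIMSEQ_unique[OF S_tendsto[OF st]])
  show "(\<lambda>N. S N t s (u + v)) \<longlonglongrightarrow> VV t s u + VV t s v"
   unfolding linear_add[OF regularD(1)[OF regular_S st]] by (intro tendsto_add S_tendsto st)
 qed
 show "VV t s (c *\<^sub>R u) = c *\<^sub>R VV t s u" for c u
 proof (rule LIMSEQ_unique[OF S_tendsto[OF st]])
  show "(\<lambda>N. S N t s (c *\<^sub>R u)) \<longlonglongrightarrow> c *\<^sub>R VV t s u"
   unfolding linear_scale[OF regularD(1)[OF regular_S st]] by (intro tendsto_scaleR tendsto_const S_tendsto st)
 qed
qed

lemma VV_cone:
 assumes "0 <= s" "s <= t" "0 <= u"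
 shows "0 <= VV t s u" "norm (VV t s u) <= norm u"
  "norm (VV t s u - U t s u) <= norm u - norm (U t s u)"
proof -
 note lim = S_tendsto[OF assms(1,2), of u]
 show "0 <= VV t s u"
  by (rule cone_limit[OF lim]) (rule regularD(2)[OF regular_S assms])
 show "norm (VV t s u) <= norm u"
  by (rule LIMSEQ_le_const2[OF tendsto_norm[OF lim]]) (use regularD(3)[OF regular_S assms] in blast)
 show "norm (VV t s u - U t s u) <= norm u - norm (U t s u)"
  by (rule LIMSEQ_le_const2[OF tendsto_norm[OF tendsto_diff[OF lim tendsto_const]]])
   (use S_minus_U[OF assms] in blast)
qed

text \<open>By the composition law the product of two partial sums consists of all terms of index pairs up to \<open>N\<close>, which lies between the triangles of side \<open>N\<close> and \<open>2 N\<close>. This yields the composition law of the sum.\<close>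

lemma S_compose_le:
 assumes st: "0 <= s" "s <= r" "r <= t" and u: "0 <= u"
 shows "S N t s u <= S N t r (S N r s u)" "S N t r (S N r s u) <= S (2 * N) t s u"
proof -
 have rt: "0 <= r" "s <= t" using st by auto
 define f where "f p = V (fst p) t r (V (snd p) r s u)" for p
 have f0: "0 <= f p" for p
  unfolding f_def using st rt u by (intro V_pos)
 have SS: "S N t r (S N r s u) = sum f ({..N} \<times> {..N})"
  by (simp add: f_def sum.cartesian_product' linear_sum[OF V_linear[OF rt(1) st(3)]])
 have S_eq: "S M t s u = sum f {(i, j). i + j <= M}" for M
 proof -
  have "S M t s u = (\<Sum>n\<le>M. \<Sum>j\<le>n. f (n - j, j))"
   by (simp add: f_def V_compose[OF st])
  also have "\<dots> = (\<Sum>(n, j)\<in>Sigma {..M} (\<lambda>n. {..n}). f (n - j, j))"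
   by (simp add: sum.Sigma)
  also have "\<dots> = sum f {(i, j). i + j <= M}"
   by (rule sum.reindex_bij_witness[of _ "\<lambda>(i, j). (i + j, j)" "\<lambda>(n, j). (n - j, j)"]) auto
  finally show ?thesis .
 qed
 have fin: "finite {(i, j). i + j <= (M::nat)}" for M
  by (rule finite_subset[of _ "{..M} \<times> {..M}"]) auto
 show "S N t s u <= S N t r (S N r s u)"
  unfolding SS S_eq by (rule sum_mono2) (auto simp: f0)
 show "S N t r (S N r s u) <= S (2 * N) t s u"
  unfolding SS S_eq by (rule sum_mono2[OF fin]) (auto simp: f0)
qed

lemma VV_compose:
 assumes st: "0 <= s" "s <= r" "r <= t"
 shows "VV t s u = VV t r (VV r s u)"
proof -
 have rt: "0 <= r" "s <= t" using st by auto
 have cone: "VV t s u = VV t r (VV r s u)" if u: "0 <= u" for u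
 proof (rule LIMSEQ_unique)
  have "(\<lambda>N. S N t r (S N r s u - VV r s u)) \<longlonglongrightarrow> 0"
  proof (rule Lim_null_comparison)
   show "\<forall>\<^sub>F N in sequentially. norm (S N t r (S N r s u - VV r s u)) <= CB * norm (S N r s u - VV r s u)"
    by (intro always_eventually allI regularD(4)[OF regular_S rt(1) st(3)])
   have "(\<lambda>N. CB * norm (S N r s u - VV r s u)) \<longlonglongrightarrow> CB * norm (VV r s u - VV r s u)"
    by (intro tendsto_intros S_tendsto st)
   then show "(\<lambda>N. CB * norm (S N r s u - VV r s u)) \<longlonglongrightarrow> 0" by simp
  qed
  from tendsto_add[OF this S_tendsto[OF rt(1) st(3), of "VV r s u"]]
  show lim: "(\<lambda>N. S N t r (S N r s u)) \<longlonglongrightarrow> VV t r (VV r s u)"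
   by (simp add: linear_diff[OF regularD(1)[OF regular_S rt(1) st(3)]])
  have "(\<lambda>N. S (2 * N) t s u) \<longlonglongrightarrow> VV t s u"
   by (rule LIMSEQ_subseq_LIMSEQ[OF S_tendsto[OF st(1) rt(2)], of "\<lambda>N. 2 * N", unfolded o_def])
    (simp add: strict_mono_def)
  from tendsto_diff[OF this S_tendsto[OF st(1) rt(2), of u]]
  have 0: "(\<lambda>N. S (2 * N) t s u - S N t s u) \<longlonglongrightarrow> 0" by simp
  have "(\<lambda>N. S N t r (S N r s u) - S N t s u) \<longlonglongrightarrow> 0"
  proof (rule Lim_null_comparison[OF _ tendsto_norm_zero[OF 0]])
   show "\<forall>\<^sub>F N in sequentially. norm (S N t r (S N r s u) - S N t s u) <= norm (S (2 * N) t s u - S N t s u)"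
    by (intro always_eventually allI norm_mono_cone diff_right_mono) (use S_compose_le[OF st u] in auto)
  qed
  from tendsto_add[OF this S_tendsto[OF st(1) rt(2), of u]]
  show "(\<lambda>N. S N t r (S N r s u)) \<longlonglongrightarrow> VV t s u" by simp
 qed
 obtain v w where vw: "0 <= v" "0 <= w" "u = v - w" using cone_generating[of u] by blast
 show ?thesis
  unfolding vw(3) linear_diff[OF VV_linear[OF st(1) rt(2)]] linear_diff[OF VV_linear[OF st(1,2)]]
   linear_diff[OF VV_linear[OF rt(1) st(3)]] cone[OF vw(1)] cone[OF vw(2)] ..
qed

end

section \<open>The perturbation applied to variation-of-constants integrals\<close>

lemma bochner_borel_zero: "bochner_borel (\<lambda>x. 0)"
 by (simp add: bochner_borel_def strongly_borel_const)

lemma bochner_borel_sum: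
 fixes f :: "'i => real => 'b::real_normed_vector"
 assumes "finite I" "\<And>i. i \<in> I ==> bochner_borel (f i)"
 shows "bochner_borel (\<lambda>x. \<Sum>i\<in>I. f i x)"
 using assms
proof (induction I rule: finite_induct)
 case empty
 then show ?case by (simp add: bochner_borel_zero)
next
 case (insert i I)
 then show ?case using bochner_borel_add[of "f i" "\<lambda>x. \<Sum>i\<in>I. f i x"] by simp
qed

lemma strongly_measurable_AE_limit:
 fixes H :: "nat => 's::euclidean_space => 'b::real_normed_vector"
 assumes H: "\<And>n. strongly_borel borel (H n)" and S: "S \<in> sets borel"
  and lim: "AE x in lborel. x \<in> S --> (\<lambda>n. H n x) \<longlonglongrightarrow> h x"
 shows "strongly_measurable (lebesgue_on S) h"
proof -
 obtain N where N: "N \<in> null_sets lborel" "\<And>x. x \<notin> N ==> x \<in> S ==> (\<lambda>n. H n x) \<longlonglongrightarrow> h x"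
  using lim by (auto elim!: AE_E3)
 have A: "S - N \<in> sets borel" using S N(1) by (auto simp: null_sets_def)
 have g: "strongly_borel borel (\<lambda>x. if x \<in> S - N then h x else 0)"
 proof (rule strongly_borel_limit[where f="\<lambda>n x. if x \<in> S - N then H n x else 0"])
  show "strongly_borel borel (\<lambda>x. if x \<in> S - N then H n x else 0)" for n
   by (rule strongly_borel_zero_outside[OF H A])
  show "(\<lambda>n. if x \<in> S - N then H n x else 0) \<longlonglongrightarrow> (if x \<in> S - N then h x else 0)" for x
   using N(2)[of x] by auto
 qed
 show ?thesis
 proof (rule strongly_borel_imp_strongly_measurable[OF g])
  have "AE x in lborel. x \<notin> N" using N(1) by (rule AE_not_in)
  then have "AE x in lborel. x \<in> S --> h x = (if x \<in> S - N then h x else 0)"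
   by eventually_elim auto
  then show "AE x in lebesgue_on S. h x = (if x \<in> S - N then h x else 0)"
   using S by (simp add: AE_lebesgue_on_iff)
 qed
qed

lemma dyadic_floor_mono:
 fixes x d :: real
 assumes "0 < d"
 shows "d * real_of_int \<lfloor>x / d\<rfloor> <= (d / 2) * real_of_int \<lfloor>x / (d / 2)\<rfloor>"
proof -
 have "2 * \<lfloor>x / d\<rfloor> <= \<lfloor>2 * (x / d)\<rfloor>"
  unfolding le_floor_iff using of_int_floor_le[of "x / d"] by (simp only: of_int_mult of_int_numeral)
 then have "2 * \<lfloor>x / d\<rfloor> <= \<lfloor>x / (d / 2)\<rfloor>"
  by (simp add: mult.commute)
 then have "2 * real_of_int \<lfloor>x / d\<rfloor> <= real_of_int \<lfloor>x / (d / 2)\<rfloor>"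
  by linarith
 then show ?thesis
  using assms by (simp add: field_simps)
qed

context substochastic_perturbation
begin

lemma conv_cone:
 assumes W: "regular W" and f: "\<And>q. 0 <= f q" and y: "0 <= y"
 shows "0 <= conv W y f x"
 unfolding conv_def by (intro integral_cone regularD(2)[OF W] f) (use y in auto)

lemma conv_norm:
 assumes W: "regular W" and f: "bochner_borel f" "\<And>q. 0 <= f q" and y: "0 <= y"
 shows "norm (conv W y f x) = integral {y..x} (\<lambda>q. norm (W x q (f q)))"
  "norm (conv W y f x) <= integral {y..x} (\<lambda>q. norm (f q))"
  "(\<lambda>q. norm (W x q (f q))) integrable_on {y..x}"
proof -
 show 1: "norm (conv W y f x) = integral {y..x} (\<lambda>q. norm (W x q (f q)))"
  unfolding conv_def
  by (intro norm_integral_cone bochner_borel_regular(2)[OF W y f(1)] regularD(2)[OF W] f(2)) (use y in auto)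
 show int: "(\<lambda>q. norm (W x q (f q))) integrable_on {y..x}"
  using bochner_borel_integrable_on(3)[OF bochner_borel_regular(1)[OF W y f(1), of x], of y x]
  by (rule integrable_eq) simp
 show "norm (conv W y f x) <= integral {y..x} (\<lambda>q. norm (f q))"
  unfolding 1
  by (intro integral_le int bochner_borel_integrable_on[OF f(1)] regularD(3)[OF W] f(2)) (use y in auto)
qed

abbreviation R :: "real => (real => 'a) => real => 'a" where
 "R \<equiv> conv U"

lemma R_split:
 assumes f: "bochner_borel f" and s: "0 <= s" "s <= r" "r <= t"
 shows "R s f t = U t r (R s f r) + R r f t"
proof -
 have r: "0 <= r" using s by simp
 have "R s f t = integral {s..r} (\<lambda>q. U t q (f q)) + integral {r..t} (\<lambda>q. U t q (f q))"
  unfolding conv_def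
  by (rule Henstock_Kurzweil_Integration.integral_combine[symmetric, OF s(2,3) bochner_borel_regular(2)[OF regular_U s(1) f]])
 also have "integral {s..r} (\<lambda>q. U t q (f q)) = integral {s..r} (\<lambda>q. U t r (U r q (f q)))"
 proof (rule Henstock_Kurzweil_Integration.integral_cong)
  fix q assume "q \<in> {s..r}"
  then show "U t q (f q) = U t r (U r q (f q))"
   by (intro U_compose) (use s in auto)
 qed
 also have "\<dots> = U t r (R s f r)"
  using integral_linear[OF bochner_borel_regular(2)[OF regular_U s(1) f, of r] regularD(5)[OF regular_U r s(3)]]
  by (simp only: conv_def o_def)
 finally show ?thesis by (simp only: conv_def)
qed

text \<open>Along a dyadic grid \<open>s <= p\<^sub>0 < p\<^sub>1 < \<dots>\<close> the values \<open>U(t,p) F(p)\<close>, with \<open>p\<close> the grid point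
 below \<open>t\<close> and \<open>F = R s f\<close>, increase to \<open>F(t)\<close> as the grid is refined, and the bound on
 \<open>B(t) U(t,p)\<close> telescopes over the grid. So \<open>B(t)\<close> being increasingly closed applies.\<close>

lemma B_conv:
 assumes f: "bochner_borel f" "\<And>q. 0 <= f q" and s: "0 <= s" "s <= T"
 obtains w where "bochner_borel w" "\<And>r. 0 <= w r" "\<And>r. r \<notin> {s..T} ==> w r = 0"
  "AE r in lborel. r \<in> {s..T} --> R s f r \<in> D r \<and> B r (R s f r) = w r"
  "integral {s..T} (\<lambda>r. norm (w r)) + norm (R s f T) <= integral {s..T} (\<lambda>r. norm (f r))"
proof (cases "s = T")
 case True
 show thesis
 proof (rule that[OF bochner_borel_zero])
  have "AE r in lborel. r ~= s" by (rule AE_lborel_singleton)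
  then show "AE r in lborel. r \<in> {s..T} --> R s f r \<in> D r \<and> B r (R s f r) = 0"
   by eventually_elim (use True in auto)
  show "integral {s..T} (\<lambda>r. norm (0::'a)) + norm (R s f T) <= integral {s..T} (\<lambda>r. norm (f r))"
   unfolding conv_def using True by simp
 qed auto
next
 case False
 then have sT: "s < T" using s by simp
 define F where "F = R s f"
 have F0: "0 <= F t" for t unfolding F_def by (rule conv_cone[OF regular_U f(2) s(1)])
 define d where "d n = (T - s) / 2 ^ n" for n :: nat
 have d: "0 < d n" for n using sT by (simp add: d_def)
 have d_half: "d (Suc n) = d n / 2" for n by (simp add: d_def)
 define p where "p n j = s + d n * real j" for n j
 have p_ge: "s <= p n j" for n j using d[of n] by (simp add: p_def less_imp_le)
 have p0: "0 <= p n j" for n j using p_ge[of n j] s by simp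
 have p_mono: "p n j <= p n (Suc j)" for n j using d[of n] by (simp add: p_def algebra_simps)
 have p_end: "p n (2 ^ n) = T" for n by (simp add: p_def d_def)
 have p_le: "p n j <= T" if "j <= 2 ^ n" for n j
 proof -
  have "d n * real j <= d n * 2 ^ n"
   using that d[of n] by (intro mult_left_mono) (auto simp: of_nat_le_iff[symmetric] simp del: of_nat_le_iff)
  then show ?thesis by (simp add: p_def d_def)
 qed
 define idx where "idx n t = nat \<lfloor>(t - s) / d n\<rfloor>" for n t
 define a where "a n t = p n (idx n t)" for n t
 have a_eq: "a n t = s + d n * real_of_int \<lfloor>(t - s) / d n\<rfloor>" if "s <= t" for n t
  using that d[of n] by (simp add: a_def p_def idx_def)
 have a_le: "a n t <= t" and a_gt: "t - d n < a n t" if "s <= t" for n t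
 proof -
  have "d n * real_of_int \<lfloor>(t - s) / d n\<rfloor> <= d n * ((t - s) / d n)"
   using d[of n] by (intro mult_left_mono) auto
  then show "a n t <= t" using a_eq[OF that] d[of n] by simp
  have "d n * ((t - s) / d n - 1) < d n * real_of_int \<lfloor>(t - s) / d n\<rfloor>"
   using d[of n] by (intro mult_strict_left_mono) linarith+
  moreover have "d n * ((t - s) / d n - 1) = t - s - d n"
   using d[of n] by (simp add: field_simps)
  ultimately show "t - d n < a n t" using a_eq[OF that, of n] by linarith
 qed
 have a_ge: "s <= a n t" for n t unfolding a_def by (rule p_ge)
 have a0: "0 <= a n t" for n t unfolding a_def by (rule p0)
 have a_Suc: "a n t <= a (Suc n) t" if "s <= t" for n t
  unfolding a_eq[OF that] d_half using dyadic_floor_mono[OF d, of n "t - s"] by simp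
 have idx_less: "idx n t < 2 ^ n" if "s <= t" "t < T" for n t
 proof -
  have "(t - s) / d n < 2 ^ n" using that sT by (simp add: d_def field_simps)
  then have "\<lfloor>(t - s) / d n\<rfloor> < 2 ^ n" by (simp add: floor_less_iff)
  then show ?thesis
   using that d[of n] by (simp add: idx_def nat_less_iff)
 qed
 have idx_piece: "p n (idx n t) <= t" "t < p n (Suc (idx n t))" if "s <= t" for n t
  using a_le[OF that, of n] a_gt[OF that, of n] by (auto simp: a_def p_def algebra_simps)
 define G where "G n t = U t (a n t) (F (a n t))" for n t
 \<comment> \<open>representatives on the grid intervals\<close>
 define Q where "Q n j g \<longleftrightarrow> version (p n j) T (F (p n j)) g \<and> (\<forall>r. 0 <= g r) \<and>
   (\<forall>t. p n j <= t --> t <= T --> integral {p n j..t} (\<lambda>r. norm (g r)) + norm (U t (p n j) (F (p n j))) <= norm (F (p n j)))" for n j g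
 define g where "g n j = (SOME g. Q n j g)" for n j
 have g_all: "Q n j (g n j)" if j: "j < 2 ^ n" for n j
 proof -
  have "p n j <= T" by (rule p_le) (use j in simp)
  from version_cone[OF p0 this F0, of "p n j"] obtain h where "version (p n j) T (F (p n j)) h" "\<And>r. 0 <= h r"
   "\<And>t. p n j <= t ==> t <= T ==> integral {p n j..t} (\<lambda>r. norm (h r)) + norm (U t (p n j) (F (p n j))) <= norm (F (p n j))"
   by blast
  then have "Q n j h" unfolding Q_def by blast
  then show ?thesis unfolding g_def by (rule someI[of "Q n j" h])
 qed
 have g_ver: "version (p n j) T (F (p n j)) (g n j)" and g0: "0 <= g n j r" if "j < 2 ^ n" for n j r
  using g_all[OF that] unfolding Q_def by blast+
 have g_int: "integral {p n j..t} (\<lambda>r. norm (g n j r)) + norm (U t (p n j) (F (p n j))) <= norm (F (p n j))"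
  if "j < 2 ^ n" "p n j <= t" "t <= T" for n j t
  using g_all[OF that(1)] that(2,3) unfolding Q_def by blast
 have g_bb: "bochner_borel (g n j)" if "j < 2 ^ n" for n j
  using g_ver[OF that] by (simp add: version_def)
 define H where "H n t = (\<Sum>j<2 ^ n. if t \<in> {p n j..<p n (Suc j)} then g n j t else 0)" for n t
 have H_bb: "bochner_borel (H n)" for n
  unfolding H_def
 proof (rule bochner_borel_sum)
  show "bochner_borel (\<lambda>t. if t \<in> {p n j..<p n (Suc j)} then g n j t else 0)" if "j \<in> {..<2 ^ n}" for j
   by (rule bochner_borel_restrict[OF g_bb]) (use that in auto)
 qed simp
 have H_eq: "H n t = g n (idx n t) t" if t: "s <= t" "t < T" for n t
 proof -
  have "(t \<in> {p n j..<p n (Suc j)}) = (j = idx n t)" for j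
  proof
   assume "t \<in> {p n j..<p n (Suc j)}"
   then have "d n * real j <= t - s" "t - s < d n * (real j + 1)"
    by (auto simp: p_def algebra_simps)
   then have "real j <= (t - s) / d n" "(t - s) / d n < real j + 1"
    using d[of n] by (auto simp: pos_le_divide_eq pos_divide_less_eq mult.commute)
   then have "\<lfloor>(t - s) / d n\<rfloor> = int j"
    by (intro floor_unique) auto
   then show "j = idx n t" by (simp add: idx_def)
  next
   assume "j = idx n t"
   then show "t \<in> {p n j..<p n (Suc j)}" using idx_piece[OF t(1), of n] by simp
  qed
  then have "H n t = (\<Sum>j<2 ^ n. if j = idx n t then g n j t else 0)"
   by (simp only: H_def)
  then show ?thesis using idx_less[OF t, of n] by simp
 qed
 have H_int: "(\<integral>\<^sup>+t. ennreal (norm (H n t)) \<partial>lborel) <= ennreal (integral {s..T} (\<lambda>r. norm (f r)) - norm (F T))" for n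
 proof -
  have F_step: "norm (F (p n (Suc j))) <= norm (U (p n (Suc j)) (p n j) (F (p n j))) + integral {p n j..p n (Suc j)} (\<lambda>r. norm (f r))" for j
  proof -
   have "F (p n (Suc j)) = U (p n (Suc j)) (p n j) (F (p n j)) + R (p n j) f (p n (Suc j))"
    unfolding F_def by (rule R_split[OF f(1) s(1) p_ge p_mono])
   then have "norm (F (p n (Suc j))) <= norm (U (p n (Suc j)) (p n j) (F (p n j))) + norm (R (p n j) f (p n (Suc j)))"
    by (simp only: norm_triangle_ineq)
   then show ?thesis
    using conv_norm(2)[OF regular_U f p0, of n j "p n (Suc j)"] by linarith
  qed
  have piece: "(\<integral>\<^sup>+t. ennreal (norm (if t \<in> {p n j..<p n (Suc j)} then g n j t else 0)) \<partial>lborel)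
    <= ennreal (norm (F (p n j)) - norm (F (p n (Suc j))) + integral {p n j..p n (Suc j)} (\<lambda>r. norm (f r)))"
   if j: "j < 2 ^ n" for j
  proof -
   have "(\<integral>\<^sup>+t. ennreal (norm (if t \<in> {p n j..<p n (Suc j)} then g n j t else 0)) \<partial>lborel)
     <= (\<integral>\<^sup>+t. ennreal (norm (g n j t)) * indicator {p n j..p n (Suc j)} t \<partial>lborel)"
    by (rule nn_integral_mono) (simp add: indicator_def)
   also have "\<dots> = ennreal (integral {p n j..p n (Suc j)} (\<lambda>r. norm (g n j r)))"
    by (rule bochner_borel_integrable_on(5)[OF g_bb[OF j], symmetric])
   also have "\<dots> <= ennreal (norm (F (p n j)) - norm (F (p n (Suc j))) + integral {p n j..p n (Suc j)} (\<lambda>r. norm (f r)))"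
    using g_int[OF j p_mono p_le] F_step[of j] j by (intro ennreal_leI) (simp add: Suc_leI)
   finally show ?thesis .
  qed
  have tele: "(\<Sum>j<m. norm (F (p n j)) - norm (F (p n (Suc j))) + integral {p n j..p n (Suc j)} (\<lambda>r. norm (f r)))
    = integral {s..p n m} (\<lambda>r. norm (f r)) - norm (F (p n m))" for m
  proof (induction m)
   case 0
   have "p n 0 = s" by (simp add: p_def)
   then show ?case by (simp add: F_def conv_def)
  next
   case (Suc m)
   have "integral {s..p n m} (\<lambda>r. norm (f r)) + integral {p n m..p n (Suc m)} (\<lambda>r. norm (f r)) = integral {s..p n (Suc m)} (\<lambda>r. norm (f r))"
    by (rule Henstock_Kurzweil_Integration.integral_combine[OF p_ge p_mono bochner_borel_integrable_on(3)[OF f(1)]])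
   then show ?case using Suc.IH by (simp only: sum.lessThan_Suc)
  qed
  have nn: "0 <= norm (F (p n j)) - norm (F (p n (Suc j))) + integral {p n j..p n (Suc j)} (\<lambda>r. norm (f r))" for j
   using F_step[of j] U_contr[OF p0[of n j] p_mono[of n j] F0, of "p n j"] by linarith
  have pm: "(\<lambda>t. norm (if t \<in> {p n j..<p n (Suc j)} then g n j t else 0)) \<in> borel_measurable borel" if "j < 2 ^ n" for j
   by (rule bochner_borelD(3)[OF bochner_borel_restrict[OF g_bb[OF that]]]) simp
  have "(\<integral>\<^sup>+t. ennreal (norm (H n t)) \<partial>lborel)
    <= (\<integral>\<^sup>+t. (\<Sum>j<2 ^ n. ennreal (norm (if t \<in> {p n j..<p n (Suc j)} then g n j t else 0))) \<partial>lborel)"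
   unfolding H_def by (intro nn_integral_mono) (simp only: sum_ennreal[OF norm_ge_zero] ennreal_leI[OF norm_sum])
  also have "\<dots> = (\<Sum>j<2 ^ n. \<integral>\<^sup>+t. ennreal (norm (if t \<in> {p n j..<p n (Suc j)} then g n j t else 0)) \<partial>lborel)"
  proof (rule nn_integral_sum)
   fix j assume "j \<in> {..<(2::nat) ^ n}"
   then have j: "j < 2 ^ n" by simp
   show "(\<lambda>t. ennreal (norm (if t \<in> {p n j..<p n (Suc j)} then g n j t else 0))) \<in> borel_measurable lborel"
    unfolding measurable_lborel2 by (rule measurable_compose[OF pm[OF j] measurable_ennreal])
  qed
  also have "\<dots> <= (\<Sum>j<2 ^ n. ennreal (norm (F (p n j)) - norm (F (p n (Suc j))) + integral {p n j..p n (Suc j)} (\<lambda>r. norm (f r))))"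
   by (rule sum_mono) (rule piece, simp)
  also have "\<dots> = ennreal (\<Sum>j<2 ^ n. norm (F (p n j)) - norm (F (p n (Suc j))) + integral {p n j..p n (Suc j)} (\<lambda>r. norm (f r)))"
   by (rule sum_ennreal) (rule nn)
  finally show ?thesis by (simp only: tele p_end)
 qed
 have dom: "AE t in lborel. \<forall>n j. p n j <= t --> U t (p n j) (F (p n j)) \<in> D t"
  unfolding AE_all_countable by (intro allI BU_dom' p0)
 have ver: "AE t in lborel. \<forall>n j. j < 2 ^ n --> t \<in> {p n j..T} --> B t (U t (p n j) (F (p n j))) = g n j t"
  unfolding AE_all_countable
 proof (intro allI)
  fix n j show "AE t in lborel. j < 2 ^ n --> t \<in> {p n j..T} --> B t (U t (p n j) (F (p n j))) = g n j t"
   using g_ver[of j n] by (cases "j < 2 ^ n") (auto simp: version_def)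
 qed
 have G_H: "AE t in lborel. t \<in> {s..<T} --> (\<forall>n. G n t \<in> D t \<and> H n t = B t (G n t))"
  using dom ver
 proof eventually_elim
  case (elim t)
  show ?case
  proof (intro impI allI)
   fix n assume t: "t \<in> {s..<T}"
   then have st: "s <= t" "t < T" by auto
   have "U t (a n t) (F (a n t)) \<in> D t"
    using elim(1) a_le[OF st(1), of n] unfolding a_def by blast
   moreover have "B t (U t (a n t) (F (a n t))) = H n t"
    using elim(2) idx_less[OF st, of n] a_le[OF st(1), of n] st unfolding H_eq[OF st] a_def
    by (meson atLeastAtMost_iff less_imp_le)
   ultimately show "G n t \<in> D t \<and> H n t = B t (G n t)"
    by (simp only: G_def)
  qed
 qed
 have G0: "0 <= G n t" if "s <= t" for n t
  unfolding G_def by (rule U_pos[OF a0 a_le[OF that] F0])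
 have G_diff: "F t - G n t = R (a n t) f t" if "s <= t" for n t
  using R_split[OF f(1) s(1) a_ge a_le[OF that], of n] by (simp add: F_def G_def)
 have G_mono: "G n t <= G (Suc n) t" if st: "s <= t" for n t
 proof -
  have eq: "F (a (Suc n) t) = U (a (Suc n) t) (a n t) (F (a n t)) + R (a n t) f (a (Suc n) t)"
   unfolding F_def by (rule R_split[OF f(1) s(1) a_ge a_Suc[OF st]])
  have lin: "linear (U t (a (Suc n) t))" by (rule U_linear[OF a0 a_le[OF st]])
  have "G (Suc n) t = U t (a (Suc n) t) (U (a (Suc n) t) (a n t) (F (a n t))) + U t (a (Suc n) t) (R (a n t) f (a (Suc n) t))"
   unfolding G_def eq by (rule linear_add[OF lin])
  also have "U t (a (Suc n) t) (U (a (Suc n) t) (a n t) (F (a n t))) = G n t"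
   unfolding G_def by (rule U_compose[OF a0 a_Suc[OF st] a_le[OF st], symmetric])
  finally have "G (Suc n) t - G n t = U t (a (Suc n) t) (R (a n t) f (a (Suc n) t))" by simp
  moreover have "0 <= U t (a (Suc n) t) (R (a n t) f (a (Suc n) t))"
   by (rule U_pos[OF a0 a_le[OF st] conv_cone[OF regular_U f(2) a0]])
  ultimately show ?thesis by (metis diff_ge_0_iff_ge)
 qed
 have d_lim: "d \<longlonglongrightarrow> 0"
 proof -
  have "(\<lambda>n. (T - s) * (1 / 2) ^ n) \<longlonglongrightarrow> (T - s) * 0"
   by (intro tendsto_mult tendsto_const LIMSEQ_power_zero) simp
  then show ?thesis by (simp add: d_def[abs_def] power_divide)
 qed
 have a_lim: "(\<lambda>n. a n t) \<longlonglongrightarrow> t" if "s <= t" for t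
 proof (rule tendsto_sandwich)
  show "\<forall>\<^sub>F n in sequentially. t - d n <= a n t" "\<forall>\<^sub>F n in sequentially. a n t <= t"
   using a_gt[OF that] a_le[OF that] by (auto intro!: always_eventually less_imp_le)
  show "(\<lambda>n. t - d n) \<longlonglongrightarrow> t" using tendsto_diff[OF tendsto_const d_lim, of t] by simp
 qed simp
 have G_lim: "(\<lambda>n. G n t) \<longlonglongrightarrow> F t" if st: "s <= t" for t
 proof -
  have "(\<lambda>n. R (a n t) f t) \<longlonglongrightarrow> R t f t"
   by (rule conv_tendsto[OF regular_U f(1) tendsto_const a_lim[OF st] a0 a_le[OF st]])
  moreover have "R t f t = 0" by (simp add: conv_def)
  ultimately have "(\<lambda>n. F t - G n t) \<longlonglongrightarrow> 0" by (simp add: G_diff[OF st])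
  from tendsto_diff[OF tendsto_const this, of "F t"] show ?thesis by simp
 qed
 \<comment> \<open>monotone convergence bounds the increasing sequence almost everywhere\<close>
 have H_mono: "AE t in lborel. t \<in> {s..<T} --> (\<forall>n. norm (H n t) <= norm (H (Suc n) t))"
  using G_H
 proof eventually_elim
  case (elim t)
  show ?case
  proof (intro impI allI)
   fix n assume t: "t \<in> {s..<T}"
   then have st: "s <= t" and t0: "0 <= t" using s by auto
   have D': "G n t \<in> D t" "G (Suc n) t \<in> D t" "H n t = B t (G n t)" "H (Suc n) t = B t (G (Suc n) t)"
    using elim t by blast+
   have "0 <= B t (G (Suc n) t - G n t)"
    by (rule B_pos[OF t0 subspace_diff[OF dom_subspace[OF t0] D'(2,1)]]) (simp add: G_mono[OF st])
   then have "B t (G n t) <= B t (G (Suc n) t)"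
    using B_diff[OF t0 D'(2,1)] by simp
   then show "norm (H n t) <= norm (H (Suc n) t)"
    unfolding D'(3,4) by (rule norm_mono_cone[OF B_pos[OF t0 D'(1) G0[OF st]]])
  qed
 qed
 have Hm[measurable]: "(\<lambda>t. norm (H n t)) \<in> borel_measurable borel" for n
  by (rule bochner_borelD(3)[OF H_bb])
 define K where "K n t = ennreal (norm (H n t)) * indicator {s..<T} t" for n t
 have Km[measurable]: "K n \<in> borel_measurable lborel" for n
  unfolding K_def by measurable
 have "(\<integral>\<^sup>+t. (SUP n. K n t) \<partial>lborel) = (SUP n. \<integral>\<^sup>+t. K n t \<partial>lborel)"
 proof (rule nn_integral_monotone_convergence_SUP_AE)
  show "AE t in lborel. K n t <= K (Suc n) t" for n
   using H_mono by eventually_elim (auto simp: K_def indicator_def intro!: ennreal_leI)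
 qed (rule Km)
 also have "\<dots> <= ennreal (integral {s..T} (\<lambda>r. norm (f r)) - norm (F T))"
 proof (rule SUP_least)
  fix n
  have "(\<integral>\<^sup>+t. K n t \<partial>lborel) <= (\<integral>\<^sup>+t. ennreal (norm (H n t)) \<partial>lborel)"
   unfolding K_def by (rule nn_integral_mono) (simp add: indicator_def)
  then show "(\<integral>\<^sup>+t. K n t \<partial>lborel) <= ennreal (integral {s..T} (\<lambda>r. norm (f r)) - norm (F T))"
   using H_int[of n] by (rule order_trans)
 qed
 finally have SUP_int: "(\<integral>\<^sup>+t. (SUP n. K n t) \<partial>lborel) <= ennreal (integral {s..T} (\<lambda>r. norm (f r)) - norm (F T))" .
 have "AE t in lborel. (SUP n. K n t) ~= \<infinity>"
 proof (rule nn_integral_PInf_AE)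
  show "(\<lambda>t. SUP n. K n t) \<in> borel_measurable lborel" by measurable
  show "(\<integral>\<^sup>+t. (SUP n. K n t) \<partial>lborel) ~= \<infinity>"
   using SUP_int by (auto simp: top_unique)
 qed
 then have main: "AE t in lborel. t \<in> {s..<T} --> F t \<in> D t \<and> (\<lambda>n. H n t) \<longlonglongrightarrow> B t (F t) \<and>
   ennreal (norm (B t (F t))) <= (SUP n. K n t)"
  using G_H
 proof eventually_elim
  case (elim t)
  show ?case
  proof (rule impI)
   assume t: "t \<in> {s..<T}"
   then have st: "s <= t" and t0: "0 <= t" using s by auto
   have D': "G n t \<in> D t" "H n t = B t (G n t)" for n using elim(2) t by blast+
   have K_le: "ennreal (norm (B t (G n t))) <= (SUP n. K n t)" for n
    using SUP_upper[of n UNIV "\<lambda>n. K n t"] t by (simp add: K_def D'(2))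
   obtain c where c: "0 <= c" "(SUP n. K n t) = ennreal c"
    using elim(1) by (cases "SUP n. K n t") auto
   have le_c: "norm (B t (G n t)) <= c" for n
    using K_le[of n] c by (simp add: ennreal_le_iff)
   have "F t \<in> D t \<and> (\<lambda>n. B t (G n t)) \<longlonglongrightarrow> B t (F t)"
   proof (rule B_increasingly_closed[OF t0 D'(1) G0[OF st] _ G_lim[OF st] F0])
    show "incseq (\<lambda>n. G n t)" by (rule incseq_SucI) (rule G_mono[OF st])
    show "bdd_above (range (\<lambda>n. norm (B t (G n t))))"
     using le_c by (intro bdd_aboveI[of _ c]) blast
   qed
   moreover from this have "norm (B t (F t)) <= c"
    by (intro LIMSEQ_le_const2[OF tendsto_norm[of "\<lambda>n. B t (G n t)"]]) (use le_c in auto)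
   ultimately show "F t \<in> D t \<and> (\<lambda>n. H n t) \<longlonglongrightarrow> B t (F t) \<and> ennreal (norm (B t (F t))) <= (SUP n. K n t)"
    unfolding D'(2) c(2) by (simp add: ennreal_leI)
  qed
 qed
 have sm: "strongly_measurable (lebesgue_on {s..<T}) (\<lambda>t. B t (F t))"
 proof (rule strongly_measurable_AE_limit[OF bochner_borelD(1)[OF H_bb]])
  show "AE t in lborel. t \<in> {s..<T} --> (\<lambda>n. H n t) \<longlonglongrightarrow> B t (F t)"
   using main by eventually_elim blast
 qed simp
 have nn_le: "(\<integral>\<^sup>+t. ennreal (norm (B t (F t))) \<partial>lebesgue_on {s..<T}) <= ennreal (integral {s..T} (\<lambda>r. norm (f r)) - norm (F T))"
 proof -
  have "(\<integral>\<^sup>+t. ennreal (norm (B t (F t))) \<partial>lebesgue_on {s..<T}) = (\<integral>\<^sup>+t. ennreal (norm (B t (F t))) * indicator {s..<T} t \<partial>lborel)"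
   by (rule nn_integral_lebesgue_on) simp
  also have "\<dots> <= (\<integral>\<^sup>+t. (SUP n. K n t) \<partial>lborel)"
   by (rule nn_integral_mono_AE, use main in eventually_elim) (simp add: indicator_def)
  finally show ?thesis using SUP_int by (rule order_trans)
 qed
 have bi: "bochner_integrable (lebesgue_on {s..<T}) (\<lambda>t. B t (F t))"
  unfolding bochner_integrable_def using sm le_less_trans[OF nn_le, of \<infinity>] by simp
 have pos: "AE t in lborel. t \<in> {s..<T} --> 0 <= B t (F t)"
  using main by eventually_elim (use B_pos F0 s in auto)
 have borelT: "{s..<T} \<in> sets borel" by simp
 obtain w where w: "bochner_borel w" "\<And>r. r \<notin> {s..<T} ==> w r = 0" "\<And>r. 0 <= w r"
   "AE t in lborel. t \<in> {s..<T} --> B t (F t) = w t"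
  by (rule bochner_borel_cone_version[OF bi borelT pos]) (rule that)
 show thesis
 proof (rule that[OF w(1) w(3)])
  show "w r = 0" if "r \<notin> {s..T}" for r
   by (rule w(2)) (use that in auto)
  show "AE r in lborel. r \<in> {s..T} --> R s f r \<in> D r \<and> B r (R s f r) = w r"
   using main w(4) AE_lborel_singleton[of T]
  proof eventually_elim
   case (elim r)
   show ?case
   proof
    assume "r \<in> {s..T}"
    then have "r \<in> {s..<T}" using elim(3) by auto
    then show "R s f r \<in> D r \<and> B r (R s f r) = w r"
     using elim(1,2) by (simp only: F_def) 
   qed
  qed
  have "ennreal (integral {s..T} (\<lambda>r. norm (w r))) = (\<integral>\<^sup>+r. ennreal (norm (w r)) * indicator {s..T} r \<partial>lborel)"
   by (rule bochner_borel_integrable_on(5)[OF w(1)])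
  also have "\<dots> = (\<integral>\<^sup>+t. ennreal (norm (B t (F t))) * indicator {s..<T} t \<partial>lborel)"
   by (rule nn_integral_cong_AE, use w(4) in eventually_elim) (use w(2) in \<open>auto simp: indicator_def\<close>)
  also have "\<dots> <= ennreal (integral {s..T} (\<lambda>r. norm (f r)) - norm (F T))"
   using nn_le by (simp add: nn_integral_lebesgue_on)
  finally show "integral {s..T} (\<lambda>r. norm (w r)) + norm (R s f T) <= integral {s..T} (\<lambda>r. norm (f r))"
   using conv_norm(2)[OF regular_U f s(1), of T] by (simp add: F_def ennreal_le_iff)
 qed
qed

end

section \<open>The evolution over one short step\<close>

lemma right_increment_tendsto:
 fixes H :: "real => 'b::real_normed_vector"
 assumes H: "(H has_vector_derivative D) (at x within {a..c})" and x: "a <= x" "x < c"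
 shows "((\<lambda>k. (1 / k) *\<^sub>R (H (x + k) - H x)) \<longlongrightarrow> D) (at_right 0)"
proof (rule tendstoI)
 fix e :: real assume e: "0 < e"
 have "\<forall>e>0. \<exists>d>0. \<forall>y\<in>{a..c}. norm (y - x) < d --> norm (H y - H x - (y - x) *\<^sub>R D) <= e * norm (y - x)"
  using H unfolding has_vector_derivative_def has_derivative_within_alt by blast
 then obtain d where d: "0 < d" "\<And>y. y \<in> {a..c} ==> norm (y - x) < d ==>
   norm (H y - H x - (y - x) *\<^sub>R D) <= e / 2 * norm (y - x)"
  using e by (meson half_gt_zero)
 have "dist ((1 / k) *\<^sub>R (H (x + k) - H x)) D < e" if k: "0 < k" "k < min d (c - x)" for k
 proof -
  have "norm (H (x + k) - H x - k *\<^sub>R D) <= e / 2 * k"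
   using d(2)[of "x + k"] k x by simp
  moreover have "(1 / k) *\<^sub>R (H (x + k) - H x) - D = (1 / k) *\<^sub>R (H (x + k) - H x - k *\<^sub>R D)"
   using k by (simp add: scaleR_diff_right)
  ultimately have "norm ((1 / k) *\<^sub>R (H (x + k) - H x) - D) = norm (H (x + k) - H x - k *\<^sub>R D) / k"
   using k by simp
  also have "\<dots> <= e / 2"
   using \<open>norm (H (x + k) - H x - k *\<^sub>R D) <= e / 2 * k\<close> k by (simp only: pos_divide_le_eq)
  finally show ?thesis using e by (simp add: dist_norm)
 qed
 then show "\<forall>\<^sub>F k in at_right 0. dist ((1 / k) *\<^sub>R (H (x + k) - H x)) D < e"
  unfolding eventually_at_right_field using d(1) x
  by (intro exI[of _ "min d (c - x)"]) auto
qed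

text \<open>The integral of the increments is the difference of two integrals over intervals of length \<open>k\<close> at the end points.\<close>

lemma average_increment:
 fixes G :: "real => 'b::banach"
 assumes G: "continuous_on {a..c} G" and ab: "a <= b" "b < c"
 shows "((\<lambda>k. (1 / k) *\<^sub>R integral {a..b} (\<lambda>y. G (y + k) - G y)) \<longlongrightarrow> G b - G a) (at_right 0)"
proof -
 define H where "H z = integral {a..z} G" for z
 have H: "(H has_vector_derivative G z) (at z within {a..c})" if "z \<in> {a..c}" for z
  unfolding H_def by (rule integral_has_vector_derivative[OF G that])
 have int: "G integrable_on {p..q}" if "a <= p" "q <= c" for p q
  by (rule integrable_continuous_real[OF continuous_on_subset[OF G]]) (use that in auto)
 have "((\<lambda>k. (1 / k) *\<^sub>R (H (b + k) - H b) - (1 / k) *\<^sub>R (H (a + k) - H a)) \<longlongrightarrow> G b - G a) (at_right 0)"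
  by (intro tendsto_diff right_increment_tendsto[OF H]) (use ab in auto)
 moreover have "\<forall>\<^sub>F k in at_right 0. (1 / k) *\<^sub>R (H (b + k) - H b) - (1 / k) *\<^sub>R (H (a + k) - H a)
   = (1 / k) *\<^sub>R integral {a..b} (\<lambda>y. G (y + k) - G y)"
  unfolding eventually_at_right_field
 proof (intro exI[of _ "c - b"] conjI allI impI)
  show "0 < c - b" using ab by simp
  fix k assume k: "0 < k" "k < c - b"
  have 1: "integral {a..b} (\<lambda>y. G (y + k)) = integral {a + k..b + k} G"
   using integral_shift_Icc_real[of a b G k] by (simp add: o_def add.commute)
  have 2: "(\<lambda>y. G (y + k)) integrable_on {a..b}"
   using has_integral_shift_Icc_real[of G k _ a b] int[of "a + k" "b + k"] k
   by (auto simp: integrable_on_def o_def add.commute)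
  have "H (a + k) + integral {a + k..b + k} G = H (b + k)"
   unfolding H_def by (rule Henstock_Kurzweil_Integration.integral_combine[OF _ _ int]) (use ab k in auto)
  then have "integral {a + k..b + k} G = H (b + k) - H (a + k)"
   by (metis add_diff_cancel_left')
  moreover have "integral {a..b} (\<lambda>y. G (y + k) - G y) = integral {a + k..b + k} G - H b"
   using Henstock_Kurzweil_Integration.integral_diff[OF 2 int[of a b]] 1 ab by (simp only: H_def order_refl less_imp_le)
  moreover have "H a = 0" by (simp add: H_def)
  ultimately have "integral {a..b} (\<lambda>y. G (y + k) - G y) = (H (b + k) - H b) - (H (a + k) - H a)"
   by simp
  then show "(1 / k) *\<^sub>R (H (b + k) - H b) - (1 / k) *\<^sub>R (H (a + k) - H a)
    = (1 / k) *\<^sub>R integral {a..b} (\<lambda>y. G (y + k) - G y)"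
   by (simp only: scaleR_diff_right)
 qed
 ultimately show ?thesis by (rule Lim_transform_eventually)
qed

lemma tendsto_ennreal_0I:
 fixes f :: "'x => ennreal"
 assumes "\<And>e. 0 < e ==> \<forall>\<^sub>F x in F. f x <= ennreal e"
 shows "(f \<longlongrightarrow> 0) F"
proof (rule order_tendstoI)
 fix a :: ennreal assume "0 < a"
 then obtain z where z: "0 < z" "z < a" using dense by blast
 then obtain e where e: "z = ennreal e" "0 < e"
  by (cases z) (auto simp: top_unique)
 from assms[OF e(2)] show "\<forall>\<^sub>F x in F. f x < a"
  by eventually_elim (use z e in auto)
qed simp

text \<open>The mean increments over a step, divided by its length, converge to the difference of the end values.\<close>

lemma equal_ends_of_small_increments:
 fixes G :: "real => 'b::banach"
 assumes G: "continuous_on {a..c} G" and ab: "a <= b" "b < c"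
  and small: "((\<lambda>k. (\<integral>\<^sup>+y. ennreal (norm (G (y + k) - G y)) * indicator {a..b} y \<partial>lborel) / ennreal k) \<longlongrightarrow> 0) (at_right 0)"
 shows "G b = G a"
proof -
 have "((\<lambda>k. (1 / k) *\<^sub>R integral {a..b} (\<lambda>y. G (y + k) - G y)) \<longlongrightarrow> 0) (at_right 0)"
 proof (rule tendstoI)
  fix e :: real assume e: "0 < e"
  have "\<forall>\<^sub>F k in at_right 0. (\<integral>\<^sup>+y. ennreal (norm (G (y + k) - G y)) * indicator {a..b} y \<partial>lborel) / ennreal k < ennreal e"
   by (rule order_tendstoD(2)[OF small]) (use e in simp)
  moreover have "\<forall>\<^sub>F k in at_right (0::real). k \<in> {0<..<c - b}"
   by (rule eventually_at_right_real) (use ab in simp)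
  ultimately show "\<forall>\<^sub>F k in at_right 0. dist ((1 / k) *\<^sub>R integral {a..b} (\<lambda>y. G (y + k) - G y)) 0 < e"
  proof eventually_elim
   case (elim k)
   then have k: "0 < k" "k < c - b" by auto
   define F where "F y = (if y \<in> {a..b} then G (y + k) - G y else 0)" for y
   have F: "bochner_borel F"
    unfolding F_def
   proof (rule bochner_borel_continuous, intro continuous_on_diff)
    show "continuous_on {a..b} (\<lambda>y. G (y + k))"
     by (rule continuous_on_compose2[OF G]) (use k in \<open>auto intro!: continuous_intros\<close>)
    show "continuous_on {a..b} G" by (rule continuous_on_subset[OF G]) (use ab in auto)
   qed
   have "integral {a..b} (\<lambda>y. G (y + k) - G y) = integral {a..b} F"
    by (rule Henstock_Kurzweil_Integration.integral_cong) (simp add: F_def)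
   then have "norm (integral {a..b} (\<lambda>y. G (y + k) - G y)) <= integral {a..b} (\<lambda>y. norm (F y))"
    using norm_integral_le_bochner[OF F] by simp
   then have "ennreal (norm (integral {a..b} (\<lambda>y. G (y + k) - G y))) <= (\<integral>\<^sup>+y. ennreal (norm (F y)) * indicator {a..b} y \<partial>lborel)"
    unfolding bochner_borel_integrable_on(5)[OF F, symmetric] by (rule ennreal_leI)
   also have "\<dots> = (\<integral>\<^sup>+y. ennreal (norm (G (y + k) - G y)) * indicator {a..b} y \<partial>lborel)"
    by (intro nn_integral_cong) (simp add: F_def indicator_def)
   also have "\<dots> < ennreal e * ennreal k"
    using elim(1) k by (simp add: divide_less_ennreal)
   also have "\<dots> = ennreal (e * k)" using k e by (simp add: ennreal_mult)
   finally have "norm (integral {a..b} (\<lambda>y. G (y + k) - G y)) < e * k"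
    using k e by (simp add: ennreal_less_iff)
   then show ?case using k by (simp add: pos_divide_less_eq)
  qed
 qed
 from tendsto_unique[OF _ average_increment[OF G ab] this] show ?thesis by simp
qed

lemma borel_pair_lborel:
 fixes f :: "real \<times> real => 'c::topological_space"
 assumes "f \<in> borel_measurable borel"
 shows "f \<in> borel_measurable (lborel \<Otimes>\<^sub>M lborel)"
proof -
 have "sets (lborel \<Otimes>\<^sub>M lborel :: (real \<times> real) measure) = sets (borel \<Otimes>\<^sub>M borel)"
  by (intro sets_pair_measure_cong sets_lborel)
 then have "sets (lborel \<Otimes>\<^sub>M lborel :: (real \<times> real) measure) = sets borel"
  by (simp only: borel_prod)
 then have "borel_measurable (lborel \<Otimes>\<^sub>M lborel) = (borel_measurable borel :: (real \<times> real => 'c) set)"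
  by (rule measurable_cong_sets) (rule refl)
 with assms show ?thesis by blast
qed

context substochastic_perturbation
begin

lemma strongly_borel_regular:
 fixes a b :: "'s::second_countable_topology => real"
 assumes W: "regular W" and ab: "continuous_on UNIV a" "continuous_on UNIV b" "\<And>z. 0 <= b z" "\<And>z. b z <= a z"
  and F: "strongly_borel borel F"
 shows "strongly_borel borel (\<lambda>z. W (a z) (b z) (F z))"
proof (rule strongly_borel_operator[OF F])
 show "strongly_borel borel (\<lambda>z. W (a z) (b z) v)" for v
  by (rule strongly_borel_continuous, rule regular_cont_comp[OF W ab(1,2)]) (simp add: ab(3,4))
 show "continuous_on UNIV (W (a z) (b z))" for z
  by (rule linear_continuous_on[OF regularD(5)[OF W ab(3,4)]])
qed

text \<open>The mass that the source \<open>f\<close> loses under \<open>U\<close> from its creation to time \<open>x\<close>; it measures the accuracy of one step.\<close>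

definition err :: "(real => 'a) => real => real => real" where
 "err f y x = integral {y..x} (\<lambda>q. norm (f q)) - norm (R y f x)"

lemma err_nonneg:
 "bochner_borel f ==> (\<And>q. 0 <= f q) ==> 0 <= y ==> 0 <= err f y x"
 using conv_norm(2)[OF regular_U, of f y x] by (simp add: err_def)

lemma err_eq:
 assumes f: "bochner_borel f" "\<And>q. 0 <= f q" and y: "0 <= y"
 shows "err f y x = integral {y..x} (\<lambda>q. norm (f q) - norm (U x q (f q)))"
 unfolding err_def conv_norm(1)[OF regular_U f y]
 by (rule Henstock_Kurzweil_Integration.integral_diff[OF bochner_borel_integrable_on(3)[OF f(1)]
    conv_norm(3)[OF regular_U f y], symmetric])

text \<open>One step of length \<open>x - y\<close> along a trajectory \<open>U(q,y) e + R y p q - R y n q\<close>: the deviation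
 of the Dyson--Phillips terms from their leading behaviour is controlled by the loss of norm
 that \<open>U\<close> causes on the sources \<open>p\<close>, \<open>n\<close> and on \<open>w = B\<close> applied to the trajectory.\<close>

lemma step:
 assumes yx: "0 <= y" "y <= x" and p: "bochner_borel p" "\<And>q. 0 <= p q" and n: "bochner_borel n" "\<And>q. 0 <= n q"
  and w: "bochner_borel w" "\<And>q. 0 <= w q"
  and eq: "AE q in lborel. q \<in> {y..x} --> B q (U q y e + R y p q - R y n q) = w q"
 shows "norm (V (Suc 0) x y e - R y w x) <= err p y x + err n y x"
  and "norm (V (Suc (Suc j)) x y e) <= err w y x + err p y x + err n y x"
  and "norm (VV x y e - U x y e - R y w x) <= err w y x + err p y x + err n y x"
proof -
 obtain wp where wp: "bochner_borel wp" "\<And>r. 0 <= wp r" "\<And>r. r \<notin> {y..x} ==> wp r = 0"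
  "AE r in lborel. r \<in> {y..x} --> R y p r \<in> D r \<and> B r (R y p r) = wp r"
  "integral {y..x} (\<lambda>r. norm (wp r)) + norm (R y p x) <= integral {y..x} (\<lambda>r. norm (p r))"
  by (rule B_conv[OF p yx]) (rule that)
 obtain wn where wn: "bochner_borel wn" "\<And>r. 0 <= wn r" "\<And>r. r \<notin> {y..x} ==> wn r = 0"
  "AE r in lborel. r \<in> {y..x} --> R y n r \<in> D r \<and> B r (R y n r) = wn r"
  "integral {y..x} (\<lambda>r. norm (wn r)) + norm (R y n x) <= integral {y..x} (\<lambda>r. norm (n r))"
  by (rule B_conv[OF n yx]) (rule that)
 obtain g where g: "version y x e g" by (rule version_ex[OF yx])
 have gb: "bochner_borel g" and g_ae: "AE r in lborel. r \<in> {y..x} --> B r (U r y e) = g r"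
  using g by (auto simp: version_def)
 have g_eq: "AE q in lborel. q \<in> {y..x} --> g q = w q - wp q + wn q"
  using eq wp(4) wn(4) g_ae BU_dom'[OF yx(1), of e]
 proof eventually_elim
  case (elim q)
  show ?case
  proof
   assume q: "q \<in> {y..x}"
   then have q0: "0 <= q" and yq: "y <= q" using yx by auto
   have D': "U q y e \<in> D q" "R y p q \<in> D q" "R y n q \<in> D q" using elim q yq by blast+
   have "w q = B q (U q y e + R y p q - R y n q)" using elim(1) q by simp
   also have "\<dots> = B q (U q y e) + B q (R y p q) - B q (R y n q)"
    by (simp only: B_diff[OF q0 subspace_add[OF dom_subspace[OF q0] D'(1,2)] D'(3)] B_add[OF q0 D'(1,2)])
   also have "\<dots> = g q + wp q - wn q" using elim q by simp
   finally show "g q = w q - wp q + wn q" by simp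
  qed
 qed
 have conv_g: "conv W y g x = conv W y w x - conv W y wp x + conv W y wn x" if W: "regular W" for W
 proof -
  have "conv W y g x = integral {y..x} (\<lambda>q. W x q (w q - wp q + wn q))"
   unfolding conv_def
   by (rule integral_AE_cong(1), use g_eq in eventually_elim) auto
  also have "\<dots> = integral {y..x} (\<lambda>q. (W x q (w q) - W x q (wp q)) + W x q (wn q))"
  proof (rule Henstock_Kurzweil_Integration.integral_cong)
   fix q assume "q \<in> {y..x}"
   then have "linear (W x q)" by (intro regularD(1)[OF W]) (use yx in auto)
   then show "W x q (w q - wp q + wn q) = (W x q (w q) - W x q (wp q)) + W x q (wn q)"
    by (simp only: linear_add linear_diff)
  qed
  also have "\<dots> = integral {y..x} (\<lambda>q. W x q (w q) - W x q (wp q)) + integral {y..x} (\<lambda>q. W x q (wn q))"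
   by (rule Henstock_Kurzweil_Integration.integral_add[OF integrable_diff[OF
      bochner_borel_regular(2)[OF W yx(1) w(1)] bochner_borel_regular(2)[OF W yx(1) wp(1)]]
      bochner_borel_regular(2)[OF W yx(1) wn(1)]])
  also have "integral {y..x} (\<lambda>q. W x q (w q) - W x q (wp q)) = integral {y..x} (\<lambda>q. W x q (w q)) - integral {y..x} (\<lambda>q. W x q (wp q))"
   by (rule Henstock_Kurzweil_Integration.integral_diff[OF
      bochner_borel_regular(2)[OF W yx(1) w(1)] bochner_borel_regular(2)[OF W yx(1) wp(1)]])
  finally show ?thesis by (simp only: conv_def)
 qed
 have dev: "norm (conv W y g x - z) <= norm (conv W y w x - z) + err p y x + err n y x" if W: "regular W" for W z
 proof -
  have "conv W y g x - z = (conv W y w x - z) + (conv W y wn x - conv W y wp x)"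
   unfolding conv_g[OF W] by simp
  also have "norm \<dots> <= norm (conv W y w x - z) + (norm (conv W y wn x) + norm (conv W y wp x))"
   by (rule order_trans[OF norm_triangle_ineq add_left_mono[OF norm_triangle_ineq4]])
  finally show ?thesis
   using conv_norm(2)[OF W wp(1,2) yx(1), of x] conv_norm(2)[OF W wn(1,2) yx(1), of x] wp(5) wn(5)
   by (simp add: err_def)
 qed
 have V_g: "V (Suc i) x y e = conv (V i) y g x" for i
  unfolding conv_def by (rule V_Suc_eq[OF regular_V yx(1) order_refl g])
 show "norm (V (Suc 0) x y e - R y w x) <= err p y x + err n y x"
  using dev[OF regular_U, of "R y w x"] V_g[of 0] by simp
 have int_err: "err w y x = integral {y..x} (\<lambda>q. norm (w q) - norm (U x q (w q)))"
  by (rule err_eq[OF w yx(1)])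
 have int_able: "(\<lambda>q. norm (w q) - norm (U x q (w q))) integrable_on {y..x}"
  by (rule integrable_diff[OF bochner_borel_integrable_on(3)[OF w(1)] conv_norm(3)[OF regular_U w yx(1)]])
 have "norm (conv (V (Suc j)) y w x) <= err w y x"
  unfolding conv_norm(1)[OF regular_V w yx(1)] int_err
 proof (rule integral_le[OF conv_norm(3)[OF regular_V w yx(1)] int_able])
  fix q assume "q \<in> {y..x}"
  then have "0 <= q" "q <= x" using yx by auto
  then show "norm (V (Suc j) x q (w q)) <= norm (w q) - norm (U x q (w q))"
   using V_Suc_cone(2)[OF regular_V, of q x "w q" j] w(2) by simp
 qed
 then show "norm (V (Suc (Suc j)) x y e) <= err w y x + err p y x + err n y x"
  using dev[OF regular_V, of "Suc j" 0] V_g[of "Suc j"] by simp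
 have S_le: "norm (S (Suc N) x y e - U x y e - R y w x) <= err w y x + err p y x + err n y x" for N
 proof -
  have "S (Suc N) x y e - U x y e = (\<Sum>i\<le>N. V (Suc i) x y e)"
   by (simp only: sum.atMost_Suc_shift dyson.simps(1) add_diff_cancel_left')
  also have "\<dots> = conv (S N) y g x"
   unfolding V_g conv_def
   by (rule Henstock_Kurzweil_Integration.integral_sum[symmetric]) (simp_all only: finite_atMost bochner_borel_regular(2)[OF regular_V yx(1) gb])
  finally have 1: "norm (S (Suc N) x y e - U x y e - R y w x) <= norm (conv (S N) y w x - R y w x) + err p y x + err n y x"
   using dev[OF regular_S, of N "R y w x"] by simp
  have "conv (S N) y w x - R y w x = integral {y..x} (\<lambda>q. S N x q (w q) - U x q (w q))"
   unfolding conv_def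
   by (rule Henstock_Kurzweil_Integration.integral_diff[OF bochner_borel_regular(2)[OF regular_S yx(1) w(1)]
      bochner_borel_regular(2)[OF regular_U yx(1) w(1)], symmetric])
  also have "norm \<dots> <= err w y x"
   unfolding int_err
  proof (rule integral_norm_bound_integral[OF _ int_able])
   show "(\<lambda>q. S N x q (w q) - U x q (w q)) integrable_on {y..x}"
    by (rule integrable_diff[OF bochner_borel_regular(2)[OF regular_S yx(1) w(1)]
      bochner_borel_regular(2)[OF regular_U yx(1) w(1)]])
   fix q assume "q \<in> {y..x}"
   then have "0 <= q" "q <= x" using yx by auto
   then show "norm (S N x q (w q) - U x q (w q)) <= norm (w q) - norm (U x q (w q))"
    by (rule S_minus_U[OF _ _ w(2)])
  qed
  finally show ?thesis using 1 by linarith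
 qed
 have "(\<lambda>N. norm (S (Suc N) x y e - U x y e - R y w x)) \<longlonglongrightarrow> norm (VV x y e - U x y e - R y w x)"
  by (intro tendsto_norm tendsto_diff tendsto_const LIMSEQ_Suc[OF S_tendsto[OF yx]])
 then show "norm (VV x y e - U x y e - R y w x) <= err w y x + err p y x + err n y x"
  by (rule LIMSEQ_le_const2) (use S_le in blast)
qed

lemma ennreal_err:
 assumes f: "bochner_borel f" "\<And>q. 0 <= f q" and y: "0 <= y"
 shows "ennreal (err f y x) = (\<integral>\<^sup>+q. ennreal (norm (f q) - norm (U x q (f q))) * indicator {y..x} q \<partial>lborel)"
proof -
 define h where "h q = (if q \<in> {y..x} then U x q (f q) else 0)" for q
 have h: "bochner_borel h" unfolding h_def by (rule bochner_borel_regular(1)[OF regular_U y f(1)])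
 have int: "integrable lborel (\<lambda>q. norm (f q) * indicator {y..x} q)" "integrable lborel (\<lambda>q. norm (h q) * indicator {y..x} q)"
  using bochner_borelD[OF f(1)] bochner_borelD[OF h] by (auto intro!: integrable_real_mult_indicator)
 have "norm (R y f x) = integral {y..x} (\<lambda>q. norm (h q))"
  unfolding conv_norm(1)[OF regular_U f y] by (rule Henstock_Kurzweil_Integration.integral_cong) (simp add: h_def)
 then have "err f y x = (\<integral>q. norm (f q) * indicator {y..x} q \<partial>lborel) - (\<integral>q. norm (h q) * indicator {y..x} q \<partial>lborel)"
  unfolding err_def bochner_borel_integrable_on(4)[OF f(1)] bochner_borel_integrable_on(4)[OF h] by simp
 also have "\<dots> = (\<integral>q. norm (f q) * indicator {y..x} q - norm (h q) * indicator {y..x} q \<partial>lborel)"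
  by (rule Bochner_Integration.integral_diff[OF int, symmetric])
 also have "ennreal \<dots> = (\<integral>\<^sup>+q. ennreal (norm (f q) * indicator {y..x} q - norm (h q) * indicator {y..x} q) \<partial>lborel)"
 proof (rule nn_integral_eq_integral[symmetric, OF Bochner_Integration.integrable_diff[OF int]])
  show "AE q in lborel. 0 <= norm (f q) * indicator {y..x} q - norm (h q) * indicator {y..x} q"
  proof (rule AE_I2)
   fix q
   show "0 <= norm (f q) * indicator {y..x} q - norm (h q) * indicator {y..x} q"
   proof (cases "q \<in> {y..x}")
    case True
    then have "0 <= q" "q <= x" using y by auto
    from U_contr[OF this f(2)] True show ?thesis by (simp add: h_def)
   next
    case False
    then show ?thesis by simp
   qed
  qed
 qed
 also have "\<dots> = (\<integral>\<^sup>+q. ennreal (norm (f q) - norm (U x q (f q))) * indicator {y..x} q \<partial>lborel)"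
  by (intro nn_integral_cong) (simp add: h_def indicator_def)
 finally show ?thesis .
qed

definition loss :: "(real => 'a) => real => real => ennreal" where
 "loss f x q = ennreal (norm (f q) - norm (U (max x (max q 0)) (max q 0) (f q)))"

lemma loss_measurable:
 assumes "bochner_borel f"
 shows "(\<lambda>z. loss f (fst z) (snd z)) \<in> borel_measurable borel"
proof -
 have f2: "strongly_borel borel (\<lambda>z::real \<times> real. f (snd z))"
  by (rule strongly_borel_compose[OF bochner_borelD(1)[OF assms]]) (intro borel_measurable_continuous_onI continuous_on_snd continuous_on_id)
 have "strongly_borel borel (\<lambda>z::real \<times> real. U (max (fst z) (max (snd z) 0)) (max (snd z) 0) (f (snd z)))"
  by (rule strongly_borel_regular[OF regular_U _ _ _ _ f2]) (auto intro!: continuous_intros)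
 from strongly_borel_norm[OF this] strongly_borel_norm[OF f2]
 show ?thesis unfolding loss_def by measurable
qed

lemma err_measurable:
 assumes f: "bochner_borel f" "\<And>q. 0 <= f q"
 shows "(\<lambda>x. ennreal (err f (max 0 (x - k)) x)) \<in> borel_measurable borel"
proof -
 let ?A = "{z::real \<times> real. max 0 (fst z - k) <= snd z \<and> snd z <= fst z}"
 have "closed ?A"
  by (intro closed_Collect_conj closed_Collect_le continuous_intros)
 then have "(\<lambda>z. loss f (fst z) (snd z) * indicator ?A z) \<in> borel_measurable borel"
  by (intro borel_measurable_times_ennreal loss_measurable f borel_measurable_indicator borel_closed)
 then have "(\<lambda>z. loss f (fst z) (snd z) * indicator ?A z) \<in> borel_measurable (lborel \<Otimes>\<^sub>M lborel)"
  by (rule borel_pair_lborel)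
 moreover have "(\<lambda>z. loss f (fst z) (snd z) * indicator ?A z)
   = (\<lambda>(x, q). ennreal (norm (f q) - norm (U x q (f q))) * indicator {max 0 (x - k)..x} q)"
 proof (rule ext, clarify)
  fix x q :: real
  show "loss f (fst (x, q)) (snd (x, q)) * indicator ?A (x, q)
    = ennreal (norm (f q) - norm (U x q (f q))) * indicator {max 0 (x - k)..x} q"
  proof (cases "max 0 (x - k) <= q \<and> q <= x")
   case True
   then have "max q 0 = q" "max x q = x" by auto
   then show ?thesis using True by (simp add: loss_def)
  qed auto
 qed
 ultimately have "(\<lambda>(x, q). ennreal (norm (f q) - norm (U x q (f q))) * indicator {max 0 (x - k)..x} q)
   \<in> borel_measurable (lborel \<Otimes>\<^sub>M lborel)" by simp
 from lborel.borel_measurable_nn_integral[OF this]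
 show ?thesis by (simp only: ennreal_err[OF f max.cobounded1] measurable_lborel2)
qed

abbreviation err_mean :: "(real => 'a) => real => ennreal" where
 "err_mean f k \<equiv> (\<integral>\<^sup>+x. ennreal (err f (max 0 (x - k)) x) * indicator {0..} x \<partial>lborel) / ennreal k"

text \<open>After exchanging the integrals the mean error is an average, over times \<open>x\<close> shortly after
 \<open>q\<close>, of the loss \<open>\<parallel>f(q)\<parallel> - \<parallel>U(x,q) f(q)\<parallel>\<close>, which vanishes as \<open>x\<close> tends to \<open>q\<close>.\<close>

lemma err_mean_tendsto_0:
 assumes f: "bochner_borel f" "\<And>q. 0 <= f q" and f_neg: "\<And>q. q < 0 ==> f q = 0"
 shows "(err_mean f \<longlongrightarrow> 0) (at_right 0)"
 unfolding tendsto_at_iff_sequentially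
proof (intro allI impI)
 fix k :: "nat => real" assume k: "\<forall>i. k i \<in> {0<..} - {0}" "k \<longlonglongrightarrow> 0"
 then have k0: "0 < k i" for i by auto
 define J where "J = loss f"
 have Jz: "(\<lambda>z. J (fst z) (snd z)) \<in> borel_measurable borel"
  unfolding J_def by (rule loss_measurable[OF f(1)])
 have J_meas[measurable]: "(\<lambda>(x, q). J x q) \<in> borel_measurable (lborel \<Otimes>\<^sub>M lborel)"
  using borel_pair_lborel[OF Jz] by (simp add: split_def)
 have J_le: "J x q <= ennreal (norm (f q))" for x q
  unfolding J_def loss_def by (rule ennreal_leI) simp
 have J_eq: "J x q = ennreal (norm (f q) - norm (U x q (f q)))" if "0 <= q" "q <= x" for x q
  using that by (simp add: J_def loss_def max_def)
 define I where "I i q = (\<integral>\<^sup>+x. J x q * indicator {q..q + k i} x \<partial>lborel) / ennreal (k i)" for i q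
 have "closed {z::real \<times> real. snd z <= fst z \<and> fst z <= snd z + k i}" for i
  by (intro closed_Collect_conj closed_Collect_le continuous_intros)
 then have "{z::real \<times> real. snd z <= fst z \<and> fst z <= snd z + k i} \<in> sets borel" for i
  by (rule borel_closed)
 then have "(\<lambda>z. J (fst z) (snd z) * indicator {z. snd z <= fst z \<and> fst z <= snd z + k i} z) \<in> borel_measurable borel" for i
  by (intro borel_measurable_times_ennreal Jz borel_measurable_indicator)
 then have "(\<lambda>z. J (fst z) (snd z) * indicator {z. snd z <= fst z \<and> fst z <= snd z + k i} z) \<in> borel_measurable (lborel \<Otimes>\<^sub>M lborel)" for i
  by (rule borel_pair_lborel)
 moreover have "(\<lambda>z. J (fst z) (snd z) * indicator {z. snd z <= fst z \<and> fst z <= snd z + k i} z)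
   = (\<lambda>(x, q). J x q * indicator {q..q + k i} x)" for i
  by (auto simp: indicator_def fun_eq_iff)
 ultimately have K1: "(\<lambda>(x, q). J x q * indicator {q..q + k i} x) \<in> borel_measurable (lborel \<Otimes>\<^sub>M lborel)" for i
  by simp
 have K2: "(\<lambda>(q, x). J x q * indicator {q..q + k i} x) \<in> borel_measurable (lborel \<Otimes>\<^sub>M lborel)" for i
  using measurable_pair_swap[OF K1] by simp
 have K_meas: "(\<lambda>q. \<integral>\<^sup>+x. J x q * indicator {q..q + k i} x \<partial>lborel) \<in> borel_measurable lborel" for i
  using lborel.borel_measurable_nn_integral[OF K2] by simp
 have I_meas: "I i \<in> borel_measurable lborel" for i
  unfolding I_def using borel_measurable_divide_ennreal[OF K_meas borel_measurable_const] by simp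
 have le: "err_mean f (k i) <= (\<integral>\<^sup>+q. I i q \<partial>lborel)" for i
 proof -
  have "(\<integral>\<^sup>+x. ennreal (err f (max 0 (x - k i)) x) * indicator {0..} x \<partial>lborel)
    = (\<integral>\<^sup>+x. (\<integral>\<^sup>+q. ennreal (norm (f q) - norm (U x q (f q))) * indicator {max 0 (x - k i)..x} q \<partial>lborel) * indicator {0..} x \<partial>lborel)"
   by (simp only: ennreal_err[OF f max.cobounded1])
  also have "\<dots> <= (\<integral>\<^sup>+x. \<integral>\<^sup>+q. J x q * indicator {q..q + k i} x \<partial>lborel \<partial>lborel)"
  proof (rule nn_integral_mono)
   fix x :: real
   have "(\<integral>\<^sup>+q. ennreal (norm (f q) - norm (U x q (f q))) * indicator {max 0 (x - k i)..x} q \<partial>lborel)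
     <= (\<integral>\<^sup>+q. J x q * indicator {q..q + k i} x \<partial>lborel)"
   proof (rule nn_integral_mono)
    fix q :: real
    show "ennreal (norm (f q) - norm (U x q (f q))) * indicator {max 0 (x - k i)..x} q <= J x q * indicator {q..q + k i} x"
     using J_eq[of q x] by (auto simp: indicator_def)
   qed
   then show "(\<integral>\<^sup>+q. ennreal (norm (f q) - norm (U x q (f q))) * indicator {max 0 (x - k i)..x} q \<partial>lborel) * indicator {0..} x
     <= (\<integral>\<^sup>+q. J x q * indicator {q..q + k i} x \<partial>lborel)"
    by (simp add: indicator_def)
  qed
  also have "\<dots> = (\<integral>\<^sup>+q. \<integral>\<^sup>+x. J x q * indicator {q..q + k i} x \<partial>lborel \<partial>lborel)"
   by (rule lborel_pair.Fubini'[symmetric, OF K1])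
  finally have "err_mean f (k i) <= (\<integral>\<^sup>+q. \<integral>\<^sup>+x. J x q * indicator {q..q + k i} x \<partial>lborel \<partial>lborel) / ennreal (k i)"
   by (rule divide_right_mono_ennreal)
  also have "\<dots> = (\<integral>\<^sup>+q. I i q \<partial>lborel)"
   unfolding I_def by (rule nn_integral_divide[symmetric, OF K_meas])
  finally show ?thesis .
 qed
 have avg: "(\<integral>\<^sup>+x. ennreal c * indicator {q..q + k i} x \<partial>lborel) / ennreal (k i) = ennreal c" if "0 <= c" for c q i
  using k0[of i] that by (simp add: nn_integral_cmult_indicator divide_ennreal ennreal_mult''[symmetric])
 have I_le: "I i q <= ennreal (norm (f q))" for i q
 proof -
  have "I i q <= (\<integral>\<^sup>+x. ennreal (norm (f q)) * indicator {q..q + k i} x \<partial>lborel) / ennreal (k i)"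
   unfolding I_def by (intro divide_right_mono_ennreal nn_integral_mono mult_right_mono J_le) simp
  then show ?thesis by (simp only: avg[OF norm_ge_zero])
 qed
 have I_lim: "(\<lambda>i. I i q) \<longlonglongrightarrow> 0" for q
 proof (rule tendsto_ennreal_0I)
  fix e :: real assume e: "0 < e"
  obtain d where d: "0 < d" "\<And>x. q <= x ==> x <= q + d ==> J x q <= ennreal e"
  proof (cases "q < 0")
   case True
   show ?thesis
   proof (rule that[of 1])
    show "J x q <= ennreal e" for x
     using J_le[of x q] f_neg[OF True] by simp
   qed simp
  next
   case False
   then have q: "0 <= q" by simp
   have c: "continuous_on {q..} (\<lambda>x. norm (U x q (f q)))"
    by (intro continuous_on_norm regular_cont_comp[OF regular_U] continuous_intros) (use q in auto)
   have "\<exists>d>0. \<forall>x\<in>{q..}. dist x q < d --> dist (norm (U x q (f q))) (norm (U q q (f q))) < e"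
    using c[unfolded continuous_on_iff] e by (metis atLeast_iff order_refl)
   then obtain d where d: "0 < d" "\<And>x. q <= x ==> dist x q < d ==> dist (norm (U x q (f q))) (norm (U q q (f q))) < e"
    by (metis atLeast_iff)
   show ?thesis
   proof (rule that[of "d / 2"])
    fix x assume x: "q <= x" "x <= q + d / 2"
    then have "dist (norm (U x q (f q))) (norm (f q)) < e"
     using d(2)[of x] d(1) U_refl[OF q] by (simp add: dist_real_def)
    then show "J x q <= ennreal e"
     unfolding J_eq[OF q x(1)] by (intro ennreal_leI) (simp add: dist_real_def abs_less_iff)
   qed (use d in simp)
  qed
  have "\<forall>\<^sub>F i in sequentially. k i < d" by (rule order_tendstoD(2)[OF k(2) d(1)])
  then show "\<forall>\<^sub>F i in sequentially. I i q <= ennreal e"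
  proof eventually_elim
   case (elim i)
   have "I i q <= (\<integral>\<^sup>+x. ennreal e * indicator {q..q + k i} x \<partial>lborel) / ennreal (k i)"
    unfolding I_def
   proof (intro divide_right_mono_ennreal nn_integral_mono)
    fix x show "J x q * indicator {q..q + k i} x <= ennreal e * indicator {q..q + k i} x"
     using d(2)[of x] elim by (auto simp: indicator_def)
   qed
   then show ?case using e by (simp only: avg)
  qed
 qed
 have "(\<lambda>i. \<integral>\<^sup>+q. I i q \<partial>lborel) \<longlonglongrightarrow> (\<integral>\<^sup>+(q::real). 0 \<partial>lborel)"
 proof (rule nn_integral_dominated_convergence[OF I_meas])
  show "(\<lambda>q. ennreal (norm (f q))) \<in> borel_measurable lborel"
   using bochner_borelD(3)[OF f(1)] by measurable
  show "(\<integral>\<^sup>+q. ennreal (norm (f q)) \<partial>lborel) < \<infinity>" by (rule bochner_borelD(2)[OF f(1)])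
  show "AE q in lborel. I j q <= ennreal (norm (f q))" for j by (rule AE_I2) (rule I_le)
  show "AE q in lborel. (\<lambda>i. I i q) \<longlonglongrightarrow> 0" by (rule AE_I2) (rule I_lim)
 qed simp
 then have lim: "(\<lambda>i. \<integral>\<^sup>+q. I i q \<partial>lborel) \<longlonglongrightarrow> 0" by simp
 show "(err_mean f \<circ> k) \<longlonglongrightarrow> 0"
  unfolding o_def
  by (rule tendsto_sandwich[OF _ _ tendsto_const lim]) (simp_all add: le)
qed

section \<open>The perturbation along the Dyson--Phillips terms\<close>

text \<open>\<open>B_version s T u m h\<close>: \<open>h\<close> represents \<open>r \<mapsto> B(r) V_m(r,s) u\<close> on the interval from \<open>s\<close> to \<open>T\<close>.\<close>

definition B_version :: "real => real => 'a => nat => (real => 'a) => bool" where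
 "B_version s T u m h \<longleftrightarrow> bochner_borel h \<and> (\<forall>r. 0 <= h r) \<and> (\<forall>r. r \<notin> {s..T} --> h r = 0) \<and>
   (AE r in lborel. r \<in> {s..T} --> B r (V m r s u) = h r)"

lemma B_versionD:
 assumes "B_version s T u m h"
 shows "bochner_borel h" "0 <= h r" "r \<notin> {s..T} ==> h r = 0"
  "AE r in lborel. r \<in> {s..T} --> B r (V m r s u) = h r"
 using assms unfolding B_version_def by blast+

lemma B_version_0:
 assumes s: "0 <= s" "s <= T" and u: "0 <= u"
 obtains h where "B_version s T u 0 h" "integral {s..T} (\<lambda>r. norm (h r)) + norm (U T s u) <= norm u"
proof -
 obtain g where g: "version s T u g" "\<And>r. 0 <= g r"
  "\<And>t. s <= t ==> t <= T ==> integral {s..t} (\<lambda>r. norm (g r)) + norm (U t s u) <= norm u"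
  by (rule version_cone[OF s u]) (rule that)
 define h where "h r = (if r \<in> {s..T} then g r else 0)" for r
 have "integral {s..T} (\<lambda>r. norm (h r)) = integral {s..T} (\<lambda>r. norm (g r))"
  by (rule Henstock_Kurzweil_Integration.integral_cong) (simp add: h_def)
 moreover have "B_version s T u 0 h"
  unfolding B_version_def
 proof (intro conjI)
  show "bochner_borel h"
   unfolding h_def by (rule bochner_borel_restrict) (use g in \<open>auto simp: version_def\<close>)
  have "AE r in lborel. r \<in> {s..T} --> B r (U r s u) = g r" using g(1) by (simp add: version_def)
  then show "AE r in lborel. r \<in> {s..T} --> B r (V 0 r s u) = h r"
   by eventually_elim (simp add: h_def)
 qed (use g(2) in \<open>auto simp: h_def\<close>)
 ultimately show thesis using that g(3)[OF s(2) order_refl] by simp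
qed

lemma B_version_Suc:
 assumes s: "0 <= s" "s <= T" and h: "B_version s T u m h"
  and eq: "\<And>t. t \<in> {s..T} ==> V (Suc m) t s u = R s h t"
 obtains w where "B_version s T u (Suc m) w"
  "integral {s..T} (\<lambda>r. norm (w r)) + norm (V (Suc m) T s u) <= integral {s..T} (\<lambda>r. norm (h r))"
proof -
 obtain w where w: "bochner_borel w" "\<And>r. 0 <= w r" "\<And>r. r \<notin> {s..T} ==> w r = 0"
  "AE r in lborel. r \<in> {s..T} --> R s h r \<in> D r \<and> B r (R s h r) = w r"
  "integral {s..T} (\<lambda>r. norm (w r)) + norm (R s h T) <= integral {s..T} (\<lambda>r. norm (h r))"
  by (rule B_conv[OF B_versionD(1,2)[OF h] s]) (rule that)
 have "AE r in lborel. r \<in> {s..T} --> B r (V (Suc m) r s u) = w r"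
  using w(4)
 proof eventually_elim
  case (elim r)
  then show ?case using eq[of r] by auto
 qed
 then have "B_version s T u (Suc m) w"
  unfolding B_version_def using w(1-3) by blast
 then show thesis
  using that w(5) eq[of T] s by auto
qed

lemma regular_apply_continuous:
 fixes a b :: "'s::metric_space => real"
 assumes W: "regular W" and ab: "continuous_on A a" "continuous_on A b" "\<And>z. z \<in> A ==> 0 <= b z \<and> b z <= a z"
  and F: "continuous_on A F"
 shows "continuous_on A (\<lambda>z. W (a z) (b z) (F z))"
 unfolding continuous_on_sequentially
proof (intro allI ballI impI)
 fix x l assume l: "l \<in> A" and x: "(\<forall>n. x n \<in> A) \<and> x \<longlonglongrightarrow> l"
 have xA: "x n \<in> A" for n using x by blast
 have "(\<lambda>n. W (a (x n)) (b (x n)) (F l)) \<longlonglongrightarrow> W (a l) (b l) (F l)"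
  using regular_cont_comp[OF W ab(1,2), of "F l"] ab(3) l x unfolding continuous_on_sequentially o_def by blast
 moreover have "(\<lambda>n. W (a (x n)) (b (x n)) (F (x n) - F l)) \<longlonglongrightarrow> 0"
 proof (rule Lim_null_comparison)
  show "\<forall>\<^sub>F n in sequentially. norm (W (a (x n)) (b (x n)) (F (x n) - F l)) <= CB * norm (F (x n) - F l)"
   using ab(3)[OF xA] by (intro always_eventually allI regularD(4)[OF W]) auto
  have "(\<lambda>n. F (x n)) \<longlonglongrightarrow> F l"
   using F l x unfolding continuous_on_sequentially o_def by blast
  then have "(\<lambda>n. CB * norm (F (x n) - F l)) \<longlonglongrightarrow> CB * norm (F l - F l)"
   by (intro tendsto_intros)
  then show "(\<lambda>n. CB * norm (F (x n) - F l)) \<longlonglongrightarrow> 0" by simp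
 qed
 ultimately have "(\<lambda>n. W (a (x n)) (b (x n)) (F (x n) - F l) + W (a (x n)) (b (x n)) (F l)) \<longlonglongrightarrow> 0 + W (a l) (b l) (F l)"
  by (intro tendsto_add)
 moreover have "W (a (x n)) (b (x n)) (F (x n) - F l) + W (a (x n)) (b (x n)) (F l) = W (a (x n)) (b (x n)) (F (x n))" for n
  using linear_diff[OF regularD(1)[OF W], of "b (x n)" "a (x n)" "F (x n)" "F l"] ab(3)[OF xA[of n]] by simp
 ultimately show "((\<lambda>z. W (a z) (b z) (F z)) \<circ> x) \<longlonglongrightarrow> W (a l) (b l) (F l)"
  by (simp add: o_def)
qed

lemma conv_continuous:
 fixes a b :: "real => real"
 assumes W: "regular W" and f: "bochner_borel f" and ab: "continuous_on A a" "continuous_on A b"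
  and le: "\<And>z. z \<in> A ==> 0 <= b z \<and> b z <= a z"
 shows "continuous_on A (\<lambda>z. conv W (b z) f (a z))"
 unfolding continuous_on_sequentially
proof (intro allI ballI impI)
 fix x l assume l: "l \<in> A" and x: "(\<forall>n. x n \<in> A) \<and> x \<longlonglongrightarrow> l"
 have xA: "x n \<in> A" for n using x by blast
 have "(\<lambda>n. a (x n)) \<longlonglongrightarrow> a l" "(\<lambda>n. b (x n)) \<longlonglongrightarrow> b l"
  using ab l x unfolding continuous_on_sequentially o_def by blast+
 from conv_tendsto[OF W f this] le[OF xA]
 show "((\<lambda>z. conv W (b z) f (a z)) \<circ> x) \<longlonglongrightarrow> conv W (b l) f (a l)"
  by (simp add: o_def)
qed

lemma conv_zero: "0 <= y ==> conv W y (\<lambda>q. 0) x = 0" if "regular W"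
 using conv_norm(2)[OF that bochner_borel_zero, of y x] by simp

lemma err_zero: "0 <= y ==> err (\<lambda>q. 0) y x = 0"
 by (simp add: err_def conv_zero[OF regular_U])

lemma nn_err_le:
 assumes f: "bochner_borel f" "\<And>q. 0 <= f q" and s: "0 <= s" and that: "0 <= k"
 shows "(\<integral>\<^sup>+y. ennreal (err f y (y + k)) * indicator {s..b} y \<partial>lborel)
   <= (\<integral>\<^sup>+x. ennreal (err f (max 0 (x - k)) x) * indicator {0..} x \<partial>lborel)"
proof -
 have m: "(\<lambda>x. ennreal (err f (max 0 (x - k)) x) * indicator {0..} x) \<in> borel_measurable borel"
  by (intro borel_measurable_times_ennreal err_measurable f borel_measurable_indicator) simp
 have "(\<integral>\<^sup>+x. ennreal (err f (max 0 (x - k)) x) * indicator {0..} x \<partial>lborel)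
   = (\<integral>\<^sup>+y. ennreal (err f (max 0 (y + k - k)) (y + k)) * indicator {0..} (y + k) \<partial>lborel)"
  using nn_integral_real_affine[OF m, of 1 k] by (simp add: add.commute)
 moreover have "(\<integral>\<^sup>+y. ennreal (err f y (y + k)) * indicator {s..b} y \<partial>lborel)
   <= (\<integral>\<^sup>+y. ennreal (err f (max 0 (y + k - k)) (y + k)) * indicator {0..} (y + k) \<partial>lborel)"
  by (rule nn_integral_mono) (use s that in \<open>auto simp: indicator_def max_def\<close>)
 ultimately show ?thesis by simp
qed

lemma nn_err_measurable:
 assumes f: "bochner_borel f" "\<And>q. 0 <= f q" and s: "0 <= s"
 shows "(\<lambda>y. ennreal (err f y (y + k)) * indicator {s..b} y) \<in> borel_measurable borel"
proof -
 have "(\<lambda>y. ennreal (err f (max 0 (y + k - k)) (y + k))) \<in> borel_measurable borel"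
  by (rule measurable_compose[OF _ err_measurable[OF f], of "\<lambda>y. y + k" _ k]) simp
 then have "(\<lambda>y. ennreal (err f (max 0 (y + k - k)) (y + k)) * indicator {s..b} y) \<in> borel_measurable borel"
  by (intro borel_measurable_times_ennreal borel_measurable_indicator) simp_all
 moreover have "(\<lambda>y. ennreal (err f (max 0 (y + k - k)) (y + k)) * indicator {s..b} y) = (\<lambda>y. ennreal (err f y (y + k)) * indicator {s..b} y)"
  using s by (auto simp: indicator_def fun_eq_iff max_def)
 ultimately show ?thesis by simp
qed

text \<open>The deviation \<open>V_{m+1}(t,s) u - R s h t\<close> satisfies, up to the errors of the lemma on one step, the
 same propagation law as \<open>U\<close>; since the errors vanish in the mean, it is propagated by \<open>U\<close>
 exactly, and it vanishes at time \<open>s\<close>.\<close>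

lemma V_Suc_eq_R_aux:
 assumes s: "0 <= s" and u: "0 <= u"
  and h: "\<And>j. j <= m ==> B_version s T u j (h j)"
  and IH: "\<And>j t. j < m ==> t \<in> {s..T} ==> V (Suc j) t s u = R s (h j) t"
  and t: "t \<in> {s..T}"
 shows "V (Suc m) t s u = R s (h m) t"
proof -
 have h_bb: "bochner_borel (h j)" and h0: "0 <= h j r" and h_out: "r \<notin> {s..T} ==> h j r = 0"
  and h_ae: "AE r in lborel. r \<in> {s..T} --> B r (V j r s u) = h j r" if "j <= m" for j r
  using B_versionD[OF h[OF that]] by blast+
 define p where "p j = (case j of 0 => (\<lambda>q. 0) | Suc i => h i)" for j
 have p_bb: "bochner_borel (p j)" and p0: "0 <= p j r" if "j <= m" for j r
  using that h_bb h0 bochner_borel_zero by (auto simp: p_def split: nat.split)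
 have mild: "V j q s u = U q y (V j y s u) + R y (p j) q" if "j <= m" "s <= y" "y <= q" "q <= T" for j y q
 proof (cases j)
  case 0
  have "U q s u = U q y (U y s u)" by (rule U_compose[OF s that(2,3)])
  then show ?thesis
   using 0 conv_zero[OF regular_U, of y q] s that by (simp add: p_def)
 next
  case (Suc i)
  then have i: "i < m" "i <= m" using that by auto
  have "V j q s u = R s (h i) q" "V j y s u = R s (h i) y"
   using IH[OF i(1)] Suc that by auto
  then show ?thesis
   using R_split[OF h_bb[OF i(2)] s that(2,3)] Suc by (simp add: p_def)
 qed
 define Dv where "Dv x = V (Suc m) x s u - R s (h m) x" for x
 have inc: "norm (Dv x - U x y (Dv y)) <= 2 * (\<Sum>i\<le>m. err (h i) y x)" if yx: "s <= y" "y <= x" "x <= T" for x y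
 proof -
  have y0: "0 <= y" using s yx by simp
  have sx: "s <= x" using yx by simp
  define d where "d j = V (Suc m - j) x y (V j y s u) - (if j = m then R y (h m) x else 0)" for j
  have "V (Suc m) x s u = (\<Sum>j\<le>m. V (Suc m - j) x y (V j y s u)) + U x y (V (Suc m) y s u)"
   unfolding V_compose[OF s yx(1,2), of "Suc m" u] by simp
  moreover have "R s (h m) x = U x y (R s (h m) y) + R y (h m) x"
   by (rule R_split[OF h_bb[OF order_refl] s yx(1,2)])
  moreover have "U x y (Dv y) = U x y (V (Suc m) y s u) - U x y (R s (h m) y)"
   unfolding Dv_def by (rule linear_diff[OF U_linear[OF y0 yx(2)]])
  moreover have "(\<Sum>j\<le>m. d j) = (\<Sum>j\<le>m. V (Suc m - j) x y (V j y s u)) - R y (h m) x"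
   by (simp add: d_def sum_subtractf)
  ultimately have "Dv x - U x y (Dv y) = (\<Sum>j\<le>m. d j)"
   unfolding Dv_def by simp
  also have "norm \<dots> <= (\<Sum>j\<le>m. err (h j) y x + err (p j) y x)"
  proof (rule sum_norm_le)
   fix j assume "j \<in> {..m}"
   then have j: "j <= m" by simp
   have ae: "AE q in lborel. q \<in> {y..x} --> B q (U q y (V j y s u) + R y (p j) q - R y (\<lambda>q. 0) q) = h j q"
    using h_ae[OF j]
   proof eventually_elim
    case (elim q)
    show ?case
    proof
     assume q: "q \<in> {y..x}"
     then have "V j q s u = U q y (V j y s u) + R y (p j) q"
      by (intro mild[OF j yx(1)]) (use yx in auto)
     then show "B q (U q y (V j y s u) + R y (p j) q - R y (\<lambda>q. 0) q) = h j q"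
      using elim q yx conv_zero[OF regular_U y0, of q] by simp
    qed
   qed
   note st = step[OF y0 yx(2) p_bb[OF j] p0[OF j] bochner_borel_zero order_refl h_bb[OF j] h0[OF j] ae, unfolded err_zero[OF y0]]
   show "norm (d j) <= err (h j) y x + err (p j) y x"
   proof (cases "j = m")
    case True
    then have eq: "d j = V (Suc 0) x y (V j y s u) - R y (h j) x"
     unfolding d_def by (simp add: Suc_diff_le)
    show ?thesis unfolding eq using st(1) err_nonneg[OF h_bb[OF j] h0[OF j] y0, of x] by linarith
   next
    case False
    then have eq: "d j = V (Suc (Suc (m - Suc j))) x y (V j y s u)"
     using j by (simp add: d_def Suc_diff_Suc Suc_diff_le del: dyson.simps)
    show ?thesis unfolding eq using st(2)[of "m - Suc j"] by linarith
   qed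
  qed
  also have "\<dots> = (\<Sum>j\<le>m. err (h j) y x) + (\<Sum>j\<le>m. err (p j) y x)"
   by (rule sum.distrib)
  also have "(\<Sum>j\<le>m. err (p j) y x) = (\<Sum>i<m. err (h i) y x)"
   by (simp add: sum.atMost_shift p_def err_zero[OF y0])
  also have "\<dots> <= (\<Sum>i\<le>m. err (h i) y x)"
   by (rule sum_mono2) (auto intro!: err_nonneg h_bb h0 y0)
  finally show ?thesis by simp
 qed
 have D_s: "Dv s = 0"
  using V_Suc_cone(2)[OF regular_V s order_refl u, of m] U_refl[OF s, of u] by (simp add: Dv_def conv_def del: dyson.simps)
 define G where "G y = U t y (Dv y)" for y
 have G_cont: "continuous_on {s..t} G"
  unfolding G_def Dv_def
 proof (rule regular_apply_continuous[OF regular_U], safe intro!: continuous_on_const continuous_on_id)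
  show "continuous_on {s..t} (\<lambda>y. V (Suc m) y s u - R s (h m) y)"
   by (intro continuous_on_diff regular_cont_comp[OF regular_V] conv_continuous[OF regular_U h_bb[OF order_refl]]
     continuous_on_const continuous_on_id) (use s in auto)
 qed (use s in auto)
 have CB0: "0 <= CB" using dec_bound(1) by simp
 have "G b = G s" if b: "s <= b" "b < t" for b
 proof (rule equal_ends_of_small_increments[OF G_cont b])
  have lim: "((\<lambda>k. ennreal (2 * CB) * (\<Sum>i\<le>m. err_mean (h i) k)) \<longlongrightarrow> ennreal (2 * CB) * (\<Sum>i\<le>m. 0)) (at_right 0)"
  proof (intro ennreal_tendsto_cmult tendsto_sum)
   show "ennreal (2 * CB) < top" by simp
   fix i assume "i \<in> {..m}"
   then have i: "i <= m" by simp
   show "(err_mean (h i) \<longlongrightarrow> 0) (at_right 0)"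
    by (rule err_mean_tendsto_0[OF h_bb[OF i] h0[OF i]]) (rule h_out[OF i], use s in simp)
  qed
  show "((\<lambda>k. (\<integral>\<^sup>+y. ennreal (norm (G (y + k) - G y)) * indicator {s..b} y \<partial>lborel) / ennreal k) \<longlongrightarrow> 0) (at_right 0)"
  proof (rule tendsto_sandwich[OF _ _ tendsto_const])
   show "((\<lambda>k. ennreal (2 * CB) * (\<Sum>i\<le>m. err_mean (h i) k)) \<longlongrightarrow> 0) (at_right 0)" using lim by simp
   have "\<forall>\<^sub>F k in at_right (0::real). k \<in> {0<..<t - b}"
    by (rule eventually_at_right_real) (use b in simp)
   then show "\<forall>\<^sub>F k in at_right 0. (\<integral>\<^sup>+y. ennreal (norm (G (y + k) - G y)) * indicator {s..b} y \<partial>lborel) / ennreal k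
     <= ennreal (2 * CB) * (\<Sum>i\<le>m. err_mean (h i) k)"
   proof eventually_elim
    case (elim k)
    then have k: "0 < k" "k < t - b" by auto
    have pt: "ennreal (norm (G (y + k) - G y)) * indicator {s..b} y
      <= ennreal (2 * CB) * (\<Sum>i\<le>m. ennreal (err (h i) y (y + k)) * indicator {s..b} y)" for y
    proof (cases "y \<in> {s..b}")
     case True
     then have y: "s <= y" "y <= y + k" "y + k <= t" "y + k <= T" using k t by auto
     have y0: "0 <= y" "0 <= y + k" using y s by auto
     have "G y = U t (y + k) (U (y + k) y (Dv y))"
      unfolding G_def by (rule U_compose[OF y0(1) y(2,3)])
     then have "G (y + k) - G y = U t (y + k) (Dv (y + k) - U (y + k) y (Dv y))"
      using linear_diff[OF U_linear[OF y0(2) y(3)]] by (simp only: G_def)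
     then have "norm (G (y + k) - G y) <= CB * norm (Dv (y + k) - U (y + k) y (Dv y))"
      using U_bound[OF y0(2) y(3)] by (simp only:)
     also have "\<dots> <= CB * (2 * (\<Sum>i\<le>m. err (h i) y (y + k)))"
      by (intro mult_left_mono inc y CB0)
     finally have "ennreal (norm (G (y + k) - G y)) <= ennreal (2 * CB * (\<Sum>i\<le>m. err (h i) y (y + k)))"
      by (intro ennreal_leI) (simp only: mult.assoc mult.left_commute)
     also have "\<dots> = ennreal (2 * CB) * (\<Sum>i\<le>m. ennreal (err (h i) y (y + k)))"
      using CB0 by (subst sum_ennreal) (auto intro!: ennreal_mult err_nonneg h_bb h0 y0 sum_nonneg)
     finally show ?thesis using True by simp
    qed simp
    have "(\<integral>\<^sup>+y. ennreal (norm (G (y + k) - G y)) * indicator {s..b} y \<partial>lborel)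
      <= (\<integral>\<^sup>+y. ennreal (2 * CB) * (\<Sum>i\<le>m. ennreal (err (h i) y (y + k)) * indicator {s..b} y) \<partial>lborel)"
     by (rule nn_integral_mono) (rule pt)
    also have "\<dots> = ennreal (2 * CB) * (\<Sum>i\<le>m. \<integral>\<^sup>+y. ennreal (err (h i) y (y + k)) * indicator {s..b} y \<partial>lborel)"
    proof -
     have m: "(\<lambda>y. ennreal (err (h i) y (y + k)) * indicator {s..b} y) \<in> borel_measurable lborel" if "i \<in> {..m}" for i
     proof -
      have i: "i <= m" using that by simp
      show ?thesis using nn_err_measurable[OF h_bb[OF i] h0[OF i] s, of k b] by simp
     qed
     show ?thesis
      by (simp only: nn_integral_cmult[OF borel_measurable_sum[OF m]] nn_integral_sum[OF m])
    qed
    also have "\<dots> <= ennreal (2 * CB) * (\<Sum>i\<le>m. \<integral>\<^sup>+x. ennreal (err (h i) (max 0 (x - k)) x) * indicator {0..} x \<partial>lborel)"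
     by (intro mult_left_mono sum_mono nn_err_le h_bb h0 s) (use k in auto)
    finally have "(\<integral>\<^sup>+y. ennreal (norm (G (y + k) - G y)) * indicator {s..b} y \<partial>lborel) / ennreal k
      <= ennreal (2 * CB) * (\<Sum>i\<le>m. \<integral>\<^sup>+x. ennreal (err (h i) (max 0 (x - k)) x) * indicator {0..} x \<partial>lborel) / ennreal k"
     by (rule divide_right_mono_ennreal)
    also have "\<dots> = ennreal (2 * CB) * (\<Sum>i\<le>m. err_mean (h i) k)"
     by (simp only: divide_ennreal_def sum_distrib_right mult.assoc)
    finally show ?case .
   qed
  qed simp
 qed
 moreover have "G s = 0" unfolding G_def D_s by (rule linear_0[OF U_linear]) (use s t in auto)
 ultimately have G0: "G b = 0" if "s <= b" "b < t" for b using that by simp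
 have "Dv t = 0"
 proof (cases "s = t")
  case True
  then show ?thesis using D_s by simp
 next
  case False
  then have st: "s < t" using t by auto
  have "closed {y \<in> {s..t}. G y = 0}"
   by (rule continuous_closed_preimage_constant[OF G_cont]) simp
  moreover have "(\<lambda>n. t - (t - s) / real (Suc n)) \<longlonglongrightarrow> t"
   using tendsto_diff[OF tendsto_const LIMSEQ_Suc[OF lim_const_over_n[of "t - s"]], of t] by simp
  moreover have "t - (t - s) / real (Suc n) \<in> {y \<in> {s..t}. G y = 0}" for n
  proof -
   have "0 < (t - s) / real (Suc n)" using st by simp
   moreover have "(t - s) / real (Suc n) <= t - s"
    using st by (simp add: pos_divide_le_eq)
   ultimately show ?thesis using G0[of "t - (t - s) / real (Suc n)"] by auto
  qed
  ultimately have "t \<in> {y \<in> {s..t}. G y = 0}"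
   using closed_sequentially[of "{y \<in> {s..t}. G y = 0}" "\<lambda>n. t - (t - s) / real (Suc n)" t] by simp
  then have "U t t (Dv t) = 0" by (simp add: G_def)
  then show ?thesis using U_refl[of t "Dv t"] s t by simp
 qed
 then show ?thesis by (simp add: Dv_def del: dyson.simps)
qed

lemma V_Suc_eq_R_ex:
 assumes s: "0 <= s" "s <= T" and u: "0 <= u"
 shows "(\<exists>h. B_version s T u m h) \<and> (\<forall>h t. B_version s T u m h --> t \<in> {s..T} --> V (Suc m) t s u = R s h t)"
proof (induction m rule: less_induct)
 case (less m)
 have ex: "\<exists>h. B_version s T u m h"
 proof (cases m)
  case 0
  obtain h where "B_version s T u 0 h" by (rule B_version_0[OF s u])
  then show ?thesis using 0 by blast
 next
  case (Suc j)
  then obtain h where h: "B_version s T u j h" "\<And>t. t \<in> {s..T} ==> V (Suc j) t s u = R s h t"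
   using less[of j] by blast
  obtain w where "B_version s T u (Suc j) w" by (rule B_version_Suc[OF s h])
  then show ?thesis using Suc by blast
 qed
 show ?case
 proof (intro conjI allI impI)
  fix h' t assume h': "B_version s T u m h'" and t: "t \<in> {s..T}"
  define h where "h j = (if j = m then h' else SOME h. B_version s T u j h)" for j
  have h: "B_version s T u j (h j)" if "j <= m" for j
  proof (cases "j = m")
   case False
   then have "\<exists>h. B_version s T u j h" using less[of j] that by auto
   then show ?thesis using False someI_ex[of "B_version s T u j"] by (simp add: h_def)
  qed (simp add: h_def h')
  have "V (Suc m) t s u = R s (h m) t"
  proof (rule V_Suc_eq_R_aux[OF s(1) u h _ t])
   fix j t assume "j < m" "t \<in> {s..T}"
   then show "V (Suc j) t s u = R s (h j) t" using less[of j] h[of j] by auto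
  qed
  then show "V (Suc m) t s u = R s h' t" by (simp add: h_def)
 qed (rule ex)
qed

lemma V_Suc_eq_R:
 assumes "0 <= s" "s <= T" "0 <= u" "B_version s T u m h" "s <= t" "t <= T"
 shows "V (Suc m) t s u = R s h t"
 using V_Suc_eq_R_ex[OF assms(1-3), of m] assms(4-6) by auto

lemma B_version_ex:
 assumes "0 <= s" "s <= T" "0 <= u"
 obtains h where "B_version s T u m h"
 using V_Suc_eq_R_ex[OF assms, of m] by blast

end

section \<open>Representatives of integrable functions\<close>

text \<open>Representatives that vanish on the negative half-line, so that translates need no truncation.\<close>

definition L1_rep :: "(real => 'b::real_normed_vector) => bool" where
 "L1_rep F \<longleftrightarrow> bochner_borel F \<and> (\<forall>x<0. F x = 0)"

lemma L1_repD:
 assumes "L1_rep F"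
 shows "bochner_borel F" "x < 0 ==> F x = 0"
 using assms by (auto simp: L1_rep_def)

lemma L1_rep_eq:
 assumes "L1_rep F"
 shows "L1_eq F F"
 unfolding L1_eq_def using bochner_borel_imp_bochner_integrable[OF L1_repD(1)[OF assms], of "{0..}" F] by simp

lemma abs_L1_cong:
 assumes F: "L1_rep F" and G: "AE x in lborel. 0 <= x --> G x = F x"
 shows "abs_L1 G = abs_L1 F"
proof (rule Quotient3_rel_abs[OF Quotient3_L1])
 have "bochner_integrable halfline G"
  by (rule bochner_borel_imp_bochner_integrable[OF L1_repD(1)[OF F]]) (use G in simp_all)
 moreover have "AE x in halfline. G x = F x" using G by (simp add: AE_lebesgue_on_iff)
 ultimately show "L1_eq G F" using L1_rep_eq[OF F] by (simp add: L1_eq_def)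
qed

lemma rep_abs_L1_AE:
 assumes F: "L1_rep F"
 shows "AE x in lborel. 0 <= x --> rep_L1 (abs_L1 F) x = F x"
proof -
 have "L1_eq (rep_L1 (abs_L1 F)) F"
  by (rule Quotient3_rep_abs[where R=L1_eq and Abs=abs_L1 and Rep=rep_L1 and r=F, OF Quotient3_L1 L1_rep_eq[OF F]])
 then have "AE x in halfline. rep_L1 (abs_L1 F) x = F x" by (simp only: L1_eq_def)
 then show ?thesis by (simp add: AE_lebesgue_on_iff)
qed

lemma L1_rep_ex:
 fixes f :: "'b::real_normed_vector L1"
 obtains F where "L1_rep F" "f = abs_L1 F"
proof -
 have "L1_eq (rep_L1 f) (rep_L1 f)" by (rule Quotient3_rep_reflp[OF Quotient3_L1])
 then have bi: "bochner_integrable halfline (rep_L1 f)" by (simp add: L1_eq_def)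
 obtain F where F: "bochner_borel F" "\<And>x. x \<notin> {0..} ==> F x = 0" "AE x in lborel. x \<in> {0..} --> rep_L1 f x = F x"
   "(\<integral>\<^sup>+x. ennreal (norm (F x)) \<partial>lborel) = (\<integral>\<^sup>+x. ennreal (norm (rep_L1 f x)) \<partial>halfline)"
  by (rule bochner_integrable_borel_version[OF bi]) (simp, rule that)
 have r: "L1_rep F" using F(1,2) by (simp add: L1_rep_def)
 have "abs_L1 (rep_L1 f) = abs_L1 F"
  by (rule abs_L1_cong[OF r]) (use F(3) in simp)
 then show thesis using that r Quotient3_abs_rep[OF Quotient3_L1, of f] by simp
qed

lemma abs_L1_eq_iff:
 assumes F: "L1_rep F" and G: "L1_rep G"
 shows "abs_L1 F = abs_L1 G \<longleftrightarrow> (AE x in lborel. F x = G x)"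
proof
 assume "abs_L1 F = abs_L1 G"
 then have "AE x in lborel. 0 <= x --> rep_L1 (abs_L1 F) x = G x" using rep_abs_L1_AE[OF G] by simp
 then show "AE x in lborel. F x = G x" using rep_abs_L1_AE[OF F]
 proof eventually_elim
  case (elim x)
  then show ?case using L1_repD(2)[OF F, of x] L1_repD(2)[OF G, of x] by (cases "x < 0") auto
 qed
next
 assume "AE x in lborel. F x = G x"
 then show "abs_L1 F = abs_L1 G"
  by (intro abs_L1_cong[OF G]) (auto elim: eventually_mono)
qed

lemma nn_integral_halfline:
 assumes F: "L1_rep F"
 shows "(\<integral>\<^sup>+x. ennreal (norm (F x)) \<partial>halfline) = (\<integral>\<^sup>+x. ennreal (norm (F x)) \<partial>lborel)"
proof -
 have "(\<integral>\<^sup>+x. ennreal (norm (F x)) * indicator {0..} x \<partial>lborel) = (\<integral>\<^sup>+x. ennreal (norm (F x)) \<partial>lborel)"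
  by (intro nn_integral_cong) (use L1_repD(2)[OF F] in \<open>auto simp: indicator_def not_le\<close>)
 then show ?thesis by (simp add: nn_integral_lebesgue_on)
qed

lemma norm_abs_L1:
 assumes F: "L1_rep F"
 shows "ennreal (norm (abs_L1 F)) = (\<integral>\<^sup>+x. ennreal (norm (F x)) \<partial>lborel)"
proof -
 have bi: "bochner_integrable halfline F" using L1_rep_eq[OF F] by (simp add: L1_eq_def)
 have "norm (abs_L1 F) = (\<integral>x. norm (F x) \<partial>halfline)"
  by (rule norm_L1.abs_eq[OF L1_rep_eq[OF F]])
 then have "ennreal (norm (abs_L1 F)) = (\<integral>\<^sup>+x. ennreal (norm (F x)) \<partial>halfline)"
  using nn_integral_eq_integral[OF bochner_integrable_halfline_norm[OF bi]] by simp
 then show ?thesis by (simp add: nn_integral_halfline[OF F])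
qed

lemma L1_rep_add: "L1_rep F ==> L1_rep G ==> L1_rep (\<lambda>x. F x + G x)"
 by (simp add: L1_rep_def bochner_borel_add)

lemma L1_rep_diff: "L1_rep F ==> L1_rep G ==> L1_rep (\<lambda>x. F x - G x)"
 by (simp add: L1_rep_def bochner_borel_diff)

lemma L1_rep_scaleR: "L1_rep F ==> L1_rep (\<lambda>x. c *\<^sub>R F x)"
 by (simp add: L1_rep_def bochner_borel_linear[OF _ bounded_linear_scaleR_right])

lemma L1_rep_zero: "L1_rep (\<lambda>x. 0)"
 by (simp add: L1_rep_def bochner_borel_zero)

lemma L1_rep_sum: "finite I ==> (\<And>i. i \<in> I ==> L1_rep (F i)) ==> L1_rep (\<lambda>x. \<Sum>i\<in>I. F i x)"
 by (simp add: L1_rep_def bochner_borel_sum)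

lemma abs_L1_add: "L1_rep F ==> L1_rep G ==> abs_L1 F + abs_L1 G = abs_L1 (\<lambda>x. F x + G x)"
 by (rule plus_L1.abs_eq) (rule L1_rep_eq, assumption)+

lemma abs_L1_scaleR: "L1_rep F ==> c *\<^sub>R abs_L1 F = abs_L1 (\<lambda>x. c *\<^sub>R F x)"
 by (rule scaleR_L1.abs_eq) (rule L1_rep_eq)

lemma abs_L1_zero: "abs_L1 (\<lambda>x. 0) = 0"
 by (simp only: zero_L1_def)

lemma abs_L1_diff:
 assumes "L1_rep F" "L1_rep G"
 shows "abs_L1 F - abs_L1 G = abs_L1 (\<lambda>x. F x - G x)"
proof -
 have "abs_L1 F - abs_L1 G = abs_L1 F + (-1) *\<^sub>R abs_L1 G" by simp
 also have "\<dots> = abs_L1 (\<lambda>x. F x + (-1) *\<^sub>R G x)"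
  by (simp only: abs_L1_scaleR[OF assms(2)] abs_L1_add[OF assms(1) L1_rep_scaleR[OF assms(2)]])
 finally show ?thesis by simp
qed

lemma abs_L1_sum:
 assumes "finite I" "\<And>i. i \<in> I ==> L1_rep (F i)"
 shows "(\<Sum>i\<in>I. abs_L1 (F i)) = abs_L1 (\<lambda>x. \<Sum>i\<in>I. F i x)"
 using assms
proof (induction I rule: finite_induct)
 case empty
 then show ?case by (simp add: abs_L1_zero)
next
 case (insert i I)
 then show ?case by (simp add: abs_L1_add L1_rep_sum)
qed

lemma norm_abs_L1_le:
 assumes "L1_rep F" "(\<integral>\<^sup>+x. ennreal (norm (F x)) \<partial>lborel) <= ennreal c" "0 <= c"
 shows "norm (abs_L1 F) <= c"
 using assms norm_abs_L1[OF assms(1)] by (metis ennreal_le_iff)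

section \<open>Completeness\<close>

text \<open>Riesz--Fischer: the representatives of a rapidly converging sequence converge almost everywhere.\<close>

lemma L1_rapid_convergent:
 fixes F :: "nat => real => 'b::banach"
 assumes F: "\<And>n. L1_rep (F n)" and fast: "\<And>n. norm (abs_L1 (F (Suc n)) - abs_L1 (F n)) <= (1 / 2) ^ n"
 shows "convergent (\<lambda>n. abs_L1 (F n))"
proof -
 define G where "G n x = F (Suc n) x - F n x" for n x
 have G: "L1_rep (G n)" for n unfolding G_def by (rule L1_rep_diff[OF F F])
 have Gm[measurable]: "(\<lambda>x. norm (G n x)) \<in> borel_measurable borel" for n
  by (rule bochner_borelD(3)[OF L1_repD(1)[OF G]])
 have G_int: "(\<integral>\<^sup>+x. ennreal (norm (G n x)) \<partial>lborel) <= ennreal ((1 / 2) ^ n)" for n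
  using fast[of n] unfolding norm_abs_L1[OF G, symmetric] abs_L1_diff[OF F F] G_def[symmetric] by (rule ennreal_leI)
 have tail: "(\<Sum>n. ennreal ((1 / 2) ^ (n + m))) = ennreal (2 * (1 / 2) ^ m)" for m :: nat
 proof -
  have "(\<lambda>n. (1 / 2) ^ m * (1 / 2) ^ n) sums ((1 / 2) ^ m * (1 / (1 - 1 / 2 :: real)))"
   by (intro sums_mult geometric_sums) simp
  then have "(\<lambda>n. (1 / 2) ^ (n + m)) sums (2 * (1 / 2) ^ m :: real)"
   by (simp add: power_add mult.commute)
  then show ?thesis
   by (intro suminf_ennreal_eq) auto
 qed
 have sum_int: "(\<integral>\<^sup>+x. (\<Sum>n. ennreal (norm (G (n + m) x))) \<partial>lborel) <= ennreal (2 * (1 / 2) ^ m)" for m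
 proof -
  have "(\<integral>\<^sup>+x. (\<Sum>n. ennreal (norm (G (n + m) x))) \<partial>lborel) = (\<Sum>n. \<integral>\<^sup>+x. ennreal (norm (G (n + m) x)) \<partial>lborel)"
   by (rule nn_integral_suminf) measurable
  also have "\<dots> <= (\<Sum>n. ennreal ((1 / 2) ^ (n + m)))"
   by (intro suminf_le G_int summableI)
  finally show ?thesis by (simp only: tail)
 qed
 have "AE x in lborel. (\<Sum>n. ennreal (norm (G n x))) ~= \<infinity>"
 proof (rule nn_integral_PInf_AE)
  show "(\<lambda>x. \<Sum>n. ennreal (norm (G n x))) \<in> borel_measurable lborel" by measurable
  show "(\<integral>\<^sup>+x. (\<Sum>n. ennreal (norm (G n x))) \<partial>lborel) ~= \<infinity>"
   using sum_int[of 0] by (auto simp: top_unique)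
 qed
 define A where "A = {x. (\<Sum>n. ennreal (norm (G n x))) ~= \<infinity>}"
 have A_AE: "AE x in lborel. x \<in> A" using \<open>AE x in lborel. (\<Sum>n. ennreal (norm (G n x))) ~= \<infinity>\<close> by (simp add: A_def)
 have A: "A \<in> sets borel" unfolding A_def by measurable
 have sumG: "summable (\<lambda>n. norm (G n x))" if "x \<in> A" for x
  using that unfolding A_def by (intro summable_suminf_not_top) auto
 have F_sum: "F n x = F 0 x + (\<Sum>k<n. G k x)" for n x
  by (induction n) (auto simp: G_def)
 define L where "L x = (if x \<in> A then F 0 x + (\<Sum>n. G n x) else 0)" for x
 have lim: "(\<lambda>n. F n x) \<longlonglongrightarrow> L x" if "x \<in> A" for x
 proof -
  have "(\<lambda>n. F 0 x + (\<Sum>k<n. G k x)) \<longlonglongrightarrow> L x"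
   using that summable_LIMSEQ[OF summable_norm_cancel[OF sumG[OF that]]]
   by (simp add: L_def tendsto_add)
  then show ?thesis by (simp only: F_sum[symmetric])
 qed
 have sb: "strongly_borel borel L"
 proof (rule strongly_borel_limit[where f="\<lambda>n x. if x \<in> A then F n x else 0"])
  show "strongly_borel borel (\<lambda>x. if x \<in> A then F n x else 0)" for n
   by (rule strongly_borel_zero_outside[OF bochner_borelD(1)[OF L1_repD(1)[OF F]] A])
  show "(\<lambda>n. if x \<in> A then F n x else 0) \<longlonglongrightarrow> L x" for x
   using lim[of x] by (cases "x \<in> A") (auto simp: L_def)
 qed
 have dist_le: "ennreal (norm (L x - F m x)) <= (\<Sum>n. ennreal (norm (G (n + m) x)))" if x: "x \<in> A" for x m
 proof -
  have s: "summable (\<lambda>n. norm (G (n + m) x))"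
   using sumG[OF x] by (rule summable_ignore_initial_segment)
  have "L x - F m x = (\<Sum>n. G (n + m) x)"
   using x suminf_split_initial_segment[OF summable_norm_cancel[OF sumG[OF x]], of m] F_sum[of m x]
   by (simp add: L_def)
  then have "norm (L x - F m x) <= (\<Sum>n. norm (G (n + m) x))"
   using summable_norm[OF s] by simp
  then show ?thesis
   using suminf_ennreal2[OF norm_ge_zero s] by (simp add: ennreal_leI)
 qed
 have nn_dist: "(\<integral>\<^sup>+x. ennreal (norm (L x - F m x)) \<partial>lborel) <= ennreal (2 * (1 / 2) ^ m)" for m
 proof -
  have "(\<integral>\<^sup>+x. ennreal (norm (L x - F m x)) \<partial>lborel) <= (\<integral>\<^sup>+x. (\<Sum>n. ennreal (norm (G (n + m) x))) \<partial>lborel)"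
   by (rule nn_integral_mono_AE, use A_AE in eventually_elim) (rule dist_le)
  then show ?thesis using sum_int[of m] by (rule order_trans)
 qed
 have bb0: "bochner_borel (\<lambda>x. L x - F 0 x)"
  unfolding bochner_borel_def
  using strongly_borel_diff[OF sb bochner_borelD(1)[OF L1_repD(1)[OF F]]] le_less_trans[OF nn_dist[of 0], of \<infinity>] by simp
 have "bochner_borel L"
  using bochner_borel_add[OF bb0 L1_repD(1)[OF F[of 0]]] by simp
 moreover have "L x = 0" if "x < 0" for x
  using L1_repD(2)[OF F that] by (simp add: L_def G_def)
 ultimately have L: "L1_rep L" by (simp add: L1_rep_def)
 have "(\<lambda>m. abs_L1 (F m)) \<longlonglongrightarrow> abs_L1 L"
 proof (rule LIM_zero_cancel, rule Lim_null_comparison)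
  have "norm (abs_L1 (F m) - abs_L1 L) <= 2 * (1 / 2) ^ m" for m
   unfolding norm_minus_commute[of "abs_L1 (F m)"] abs_L1_diff[OF L F]
   by (rule norm_abs_L1_le[OF L1_rep_diff[OF L F] nn_dist]) simp
  then show "\<forall>\<^sub>F m in sequentially. norm (abs_L1 (F m) - abs_L1 L) <= 2 * (1 / 2) ^ m" by simp
  have "(\<lambda>m. 2 * (1 / 2) ^ m) \<longlonglongrightarrow> 2 * (0::real)"
   by (intro tendsto_mult tendsto_const LIMSEQ_power_zero) simp
  then show "(\<lambda>m. 2 * (1 / 2) ^ m) \<longlonglongrightarrow> (0::real)" by simp
 qed
 then show ?thesis by (rule convergentI)
qed

instance L1 :: (banach) banach
proof
 fix X :: "nat => 'a L1" assume X: "Cauchy X"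
 have "\<exists>r. \<forall>n. (\<forall>i\<ge>r n. \<forall>j\<ge>r n. norm (X i - X j) < (1 / 2) ^ n) \<and> r n < r (Suc n)"
 proof (rule dependent_nat_choice)
  show "\<exists>N. \<forall>i\<ge>N. \<forall>j\<ge>N. norm (X i - X j) < (1 / 2) ^ 0"
   using CauchyD[OF X, of "(1/2)^0"] by auto
  fix N n
  obtain M where "\<And>i j. i \<ge> M ==> j \<ge> M ==> norm (X i - X j) < (1 / 2) ^ Suc n"
   using CauchyD[OF X, of "(1/2)^Suc n"] by auto
  then show "\<exists>N'. (\<forall>i\<ge>N'. \<forall>j\<ge>N'. norm (X i - X j) < (1 / 2) ^ Suc n) \<and> N < N'"
   by (intro exI[of _ "max M (Suc N)"]) auto
 qed
 then obtain r where r: "\<And>n i j. i \<ge> r n ==> j \<ge> r n ==> norm (X i - X j) < (1 / 2) ^ n" "\<And>n. r n < r (Suc n)"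
  by blast
 have sm: "strict_mono r" by (rule strict_monoI_Suc) (rule r(2))
 have "\<exists>F. L1_rep F \<and> X (r n) = abs_L1 F" for n
  by (rule L1_rep_ex[of "X (r n)"]) blast
 then obtain F where F: "\<And>n. L1_rep (F n)" "\<And>n. X (r n) = abs_L1 (F n)" by metis
 have "convergent (\<lambda>n. abs_L1 (F n))"
 proof (rule L1_rapid_convergent[OF F(1)])
  show "norm (abs_L1 (F (Suc n)) - abs_L1 (F n)) <= (1 / 2) ^ n" for n
   unfolding F(2)[symmetric] using r(1)[of n "r (Suc n)" "r n"] r(2)[of n] by simp
 qed
 then obtain l where "(X \<circ> r) \<longlonglongrightarrow> l"
  unfolding convergent_def o_def F(2) by blast
 then have "X \<longlonglongrightarrow> l" by (rule Cauchy_converges_subseq[OF X sm])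
 then show "convergent X" by (rule convergentI)
qed

section \<open>The pointwise order\<close>

instantiation L1 :: ("{banach, ordered_real_vector}") ordered_real_vector
begin

definition less_eq_L1 :: "'a L1 => 'a L1 => bool" where
 "less_eq_L1 f g \<longleftrightarrow> (AE s in halfline. rep_L1 f s <= rep_L1 g s)"

definition less_L1 :: "'a L1 => 'a L1 => bool" where
 "less_L1 f g \<longleftrightarrow> f <= g \<and> \<not> g <= f"

lemma abs_L1_le_iff:
 fixes F G :: "real => 'a"
 assumes F: "L1_rep F" and G: "L1_rep G"
 shows "abs_L1 F <= abs_L1 G \<longleftrightarrow> (AE x in lborel. F x <= G x)"
proof -
 have "abs_L1 F <= abs_L1 G \<longleftrightarrow> (AE x in lborel. 0 <= x --> rep_L1 (abs_L1 F) x <= rep_L1 (abs_L1 G) x)"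
  by (simp add: less_eq_L1_def AE_lebesgue_on_iff)
 also have "\<dots> \<longleftrightarrow> (AE x in lborel. F x <= G x)"
 proof
  assume "AE x in lborel. 0 <= x --> rep_L1 (abs_L1 F) x <= rep_L1 (abs_L1 G) x"
  then show "AE x in lborel. F x <= G x" using rep_abs_L1_AE[OF F] rep_abs_L1_AE[OF G]
  proof eventually_elim
   case (elim x)
   then show ?case using L1_repD(2)[OF F, of x] L1_repD(2)[OF G, of x] by (cases "x < 0") auto
  qed
 next
  assume "AE x in lborel. F x <= G x"
  then show "AE x in lborel. 0 <= x --> rep_L1 (abs_L1 F) x <= rep_L1 (abs_L1 G) x"
   using rep_abs_L1_AE[OF F] rep_abs_L1_AE[OF G] by eventually_elim simp
 qed
 finally show ?thesis .
qed

instance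
proof
 fix f g h :: "'a L1" and a b :: real
 obtain F where F: "L1_rep F" "f = abs_L1 F" by (rule L1_rep_ex)
 obtain G where G: "L1_rep G" "g = abs_L1 G" by (rule L1_rep_ex)
 obtain H where H: "L1_rep H" "h = abs_L1 H" by (rule L1_rep_ex)
 show "(f < g) = (f <= g \<and> \<not> g <= f)" by (rule less_L1_def)
 show "f <= f" unfolding F(2) abs_L1_le_iff[OF F(1) F(1)] by simp
 show "f <= h" if "f <= g" "g <= h"
  using that unfolding F(2) G(2) H(2) abs_L1_le_iff[OF F(1) G(1)] abs_L1_le_iff[OF G(1) H(1)] abs_L1_le_iff[OF F(1) H(1)]
  by eventually_elim simp
 show "f = g" if "f <= g" "g <= f"
  using that unfolding F(2) G(2) abs_L1_le_iff[OF F(1) G(1)] abs_L1_le_iff[OF G(1) F(1)] abs_L1_eq_iff[OF F(1) G(1)]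
  by eventually_elim simp
 show "h + f <= h + g" if "f <= g"
  using that unfolding F(2) G(2) H(2) abs_L1_add[OF H(1) F(1)] abs_L1_add[OF H(1) G(1)] abs_L1_le_iff[OF F(1) G(1)]
   abs_L1_le_iff[OF L1_rep_add[OF H(1) F(1)] L1_rep_add[OF H(1) G(1)]]
  by eventually_elim simp
 show "a *\<^sub>R f <= a *\<^sub>R g" if "f <= g" "0 <= a"
  using that(1) unfolding F(2) G(2) abs_L1_scaleR[OF F(1)] abs_L1_scaleR[OF G(1)] abs_L1_le_iff[OF F(1) G(1)]
   abs_L1_le_iff[OF L1_rep_scaleR[OF F(1)] L1_rep_scaleR[OF G(1)]]
  by eventually_elim (rule scaleR_left_mono[OF _ that(2)])
 show "a *\<^sub>R f <= b *\<^sub>R f" if "a <= b" "0 <= f"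
  using that(2) unfolding F(2) abs_L1_zero[symmetric] abs_L1_scaleR[OF F(1)] abs_L1_le_iff[OF L1_rep_zero F(1)]
   abs_L1_le_iff[OF L1_rep_scaleR[OF F(1)] L1_rep_scaleR[OF F(1)]]
  by eventually_elim (rule scaleR_right_mono[OF that(1)])
qed

end

lemma L1_cone_eq: "L1_cone = {f::'b::{banach, ordered_real_vector} L1. 0 <= f}"
proof (rule set_eqI, unfold mem_Collect_eq)
 fix f :: "'b L1"
 obtain F where F: "L1_rep F" "f = abs_L1 F" by (rule L1_rep_ex)
 have "f \<in> L1_cone \<longleftrightarrow> (AE x in lborel. 0 <= x --> 0 <= rep_L1 f x)"
  by (simp add: L1_cone_def AE_lebesgue_on_iff)
 also have "\<dots> \<longleftrightarrow> (AE x in lborel. 0 <= F x)"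
 proof
  assume "AE x in lborel. 0 <= x --> 0 <= rep_L1 f x"
  then show "AE x in lborel. 0 <= F x" using rep_abs_L1_AE[OF F(1)]
  proof eventually_elim
   case (elim x)
   then show ?case using L1_repD(2)[OF F(1), of x] F(2) by (cases "x < 0") auto
  qed
 next
  assume "AE x in lborel. 0 <= F x"
  then show "AE x in lborel. 0 <= x --> 0 <= rep_L1 f x" using rep_abs_L1_AE[OF F(1)]
   unfolding F(2) by eventually_elim simp
 qed
 also have "\<dots> \<longleftrightarrow> 0 <= f"
  unfolding F(2) abs_L1_zero[symmetric] abs_L1_le_iff[OF L1_rep_zero F(1)] ..
 finally show "f \<in> L1_cone \<longleftrightarrow> 0 <= f" .
qed

context additive_norm_cone
begin

lemma L1_rep_cone:
 fixes f :: "'a L1"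
 assumes "0 <= f"
 obtains F where "L1_rep F" "f = abs_L1 F" "\<And>x. 0 <= F x"
proof -
 obtain F where F: "L1_rep F" "f = abs_L1 F" by (rule L1_rep_ex)
 have ae: "AE x in lborel. 0 <= F x"
  using assms unfolding F(2) abs_L1_zero[symmetric] abs_L1_le_iff[OF L1_rep_zero F(1)] .
 have "F -` {u. 0 <= u} \<inter> space borel \<in> sets borel"
  by (rule measurable_sets[OF strongly_borel_measurable[OF bochner_borelD(1)[OF L1_repD(1)[OF F(1)]]] cone_borel])
 then have A: "{x. 0 <= F x} \<in> sets borel" by (simp add: vimage_def)
 define F' where "F' x = (if x \<in> {x. 0 <= F x} then F x else 0)" for x
 have F': "L1_rep F'"
  unfolding L1_rep_def F'_def using bochner_borel_restrict[OF L1_repD(1)[OF F(1)] A] L1_repD(2)[OF F(1)] by simp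
 have "AE x in lborel. F x = F' x" using ae by eventually_elim (simp add: F'_def)
 then have "f = abs_L1 F'" unfolding F(2) abs_L1_eq_iff[OF F(1) F'] .
 then show thesis by (rule that[OF F']) (simp add: F'_def)
qed

lemma abs_L1_nonneg: "L1_rep F ==> (\<And>x. 0 <= F x) ==> 0 <= abs_L1 F"
 unfolding abs_L1_zero[symmetric] by (subst abs_L1_le_iff[OF L1_rep_zero]) auto

text \<open>The distance to the cone is Lipschitz continuous, so its integral passes to limits in the mean.\<close>

lemma L1_cone_closed: "closed {f::'a L1. 0 <= f}"
 unfolding closed_sequential_limits
proof (intro allI impI, elim conjE)
 fix X :: "nat => 'a L1" and f assume X: "\<forall>n. X n \<in> {f. 0 <= f}" and lim: "X \<longlonglongrightarrow> f"
 obtain F where F: "L1_rep F" "f = abs_L1 F" by (rule L1_rep_ex)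
 let ?C = "{u::'a. 0 <= u}"
 have ne: "?C ~= {}" by auto
 define dC where "dC x = infdist (F x) ?C" for x
 have m: "(\<lambda>x. ennreal (dC x)) \<in> borel_measurable lborel"
  unfolding dC_def measurable_lborel2
  by (rule measurable_compose[OF measurable_compose[OF strongly_borel_measurable[OF bochner_borelD(1)[OF L1_repD(1)[OF F(1)]]]
     borel_measurable_continuous_onI] measurable_ennreal]) (intro continuous_intros)
 have le: "(\<integral>\<^sup>+x. ennreal (dC x) \<partial>lborel) <= ennreal (norm (f - X n))" for n
 proof -
  have "0 <= X n" using X by simp
  then obtain G where G: "L1_rep G" "X n = abs_L1 G" "\<And>x. 0 <= G x" by (rule L1_rep_cone) (rule that)
  have "(\<integral>\<^sup>+x. ennreal (dC x) \<partial>lborel) <= (\<integral>\<^sup>+x. ennreal (norm (F x - G x)) \<partial>lborel)"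
  proof (intro nn_integral_mono ennreal_leI)
   fix x show "dC x <= norm (F x - G x)"
    using infdist_le[of "G x" ?C "F x"] G(3)[of x] by (simp add: dC_def dist_norm)
  qed
  then show ?thesis unfolding F(2) G(2) abs_L1_diff[OF F(1) G(1)] norm_abs_L1[OF L1_rep_diff[OF F(1) G(1)]] .
 qed
 have "(\<lambda>n. ennreal (norm (f - X n))) \<longlonglongrightarrow> ennreal (norm (f - f))"
  by (intro tendsto_ennrealI tendsto_norm tendsto_diff tendsto_const lim)
 then have "(\<integral>\<^sup>+x. ennreal (dC x) \<partial>lborel) <= ennreal (norm (f - f))"
  by (rule LIMSEQ_le_const) (use le in blast)
 then have "AE x in lborel. ennreal (dC x) = 0"
  by (simp add: nn_integral_0_iff_AE[OF m])
 then have "AE x in lborel. 0 <= F x"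
 proof eventually_elim
  case (elim x)
  have "0 <= dC x" unfolding dC_def by (rule infdist_nonneg)
  then have "infdist (F x) ?C = 0" using elim by (simp add: dC_def)
  then show ?case using in_closed_iff_infdist_zero[OF cone_closed ne, of "F x"] by simp
 qed
 then show "f \<in> {f. 0 <= f}"
  unfolding F(2) abs_L1_zero[symmetric] mem_Collect_eq abs_L1_le_iff[OF L1_rep_zero F(1)] .
qed

lemma L1_simple_approx:
 assumes F: "L1_rep (F::real => 'b::banach)" and e: "0 < e"
 obtains \<phi> N where "simple_function borel \<phi>" "L1_rep \<phi>" "norm (abs_L1 F - abs_L1 \<phi>) < e"
   "\<And>x. norm (\<phi> x) <= 2 * norm (F x)" "\<And>x. x \<notin> {0..real N} ==> \<phi> x = 0"
proof -
 have sb: "strongly_borel borel F" by (rule bochner_borelD(1)[OF L1_repD(1)[OF F]])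
 obtain \<phi> where \<phi>: "\<And>i::nat. simple_function borel (\<phi> i)" "\<And>x. x \<in> space borel ==> (\<lambda>i. \<phi> i x) \<longlonglongrightarrow> F x"
  "\<And>i x. norm (\<phi> i x) <= 2 * norm (F x)"
  by (rule strongly_borel_approx[OF sb]) (rule that)
 define \<psi> where "\<psi> i x = (if x \<in> {0..real i} then \<phi> i x else 0)" for i x
 have simple: "simple_function borel (\<psi> i)" for i
  unfolding \<psi>_def by (rule simple_function_If_set[OF \<phi>(1)]) auto
 have le: "norm (\<psi> i x) <= 2 * norm (F x)" for i x
  using \<phi>(3)[of i x] by (simp add: \<psi>_def)
 have rep: "L1_rep (\<psi> i)" for i
  unfolding L1_rep_def
 proof
  show "bochner_borel (\<psi> i)" by (rule bochner_borel_dominated[OF L1_repD(1)[OF F] strongly_borel_simple[OF simple] le])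
  show "\<forall>x<0. \<psi> i x = 0" by (simp add: \<psi>_def)
 qed
 have lim: "(\<lambda>i. \<psi> i x) \<longlonglongrightarrow> F x" for x
 proof (cases "x < 0")
  case True
  then show ?thesis using L1_repD(2)[OF F True] by (simp add: \<psi>_def)
 next
  case False
  obtain m where m: "x <= real m" using real_arch_simple by blast
  have "\<forall>\<^sub>F i in sequentially. \<phi> i x = \<psi> i x"
   using eventually_ge_at_top[of m] by eventually_elim (use m False in \<open>auto simp: \<psi>_def\<close>)
  then show ?thesis by (rule Lim_transform_eventually[OF \<phi>(2)[of x, unfolded space_borel, OF UNIV_I]])
 qed
 have fin: "(\<integral>\<^sup>+x. ennreal (2 * norm (F x)) \<partial>lborel) < \<infinity>"
  using bochner_borelD(2)[OF bochner_borel_linear[OF L1_repD(1)[OF F] bounded_linear_scaleR_right[of 2]]] by simp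
 have "(\<lambda>i. \<integral>\<^sup>+x. ennreal (norm (\<psi> i x - F x)) \<partial>lborel) \<longlonglongrightarrow> 0"
  by (rule bochner_borel_DCT(1)[OF L1_repD(1)[OF rep] L1_repD(1)[OF F] _ fin le])
   (use bochner_borelD(3)[OF L1_repD(1)[OF F]] lim in auto)
 then have "\<forall>\<^sub>F i in sequentially. (\<integral>\<^sup>+x. ennreal (norm (\<psi> i x - F x)) \<partial>lborel) < ennreal e"
  by (rule order_tendstoD) (use e in simp)
 then obtain i where "(\<integral>\<^sup>+x. ennreal (norm (\<psi> i x - F x)) \<partial>lborel) < ennreal e"
  by (auto simp: eventually_sequentially)
 then have "norm (abs_L1 (\<psi> i) - abs_L1 F) < e"
  unfolding norm_abs_L1[OF L1_rep_diff[OF rep F], symmetric] abs_L1_diff[OF rep F] using e by (simp add: ennreal_less_iff)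
 then show thesis
  by (intro that[OF simple rep, of i i]) (use le in \<open>auto simp: norm_minus_commute \<psi>_def\<close>)
qed

text \<open>Only the decomposition into positive parts needs an argument: a bounded but nonlinear choice of decompositions is applied to the finitely many values of simple functions, and the approximate decompositions so obtained are completed by summing corrections.\<close>

lemma L1_additive_norm_cone: "additive_norm_cone TYPE('a L1)"
proof
 show "closed {f::'a L1. 0 <= f}" by (rule L1_cone_closed)
 show "norm (f + g) = norm f + norm g" if fg: "0 <= f" "0 <= g" for f g :: "'a L1"
 proof -
  obtain F where F: "L1_rep F" "f = abs_L1 F" "\<And>x. 0 <= F x" by (rule L1_rep_cone[OF fg(1)]) (rule that)
  obtain G where G: "L1_rep G" "g = abs_L1 G" "\<And>x. 0 <= G x" by (rule L1_rep_cone[OF fg(2)]) (rule that)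
  have "ennreal (norm (f + g)) = (\<integral>\<^sup>+x. ennreal (norm (F x)) + ennreal (norm (G x)) \<partial>lborel)"
   unfolding F(2) G(2) abs_L1_add[OF F(1) G(1)] norm_abs_L1[OF L1_rep_add[OF F(1) G(1)]]
   by (simp add: norm_additive F(3) G(3))
  also have "\<dots> = (\<integral>\<^sup>+x. ennreal (norm (F x)) \<partial>lborel) + (\<integral>\<^sup>+x. ennreal (norm (G x)) \<partial>lborel)"
   by (rule nn_integral_add) (use bochner_borelD(3)[OF L1_repD(1)[OF F(1)]] bochner_borelD(3)[OF L1_repD(1)[OF G(1)]] in simp_all)
  also have "\<dots> = ennreal (norm f + norm g)"
   unfolding F(2) G(2) norm_abs_L1[OF F(1), symmetric] norm_abs_L1[OF G(1), symmetric] by simp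
  finally show ?thesis by (simp del: ennreal_plus)
 qed
 define v where "v u = (if u = 0 then 0 else SOME v::'a. \<exists>w. 0 <= v \<and> 0 <= w \<and> u = v - w \<and> norm v <= dec_bound E * norm u \<and> norm w <= dec_bound E * norm u)" for u
 have v: "0 <= v u" "0 <= v u - u" "norm (v u) <= dec_bound E * norm u" "norm (v u - u) <= dec_bound E * norm u" for u
 proof -
  have "0 <= v u \<and> 0 <= v u - u \<and> norm (v u) <= dec_bound E * norm u \<and> norm (v u - u) <= dec_bound E * norm u"
  proof (cases "u = 0")
   case False
   have "\<exists>w. 0 <= v u \<and> 0 <= w \<and> u = v u - w \<and> norm (v u) <= dec_bound E * norm u \<and> norm w <= dec_bound E * norm u"
    using someI_ex[OF dec_bound(2)[of u]] False by (simp add: v_def)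
   then obtain w where w: "0 <= v u" "0 <= w" "u = v u - w" "norm (v u) <= dec_bound E * norm u" "norm w <= dec_bound E * norm u"
    by blast
   have "v u - u = w" using w(3) by (simp add: algebra_simps)
   then show ?thesis using w by simp
  qed (simp add: v_def)
  then show "0 <= v u" "0 <= v u - u" "norm (v u) <= dec_bound E * norm u" "norm (v u - u) <= dec_bound E * norm u"
   by blast+
 qed
 have v0: "v 0 = 0" by (simp add: v_def)
 define K where "K = 2 * dec_bound E"
 have approx: "\<exists>p n. 0 <= p \<and> 0 <= n \<and> norm p <= K * norm f \<and> norm n <= K * norm f \<and> norm (f - (p - n)) < e"
  if e: "0 < e" for f :: "'a L1" and e
 proof -
  obtain F where F: "L1_rep F" "f = abs_L1 F" by (rule L1_rep_ex)
  obtain \<phi> N where \<phi>: "simple_function borel \<phi>" "L1_rep \<phi>" "norm (abs_L1 F - abs_L1 \<phi>) < e"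
   "\<And>x. norm (\<phi> x) <= 2 * norm (F x)" "\<And>x. x \<notin> {0..real N} ==> \<phi> x = 0"
   by (rule L1_simple_approx[OF F(1) e]) (rule that)
  have d0: "0 <= dec_bound E" using dec_bound(1) by simp
  have part: "L1_rep (\<lambda>x. q (\<phi> x)) \<and> norm (abs_L1 (\<lambda>x. q (\<phi> x))) <= K * norm f"
   if q: "q 0 = 0" "\<And>u. norm (q u) <= dec_bound E * norm u" for q :: "'a => 'a"
  proof
   have le: "norm (q (\<phi> x)) <= K * norm (F x)" for x
    using order_trans[OF q(2) mult_left_mono[OF \<phi>(4) d0], of x] by (simp add: K_def)
   have sb: "strongly_borel borel (\<lambda>x. q (\<phi> x))"
    by (rule strongly_borel_simple[OF simple_function_compose1[OF \<phi>(1)]])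
   show r: "L1_rep (\<lambda>x. q (\<phi> x))"
    unfolding L1_rep_def using bochner_borel_dominated[OF L1_repD(1)[OF F(1)] sb le] L1_repD(2)[OF \<phi>(2)] q(1) by simp
   have "(\<integral>\<^sup>+x. ennreal (norm (q (\<phi> x))) \<partial>lborel) <= (\<integral>\<^sup>+x. ennreal K * ennreal (norm (F x)) \<partial>lborel)"
    using d0 by (intro nn_integral_mono) (simp add: ennreal_mult[symmetric] K_def ennreal_leI le[unfolded K_def])
   also have "\<dots> = ennreal K * ennreal (norm f)"
    unfolding F(2) norm_abs_L1[OF F(1)] by (rule nn_integral_cmult) (use bochner_borelD(3)[OF L1_repD(1)[OF F(1)]] in simp)
   also have "\<dots> = ennreal (K * norm f)" using d0 by (simp add: ennreal_mult K_def)
   finally show "norm (abs_L1 (\<lambda>x. q (\<phi> x))) <= K * norm f"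
    by (rule norm_abs_L1_le[OF r]) (use d0 in \<open>simp add: K_def\<close>)
  qed
  have P: "L1_rep (\<lambda>x. v (\<phi> x))" "norm (abs_L1 (\<lambda>x. v (\<phi> x))) <= K * norm f"
   using part[of v] v0 v(3) by blast+
  have N: "L1_rep (\<lambda>x. v (\<phi> x) - \<phi> x)" "norm (abs_L1 (\<lambda>x. v (\<phi> x) - \<phi> x)) <= K * norm f"
   using part[of "\<lambda>u. v u - u"] v0 v(4) by simp_all
  have "abs_L1 (\<lambda>x. v (\<phi> x)) - abs_L1 (\<lambda>x. v (\<phi> x) - \<phi> x) = abs_L1 \<phi>"
   by (simp add: abs_L1_diff[OF P(1) N(1)])
  then show ?thesis
   using P(2) N(2) \<phi>(3) abs_L1_nonneg[OF P(1) v(1)] abs_L1_nonneg[OF N(1) v(2)] F(2)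
   by (intro exI[of _ "abs_L1 (\<lambda>x. v (\<phi> x))"] exI[of _ "abs_L1 (\<lambda>x. v (\<phi> x) - \<phi> x)"]) simp
 qed
 have K0: "0 < K" using dec_bound(1) by (simp add: K_def)
 show "\<exists>p n. 0 <= p \<and> 0 <= n \<and> f = p - n" for f :: "'a L1"
  using decomposition_of_approximations[OF L1_cone_closed K0 approx, of f] by blast
qed

end

section \<open>The operators on \<open>L\<^sup>1\<close>\<close>

lemma AE_lborel_translate:
 fixes t :: real
 assumes "AE x in lborel. P x"
 shows "AE x in lborel. P (x - t)"
proof -
 obtain N where N: "{x \<in> space lborel. \<not> P x} \<subseteq> N" "emeasure lborel N = 0" "N \<in> sets lborel"
  using AE_E[OF assms] by blast
 have [measurable]: "N \<in> sets borel" using N(3) by simp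
 have "AE x in lborel. x \<notin> N"
  by (rule AE_not_in) (use N in \<open>simp add: null_sets_def\<close>)
 then have "AE x in lborel. (- t) + 1 * x \<notin> N"
  by (intro AE_borel_affine) auto
 then show ?thesis
  by eventually_elim (use N(1) in auto)
qed

lemma nn_integral_translate:
 fixes t :: real
 assumes "f \<in> borel_measurable borel"
 shows "(\<integral>\<^sup>+x. f (x - t) \<partial>lborel) = (\<integral>\<^sup>+x. f x \<partial>lborel)"
 using nn_integral_real_affine[OF assms, of 1 "- t"] by simp

text \<open>The set lies between a compact and an open set whose difference is small. A translation by less than the distance of the compact set from the complement of the open one changes the indicator only on this difference and its translate.\<close>

lemma translate_indicator_small:
 fixes A :: "real set"
 assumes A: "A \<in> sets borel" "bounded A" and e: "0 < e"
 obtains d where "0 < d"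
  "\<And>k. \<bar>k\<bar> < d ==> (\<integral>\<^sup>+x. ennreal \<bar>indicator A (x - k) - indicator A x\<bar> \<partial>lborel) <= ennreal e"
proof -
 have AL: "A \<in> sets lebesgue" using A(1) by simp
 obtain O' where O: "open O'" "A \<subseteq> O'" "emeasure lebesgue (O' - A) < ennreal (e / 4)"
  by (rule sets_lebesgue_outer_open[OF AL, of "e / 4"]) (use e in auto)
 obtain K where K: "closed K" "K \<subseteq> A" "emeasure lebesgue (A - K) < ennreal (e / 4)"
  by (rule sets_lebesgue_inner_closed[OF AL, of "e / 4"]) (use e in auto)
 have cK: "compact K" using K A(2) by (auto simp: compact_eq_bounded_closed intro: bounded_subset)
 have "\<exists>d>0. \<forall>x\<in>- O'. \<forall>y\<in>K. d <= dist x y"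
  by (rule separate_closed_compact) (use O K cK in auto)
 then obtain d where d: "0 < d" "\<And>x y. x \<notin> O' ==> y \<in> K ==> d <= dist x y" by auto
 let ?M = "O' - K"
 have Kb[measurable]: "K \<in> sets borel" and Ob[measurable]: "O' \<in> sets borel" using K(1) O(1) by auto
 note [measurable] = A(1)
 have "emeasure lborel ?M = emeasure lborel ((O' - A) \<union> (A - K))"
  by (rule arg_cong[where f="emeasure lborel"]) (use O K in auto)
 also have "\<dots> <= emeasure lborel (O' - A) + emeasure lborel (A - K)"
  by (rule emeasure_subadditive) auto
 also have "\<dots> <= ennreal (e / 4) + ennreal (e / 4)"
  using O(3) K(3) by (intro add_mono) auto
 also have "\<dots> = ennreal (e / 2)" using e by (simp flip: ennreal_plus)
 finally have M: "emeasure lborel ?M <= ennreal (e / 2)" .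
 have Mb: "?M \<in> sets borel" by measurable
 show thesis
 proof (rule that[OF d(1)])
  fix k assume k: "\<bar>k\<bar> < d"
  have "ennreal \<bar>indicator A (x - k) - indicator A x\<bar> <= indicator ?M (x - k) + indicator ?M x" for x
  proof (cases "indicator A (x - k) = (indicator A x :: real)")
   case False
   have near: "x \<in> O'" if "x - k \<in> K" using d(2)[of x "x - k"] that k by (auto simp: dist_real_def)
   have near': "x - k \<in> O'" if "x \<in> K" using d(2)[of "x - k" x] that k by (auto simp: dist_real_def)
   have "(x - k \<in> A) ~= (x \<in> A)" using False by (cases "x - k \<in> A"; cases "x \<in> A") simp_all
   then have "x - k \<in> ?M \<or> x \<in> ?M" using near near' O(2) K(2) by blast
   then show ?thesis by (auto simp: indicator_def)
  qed simp
  then have "(\<integral>\<^sup>+x. ennreal \<bar>indicator A (x - k) - indicator A x\<bar> \<partial>lborel) <= (\<integral>\<^sup>+x. indicator ?M (x - k) + indicator ?M x \<partial>lborel)"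
   by (intro nn_integral_mono)
  also have "\<dots> = (\<integral>\<^sup>+x. indicator ?M (x - k) \<partial>lborel) + (\<integral>\<^sup>+x. indicator ?M x \<partial>lborel)"
   by (rule nn_integral_add) measurable
  also have "(\<integral>\<^sup>+x. indicator ?M (x - k) \<partial>lborel) = (\<integral>\<^sup>+x. indicator ?M x \<partial>lborel)"
   by (rule nn_integral_translate) measurable
  also have "(\<integral>\<^sup>+x. indicator ?M x \<partial>lborel) = emeasure lborel ?M" using Mb by simp
  also have "\<dots> + \<dots> <= ennreal (e / 2) + ennreal (e / 2)" by (intro add_mono M)
  also have "\<dots> = ennreal e" using e by (simp flip: ennreal_plus)
  finally show "(\<integral>\<^sup>+x. ennreal \<bar>indicator A (x - k) - indicator A x\<bar> \<partial>lborel) <= ennreal e" .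
 qed
qed

context substochastic_perturbation
begin

sublocale X: additive_norm_cone "TYPE('a L1)" by (rule L1_additive_norm_cone)

lemma norm_functional_eq: "(norm_functional :: 'a L1 => real) = X.psi"
 unfolding norm_functional_def L1_cone_eq
proof (rule the_equality)
 show "bounded_linear X.psi \<and> (\<forall>f\<in>{f. 0 <= f}. X.psi f = norm f)"
  using X.bounded_linear_psi X.psi_cone by simp
 fix \<Psi> :: "'a L1 => real" assume *: "bounded_linear \<Psi> \<and> (\<forall>f\<in>{f. 0 <= f}. \<Psi> f = norm f)"
 then have l: "linear \<Psi>" by (simp add: bounded_linear.linear)
 show "\<Psi> = X.psi"
 proof
  fix f :: "'a L1"
  obtain v w where "0 <= v" "0 <= w" "f = v - w" using X.cone_generating[of f] by blast
  then show "\<Psi> f = X.psi f" using * linear_diff[OF l, of v w] by (simp add: X.psi_diff)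
 qed
qed

text \<open>The properties that the lift to \<open>L\<^sup>1\<close> uses. Measurability along the characteristics, unlike joint continuity, is inherited by pointwise limits such as the sum of the series.\<close>

definition admissible :: "(real => real => 'a => 'a) => bool" where
 "admissible W \<longleftrightarrow> (\<forall>t s. 0 <= s --> s <= t --> linear (W t s) \<and> (\<forall>u\<ge>0. 0 <= W t s u \<and> norm (W t s u) <= norm u)) \<and>
   (\<forall>v. \<forall>t\<ge>0. strongly_borel borel (\<lambda>x. if t <= x then W x (x - t) v else 0))"

lemma admissibleD:
 assumes "admissible W" "0 <= s" "s <= t"
 shows "linear (W t s)" "0 <= u ==> 0 <= W t s u" "0 <= u ==> norm (W t s u) <= norm u"
  "norm (W t s u) <= CB * norm u"
proof -
 show *: "linear (W t s)" and "0 <= u ==> 0 <= W t s u" and "0 <= u ==> norm (W t s u) <= norm u"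
  using assms by (auto simp: admissible_def)
 have "norm (W t s v) <= norm v" if "0 <= v" for v
  using that assms by (auto simp: admissible_def)
 then show "norm (W t s u) <= CB * norm u" by (rule cone_contraction_bound[OF *])
qed

lemma admissible_regular:
 assumes W: "regular W"
 shows "admissible W"
 unfolding admissible_def
proof (intro conjI allI impI)
 fix v and t :: real assume t: "0 <= t"
 have "strongly_borel borel (\<lambda>x::real. W (max t x) (max t x - t) v)"
  by (rule strongly_borel_regular[OF W _ _ _ _ strongly_borel_const]) (use t in \<open>auto intro!: continuous_intros\<close>)
 then have "strongly_borel borel (\<lambda>x. if x \<in> {t..} then W (max t x) (max t x - t) v else 0)"
  by (rule strongly_borel_zero_outside) simp
 moreover have "(\<lambda>x. if x \<in> {t..} then W (max t x) (max t x - t) v else 0) = (\<lambda>x. if t <= x then W x (x - t) v else 0)"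
  by (auto simp: fun_eq_iff max_def)
 ultimately show "strongly_borel borel (\<lambda>x. if t <= x then W x (x - t) v else 0)" by simp
qed (use regularD[OF W] in auto)

lemma admissible_VV: "admissible VV"
 unfolding admissible_def
proof (intro conjI allI impI)
 fix v and t :: real assume t: "0 <= t"
 show "strongly_borel borel (\<lambda>x. if t <= x then VV x (x - t) v else 0)"
 proof (rule strongly_borel_limit[where f="\<lambda>N x. if t <= x then S N x (x - t) v else 0"])
  show "strongly_borel borel (\<lambda>x. if t <= x then S N x (x - t) v else 0)" for N
   using admissible_regular[OF regular_S[of N]] t unfolding admissible_def by blast
  show "(\<lambda>N. if t <= x then S N x (x - t) v else 0) \<longlonglongrightarrow> (if t <= x then VV x (x - t) v else 0)" for x
  proof (cases "t <= x")
   case True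
   then show ?thesis using S_tendsto[of "x - t" x v] t by simp
  qed simp
 qed
qed (use VV_linear VV_cone in auto)

text \<open>The action of the lift on representatives.\<close>

definition shift :: "(real => real => 'a => 'a) => real => (real => 'a) => real => 'a" where
 "shift W t F x = (if t <= x then W x (x - t) (F (x - t)) else 0)"

lemma shift_rep:
 assumes W: "admissible W" and t: "0 <= t" and F: "L1_rep F"
 shows "L1_rep (shift W t F)"
 unfolding L1_rep_def
proof
 have "bochner_borel (\<lambda>x. (\<lambda>x v. if t <= x then W x (x - t) v else 0) x (F (x - t)))"
 proof (rule bochner_borel_operator[OF bochner_borel_translate(1)[OF L1_repD(1)[OF F]]])
  show "strongly_borel borel (\<lambda>x. if t <= x then W x (x - t) v else 0)" for v
   using W t by (simp add: admissible_def)
  show "linear (\<lambda>v. if t <= x then W x (x - t) v else 0)" for x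
   using admissibleD(1)[OF W, of "x - t" x] t by (cases "t <= x") (auto intro: linearI)
  show "norm (if t <= x then W x (x - t) v else 0) <= CB * norm v" for x v
   using admissibleD(4)[OF W, of "x - t" x v] t dec_bound(1) by simp
 qed
 then show "bochner_borel (shift W t F)" by (simp add: shift_def[abs_def])
 show "\<forall>x<0. shift W t F x = 0" using t by (simp add: shift_def)
qed

lemma lift_abs:
 assumes W: "admissible W" and t: "0 <= t" and F: "L1_rep F"
 shows "lift_L1 W t (abs_L1 F) = abs_L1 (shift W t F)"
 unfolding lift_L1_def
proof (rule abs_L1_cong[OF shift_rep[OF W t F]])
 show "AE x in lborel. 0 <= x --> (if t <= x then W x (x - t) (rep_L1 (abs_L1 F) (x - t)) else 0) = shift W t F x"
  using AE_lborel_translate[OF rep_abs_L1_AE[OF F], of t] by eventually_elim (auto simp: shift_def)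
qed

lemma lift_linear:
 assumes W: "admissible W" and t: "0 <= t"
 shows "linear (lift_L1 W t)"
proof (rule linearI)
 fix f g :: "'a L1" and c
 obtain F where F: "L1_rep F" "f = abs_L1 F" by (rule L1_rep_ex)
 obtain G where G: "L1_rep G" "g = abs_L1 G" by (rule L1_rep_ex)
 have lin: "linear (W x (x - t))" if "t <= x" for x using admissibleD(1)[OF W, of "x - t" x] that t by simp
 have "shift W t (\<lambda>x. F x + G x) = (\<lambda>x. shift W t F x + shift W t G x)"
  by (auto simp: shift_def fun_eq_iff linear_add[OF lin])
 then show "lift_L1 W t (f + g) = lift_L1 W t f + lift_L1 W t g"
  by (simp add: F(2) G(2) abs_L1_add[OF F(1) G(1)] lift_abs[OF W t] F(1) G(1) L1_rep_add abs_L1_add shift_rep[OF W t])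
 have "shift W t (\<lambda>x. c *\<^sub>R F x) = (\<lambda>x. c *\<^sub>R shift W t F x)"
  by (auto simp: shift_def fun_eq_iff linear_cmul[OF lin])
 then show "lift_L1 W t (c *\<^sub>R f) = c *\<^sub>R lift_L1 W t f"
  by (simp add: F(2) abs_L1_scaleR[OF F(1)] lift_abs[OF W t] F(1) L1_rep_scaleR abs_L1_scaleR shift_rep[OF W t])
qed

lemma lift_cone:
 assumes W: "admissible W" and t: "0 <= t" and f: "0 <= f"
 shows "0 <= lift_L1 W t f" "norm (lift_L1 W t f) <= norm f"
proof -
 obtain F where F: "L1_rep F" "f = abs_L1 F" "\<And>x. 0 <= F x" by (rule L1_rep_cone[OF f]) (rule that)
 have r: "L1_rep (shift W t F)" by (rule shift_rep[OF W t F(1)])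
 show "0 <= lift_L1 W t f"
  unfolding F(2) lift_abs[OF W t F(1)]
  by (rule abs_L1_nonneg[OF r]) (use admissibleD(2)[OF W] F(3) t in \<open>simp add: shift_def\<close>)
 have "(\<integral>\<^sup>+x. ennreal (norm (shift W t F x)) \<partial>lborel) <= (\<integral>\<^sup>+x. ennreal (norm (F (x - t))) \<partial>lborel)"
  by (intro nn_integral_mono ennreal_leI) (use admissibleD(3)[OF W] F(3) t in \<open>simp add: shift_def\<close>)
 also have "\<dots> = ennreal (norm f)"
  unfolding bochner_borel_translate(2)[OF L1_repD(1)[OF F(1)]] F(2) norm_abs_L1[OF F(1)] ..
 finally show "norm (lift_L1 W t f) <= norm f"
  unfolding F(2) lift_abs[OF W t F(1)] by (rule norm_abs_L1_le[OF r]) simp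
qed

abbreviation TN :: "nat => real => 'a L1 => 'a L1" where "TN \<equiv> T_n U B"
abbreviation TS :: "real => 'a L1 => 'a L1" where "TS \<equiv> T_sum U B"
definition L1_dec_bound :: "'a itself => real" where "L1_dec_bound T = X.dec_bound TYPE('a L1)"
abbreviation CX :: real where "CX \<equiv> 2 * L1_dec_bound E"

lemma CX_pos: "0 < CX"
 using X.dec_bound(1) by (simp add: L1_dec_bound_def)

lemma admissible_V: "admissible (V n)"
 by (rule admissible_regular[OF regular_V])

lemma TN_abs: "0 <= t ==> L1_rep F ==> TN n t (abs_L1 F) = abs_L1 (shift (V n) t F)"
 unfolding T_n_def by (rule lift_abs[OF admissible_V])

lemma TS_abs: "0 <= t ==> L1_rep F ==> TS t (abs_L1 F) = abs_L1 (shift VV t F)"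
 unfolding T_sum_def by (rule lift_abs[OF admissible_VV])

lemma TN_linear: "0 <= t ==> linear (TN n t)"
 unfolding T_n_def by (rule lift_linear[OF admissible_V])

lemma TS_linear: "0 <= t ==> linear (TS t)"
 unfolding T_sum_def by (rule lift_linear[OF admissible_VV])

lemma TN_cone: "0 <= t ==> 0 <= f ==> 0 <= TN n t f" "0 <= t ==> 0 <= f ==> norm (TN n t f) <= norm f"
 unfolding T_n_def by (rule lift_cone[OF admissible_V]; assumption)+

lemma TS_cone: "0 <= t ==> 0 <= f ==> 0 <= TS t f" "0 <= t ==> 0 <= f ==> norm (TS t f) <= norm f"
 unfolding T_sum_def by (rule lift_cone[OF admissible_VV]; assumption)+

lemma TN_bound: "0 <= t ==> norm (TN n t f) <= CX * norm f"
 unfolding L1_dec_bound_def by (rule X.cone_contraction_bound[OF TN_linear TN_cone(2)])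

lemma TS_bound: "0 <= t ==> norm (TS t f) <= CX * norm f"
 unfolding L1_dec_bound_def by (rule X.cone_contraction_bound[OF TS_linear TS_cone(2)])

lemma TN_bounded_linear: "0 <= t ==> bounded_linear (TN n t)"
 using TN_linear[of t n] TN_bound[of t n]
 by (auto simp: bounded_linear_def bounded_linear_axioms_def mult.commute[of CX] intro!: exI[of _ CX])

lemma TS_bounded_linear: "0 <= t ==> bounded_linear (TS t)"
 using TS_linear[of t] TS_bound[of t]
 by (auto simp: bounded_linear_def bounded_linear_axioms_def mult.commute[of CX] intro!: exI[of _ CX])

lemma TN_add:
 assumes t: "0 <= t" and s: "0 <= s"
 shows "TN n (t + s) f = (\<Sum>j\<le>n. TN (n - j) t (TN j s f))"
proof -
 obtain F where F: "L1_rep F" "f = abs_L1 F" by (rule L1_rep_ex)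
 have r: "L1_rep (shift (V j) s F)" for j by (rule shift_rep[OF admissible_V s F(1)])
 have rr: "L1_rep (shift (V i) t (shift (V j) s F))" for i j by (rule shift_rep[OF admissible_V t r])
 have "shift (V n) (t + s) F x = (\<Sum>j\<le>n. shift (V (n - j)) t (shift (V j) s F) x)" for x
 proof (cases "t + s <= x")
  case True
  then show ?thesis
   using V_compose[of "x - (t + s)" "x - t" x n "F (x - (t + s))"] t s
   by (simp add: shift_def algebra_simps)
 next
  case False
  have "V i x (x - t) 0 = 0" if "t <= x" for i
   by (rule linear_0[OF admissibleD(1)[OF admissible_V]]) (use that t in auto)
  then show ?thesis using False s by (cases "t <= x") (simp_all add: shift_def)
 qed
 then have "shift (V n) (t + s) F = (\<lambda>x. \<Sum>j\<le>n. shift (V (n - j)) t (shift (V j) s F) x)" by (rule ext)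
 then show ?thesis
  using t s by (simp add: F(2) TN_abs F(1) r rr abs_L1_sum)
qed

lemma TS_add:
 assumes t: "0 <= t" and s: "0 <= s"
 shows "TS (t + s) f = TS t (TS s f)"
proof -
 obtain F where F: "L1_rep F" "f = abs_L1 F" by (rule L1_rep_ex)
 have r: "L1_rep (shift VV s F)" by (rule shift_rep[OF admissible_VV s F(1)])
 have "shift VV (t + s) F x = shift VV t (shift VV s F) x" for x
 proof (cases "t + s <= x")
  case True
  then show ?thesis
   using VV_compose[of "x - (t + s)" "x - t" x "F (x - (t + s))"] t s
   by (simp add: shift_def algebra_simps)
 next
  case False
  have "VV x (x - t) 0 = 0" if "t <= x"
   by (rule linear_0[OF admissibleD(1)[OF admissible_VV]]) (use that t in auto)
  then show ?thesis using False s by (auto simp: shift_def)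
 qed
 then have "shift VV (t + s) F = shift VV t (shift VV s F)" by (rule ext)
 then show ?thesis
  using t s by (simp add: F(2) TS_abs F(1) r)
qed

lemma TN_partial_sum:
 assumes t: "0 <= t"
 shows "(\<Sum>n\<le>N. TN n t f) = lift_L1 (S N) t f"
proof -
 obtain F where F: "L1_rep F" "f = abs_L1 F" by (rule L1_rep_ex)
 have "shift (S N) t F = (\<lambda>x. \<Sum>n\<le>N. shift (V n) t F x)" by (auto simp: shift_def fun_eq_iff)
 then show ?thesis
  by (simp add: F t TN_abs lift_abs[OF admissible_regular[OF regular_S] t] abs_L1_sum shift_rep[OF admissible_V t])
qed

lemma TN_sums:
 assumes t: "0 <= t"
 shows "(\<lambda>n. TN n t f) sums TS t f"
proof -
 obtain F where F: "L1_rep F" "f = abs_L1 F" by (rule L1_rep_ex)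
 have r: "L1_rep (shift (S N) t F)" for N by (rule shift_rep[OF admissible_regular[OF regular_S] t F(1)])
 have r': "L1_rep (shift VV t F)" by (rule shift_rep[OF admissible_VV t F(1)])
 have c0: "0 <= CB" using dec_bound(1) by simp
 have Ft: "bochner_borel (\<lambda>x. CB *\<^sub>R F (x - t))"
  by (rule bochner_borel_linear[OF bochner_borel_translate(1)[OF L1_repD(1)[OF F(1)]] bounded_linear_scaleR_right])
 have "(\<lambda>N. \<integral>\<^sup>+x. ennreal (norm (shift (S N) t F x - shift VV t F x)) \<partial>lborel) \<longlonglongrightarrow> 0"
 proof (rule bochner_borel_DCT(1)[where w="\<lambda>x. CB * norm (F (x - t))"])
  show "(\<lambda>x. CB * norm (F (x - t))) \<in> borel_measurable borel"
   using bochner_borelD(3)[OF Ft] c0 by simp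
  show "(\<integral>\<^sup>+x. ennreal (CB * norm (F (x - t))) \<partial>lborel) < \<infinity>"
   using bochner_borelD(2)[OF Ft] c0 by simp
  show "norm (shift (S N) t F x) <= CB * norm (F (x - t))" for N x
   using regularD(4)[OF regular_S[of N], of "x - t" x "F (x - t)"] t c0 by (simp add: shift_def)
  show "AE x in lborel. (\<lambda>N. shift (S N) t F x) \<longlonglongrightarrow> shift VV t F x"
  proof (rule AE_I2)
   fix x
   show "(\<lambda>N. shift (S N) t F x) \<longlonglongrightarrow> shift VV t F x"
    using S_tendsto[of "x - t" x "F (x - t)"] t by (cases "t <= x") (simp_all add: shift_def)
  qed
 qed (use L1_repD(1)[OF r] L1_repD(1)[OF r'] in simp_all)
 then have "(\<lambda>N. ennreal (norm (abs_L1 (shift (S N) t F) - abs_L1 (shift VV t F)))) \<longlonglongrightarrow> ennreal 0"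
  by (simp add: abs_L1_diff[OF r r'] norm_abs_L1[OF L1_rep_diff[OF r r']])
 then have "(\<lambda>N. norm (abs_L1 (shift (S N) t F) - abs_L1 (shift VV t F))) \<longlonglongrightarrow> 0"
  by (rule tendsto_ennrealD) (auto intro!: always_eventually)
 then have "(\<lambda>N. abs_L1 (shift (S N) t F) - abs_L1 (shift VV t F)) \<longlonglongrightarrow> 0"
  by (rule tendsto_norm_zero_cancel)
 then have "(\<lambda>N. \<Sum>n\<le>N. TN n t f) \<longlonglongrightarrow> TS t f"
  unfolding TN_partial_sum[OF t] F(2) lift_abs[OF admissible_regular[OF regular_S] t F(1)] TS_abs[OF t F(1)]
  by (rule LIM_zero_cancel)
 then show ?thesis by (simp add: sums_def_le)
qed

lemma TN_norm_sum:
 assumes t: "0 <= t" and f: "0 <= f"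
 shows "(\<Sum>n\<le>N. norm (TN n t f)) <= norm f"
proof -
 have "0 <= (\<Sum>n\<le>N. TN n t f) \<and> norm (\<Sum>n\<le>N. TN n t f) = (\<Sum>n\<le>N. norm (TN n t f))" for N
  by (induction N) (use TN_cone(1)[OF t f] in \<open>auto simp: X.norm_additive\<close>)
 then show ?thesis
  using lift_cone(2)[OF admissible_regular[OF regular_S] t f, of N] by (simp add: TN_partial_sum[OF t])
qed

lemma TN_norm_sums:
 assumes t: "0 <= t" and f: "0 <= f"
 shows "(\<lambda>n. norm (TN n t f)) sums norm (TS t f)"
proof -
 have "(\<lambda>n. X.psi (TN n t f)) sums X.psi (TS t f)"
  by (rule bounded_linear.sums[OF X.bounded_linear_psi TN_sums[OF t]])
 then show ?thesis using TN_cone(1)[OF t f] TS_cone(1)[OF t f] by (simp add: X.psi_cone)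
qed

lemma TN_0: "TN n 0 f = (if n = 0 then f else 0)"
proof -
 obtain F where F: "L1_rep F" "f = abs_L1 F" by (rule L1_rep_ex)
 have V0: "V n x x u = (if n = 0 then u else 0)" if x: "0 <= x" for x u
 proof -
  have pos: "V n x x u = (if n = 0 then u else 0)" if u: "0 <= u" for u
  proof (cases n)
   case (Suc m)
   have "(\<Sum>i\<in>{0, n}. norm (V i x x u)) <= (\<Sum>i\<le>n. norm (V i x x u))" by (rule sum_mono2) auto
   also have "\<dots> <= norm u" by (rule V_norm_sum_le[OF x order_refl u])
   finally show ?thesis using Suc U_refl[OF x, of u] by simp
  qed (use U_refl[OF x] in simp)
  obtain v w where "0 <= v" "0 <= w" "u = v - w" using cone_generating by blast
  then show ?thesis using linear_diff[OF regularD(1)[OF regular_V x order_refl], of n v w] pos by simp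
 qed
 have "shift (V n) 0 F = (\<lambda>x. if n = 0 then F x else 0)"
  using L1_repD(2)[OF F(1)] by (auto simp: shift_def fun_eq_iff V0 U_refl)
 then show ?thesis by (simp add: F TN_abs abs_L1_zero)
qed

lemma TS_0: "TS 0 f = f"
proof -
 have "(\<lambda>n. TN n 0 f) sums f" using sums_If_finite_set[of "{0}" "\<lambda>n. f"] by (simp add: TN_0)
 then show ?thesis using TN_sums[of 0 f] sums_unique2 by blast
qed

text \<open>The terms of positive order are positive, so their norms add to that of \<open>T\<^sub>0 f\<close>.\<close>

lemma TS_minus_TN0:
 assumes t: "0 <= t" and f: "0 <= f"
 shows "0 <= TS t f - TN 0 t f" "norm (TS t f - TN 0 t f) <= norm f - norm (TN 0 t f)"
  "norm (TN (Suc n) t f) <= norm f - norm (TN 0 t f)"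
proof -
 have s: "(\<lambda>n. TN (Suc n) t f) sums (TS t f - TN 0 t f)"
  using TN_sums[OF t, of f] by (subst sums_Suc_iff) simp
 show *: "0 <= TS t f - TN 0 t f"
  unfolding sums_unique[OF s] by (rule cone_suminf[OF X.cone_closed sums_summable[OF s] TN_cone(1)[OF t f]])
 have "norm (TN 0 t f + (TS t f - TN 0 t f)) = norm (TN 0 t f) + norm (TS t f - TN 0 t f)"
  by (rule X.norm_additive[OF TN_cone(1)[OF t f] *])
 then show "norm (TS t f - TN 0 t f) <= norm f - norm (TN 0 t f)" using TS_cone(2)[OF t f] by simp
 have "(\<Sum>i\<in>{0, Suc n}. norm (TN i t f)) <= (\<Sum>i\<le>Suc n. norm (TN i t f))" by (rule sum_mono2) auto
 then show "norm (TN (Suc n) t f) <= norm f - norm (TN 0 t f)" using TN_norm_sum[OF t f, of "Suc n"] by simp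
qed

end

section \<open>Strong continuity\<close>

text \<open>For a semigroup the increments over a time interval are controlled by the increment at time \<open>0\<close>, which gives such a modulus.\<close>

lemma continuous_on_of_modulus:
 fixes g :: "real => 'b::real_normed_vector"
 assumes le: "\<And>s t. 0 <= s ==> s <= t ==> norm (g t - g s) <= \<omega> (t - s)" and lim: "(\<omega> \<longlongrightarrow> 0) (at_right 0)"
 shows "continuous_on {0..} g"
 unfolding continuous_on_iff
proof (intro ballI allI impI)
 fix x e :: real assume x: "x \<in> {0..}" and e: "0 < e"
 have "\<forall>\<^sub>F k in at_right 0. \<omega> k < e" by (rule order_tendstoD(2)[OF lim e])
 then obtain d where d: "0 < d" "\<And>k. 0 < k ==> k < d ==> \<omega> k < e"
  unfolding eventually_at_right_field by auto
 show "\<exists>d>0. \<forall>y\<in>{0..}. dist y x < d --> dist (g y) (g x) < e"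
 proof (intro exI[of _ d] conjI ballI impI d(1))
  fix y assume y: "y \<in> {0..}" "dist y x < d"
  consider "y = x" | "y < x" | "x < y" by linarith
  then show "dist (g y) (g x) < e"
  proof cases
   case 2
   then show ?thesis using le[of y x] d(2)[of "x - y"] x y by (simp add: dist_norm norm_minus_commute dist_real_def)
  next
   case 3
   then show ?thesis using le[of x y] d(2)[of "y - x"] x y by (simp add: dist_norm dist_real_def)
  qed (use e in simp)
 qed
qed

context substochastic_perturbation
begin

text \<open>The translation of the set and the evolution of the fixed vector \<open>v\<close> are estimated separately; the latter by dominated convergence.\<close>

lemma TN0_indicator_tendsto:
 assumes A: "A \<in> sets borel" "A \<subseteq> {0..real N}"
 shows "L1_rep (\<lambda>x. if x \<in> A then v else 0)"
  and "((\<lambda>k. TN 0 k (abs_L1 (\<lambda>x. if x \<in> A then v else 0))) \<longlongrightarrow> abs_L1 (\<lambda>x. if x \<in> A then v else 0)) (at_right 0)"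
proof -
 define F where "F x = (if x \<in> A then v else 0)" for x
 have "bochner_borel (\<lambda>x. if x \<in> A then (if x \<in> {0..real N} then v else 0) else 0)"
  by (intro bochner_borel_restrict bochner_borel_continuous A(1) continuous_intros)
 moreover have "(\<lambda>x. if x \<in> A then (if x \<in> {0..real N} then v else 0) else 0) = F"
  using A(2) by (auto simp: F_def fun_eq_iff)
 ultimately have F: "L1_rep F" using A(2) by (auto simp: L1_rep_def F_def)
 then show "L1_rep (\<lambda>x. if x \<in> A then v else 0)" by (simp add: F_def[abs_def])
 note [measurable] = A(1)
 have bA: "bounded A" using A(2) bounded_subset[OF bounded_closed_interval] by blast
 define w where "w k y = indicator A y * norm (U (max 0 y + k) (max 0 y) v - v)" for k y
 have wm: "w k \<in> borel_measurable borel" if "0 <= k" for k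
 proof -
  have "continuous_on UNIV (\<lambda>y. norm (U (max 0 y + k) (max 0 y) v - v))"
   by (intro continuous_intros regular_cont_comp[OF regular_U]) (use that in auto)
  then have [measurable]: "(\<lambda>y. norm (U (max 0 y + k) (max 0 y) v - v)) \<in> borel_measurable borel"
   by (rule borel_measurable_continuous_onI)
  show ?thesis unfolding w_def by measurable
 qed
 have w0: "0 <= w k y" for k y by (simp add: w_def)
 define a where "a k = (\<integral>\<^sup>+y. ennreal (w k y) \<partial>lborel)" for k
 define b where "b k = (\<integral>\<^sup>+x. ennreal (norm v * \<bar>indicator A (x - k) - indicator A x\<bar>) \<partial>lborel)" for k
 have a: "(a \<longlongrightarrow> 0) (at_right 0)"
 proof (rule tendsto_at_right_sequentially[of 0 1])
  fix k :: "nat => real" assume k: "\<And>n. 0 < k n" "\<And>n. k n < 1" "k \<longlonglongrightarrow> 0"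
  have "(\<lambda>n. \<integral>\<^sup>+y. ennreal (w (k n) y) \<partial>lborel) \<longlonglongrightarrow> (\<integral>\<^sup>+(y::real). 0 \<partial>lborel)"
  proof (rule nn_integral_dominated_convergence[where w="\<lambda>y. ennreal (CB * norm v + norm v) * indicator A y"])
   show "(\<lambda>y. ennreal (w (k n) y)) \<in> borel_measurable lborel" for n
    using wm[of "k n"] k(1)[of n] by simp
   have "emeasure lborel A < \<infinity>" by (rule emeasure_bounded_finite[OF bA])
   then show "(\<integral>\<^sup>+y. ennreal (CB * norm v + norm v) * indicator A y \<partial>lborel) < \<infinity>"
    by (simp add: nn_integral_cmult_indicator ennreal_mult_less_top)
   have "norm (U (max 0 y + k n) (max 0 y) v - v) <= CB * norm v + norm v" for n y
    using norm_triangle_ineq4[of "U (max 0 y + k n) (max 0 y) v" v] U_bound[of "max 0 y" "max 0 y + k n" v] k(1)[of n] by simp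
   then show "AE y in lborel. ennreal (w (k n) y) <= ennreal (CB * norm v + norm v) * indicator A y" for n
    by (intro AE_I2) (auto simp: w_def indicator_def intro!: ennreal_leI)
   show "AE y in lborel. (\<lambda>n. ennreal (w (k n) y)) \<longlonglongrightarrow> 0"
   proof (rule AE_I2)
    fix y
    have "(\<lambda>n. norm (U (max 0 y + k n) (max 0 y) v - v)) \<longlonglongrightarrow> 0"
     by (rule U_diagonal_tendsto[of _ "max 0 y"]) (use k(1) k(3) tendsto_add[OF tendsto_const k(3), of "max 0 y"] less_imp_le in auto)
    then have "(\<lambda>n. w (k n) y) \<longlonglongrightarrow> 0" unfolding w_def by (rule tendsto_mult_right_zero)
    then show "(\<lambda>n. ennreal (w (k n) y)) \<longlonglongrightarrow> 0" using tendsto_ennrealI by fastforce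
   qed
  qed simp_all
  then show "(\<lambda>n. a (k n)) \<longlonglongrightarrow> 0" by (simp add: a_def)
 qed simp
 have b: "(b \<longlongrightarrow> 0) (at_right 0)"
 proof (rule tendsto_ennreal_0I)
  fix e :: real assume e: "0 < e"
  let ?e = "e / (norm v + 1)"
  have v1: "0 < norm v + 1" by (simp add: add_nonneg_pos)
  have e': "0 < ?e" using e v1 by simp
  obtain d where d: "0 < d"
   "\<And>k. \<bar>k\<bar> < d ==> (\<integral>\<^sup>+x. ennreal \<bar>indicator A (x - k) - indicator A x\<bar> \<partial>lborel) <= ennreal ?e"
   by (rule translate_indicator_small[OF A(1) bA e']) (rule that)
  have "b k <= ennreal e" if k: "0 < k" "k < d" for k
  proof -
   have "b k = ennreal (norm v) * (\<integral>\<^sup>+x. ennreal \<bar>indicator A (x - k) - indicator A x\<bar> \<partial>lborel)"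
    unfolding b_def by (subst nn_integral_cmult[symmetric]) (simp_all add: ennreal_mult)
   also have "\<dots> <= ennreal (norm v) * ennreal ?e" using d(2)[of k] k by (intro mult_left_mono) auto
   also have "\<dots> = ennreal (norm v * ?e)" by (rule ennreal_mult[symmetric]) (use e' in auto)
   also have "\<dots> <= ennreal e" using e v1 by (intro ennreal_leI) (simp add: field_simps)
   finally show ?thesis .
  qed
  then show "\<forall>\<^sub>F k in at_right 0. b k <= ennreal e"
   unfolding eventually_at_right_field using d(1) by auto
 qed
 have le: "ennreal (norm (TN 0 k (abs_L1 F) - abs_L1 F)) <= a k + b k" if k: "0 < k" for k
 proof -
  have r: "L1_rep (shift U k F)" using shift_rep[OF admissible_regular[OF regular_U], of k F] F k by simp
  have "norm (shift U k F x - F x) <= w k (x - k) + norm v * \<bar>indicator A (x - k) - indicator A x\<bar>" for x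
  proof (cases "x - k \<in> A")
   case True
   then have x: "0 <= x - k" using A(2) by auto
   then have *: "shift U k F x = U x (x - k) v" "w k (x - k) = norm (U x (x - k) v - v)"
    using True k by (simp_all add: shift_def F_def w_def)
   show ?thesis
    using True norm_triangle_sub[of "U x (x - k) v" v] by (cases "x \<in> A") (simp_all add: * F_def algebra_simps)
  next
   case False
   have "shift U k F x = 0"
    using False linear_0[OF U_linear[of "x - k" x]] k by (simp add: shift_def F_def)
   then show ?thesis using False by (simp add: F_def w_def)
  qed
  then have "ennreal (norm (TN 0 k (abs_L1 F) - abs_L1 F)) <= (\<integral>\<^sup>+x. ennreal (w k (x - k)) + ennreal (norm v * \<bar>indicator A (x - k) - indicator A x\<bar>) \<partial>lborel)"
   using k F by (simp add: TN_abs abs_L1_diff[OF r F] norm_abs_L1[OF L1_rep_diff[OF r F]])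
    (intro nn_integral_mono, simp add: ennreal_plus[symmetric] w0 ennreal_leI del: ennreal_plus)
  also have "\<dots> = (\<integral>\<^sup>+x. ennreal (w k (x - k)) \<partial>lborel) + b k"
   unfolding b_def by (rule nn_integral_add) (use measurable_compose[OF _ wm[of k], of "\<lambda>x. x - k"] k in simp_all)
  also have "(\<integral>\<^sup>+x. ennreal (w k (x - k)) \<partial>lborel) = a k"
   unfolding a_def by (rule nn_integral_translate) (use wm[of k] k in simp)
  finally show ?thesis .
 qed
 have "((\<lambda>k. ennreal (norm (TN 0 k (abs_L1 F) - abs_L1 F))) \<longlongrightarrow> 0) (at_right 0)"
 proof (rule tendsto_sandwich[OF _ _ tendsto_const])
  show "((\<lambda>k. a k + b k) \<longlongrightarrow> 0) (at_right 0)" using tendsto_add[OF a b] by simp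
  show "\<forall>\<^sub>F k in at_right 0. ennreal (norm (TN 0 k (abs_L1 F) - abs_L1 F)) <= a k + b k"
   using eventually_at_right_less[of 0] by eventually_elim (rule le)
 qed simp
 then have "((\<lambda>k. ennreal (norm (TN 0 k (abs_L1 F) - abs_L1 F))) \<longlongrightarrow> ennreal 0) (at_right 0)" by simp
 then have "((\<lambda>k. norm (TN 0 k (abs_L1 F) - abs_L1 F)) \<longlongrightarrow> 0) (at_right 0)"
  by (rule tendsto_ennrealD) (auto intro!: always_eventually)
 then have "((\<lambda>k. TN 0 k (abs_L1 F) - abs_L1 F) \<longlongrightarrow> 0) (at_right 0)" by (rule tendsto_norm_zero_cancel)
 then show "((\<lambda>k. TN 0 k (abs_L1 (\<lambda>x. if x \<in> A then v else 0))) \<longlongrightarrow> abs_L1 (\<lambda>x. if x \<in> A then v else 0)) (at_right 0)"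
  unfolding F_def[abs_def] by (rule LIM_zero_cancel)
qed

text \<open>The operators are uniformly bounded and simple functions with bounded support are dense.\<close>

lemma TN0_tendsto: "((\<lambda>k. TN 0 k f) \<longlongrightarrow> f) (at_right 0)"
proof (rule tendstoI)
 fix e :: real assume e: "0 < e"
 obtain F where F: "L1_rep F" "f = abs_L1 F" by (rule L1_rep_ex)
 define e' where "e' = e / (2 * (CX + 1))"
 have e': "0 < e'" using e CX_pos by (simp add: e'_def)
 obtain \<phi> N where \<phi>: "simple_function borel \<phi>" "L1_rep \<phi>" "norm (abs_L1 F - abs_L1 \<phi>) < e'"
   "\<And>x. x \<notin> {0..real N} ==> \<phi> x = 0"
  by (rule L1_simple_approx[OF F(1) e']) (rule that)
 define I where "I = range \<phi> - {0}"
 define P where "P v x = (if x \<in> \<phi> -` {v} then v else 0)" for v x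
 have I: "finite I" using simple_functionD(1)[OF \<phi>(1)] by (simp add: I_def)
 have A: "\<phi> -` {v} \<in> sets borel" "v \<in> I ==> \<phi> -` {v} \<subseteq> {0..real N}" for v
 proof -
  show "\<phi> -` {v} \<in> sets borel" using simple_functionD(2)[OF \<phi>(1), of "{v}"] by simp
  assume "v \<in> I"
  then show "\<phi> -` {v} \<subseteq> {0..real N}" using \<phi>(4) by (fastforce simp: I_def simp del: atLeastAtMost_iff)
 qed
 have P: "L1_rep (P v)" "((\<lambda>k. TN 0 k (abs_L1 (P v))) \<longlongrightarrow> abs_L1 (P v)) (at_right 0)" if "v \<in> I" for v
  using TN0_indicator_tendsto[OF A(1) A(2)[OF that], of v] unfolding P_def[abs_def] by blast+
 have "\<phi> x = (\<Sum>v\<in>I. P v x)" for x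
 proof (cases "\<phi> x = 0")
  case True
  then show ?thesis by (auto simp: P_def I_def intro!: sum.neutral[symmetric])
 next
  case False
  then have "(\<Sum>v\<in>I. P v x) = (\<Sum>v\<in>I. if v = \<phi> x then \<phi> x else 0)" by (intro sum.cong) (auto simp: P_def)
  then show ?thesis using False I by (simp add: I_def)
 qed
 then have \<phi>_eq: "\<phi> = (\<lambda>x. \<Sum>v\<in>I. P v x)" by (rule ext)
 have \<phi>_sum: "abs_L1 \<phi> = (\<Sum>v\<in>I. abs_L1 (P v))"
  unfolding \<phi>_eq by (rule abs_L1_sum[OF I P(1), symmetric])
 have "((\<lambda>k. \<Sum>v\<in>I. TN 0 k (abs_L1 (P v))) \<longlongrightarrow> abs_L1 \<phi>) (at_right 0)"
  unfolding \<phi>_sum by (intro tendsto_sum P(2))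
 moreover have "\<forall>\<^sub>F k in at_right 0. (\<Sum>v\<in>I. TN 0 k (abs_L1 (P v))) = TN 0 k (abs_L1 \<phi>)"
  using eventually_at_right_less[of 0] by eventually_elim (simp add: \<phi>_sum linear_sum[OF TN_linear])
 ultimately have lim: "((\<lambda>k. TN 0 k (abs_L1 \<phi>)) \<longlongrightarrow> abs_L1 \<phi>) (at_right 0)" by (rule Lim_transform_eventually)
 have "\<forall>\<^sub>F k in at_right 0. dist (TN 0 k (abs_L1 \<phi>)) (abs_L1 \<phi>) < e / 2" by (rule tendstoD[OF lim]) (use e in simp)
 then show "\<forall>\<^sub>F k in at_right 0. dist (TN 0 k f) f < e"
  using eventually_at_right_less[of 0]
 proof eventually_elim
  case (elim k)
  let ?g = "abs_L1 \<phi>"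
  have "norm (TN 0 k f - TN 0 k ?g) <= CX * norm (f - ?g)"
   using TN_bound[of k 0 "f - ?g"] elim(2) linear_diff[OF TN_linear[of k 0], of f ?g] by simp
  moreover have "TN 0 k f - f = (TN 0 k f - TN 0 k ?g) + (TN 0 k ?g - ?g) + (?g - f)" by simp
  then have "norm (TN 0 k f - f) <= norm (TN 0 k f - TN 0 k ?g) + norm (TN 0 k ?g - ?g) + norm (?g - f)"
   by (metis norm_triangle_ineq norm_triangle_mono order_refl)
  ultimately have "norm (TN 0 k f - f) <= (CX + 1) * norm (f - ?g) + norm (TN 0 k ?g - ?g)"
   by (simp add: norm_minus_commute algebra_simps)
  also have "\<dots> < (CX + 1) * e' + e / 2"
   using \<phi>(3) elim(1) CX_pos F(2) by (intro add_strict_mono mult_strict_left_mono) (auto simp: dist_norm)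
  also have "(CX + 1) * e' = e / 2" unfolding e'_def using CX_pos by (simp add: field_simps)
  finally show ?case by (simp add: dist_norm)
 qed
qed

lemma TN_TS_tendsto_aux:
 assumes W: "\<And>k. 0 < k ==> linear (W k)" "\<And>k f. 0 < k ==> 0 <= f ==> norm (W k f) <= norm f - norm (TN 0 k f)"
 shows "((\<lambda>k. W k (f::'a L1)) \<longlongrightarrow> (0::'a L1)) (at_right 0)"
proof -
 have pos: "((\<lambda>k. W k f) \<longlongrightarrow> 0) (at_right 0)" if f: "0 <= f" for f
 proof (rule Lim_null_comparison)
  show "\<forall>\<^sub>F k in at_right 0. norm (W k f) <= norm f - norm (TN 0 k f)"
   using eventually_at_right_less[of 0] by eventually_elim (rule W(2)[OF _ f])
  have "((\<lambda>k. norm f - norm (TN 0 k f)) \<longlongrightarrow> norm f - norm f) (at_right 0)"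
   by (intro tendsto_diff tendsto_const tendsto_norm TN0_tendsto)
  then show "((\<lambda>k. norm f - norm (TN 0 k f)) \<longlongrightarrow> 0) (at_right 0)" by simp
 qed
 obtain v w where vw: "0 <= v" "0 <= w" "f = v - w" using X.cone_generating by blast
 have "((\<lambda>k. W k v - W k w) \<longlongrightarrow> 0 - 0) (at_right 0)" by (intro tendsto_diff pos vw)
 moreover have "\<forall>\<^sub>F k in at_right 0. W k v - W k w = W k f"
  using eventually_at_right_less[of 0] by eventually_elim (simp add: vw(3) linear_diff[OF W(1)])
 ultimately show ?thesis by (simp add: Lim_transform_eventually)
qed

lemma TN_tendsto: "((\<lambda>k. TN n k f) \<longlongrightarrow> TN n 0 f) (at_right 0)"
proof (cases n)
 case 0
 then show ?thesis using TN0_tendsto by (simp add: TN_0)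
next
 case (Suc m)
 have "((\<lambda>k. TN (Suc m) k f) \<longlongrightarrow> 0) (at_right 0)"
  by (rule TN_TS_tendsto_aux) (use TN_linear TS_minus_TN0(3) less_imp_le in auto)
 then show ?thesis by (simp add: TN_0 Suc)
qed

lemma TS_tendsto: "((\<lambda>k. TS k f) \<longlongrightarrow> f) (at_right 0)"
proof -
 have "((\<lambda>k. (\<lambda>f. TS k f - TN 0 k f) f) \<longlongrightarrow> 0) (at_right 0)"
  by (rule TN_TS_tendsto_aux[where W="\<lambda>k f. TS k f - TN 0 k f"])
   (use TN_linear TS_linear TS_minus_TN0(2) in \<open>auto intro!: linear_compose_sub\<close>)
 from tendsto_add[OF this TN0_tendsto[of f]] show ?thesis by simp
qed

lemma TN_continuous: "continuous_on {0..} (\<lambda>t. TN n t f)"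
proof (rule continuous_on_of_modulus[where \<omega>="\<lambda>k. CX * (\<Sum>j\<le>n. norm (TN j k f - TN j 0 f))"])
 have "((\<lambda>k. CX * (\<Sum>j\<le>n. norm (TN j k f - TN j 0 f))) \<longlongrightarrow> CX * (\<Sum>j\<le>n. norm (TN j 0 f - TN j 0 f))) (at_right 0)"
  by (intro tendsto_mult tendsto_const tendsto_sum tendsto_norm tendsto_diff TN_tendsto)
 then show "((\<lambda>k. CX * (\<Sum>j\<le>n. norm (TN j k f - TN j 0 f))) \<longlongrightarrow> 0) (at_right 0)" by simp
 fix s t :: real assume st: "0 <= s" "s <= t"
 have "TN n t f - TN n s f = (\<Sum>j\<le>n. TN (n - j) s (TN j (t - s) f - TN j 0 f))"
  using TN_add[of s "t - s" n f] TN_add[of s 0 n f] st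
  by (simp add: linear_diff[OF TN_linear] sum_subtractf)
 then have "norm (TN n t f - TN n s f) <= (\<Sum>j\<le>n. CX * norm (TN j (t - s) f - TN j 0 f))"
  by (simp add: sum_norm_le TN_bound[OF st(1)])
 then show "norm (TN n t f - TN n s f) <= CX * (\<Sum>j\<le>n. norm (TN j (t - s) f - TN j 0 f))"
  by (simp add: sum_distrib_left)
qed

lemma TS_continuous: "continuous_on {0..} (\<lambda>t. TS t f)"
proof (rule continuous_on_of_modulus[where \<omega>="\<lambda>k. CX * norm (TS k f - f)"])
 have "((\<lambda>k. CX * norm (TS k f - f)) \<longlongrightarrow> CX * norm (f - f)) (at_right 0)"
  by (intro tendsto_mult tendsto_const tendsto_norm tendsto_diff TS_tendsto)
 then show "((\<lambda>k. CX * norm (TS k f - f)) \<longlongrightarrow> 0) (at_right 0)" by simp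
 fix s t :: real assume st: "0 <= s" "s <= t"
 then show "norm (TS t f - TS s f) <= CX * norm (TS (t - s) f - f)"
  using TS_add[of s "t - s" f] TS_bound[of s "TS (t - s) f - f"] by (simp add: linear_diff[OF TS_linear])
qed

section \<open>Mean values of the unperturbed semigroup\<close>

text \<open>The integral of \<open>T\<^sub>0(\<sigma>) F\<close> over \<open>\<sigma>\<close> from \<open>0\<close> to \<open>k\<close>, written as a function of \<open>x\<close>.\<close>

definition Eop :: "real => (real => 'a) => real => 'a" where
 "Eop k F x = (if 0 <= x then R (max 0 (x - k)) F x else 0)"

lemma Eop_measurable:
 assumes F: "bochner_borel F" and k: "0 <= k"
 shows "strongly_borel borel (Eop k F)"
proof -
 have "continuous_on UNIV (\<lambda>x. R (max 0 (max 0 x - k)) F (max 0 x))"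
  by (rule conv_continuous[OF regular_U F]) (use k in \<open>auto intro!: continuous_intros\<close>)
 then have "strongly_borel borel (\<lambda>x. if x \<in> {0..} then R (max 0 (max 0 x - k)) F (max 0 x) else 0)"
  by (intro strongly_borel_zero_outside strongly_borel_continuous) auto
 moreover have "(\<lambda>x. if x \<in> {0..} then R (max 0 (max 0 x - k)) F (max 0 x) else 0) = Eop k F"
  by (auto simp: fun_eq_iff Eop_def)
 ultimately show ?thesis by simp
qed

text \<open>At a point \<open>x\<close> the difference is an integral of increments of \<open>T\<^sub>0 s F\<close> over \<open>s\<close> from \<open>0\<close> to \<open>k\<close>, and Tonelli's theorem exchanges it with the norm of \<open>L\<^sup>1\<close>.\<close>

lemma Eop_mean:
 assumes F: "L1_rep F" and k: "0 <= k"
  and C: "\<And>s. 0 <= s ==> s <= k ==> norm (TN 0 s (abs_L1 F) - abs_L1 F) <= C"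
 shows "L1_rep (Eop k F)" "norm (abs_L1 (Eop k F) - k *\<^sub>R abs_L1 F) <= k * C"
proof -
 have C0: "0 <= C" using C[of 0] k norm_ge_zero order_trans by blast
 have Fb: "bochner_borel F" by (rule L1_repD(1)[OF F])
 have Fneg: "F x = 0" if "x < 0" for x by (rule L1_repD(2)[OF F that])
 define G where "G z = norm ((if 0 <= snd z \<and> snd z <= fst z
   then U (max (fst z) (max 0 (snd z))) (max 0 (snd z)) (F (snd z)) else 0) - F (fst z))" for z
 have c2: "strongly_borel borel (\<lambda>z::real \<times> real. F (snd z))"
  by (rule strongly_borel_compose[OF bochner_borelD(1)[OF Fb]]) (intro borel_measurable_continuous_onI continuous_intros)
 have c1: "strongly_borel borel (\<lambda>z::real \<times> real. F (fst z))"
  by (rule strongly_borel_compose[OF bochner_borelD(1)[OF Fb]]) (intro borel_measurable_continuous_onI continuous_intros)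
 have "closed {z::real \<times> real. 0 <= snd z \<and> snd z <= fst z}"
  by (intro closed_Collect_conj closed_Collect_le continuous_intros)
 then have cl: "{z\<in>space borel. 0 <= snd (z::real \<times> real) \<and> snd z <= fst z} \<in> sets borel" by simp
 have Gm: "G \<in> borel_measurable borel"
  unfolding G_def[abs_def]
  by (intro strongly_borel_norm strongly_borel_diff c1 strongly_borel_If[OF _ strongly_borel_const cl]
    strongly_borel_regular[OF regular_U _ _ _ _ c2]) (auto intro!: continuous_intros)
 have Gx[measurable]: "(\<lambda>q. G (x, q)) \<in> borel_measurable borel" for x
  by (rule measurable_compose[OF _ Gm]) (intro borel_measurable_continuous_onI continuous_intros)
 have pw: "ennreal (norm (Eop k F x - k *\<^sub>R F x)) <= (\<integral>\<^sup>+s. ennreal (G (x, x - s)) * indicator {0..k} s \<partial>lborel)" for x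
 proof (cases "0 <= x")
  case False
  then show ?thesis using Fneg[of x] by (simp add: Eop_def)
 next
  case True
  let ?y = "max 0 (x - k)"
  define h where "h q = (if q \<in> {?y..x} then U x q (F q) else 0) - (if q \<in> {x - k..x} then F x else 0)" for q
  have hb: "bochner_borel h"
   unfolding h_def
   by (intro bochner_borel_diff bochner_borel_regular(1)[OF regular_U _ Fb] bochner_borel_continuous continuous_intros) simp
  have "integral {x - k..x} h = integral {x - k..x} (\<lambda>q. if q \<in> {?y..x} then U x q (F q) else 0) - integral {x - k..x} (\<lambda>q. if q \<in> {x - k..x} then F x else 0)"
   unfolding h_def
   by (intro integral_diff bochner_borel_integrable_on(1) bochner_borel_regular(1)[OF regular_U _ Fb] bochner_borel_continuous continuous_intros) simp
  also have "\<dots> = Eop k F x - k *\<^sub>R F x"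
   using k True by (subst (1 2) integral_restrict_subset) (auto simp: Eop_def conv_def)
  finally have "norm (Eop k F x - k *\<^sub>R F x) <= integral {x - k..x} (\<lambda>q. norm (h q))"
   using norm_integral_le_bochner[OF hb, of "x - k" x] by simp
  then have "ennreal (norm (Eop k F x - k *\<^sub>R F x)) <= (\<integral>\<^sup>+q. ennreal (norm (h q)) * indicator {x - k..x} q \<partial>lborel)"
   unfolding bochner_borel_integrable_on(5)[OF hb, symmetric] by (rule ennreal_leI)
  also have "\<dots> = (\<integral>\<^sup>+q. ennreal (G (x, q)) * indicator {x - k..x} q \<partial>lborel)"
   by (intro nn_integral_cong) (auto simp: h_def G_def indicator_def max_def)
  also have "\<dots> = (\<integral>\<^sup>+s. ennreal (G (x, x + (-1) * s)) * indicator {x - k..x} (x + (-1) * s) \<partial>lborel)"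
   by (subst nn_integral_real_affine[where c="-1" and t=x]) auto
  also have "\<dots> = (\<integral>\<^sup>+s. ennreal (G (x, x - s)) * indicator {0..k} s \<partial>lborel)"
   by (intro nn_integral_cong) (auto simp: indicator_def)
  finally show ?thesis .
 qed
 have inner: "(\<integral>\<^sup>+x. ennreal (G (x, x - s)) * indicator {0..k} s \<partial>lborel) <= ennreal C * indicator {0..k} s" for s
 proof (cases "s \<in> {0..k}")
  case True
  have r: "L1_rep (shift U s F)" using shift_rep[OF admissible_regular[OF regular_U], of s F] F True by simp
  have "(\<integral>\<^sup>+x. ennreal (G (x, x - s)) * indicator {0..k} s \<partial>lborel) = (\<integral>\<^sup>+x. ennreal (norm (shift U s F x - F x)) \<partial>lborel)"
   using True by (intro nn_integral_cong) (auto simp: G_def shift_def max_def)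
  also have "\<dots> = ennreal (norm (TN 0 s (abs_L1 F) - abs_L1 F))"
   using True F by (simp add: TN_abs abs_L1_diff[OF r F] norm_abs_L1[OF L1_rep_diff[OF r F]])
  also have "\<dots> <= ennreal C" using C True by (intro ennreal_leI) auto
  finally show ?thesis using True by simp
 qed simp
 have "(\<lambda>z. ennreal (G (fst z, fst z - snd z)) * indicator {0..k} (snd z)) \<in> borel_measurable borel"
 proof -
  have "(\<lambda>z::real\<times>real. G (fst z, fst z - snd z)) \<in> borel_measurable borel"
   by (rule measurable_compose[OF _ Gm]) (intro borel_measurable_continuous_onI continuous_intros)
  moreover have "(\<lambda>z::real\<times>real. indicator {0..k} (snd z) :: ennreal) \<in> borel_measurable borel"
   by (rule measurable_compose[of snd _ borel]) (auto intro!: borel_measurable_continuous_onI continuous_intros)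
  ultimately show ?thesis by measurable
 qed
 then have m2: "(\<lambda>z. ennreal (G (fst z, fst z - snd z)) * indicator {0..k} (snd z)) \<in> borel_measurable (lborel \<Otimes>\<^sub>M lborel)"
  by (rule borel_pair_lborel)
 have "(\<integral>\<^sup>+x. ennreal (norm (Eop k F x - k *\<^sub>R F x)) \<partial>lborel) <= (\<integral>\<^sup>+x. (\<integral>\<^sup>+s. ennreal (G (x, x - s)) * indicator {0..k} s \<partial>lborel) \<partial>lborel)"
  by (intro nn_integral_mono pw)
 also have "\<dots> = (\<integral>\<^sup>+s. (\<integral>\<^sup>+x. ennreal (G (x, x - s)) * indicator {0..k} s \<partial>lborel) \<partial>lborel)"
  by (rule lborel_pair.Fubini'[symmetric]) (use m2 in \<open>simp add: case_prod_unfold\<close>)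
 also have "\<dots> <= (\<integral>\<^sup>+s. ennreal C * indicator {0..k} s \<partial>lborel)"
  by (intro nn_integral_mono inner)
 also have "\<dots> = ennreal (k * C)" using k C0 by (simp add: nn_integral_cmult_indicator ennreal_mult mult.commute)
 finally have le: "(\<integral>\<^sup>+x. ennreal (norm (Eop k F x - k *\<^sub>R F x)) \<partial>lborel) <= ennreal (k * C)" .
 have kF: "L1_rep (\<lambda>x. k *\<^sub>R F x)" by (rule L1_rep_scaleR[OF F])
 have "bochner_borel (\<lambda>x. Eop k F x - k *\<^sub>R F x)"
  unfolding bochner_borel_def
  using strongly_borel_diff[OF Eop_measurable[OF Fb k] bochner_borelD(1)[OF L1_repD(1)[OF kF]]] le_less_trans[OF le, of \<infinity>] by simp
 from bochner_borel_add[OF this L1_repD(1)[OF kF]] have "bochner_borel (Eop k F)" by simp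
 then show r: "L1_rep (Eop k F)" by (simp add: L1_rep_def) (simp add: Eop_def)
 show "norm (abs_L1 (Eop k F) - k *\<^sub>R abs_L1 F) <= k * C"
  unfolding abs_L1_scaleR[OF F] abs_L1_diff[OF r kF]
  by (rule norm_abs_L1_le[OF L1_rep_diff[OF r kF] le]) (use k C0 in simp)
qed

lemma Eop_rep: "L1_rep F ==> 0 <= k ==> L1_rep (Eop k F)"
proof (rule Eop_mean(1)[where C="CX * norm (abs_L1 F) + norm (abs_L1 F)"])
 fix s :: real assume "0 <= s"
 then show "norm (TN 0 s (abs_L1 F) - abs_L1 F) <= CX * norm (abs_L1 F) + norm (abs_L1 F)"
  using norm_triangle_ineq4[of "TN 0 s (abs_L1 F)" "abs_L1 F"] TN_bound[of s 0 "abs_L1 F"] by simp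
qed

lemma Eop_tendsto:
 assumes F: "L1_rep F"
 shows "((\<lambda>k. (1 / k) *\<^sub>R abs_L1 (Eop k F)) \<longlongrightarrow> abs_L1 F) (at_right 0)"
proof (rule tendstoI)
 fix e :: real assume e: "0 < e"
 have "\<forall>\<^sub>F k in at_right 0. dist (TN 0 k (abs_L1 F)) (abs_L1 F) < e / 2"
  by (rule tendstoD[OF TN0_tendsto]) (use e in simp)
 then obtain d where d: "0 < d" "\<And>k. 0 < k ==> k < d ==> norm (TN 0 k (abs_L1 F) - abs_L1 F) < e / 2"
  unfolding eventually_at_right_field dist_norm by auto
 have "norm ((1 / k) *\<^sub>R abs_L1 (Eop k F) - abs_L1 F) < e" if k: "0 < k" "k < d" for k
 proof -
  have s: "norm (TN 0 s (abs_L1 F) - abs_L1 F) <= e / 2" if "0 <= s" "s <= k" for s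
   using d(2)[of s] that k e by (cases "s = 0") (auto simp: TN_0)
  have "(1 / k) *\<^sub>R abs_L1 (Eop k F) - abs_L1 F = (1 / k) *\<^sub>R (abs_L1 (Eop k F) - k *\<^sub>R abs_L1 F)"
   using k by (simp add: scaleR_diff_right)
  then have "norm ((1 / k) *\<^sub>R abs_L1 (Eop k F) - abs_L1 F) <= (1 / k) * (k * (e / 2))"
   using mult_left_mono[OF Eop_mean(2)[OF F less_imp_le[OF k(1)] s], of "1 / k"] k by simp
  then show ?thesis using k e by simp
 qed
 then show "\<forall>\<^sub>F k in at_right 0. dist ((1 / k) *\<^sub>R abs_L1 (Eop k F)) (abs_L1 F) < e"
  unfolding eventually_at_right_field dist_norm using d(1) by auto
qed

text \<open>The cocycle identity of the integrals \<open>Eop k F\<close>, shared by \<open>\<phi> - TN 0 k \<phi>\<close>: two such cocycles coincide as soon as their difference is \<open>o(k)\<close>.\<close>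

lemma Eop_add:
 assumes F: "L1_rep F" and k: "0 <= k" and d: "0 <= d"
 shows "abs_L1 (Eop (k + d) F) = abs_L1 (Eop k F) + TN 0 k (abs_L1 (Eop d F))"
proof -
 have "Eop (k + d) F x = Eop k F x + shift U k (Eop d F) x" for x
 proof (cases "k <= x")
  case True
  then show ?thesis
   using R_split[OF L1_repD(1)[OF F], of "max 0 (x - (k + d))" "x - k" x] k d
   by (simp add: Eop_def shift_def algebra_simps)
 next
  case False
  then show ?thesis using d by (simp add: Eop_def shift_def)
 qed
 then have "Eop (k + d) F = (\<lambda>x. Eop k F x + shift U k (Eop d F) x)" by (rule ext)
 then show ?thesis
  using k d shift_rep[OF admissible_regular[OF regular_U] k Eop_rep[OF F d]]
  by (simp add: TN_abs Eop_rep[OF F] abs_L1_add)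
qed

text \<open>Both sides satisfy the cocycle identity of \<open>Eop_add\<close> and differ by \<open>o(k)\<close>. Subdividing the time \<open>k\<close> into \<open>n\<close> equal steps, the difference at \<open>k\<close> is at most a constant times \<open>n\<close> times the difference at \<open>k / n\<close>, which tends to \<open>0\<close>.\<close>

lemma generator_resolution:
 assumes F: "L1_rep F" and lim: "((\<lambda>k. (1 / k) *\<^sub>R (\<phi> - TN 0 k \<phi>)) \<longlongrightarrow> abs_L1 F) (at_right 0)" and k: "0 <= k"
 shows "\<phi> - TN 0 k \<phi> = abs_L1 (Eop k F)"
proof -
 define D' where "D' k = \<phi> - TN 0 k \<phi> - abs_L1 (Eop k F)" for k
 have add: "D' (k + d) = D' k + TN 0 k (D' d)" if "0 <= k" "0 <= d" for k d
  using that TN_add[of k d 0 \<phi>] by (simp add: D'_def Eop_add[OF F] linear_diff[OF TN_linear])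
 have mult: "norm (D' (real n * d)) <= real n * (CX * norm (D' d))" if d: "0 <= d" for n d
 proof (induction n)
  case 0
  have "D' 0 + TN 0 0 (D' 0) = D' 0" using add[of 0 0] by simp
  then show ?case by (simp add: TN_0)
 next
  case (Suc n)
  have "D' (real (Suc n) * d) = D' (real n * d) + TN 0 (real n * d) (D' d)"
   using add[of "real n * d" d] d by (simp add: algebra_simps)
  then have "norm (D' (real (Suc n) * d)) <= norm (D' (real n * d)) + CX * norm (D' d)"
   using norm_triangle_ineq[of "D' (real n * d)" "TN 0 (real n * d) (D' d)"] TN_bound[of "real n * d" 0 "D' d"] d by simp
  then show ?case using Suc by (simp add: algebra_simps)
 qed
 have "((\<lambda>k. (1 / k) *\<^sub>R (\<phi> - TN 0 k \<phi>) - (1 / k) *\<^sub>R abs_L1 (Eop k F)) \<longlongrightarrow> abs_L1 F - abs_L1 F) (at_right 0)"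
  by (intro tendsto_diff lim Eop_tendsto F)
 then have D0: "((\<lambda>k. (1 / k) *\<^sub>R D' k) \<longlongrightarrow> 0) (at_right 0)"
  by (simp add: D'_def scaleR_diff_right)
 have "D' k = 0"
 proof (cases "k = 0")
  case True
  then show ?thesis using mult[of 0 0] by simp
 next
  case False
  then have k: "0 < k" using k by simp
  have "(\<lambda>n. inverse (real (Suc n)) * k) \<longlonglongrightarrow> 0 * k"
   by (intro tendsto_mult LIMSEQ_inverse_real_of_nat tendsto_const)
  then have "filterlim (\<lambda>n. k / real (Suc n)) (at_right 0) sequentially"
   using k by (intro tendsto_imp_filterlim_at_right) (auto simp: field_simps)
  from filterlim_compose[OF D0 this]
  have "(\<lambda>n. CX * (k * norm ((1 / (k / real (Suc n))) *\<^sub>R D' (k / real (Suc n))))) \<longlonglongrightarrow> CX * (k * norm (0::'a L1))"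
   by (intro tendsto_mult tendsto_const tendsto_norm)
  then have lim0: "(\<lambda>n. CX * (k * norm ((1 / (k / real (Suc n))) *\<^sub>R D' (k / real (Suc n))))) \<longlonglongrightarrow> 0" by simp
  have "norm (D' k) <= CX * (k * norm ((1 / (k / real (Suc n))) *\<^sub>R D' (k / real (Suc n))))" for n
  proof -
   have "norm (D' (real (Suc n) * (k / real (Suc n)))) <= real (Suc n) * (CX * norm (D' (k / real (Suc n))))"
    by (rule mult) (use k in simp)
   also have "real (Suc n) * (k / real (Suc n)) = k" by simp
   finally show ?thesis using k by (simp add: mult.assoc mult.left_commute)
  qed
  then have "norm (D' k) <= 0" by (intro LIMSEQ_le_const[OF lim0]) auto
  then show ?thesis by simp
 qed
 then show ?thesis by (simp add: D'_def)
qed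

text \<open>For \<open>x < k\<close> the translated term in \<open>\<phi> - TN 0 k \<phi>\<close> vanishes at \<open>x\<close>, so the resolution formula determines \<open>\<phi>\<close> on every bounded interval.\<close>

lemma generator_resolvent:
 assumes F: "L1_rep F" and lim: "((\<lambda>k. (1 / k) *\<^sub>R (\<phi> - TN 0 k \<phi>)) \<longlongrightarrow> abs_L1 F) (at_right 0)"
 shows "L1_rep (\<lambda>x. if 0 <= x then R 0 F x else 0)" "\<phi> = abs_L1 (\<lambda>x. if 0 <= x then R 0 F x else 0)"
proof -
 obtain \<Phi> where \<Phi>: "L1_rep \<Phi>" "\<phi> = abs_L1 \<Phi>" by (rule L1_rep_ex)
 define H where "H x = (if 0 <= x then R 0 F x else 0)" for x
 have "AE x in lborel. \<forall>n. \<Phi> x - shift U (real n) \<Phi> x = Eop (real n) F x"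
  unfolding AE_all_countable
 proof
  fix n
  have r: "L1_rep (shift U (real n) \<Phi>)" by (rule shift_rep[OF admissible_regular[OF regular_U] _ \<Phi>(1)]) simp
  have "abs_L1 (\<lambda>x. \<Phi> x - shift U (real n) \<Phi> x) = abs_L1 (Eop (real n) F)"
   using generator_resolution[OF F lim, of "real n"] \<Phi> by (simp add: TN_abs abs_L1_diff[OF \<Phi>(1) r])
  then show "AE x in lborel. \<Phi> x - shift U (real n) \<Phi> x = Eop (real n) F x"
   unfolding abs_L1_eq_iff[OF L1_rep_diff[OF \<Phi>(1) r] Eop_rep[OF F of_nat_0_le_iff]] .
 qed
 then have ae: "AE x in lborel. \<Phi> x = H x"
 proof eventually_elim
  case (elim x)
  obtain n where n: "x < real n" using reals_Archimedean2 by blast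
  show ?case using elim[rule_format, of n] n L1_repD(2)[OF \<Phi>(1), of x]
   by (cases "0 <= x") (auto simp: shift_def Eop_def H_def)
 qed
 have "strongly_borel borel H"
 proof -
  have "continuous_on UNIV (\<lambda>x. R 0 F (max 0 x))"
   by (rule conv_continuous[OF regular_U L1_repD(1)[OF F]]) (auto intro!: continuous_intros)
  then have "strongly_borel borel (\<lambda>x. if x \<in> {0..} then R 0 F (max 0 x) else 0)"
   by (intro strongly_borel_zero_outside strongly_borel_continuous) auto
  moreover have "(\<lambda>x. if x \<in> {0..} then R 0 F (max 0 x) else 0) = H" by (auto simp: fun_eq_iff H_def)
  ultimately show ?thesis by simp
 qed
 moreover have "(\<integral>\<^sup>+x. ennreal (norm (H x)) \<partial>lborel) = (\<integral>\<^sup>+x. ennreal (norm (\<Phi> x)) \<partial>lborel)"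
  by (rule nn_integral_cong_AE) (use ae in eventually_elim, simp)
 ultimately have H: "L1_rep H"
  using bochner_borelD(2)[OF L1_repD(1)[OF \<Phi>(1)]] by (simp add: L1_rep_def bochner_borel_def H_def)
 then show "L1_rep (\<lambda>x. if 0 <= x then R 0 F x else 0)" by (simp add: H_def[abs_def])
 show "\<phi> = abs_L1 (\<lambda>x. if 0 <= x then R 0 F x else 0)"
  using ae unfolding \<Phi>(2) H_def[abs_def, symmetric] abs_L1_eq_iff[OF \<Phi>(1) H] .
qed

section \<open>The perturbation on mean values\<close>

text \<open>The representatives on the intervals from \<open>0\<close> to an integer agree almost everywhere on their common domains, so they can be glued, and the mass bound is uniform.\<close>

lemma B_conv_halfline:
 assumes f: "bochner_borel f" "\<And>q. 0 <= f q"
 obtains w where "L1_rep w" "\<And>r. 0 <= w r" "AE r in lborel. 0 <= r --> R 0 f r \<in> D r \<and> B r (R 0 f r) = w r"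
proof -
 define P where "P n w \<longleftrightarrow> bochner_borel w \<and> (\<forall>r. 0 <= w r) \<and>
   (AE r in lborel. r \<in> {0..real (Suc n)} --> R 0 f r \<in> D r \<and> B r (R 0 f r) = w r) \<and>
   integral {0..real (Suc n)} (\<lambda>r. norm (w r)) <= integral {0..real (Suc n)} (\<lambda>r. norm (f r))" for n w
 have ex: "\<exists>w. P n w" for n
 proof -
  have T: "0 <= real (Suc n)" by simp
  obtain w where w: "bochner_borel w" "\<And>r. 0 <= w r"
   "AE r in lborel. r \<in> {0..real (Suc n)} --> R 0 f r \<in> D r \<and> B r (R 0 f r) = w r"
   "integral {0..real (Suc n)} (\<lambda>r. norm (w r)) + norm (R 0 f (real (Suc n))) <= integral {0..real (Suc n)} (\<lambda>r. norm (f r))"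
   by (rule B_conv[OF f order_refl T]) (rule that)
  have "integral {0..real (Suc n)} (\<lambda>r. norm (w r)) <= integral {0..real (Suc n)} (\<lambda>r. norm (f r))"
   using w(4) norm_ge_zero[of "R 0 f (real (Suc n))"] by linarith
  then show ?thesis using w unfolding P_def by blast
 qed
 define v where "v n = (SOME w. P n w)" for n
 have "P n (v n)" for n unfolding v_def by (rule someI_ex[OF ex])
 then have v: "bochner_borel (v n)" "0 <= v n r"
   "AE r in lborel. r \<in> {0..real (Suc n)} --> R 0 f r \<in> D r \<and> B r (R 0 f r) = v n r"
   "integral {0..real (Suc n)} (\<lambda>r. norm (v n r)) <= integral {0..real (Suc n)} (\<lambda>r. norm (f r))" for n r
  by (auto simp: P_def)
 define w where "w r = (if 0 <= r then v (nat \<lfloor>r\<rfloor>) r else 0)" for r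
 have floor_iff: "nat \<lfloor>r\<rfloor> = i \<longleftrightarrow> r \<in> {real i..<real (Suc i)}" if "0 <= r" for r i
  using that by (auto simp: nat_eq_iff floor_eq_iff)
 have w_lim: "(\<lambda>N. \<Sum>i<N. if r \<in> {real i..<real (Suc i)} then v i r else 0) \<longlonglongrightarrow> w r" for r
 proof (rule tendsto_eventually)
  have eq: "(\<Sum>i<N. if r \<in> {real i..<real (Suc i)} then v i r else 0) = w r" if N: "nat \<lfloor>r\<rfloor> < N" for N
  proof (cases "0 <= r")
   case True
   have "(\<Sum>i<N. if r \<in> {real i..<real (Suc i)} then v i r else 0) = (\<Sum>i<N. if i = nat \<lfloor>r\<rfloor> then v i r else 0)"
    by (rule sum.cong[OF refl]) (simp only: floor_iff[OF True, symmetric] eq_commute[of "nat \<lfloor>r\<rfloor>"])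
   then show ?thesis using N True by (simp add: w_def)
  qed (auto simp: w_def intro!: sum.neutral)
  show "\<forall>\<^sub>F N in sequentially. (\<Sum>i<N. if r \<in> {real i..<real (Suc i)} then v i r else 0) = w r"
   using eventually_gt_at_top[of "nat \<lfloor>r\<rfloor>"] by eventually_elim (rule eq)
 qed
 have wm: "strongly_borel borel w"
  by (rule strongly_borel_limit[OF _ w_lim])
   (intro bochner_borelD(1) bochner_borel_sum bochner_borel_restrict v(1), auto)
 have ae: "AE r in lborel. 0 <= r --> R 0 f r \<in> D r \<and> B r (R 0 f r) = w r"
  "AE r in lborel. r \<in> {0..real (Suc n)} --> w r = v n r" for n
 proof -
  have "AE r in lborel. \<forall>n. r \<in> {0..real (Suc n)} --> R 0 f r \<in> D r \<and> B r (R 0 f r) = v n r"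
   unfolding AE_all_countable using v(3) by blast
  then show *: "AE r in lborel. 0 <= r --> R 0 f r \<in> D r \<and> B r (R 0 f r) = w r"
  proof eventually_elim
   case (elim r)
   have "r \<in> {0..real (Suc (nat \<lfloor>r\<rfloor>))}" if "0 <= r" using floor_iff[OF that, of "nat \<lfloor>r\<rfloor>"] that by auto
   then show ?case using elim[THEN spec, of "nat \<lfloor>r\<rfloor>"] by (simp add: w_def del: atLeastAtMost_iff of_nat_Suc)
  qed
  show "AE r in lborel. r \<in> {0..real (Suc n)} --> w r = v n r"
   using * v(3)[of n] by eventually_elim auto
 qed
 have wn[measurable]: "(\<lambda>r. norm (w r)) \<in> borel_measurable borel" by (rule strongly_borel_norm[OF wm])
 have le: "(\<integral>\<^sup>+r. ennreal (norm (w r)) * indicator {0..real (Suc n)} r \<partial>lborel) <= (\<integral>\<^sup>+r. ennreal (norm (f r)) \<partial>lborel)" for n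
 proof -
  have "(\<integral>\<^sup>+r. ennreal (norm (w r)) * indicator {0..real (Suc n)} r \<partial>lborel) = (\<integral>\<^sup>+r. ennreal (norm (v n r)) * indicator {0..real (Suc n)} r \<partial>lborel)"
   by (rule nn_integral_cong_AE) (use ae(2)[of n] in eventually_elim, auto simp: indicator_def)
  also have "\<dots> <= (\<integral>\<^sup>+r. ennreal (norm (f r)) * indicator {0..real (Suc n)} r \<partial>lborel)"
   unfolding bochner_borel_integrable_on(5)[OF v(1), symmetric] bochner_borel_integrable_on(5)[OF f(1), symmetric]
   by (rule ennreal_leI[OF v(4)])
  also have "\<dots> <= (\<integral>\<^sup>+r. ennreal (norm (f r)) \<partial>lborel)"
   by (intro nn_integral_mono) (auto simp: indicator_def)
  finally show ?thesis .
 qed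
 have "(\<integral>\<^sup>+r. ennreal (norm (w r)) \<partial>lborel) = (\<integral>\<^sup>+r. liminf (\<lambda>n. ennreal (norm (w r)) * indicator {0..real (Suc n)} r) \<partial>lborel)"
 proof (rule nn_integral_cong)
  fix r
  obtain m where m: "r <= real m" using real_arch_simple by blast
  have "\<forall>\<^sub>F n in sequentially. ennreal (norm (w r)) * indicator {0..real (Suc n)} r = ennreal (norm (w r))"
   using eventually_ge_at_top[of m] by eventually_elim (use m in \<open>auto simp: indicator_def w_def\<close>)
  then have "(\<lambda>n. ennreal (norm (w r)) * indicator {0..real (Suc n)} r) \<longlonglongrightarrow> ennreal (norm (w r))"
   by (rule tendsto_eventually)
  then show "ennreal (norm (w r)) = liminf (\<lambda>n. ennreal (norm (w r)) * indicator {0..real (Suc n)} r)"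
   using lim_imp_Liminf sequentially_bot by fastforce
 qed
 also have "\<dots> <= liminf (\<lambda>n. \<integral>\<^sup>+r. ennreal (norm (w r)) * indicator {0..real (Suc n)} r \<partial>lborel)"
  by (rule nn_integral_liminf) measurable
 also have "\<dots> <= (\<integral>\<^sup>+r. ennreal (norm (f r)) \<partial>lborel)"
  by (rule order_trans[OF Liminf_le_Limsup Limsup_bounded]) (use le in \<open>auto intro!: always_eventually\<close>)
 also have "\<dots> < \<infinity>" by (rule bochner_borelD(2)[OF f(1)])
 finally have "L1_rep w" using wm by (simp add: L1_rep_def bochner_borel_def w_def)
 then show thesis by (rule that[OF _ _ ae(1)]) (simp add: w_def v(2))
qed

text \<open>Pointwise bounds by the errors of one step of length \<open>k\<close> are \<open>o(k)\<close> in the norm of \<open>L\<^sup>1\<close>.\<close>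

lemma err_mean_dominated:
 fixes f :: "real => 'a L1"
 assumes Z: "\<And>k. 0 < k ==> L1_rep (Z k)" "\<And>k. 0 < k ==> f k = abs_L1 (Z k)"
  and p: "\<And>i. i < (3::nat) ==> L1_rep (p i)" "\<And>i q. i < 3 ==> 0 <= p i q"
  and le: "\<And>k x. 0 < k ==> 0 <= x ==> norm (Z k x) <= (\<Sum>i<3. err (p i) (max 0 (x - k)) x)"
 shows "((\<lambda>k. (1 / k) *\<^sub>R f k) \<longlongrightarrow> 0) (at_right 0)"
proof -
 have bound: "ennreal (norm ((1 / k) *\<^sub>R f k)) <= (\<Sum>i<3. err_mean (p i) k)" if k: "0 < k" for k
 proof -
  have m: "(\<lambda>x. ennreal (err (p i) (max 0 (x - k)) x) * indicator {0..} x) \<in> borel_measurable lborel" if "i < 3" for i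
   using err_measurable[OF L1_repD(1)[OF p(1)[OF that]] p(2)[OF that], of k] by simp
  have "ennreal (norm (f k)) = (\<integral>\<^sup>+x. ennreal (norm (Z k x)) \<partial>lborel)"
   unfolding Z(2)[OF k] by (rule norm_abs_L1[OF Z(1)[OF k]])
  also have "\<dots> <= (\<integral>\<^sup>+x. (\<Sum>i<3. ennreal (err (p i) (max 0 (x - k)) x) * indicator {0..} x) \<partial>lborel)"
  proof (rule nn_integral_mono)
   fix x
   show "ennreal (norm (Z k x)) <= (\<Sum>i<3. ennreal (err (p i) (max 0 (x - k)) x) * indicator {0..} x)"
   proof (cases "0 <= x")
    case True
    have "0 <= err (p i) (max 0 (x - k)) x" if "i < 3" for i
     by (rule err_nonneg[OF L1_repD(1)[OF p(1)[OF that]] p(2)[OF that]]) simp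
    then have "(\<Sum>i<3. ennreal (err (p i) (max 0 (x - k)) x)) = ennreal (\<Sum>i<3. err (p i) (max 0 (x - k)) x)"
     by (intro sum_ennreal) simp
    then show ?thesis using ennreal_leI[OF le[OF k True]] True by simp
   qed (use L1_repD(2)[OF Z(1)[OF k], of x] in simp)
  qed
  also have "\<dots> = (\<Sum>i<3. \<integral>\<^sup>+x. ennreal (err (p i) (max 0 (x - k)) x) * indicator {0..} x \<partial>lborel)"
   by (rule nn_integral_sum) (use m in auto)
  finally have "ennreal (norm (f k)) / ennreal k <= (\<Sum>i<3. \<integral>\<^sup>+x. ennreal (err (p i) (max 0 (x - k)) x) * indicator {0..} x \<partial>lborel) / ennreal k"
   by (rule divide_right_mono_ennreal)
  also have "\<dots> = (\<Sum>i<3. err_mean (p i) k)"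
   by (simp add: divide_ennreal_def sum_distrib_right)
  finally show ?thesis using k by (simp add: divide_ennreal)
 qed
 have "((\<lambda>k. \<Sum>i<3. err_mean (p i) k) \<longlongrightarrow> (\<Sum>i<(3::nat). 0)) (at_right 0)"
  by (intro tendsto_sum err_mean_tendsto_0) (use L1_repD p in auto)
 then have z: "((\<lambda>k. \<Sum>i<3. err_mean (p i) k) \<longlongrightarrow> 0) (at_right 0)" by simp
 have "((\<lambda>k. ennreal (norm ((1 / k) *\<^sub>R f k))) \<longlongrightarrow> 0) (at_right 0)"
 proof (rule tendsto_sandwich[OF _ _ tendsto_const z])
  show "\<forall>\<^sub>F k in at_right 0. ennreal (norm ((1 / k) *\<^sub>R f k)) <= (\<Sum>i<3. err_mean (p i) k)"
   using eventually_at_right_less[of 0] by eventually_elim (rule bound)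
 qed simp
 then have "((\<lambda>k. ennreal (norm ((1 / k) *\<^sub>R f k))) \<longlongrightarrow> ennreal 0) (at_right 0)" by simp
 then have "((\<lambda>k. norm ((1 / k) *\<^sub>R f k)) \<longlongrightarrow> 0) (at_right 0)"
  by (rule tendsto_ennrealD) (auto intro!: always_eventually)
 then show ?thesis by (rule tendsto_norm_zero_cancel)
qed

text \<open>An element of the domain of the generator of \<open>T\<^sub>0\<close> is the variation-of-constants integral of its image. Splitting this source into positive parts, \<open>B\<close> can be applied pointwise by increasing closedness, and the estimate for one step compares \<open>V\<^sub>1\<close> over a step of length \<open>k\<close> with the mean \<open>Eop k\<close> of the result.\<close>

lemma perturbation_on_domain:
 assumes F: "L1_rep F" and lim: "((\<lambda>k. (1 / k) *\<^sub>R (\<phi> - TN 0 k \<phi>)) \<longlongrightarrow> abs_L1 F) (at_right 0)" and \<phi>: "0 <= \<phi>"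
 obtains w where "0 <= w" "((\<lambda>k. (1 / k) *\<^sub>R TN (Suc 0) k \<phi>) \<longlongrightarrow> w) (at_right 0)"
  "\<And>j. ((\<lambda>k. (1 / k) *\<^sub>R TN (Suc (Suc j)) k \<phi>) \<longlongrightarrow> 0) (at_right 0)"
  "((\<lambda>k. (1 / k) *\<^sub>R (TS k \<phi> - TN 0 k \<phi>)) \<longlongrightarrow> w) (at_right 0)"
proof -
 define H where "H x = (if 0 <= x then R 0 F x else 0)" for x
 have H: "L1_rep H" "\<phi> = abs_L1 H"
  using generator_resolvent[OF F lim] by (simp_all add: H_def[abs_def])
 have H_pos: "AE x in lborel. 0 <= H x"
  using \<phi> unfolding H(2) abs_L1_zero[symmetric] abs_L1_le_iff[OF L1_rep_zero H(1)] .
 have H0: "H 0 = 0" by (simp add: H_def conv_def)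
 obtain p n where pn: "0 <= p" "0 <= n" "abs_L1 F = p - n" using X.cone_generating by blast
 obtain P where P: "L1_rep P" "p = abs_L1 P" "\<And>x. 0 <= P x" by (rule L1_rep_cone[OF pn(1)]) (rule that)
 obtain N where N: "L1_rep N" "n = abs_L1 N" "\<And>x. 0 <= N x" by (rule L1_rep_cone[OF pn(2)]) (rule that)
 have FPN: "AE x in lborel. F x = P x - N x"
  using pn(3) unfolding P(2) N(2) abs_L1_diff[OF P(1) N(1)] abs_L1_eq_iff[OF F L1_rep_diff[OF P(1) N(1)]] .
 have RF: "R y F x = R y P x - R y N x" if y: "0 <= y" for y x
 proof -
  have "R y F x = integral {y..x} (\<lambda>q. U x q (P q) - U x q (N q))"
   unfolding conv_def
  proof (rule integral_AE_cong(1))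
   show "AE q in lborel. q \<in> {y..x} --> U x q (F q) = U x q (P q) - U x q (N q)"
    using FPN by eventually_elim (use y in \<open>simp add: linear_diff[OF U_linear]\<close>)
  qed
  then show ?thesis
   unfolding conv_def using y
   by (simp add: integral_diff bochner_borel_regular(2)[OF regular_U] L1_repD(1)[OF P(1)] L1_repD(1)[OF N(1)])
 qed
 obtain v where v: "L1_rep v" "AE r in lborel. 0 <= r --> R 0 P r \<in> D r \<and> B r (R 0 P r) = v r"
  by (rule B_conv_halfline[OF L1_repD(1)[OF P(1)] P(3)]) (rule that)
 obtain v' where v': "L1_rep v'" "AE r in lborel. 0 <= r --> R 0 N r \<in> D r \<and> B r (R 0 N r) = v' r"
  by (rule B_conv_halfline[OF L1_repD(1)[OF N(1)] N(3)]) (rule that)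
 have d: "L1_rep (\<lambda>r. v r - v' r)" by (rule L1_rep_diff[OF v(1) v'(1)])
 have "(\<lambda>r. v r - v' r) -` {u. 0 <= u} \<inter> space borel \<in> sets borel"
  by (rule measurable_sets[OF strongly_borel_measurable[OF bochner_borelD(1)[OF L1_repD(1)[OF d]]] cone_borel])
 then have A: "{r. 0 <= v r - v' r} \<in> sets borel" by (simp add: vimage_def)
 define G where "G r = (if r \<in> {r. 0 <= v r - v' r} then v r - v' r else 0)" for r
 have G: "L1_rep G" "0 <= G r" for r
 proof -
  have "bochner_borel G" unfolding G_def by (rule bochner_borel_restrict[OF L1_repD(1)[OF d] A])
  then show "L1_rep G" using L1_repD(2)[OF v(1)] L1_repD(2)[OF v'(1)] by (auto simp: L1_rep_def G_def)
 qed (simp add: G_def)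
 have BG: "AE r in lborel. 0 <= r --> B r (R 0 F r) = G r"
  using v(2) v'(2) H_pos
 proof eventually_elim
  case (elim r)
  show ?case
  proof
   assume r: "0 <= r"
   have eq: "B r (R 0 F r) = v r - v' r" using elim r by (simp add: RF B_diff)
   have "R 0 F r \<in> D r" using elim r subspace_diff[OF dom_subspace[OF r]] by (simp add: RF)
   then have "0 <= v r - v' r" using B_pos[OF r _, of "R 0 F r"] elim(3) r by (simp add: H_def eq)
   then show "B r (R 0 F r) = G r" using eq by (simp add: G_def)
  qed
 qed
 define p3 where "p3 i = (if i = 0 then G else if i = 1 then P else N)" for i :: nat
 have p3: "L1_rep (p3 i)" "0 <= p3 i q" for i q by (simp_all add: p3_def G P N)
 have p3_sum: "(\<Sum>i<3. err (p3 i) y x) = err G y x + err P y x + err N y x" for y x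
  by (simp add: p3_def numeral_3_eq_3)
 have st: "norm (V (Suc 0) x y (H y) - R y G x) <= err P y x + err N y x"
  "norm (V (Suc (Suc j)) x y (H y)) <= err G y x + err P y x + err N y x"
  "norm (VV x y (H y) - U x y (H y) - R y G x) <= err G y x + err P y x + err N y x"
  if y: "0 <= y" "y <= x" for x y j
 proof -
  have "AE q in lborel. q \<in> {y..x} --> B q (U q y (H y) + R y P q - R y N q) = G q"
   using BG
  proof eventually_elim
   case (elim q)
   have "U q y (H y) + R y P q - R y N q = R 0 F q" if "q \<in> {y..x}"
    using R_split[OF L1_repD(1)[OF F], of 0 y q] RF[OF y(1), of q] y that by (simp add: H_def)
   then show ?case using elim y by auto
  qed
  note s = step[OF y L1_repD(1)[OF P(1)] P(3) L1_repD(1)[OF N(1)] N(3) L1_repD(1)[OF G(1)] G(2) this]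
  show "norm (V (Suc 0) x y (H y) - R y G x) <= err P y x + err N y x"
   "norm (V (Suc (Suc j)) x y (H y)) <= err G y x + err P y x + err N y x"
   "norm (VV x y (H y) - U x y (H y) - R y G x) <= err G y x + err P y x + err N y x"
   by (fact s(1), fact s(2), fact s(3))
 qed
 have sh: "shift W k H x = W x (max 0 (x - k)) (H (max 0 (x - k)))" if "admissible W" "0 < k" "0 <= x" for W k x
 proof (cases "k <= x")
  case False
  then show ?thesis using that(3) linear_0[OF admissibleD(1)[OF that(1) order_refl that(3)]] by (simp add: shift_def H0)
 qed (simp add: shift_def)
 have errG: "0 <= err G y x" if "0 <= y" for y x by (rule err_nonneg[OF L1_repD(1)[OF G(1)] G(2) that])
 have rE: "L1_rep (Eop k G)" if "0 < k" for k using Eop_rep[OF G(1)] that by simp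
 have rV: "L1_rep (shift (V m) k H)" if "0 < k" for k m using shift_rep[OF admissible_V _ H(1)] that by simp
 have rVV: "L1_rep (shift VV k H)" if "0 < k" for k using shift_rep[OF admissible_VV _ H(1)] that by simp
 have rU: "L1_rep (shift U k H)" if "0 < k" for k using rV[of k 0] that by simp
 note EG = Eop_tendsto[OF G(1)]
 have l1: "((\<lambda>k. (1 / k) *\<^sub>R (TN (Suc 0) k \<phi> - abs_L1 (Eop k G))) \<longlongrightarrow> 0) (at_right 0)"
 proof (rule err_mean_dominated[where Z="\<lambda>k x. shift (V (Suc 0)) k H x - Eop k G x" and p=p3])
  fix k :: real assume k: "0 < k"
  show "L1_rep (\<lambda>x. shift (V (Suc 0)) k H x - Eop k G x)" by (intro L1_rep_diff rV rE k)
  show "TN (Suc 0) k \<phi> - abs_L1 (Eop k G) = abs_L1 (\<lambda>x. shift (V (Suc 0)) k H x - Eop k G x)"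
   using k by (simp add: H(2) TN_abs H(1) abs_L1_diff rV rE del: dyson.simps)
  fix x :: real assume x: "0 <= x"
  show "norm (shift (V (Suc 0)) k H x - Eop k G x) <= (\<Sum>i<3. err (p3 i) (max 0 (x - k)) x)"
   unfolding p3_sum sh[OF admissible_V k x] using st(1)[of "max 0 (x - k)" x] errG[of "max 0 (x - k)" x] k x
   by (simp add: Eop_def del: dyson.simps)
 qed (use p3 in auto)
 have l2: "((\<lambda>k. (1 / k) *\<^sub>R TN (Suc (Suc j)) k \<phi>) \<longlongrightarrow> 0) (at_right 0)" for j
 proof (rule err_mean_dominated[where Z="\<lambda>k x. shift (V (Suc (Suc j))) k H x" and p=p3])
  fix k :: real assume k: "0 < k"
  show "L1_rep (\<lambda>x. shift (V (Suc (Suc j))) k H x)" by (rule rV[OF k])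
  show "TN (Suc (Suc j)) k \<phi> = abs_L1 (\<lambda>x. shift (V (Suc (Suc j))) k H x)"
   using k by (simp add: H(2) TN_abs H(1) del: dyson.simps)
  fix x :: real assume x: "0 <= x"
  show "norm (shift (V (Suc (Suc j))) k H x) <= (\<Sum>i<3. err (p3 i) (max 0 (x - k)) x)"
   unfolding p3_sum sh[OF admissible_V k x] by (rule st(2)) (use k x in auto)
 qed (use p3 in auto)
 have l3: "((\<lambda>k. (1 / k) *\<^sub>R (TS k \<phi> - TN 0 k \<phi> - abs_L1 (Eop k G))) \<longlongrightarrow> 0) (at_right 0)"
 proof (rule err_mean_dominated[where Z="\<lambda>k x. shift VV k H x - shift U k H x - Eop k G x" and p=p3])
  fix k :: real assume k: "0 < k"
  show "L1_rep (\<lambda>x. shift VV k H x - shift U k H x - Eop k G x)" by (intro L1_rep_diff rVV rU rE k)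
  show "TS k \<phi> - TN 0 k \<phi> - abs_L1 (Eop k G) = abs_L1 (\<lambda>x. shift VV k H x - shift U k H x - Eop k G x)"
   using k by (simp add: H(2) TN_abs TS_abs H(1) abs_L1_diff L1_rep_diff rVV rU rE)
  fix x :: real assume x: "0 <= x"
  show "norm (shift VV k H x - shift U k H x - Eop k G x) <= (\<Sum>i<3. err (p3 i) (max 0 (x - k)) x)"
   unfolding p3_sum sh[OF admissible_VV k x] sh[OF admissible_regular[OF regular_U] k x]
   using st(3)[of "max 0 (x - k)" x] k x by (simp add: Eop_def)
 qed (use p3 in auto)
 show thesis
 proof (rule that[of "abs_L1 G"])
  show "0 <= abs_L1 G" by (rule abs_L1_nonneg[OF G])
  show "((\<lambda>k. (1 / k) *\<^sub>R TN (Suc 0) k \<phi>) \<longlongrightarrow> abs_L1 G) (at_right 0)"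
   using tendsto_add[OF l1 EG] by (simp add: scaleR_diff_right)
  show "((\<lambda>k. (1 / k) *\<^sub>R TN (Suc (Suc j)) k \<phi>) \<longlongrightarrow> 0) (at_right 0)" for j by (rule l2)
  show "((\<lambda>k. (1 / k) *\<^sub>R (TS k \<phi> - TN 0 k \<phi>)) \<longlongrightarrow> abs_L1 G) (at_right 0)"
   using tendsto_add[OF l3 EG] by (simp add: scaleR_diff_right)
 qed
qed

section \<open>The defect functional\<close>

definition Phi :: "nat => real => 'a L1 => 'a L1" where
 "Phi n h g = integral {0..h} (\<lambda>s. TN n s g)"

lemma TN_integrable: "0 <= a ==> (\<lambda>s. TN n s g) integrable_on {a..b}"
 by (intro integrable_continuous_real continuous_on_subset[OF TN_continuous]) auto

lemma TS_integrable: "0 <= a ==> (\<lambda>s. TS s g) integrable_on {a..b}"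
 by (intro integrable_continuous_real continuous_on_subset[OF TS_continuous]) auto

lemma integral_bounded_linear:
 assumes "f integrable_on A" "bounded_linear T"
 shows "integral A (\<lambda>s. T (f s)) = T (integral A f)" "(\<lambda>s. T (f s)) integrable_on A"
 using integral_linear[OF assms] integrable_linear[OF assms] by (simp_all add: o_def)

lemma Phi_cone: "0 <= g ==> 0 <= Phi n h g"
 unfolding Phi_def by (rule X.integral_cone) (simp add: TN_cone)

lemma Phi_linear: "linear (Phi n h)"
proof (rule linearI)
 have e: "{0..h} \<subseteq> {0..}" by auto
 show "Phi n h (f + g) = Phi n h f + Phi n h g" for f g
  unfolding Phi_def
  by (subst integral_add[symmetric, OF TN_integrable TN_integrable])
   (auto intro!: integral_cong simp: linear_add[OF TN_linear])
 show "Phi n h (c *\<^sub>R f) = c *\<^sub>R Phi n h f" for c f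
  unfolding Phi_def integral_cmul[symmetric]
  by (rule integral_cong) (simp add: linear_cmul[OF TN_linear])
qed

text \<open>Integrate \<open>TN m (s + k) g = (\<Sum>j\<le>m. TN (m - j) k (TN j s g))\<close> over \<open>s\<close>.\<close>

lemma TN0_Phi:
 assumes h: "0 <= h" and k: "0 <= k"
 shows "TN 0 k (Phi m h g) - Phi m h g
   = integral {0..h} (\<lambda>s. TN m (s + k) g - TN m s g) - (\<Sum>j<m. TN (m - j) k (Phi j h g))"
proof -
 have i: "(\<lambda>s. TN n k (TN j s g)) integrable_on {0..h}" "integral {0..h} (\<lambda>s. TN n k (TN j s g)) = TN n k (Phi j h g)" for n j
  using integral_bounded_linear[OF TN_integrable[OF order_refl] TN_bounded_linear[OF k]] by (simp_all add: Phi_def)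
 have eq: "TN m (s + k) g = TN 0 k (TN m s g) + (\<Sum>j<m. TN (m - j) k (TN j s g))" if "s \<in> {0..h}" for s
 proof -
  have "TN m (s + k) g = (\<Sum>j\<in>insert m {..<m}. TN (m - j) k (TN j s g))"
   using TN_add[OF k, of s m g] that by (simp add: add.commute lessThan_Suc_atMost[symmetric] lessThan_Suc)
  then show ?thesis by simp
 qed
 have "integral {0..h} (\<lambda>s. TN m (s + k) g - TN m s g)
   = integral {0..h} (\<lambda>s. TN 0 k (TN m s g) + (\<Sum>j<m. TN (m - j) k (TN j s g)) - TN m s g)"
  by (rule integral_cong) (simp add: eq)
 also have "\<dots> = TN 0 k (Phi m h g) + (\<Sum>j<m. TN (m - j) k (Phi j h g)) - Phi m h g"
  using i TN_integrable[OF order_refl, of m g h]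
  by (simp add: integral_diff integral_add integral_sum integrable_add integrable_sum Phi_def[symmetric])
 finally show ?thesis by simp
qed

text \<open>Induction on \<open>m\<close>. After division by \<open>k\<close> the identity for \<open>TN 0 k (Phi m h g)\<close> has a limit, because the terms \<open>TN (m - j) k (Phi j h g)\<close> with \<open>m - j \<ge> 2\<close> are \<open>o(k)\<close> and the one with \<open>m - j = 1\<close> converges by induction. Hence \<open>Phi m h g\<close> is in the domain of the generator of \<open>T\<^sub>0\<close>, where the perturbation is known.\<close>

lemma Phi_domain:
 assumes h: "0 <= h" and g: "0 <= g"
 shows "\<exists>w v. 0 <= w \<and> ((\<lambda>k. (1 / k) *\<^sub>R TN (Suc 0) k (Phi m h g)) \<longlongrightarrow> w) (at_right 0)
  \<and> (\<forall>j. ((\<lambda>k. (1 / k) *\<^sub>R TN (Suc (Suc j)) k (Phi m h g)) \<longlongrightarrow> 0) (at_right 0))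
  \<and> ((\<lambda>k. (1 / k) *\<^sub>R (TS k (Phi m h g) - TN 0 k (Phi m h g))) \<longlongrightarrow> w) (at_right 0)
  \<and> ((\<lambda>k. (1 / k) *\<^sub>R (Phi m h g - TN 0 k (Phi m h g))) \<longlongrightarrow> TN m 0 g - TN m h g + v) (at_right 0)
  \<and> (if m = 0 then v = 0 else ((\<lambda>k. (1 / k) *\<^sub>R TN (Suc 0) k (Phi (m - 1) h g)) \<longlongrightarrow> v) (at_right 0))"
proof (induction m rule: less_induct)
 case (less m)
 have "\<exists>v. (if m = 0 then v = 0 else ((\<lambda>k. (1 / k) *\<^sub>R TN (Suc 0) k (Phi (m - 1) h g)) \<longlongrightarrow> v) (at_right 0))"
  using less[of "m - 1"] by (cases "m = 0") auto
 then obtain v where v: "if m = 0 then v = 0 else ((\<lambda>k. (1 / k) *\<^sub>R TN (Suc 0) k (Phi (m - 1) h g)) \<longlongrightarrow> v) (at_right 0)" by blast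
 have "((\<lambda>k. (1 / k) *\<^sub>R TN (m - j) k (Phi j h g)) \<longlongrightarrow> (if j = m - 1 then v else 0)) (at_right 0)" if j: "j < m" for j
 proof (cases "j = m - 1")
  case True
  then have "m - j = Suc 0" using j by simp
  then show ?thesis using v True j by simp
 next
  case False
  then obtain i where "m - j = Suc (Suc i)" using j by (metis Suc_diff_Suc Suc_lessI diff_Suc_1)
  then show ?thesis using less[OF j] False by auto
 qed
 then have "((\<lambda>k. \<Sum>j<m. (1 / k) *\<^sub>R TN (m - j) k (Phi j h g)) \<longlongrightarrow> (\<Sum>j<m. if j = m - 1 then v else 0)) (at_right 0)"
  by (intro tendsto_sum) auto
 moreover have "(\<Sum>j<m. if j = m - 1 then v else 0) = v" using v by (cases "m = 0") auto
 ultimately have s: "((\<lambda>k. \<Sum>j<m. (1 / k) *\<^sub>R TN (m - j) k (Phi j h g)) \<longlongrightarrow> v) (at_right 0)" by simp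
 have a: "((\<lambda>k. (1 / k) *\<^sub>R integral {0..h} (\<lambda>s. TN m (s + k) g - TN m s g)) \<longlongrightarrow> TN m h g - TN m 0 g) (at_right 0)"
  by (rule average_increment[where c="h + 1"]) (use h in \<open>auto intro: continuous_on_subset[OF TN_continuous]\<close>)
 have "\<forall>\<^sub>F k in at_right 0. (\<Sum>j<m. (1 / k) *\<^sub>R TN (m - j) k (Phi j h g)) - (1 / k) *\<^sub>R integral {0..h} (\<lambda>s. TN m (s + k) g - TN m s g)
   = (1 / k) *\<^sub>R (Phi m h g - TN 0 k (Phi m h g))"
  using eventually_at_right_less[of 0]
 proof eventually_elim
  case (elim k)
  have "Phi m h g - TN 0 k (Phi m h g) = (\<Sum>j<m. TN (m - j) k (Phi j h g)) - integral {0..h} (\<lambda>s. TN m (s + k) g - TN m s g)"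
   using TN0_Phi[OF h, of k m g] elim by (simp add: algebra_simps)
  then show ?case by (simp only: scaleR_diff_right scaleR_sum_right)
 qed
 with tendsto_diff[OF s a]
 have lim: "((\<lambda>k. (1 / k) *\<^sub>R (Phi m h g - TN 0 k (Phi m h g))) \<longlongrightarrow> TN m 0 g - TN m h g + v) (at_right 0)"
  by (auto simp: algebra_simps intro: Lim_transform_eventually)
 obtain F where F: "L1_rep F" "TN m 0 g - TN m h g + v = abs_L1 F" by (rule L1_rep_ex)
 obtain w where "0 <= w" "((\<lambda>k. (1 / k) *\<^sub>R TN (Suc 0) k (Phi m h g)) \<longlongrightarrow> w) (at_right 0)"
  "\<And>j. ((\<lambda>k. (1 / k) *\<^sub>R TN (Suc (Suc j)) k (Phi m h g)) \<longlongrightarrow> 0) (at_right 0)"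
  "((\<lambda>k. (1 / k) *\<^sub>R (TS k (Phi m h g) - TN 0 k (Phi m h g))) \<longlongrightarrow> w) (at_right 0)"
  by (rule perturbation_on_domain[OF F(1) lim[unfolded F(2)] Phi_cone[OF g]]) (rule that)
 with lim v show ?case by blast
qed

text \<open>The perturbation applied to \<open>Phi m h g\<close>, obtained as a derivative at time \<open>0\<close>.\<close>

definition BPhi :: "nat => real => 'a L1 => 'a L1" where
 "BPhi m h g = Lim (at_right 0) (\<lambda>k. (1 / k) *\<^sub>R TN (Suc 0) k (Phi m h g))"

lemma BPhi_tendsto:
 assumes h: "0 <= h"
 shows "((\<lambda>k. (1 / k) *\<^sub>R TN (Suc 0) k (Phi m h g)) \<longlongrightarrow> BPhi m h g) (at_right 0)"
proof -
 have ex: "\<exists>w. ((\<lambda>k. (1 / k) *\<^sub>R TN (Suc 0) k (Phi m h g)) \<longlongrightarrow> w) (at_right 0)" if "0 <= g" for g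
  using Phi_domain[OF h that, of m] by blast
 obtain p n where pn: "0 <= p" "0 <= n" "g = p - n" using X.cone_generating by blast
 obtain w v where wv: "((\<lambda>k. (1 / k) *\<^sub>R TN (Suc 0) k (Phi m h p)) \<longlongrightarrow> w) (at_right 0)"
  "((\<lambda>k. (1 / k) *\<^sub>R TN (Suc 0) k (Phi m h n)) \<longlongrightarrow> v) (at_right 0)"
  using ex[OF pn(1)] ex[OF pn(2)] by blast
 have "\<forall>\<^sub>F k in at_right 0. (1 / k) *\<^sub>R TN (Suc 0) k (Phi m h p) - (1 / k) *\<^sub>R TN (Suc 0) k (Phi m h n) = (1 / k) *\<^sub>R TN (Suc 0) k (Phi m h g)"
  using eventually_at_right_less[of 0]
  by eventually_elim (simp add: pn(3) linear_diff[OF Phi_linear] linear_diff[OF TN_linear] scaleR_diff_right)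
 with tendsto_diff[OF wv] have "((\<lambda>k. (1 / k) *\<^sub>R TN (Suc 0) k (Phi m h g)) \<longlongrightarrow> w - v) (at_right 0)"
  by (rule Lim_transform_eventually)
 from tendsto_Lim[OF trivial_limit_at_right_real this] this show ?thesis unfolding BPhi_def by (simp only:)
qed

lemma BPhi_eqI:
 assumes "0 <= h" "((\<lambda>k. (1 / k) *\<^sub>R TN (Suc 0) k (Phi m h g)) \<longlongrightarrow> w) (at_right 0)"
 shows "BPhi m h g = w"
 by (rule tendsto_unique[OF trivial_limit_at_right_real BPhi_tendsto[OF assms(1)] assms(2)])

lemma BPhi_linear: 
 assumes h: "0 <= h" 
 shows "linear (BPhi m h)"
proof (rule linearI)
 fix f g c
 show "BPhi m h (f + g) = BPhi m h f + BPhi m h g"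
 proof (rule BPhi_eqI[OF h Lim_transform_eventually[OF tendsto_add[OF BPhi_tendsto[OF h] BPhi_tendsto[OF h]]]])
  show "\<forall>\<^sub>F k in at_right 0. (1 / k) *\<^sub>R TN (Suc 0) k (Phi m h f) + (1 / k) *\<^sub>R TN (Suc 0) k (Phi m h g) = (1 / k) *\<^sub>R TN (Suc 0) k (Phi m h (f + g))"
   using eventually_at_right_less[of 0]
   by eventually_elim (simp add: linear_add[OF Phi_linear] linear_add[OF TN_linear] scaleR_add_right)
 qed
 show "BPhi m h (c *\<^sub>R g) = c *\<^sub>R BPhi m h g"
 proof (rule BPhi_eqI[OF h Lim_transform_eventually[OF tendsto_scaleR[OF tendsto_const BPhi_tendsto[OF h]]]])
  show "\<forall>\<^sub>F k in at_right 0. c *\<^sub>R (1 / k) *\<^sub>R TN (Suc 0) k (Phi m h g) = (1 / k) *\<^sub>R TN (Suc 0) k (Phi m h (c *\<^sub>R g))"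
   using eventually_at_right_less[of 0]
   by eventually_elim (simp add: linear_cmul[OF Phi_linear] linear_cmul[OF TN_linear])
 qed
qed

lemma BPhi_cone:
 assumes h: "0 <= h" and g: "0 <= g"
 shows "0 <= BPhi m h g"
proof -
 obtain w where w: "0 <= w" "((\<lambda>k. (1 / k) *\<^sub>R TN (Suc 0) k (Phi m h g)) \<longlongrightarrow> w) (at_right 0)"
  using Phi_domain[OF h g, of m] by blast
 then show ?thesis using BPhi_eqI[OF h w(2)] by simp
qed

lemma generator_Phi:
 assumes h: "0 <= h" and g: "0 <= g"
 shows "((\<lambda>k. (TS k (Phi m h g) - Phi m h g) /\<^sub>R k) \<longlongrightarrow>
   BPhi m h g - (TN m 0 g - TN m h g + (if m = 0 then 0 else BPhi (m - 1) h g))) (at_right 0)"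
proof -
 obtain w v where wv: "((\<lambda>k. (1 / k) *\<^sub>R TN (Suc 0) k (Phi m h g)) \<longlongrightarrow> w) (at_right 0)"
  "((\<lambda>k. (1 / k) *\<^sub>R (TS k (Phi m h g) - TN 0 k (Phi m h g))) \<longlongrightarrow> w) (at_right 0)"
  "((\<lambda>k. (1 / k) *\<^sub>R (Phi m h g - TN 0 k (Phi m h g))) \<longlongrightarrow> TN m 0 g - TN m h g + v) (at_right 0)"
  "if m = 0 then v = 0 else ((\<lambda>k. (1 / k) *\<^sub>R TN (Suc 0) k (Phi (m - 1) h g)) \<longlongrightarrow> v) (at_right 0)"
  using Phi_domain[OF h g, of m] by blast
 have v: "v = (if m = 0 then 0 else BPhi (m - 1) h g)"
  using wv(4) BPhi_eqI[OF h, of "m - 1" g v] by (simp split: if_splits)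
 have eq: "(1 / k) *\<^sub>R (TS k (Phi m h g) - TN 0 k (Phi m h g)) - (1 / k) *\<^sub>R (Phi m h g - TN 0 k (Phi m h g))
   = (TS k (Phi m h g) - Phi m h g) /\<^sub>R k" for k
  by (simp add: scaleR_diff_right inverse_eq_divide)
 show ?thesis
  using tendsto_diff[OF wv(2) wv(3)] unfolding eq v BPhi_eqI[OF h wv(1)] .
qed

text \<open>The functional reduces to minus \<open>psi\<close> of the generator of the perturbed semigroup. Its value is a telescoping difference, and its sign is that of the mass lost by a contraction on the cone.\<close>

lemma fun_a_Phi:
 assumes h: "0 <= h" and g: "0 <= g"
 shows "fun_a U B (Phi m h g) = (if m = 0 then norm g else norm (BPhi (m - 1) h g)) - norm (TN m h g) - norm (BPhi m h g)"
  and "0 <= fun_a U B (Phi m h g)"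
proof -
 let ?G = "BPhi m h g - (TN m 0 g - TN m h g + (if m = 0 then 0 else BPhi (m - 1) h g))"
 have gen: "generator TS (Phi m h g) = ?G"
  unfolding generator_def by (rule tendsto_Lim[OF trivial_limit_at_right_real generator_Phi[OF h g]])
 have a: "fun_a U B (Phi m h g) = - X.psi ?G"
  by (simp add: fun_a_def B_hat_def norm_functional_eq gen)
 have l: "linear X.psi" by (rule bounded_linear.linear[OF X.bounded_linear_psi])
 show "fun_a U B (Phi m h g) = (if m = 0 then norm g else norm (BPhi (m - 1) h g)) - norm (TN m h g) - norm (BPhi m h g)"
  unfolding a using g TN_cone(1)[OF h g] BPhi_cone[OF h g]
  by (simp add: linear_diff[OF l] linear_add[OF l] X.psi_cone TN_0 linear_0[OF l])
 have "((\<lambda>k. X.psi ((TS k (Phi m h g) - Phi m h g) /\<^sub>R k)) \<longlongrightarrow> X.psi ?G) (at_right 0)"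
  by (rule bounded_linear.tendsto[OF X.bounded_linear_psi generator_Phi[OF h g]])
 then have "X.psi ?G <= 0"
 proof (rule tendsto_upperbound)
  show "\<forall>\<^sub>F k in at_right 0. X.psi ((TS k (Phi m h g) - Phi m h g) /\<^sub>R k) <= 0"
   using eventually_at_right_less[of 0]
  proof eventually_elim
   case (elim k)
   have "X.psi (TS k (Phi m h g) - Phi m h g) <= 0"
    using TS_cone[of k "Phi m h g"] Phi_cone[OF g, of m h] elim by (simp add: linear_diff[OF l] X.psi_cone)
   then show ?case using elim by (simp add: linear_cmul[OF l] mult_nonneg_nonpos)
  qed
 qed (rule trivial_limit_at_right_real)
 then show "0 <= fun_a U B (Phi m h g)" unfolding a by simp
qed

lemma BPhi_norm:
 assumes h: "0 <= h" and g: "0 <= g"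
 shows "norm (BPhi (Suc m) h g) <= norm (BPhi m h g)" "norm (BPhi m h g) <= norm g"
  "(\<Sum>n\<le>m. fun_a U B (Phi n h g)) = norm g - (\<Sum>n\<le>m. norm (TN n h g)) - norm (BPhi m h g)"
proof -
 show *: "norm (BPhi (Suc m) h g) <= norm (BPhi m h g)" for m
  using fun_a_Phi[OF h g, of "Suc m"] by simp (smt (verit) norm_ge_zero)
 show "norm (BPhi m h g) <= norm g"
 proof (induction m)
  case 0
  then show ?case using fun_a_Phi[OF h g, of 0] by simp (smt (verit) norm_ge_zero)
 qed (use * order_trans in blast)
 show "(\<Sum>n\<le>m. fun_a U B (Phi n h g)) = norm g - (\<Sum>n\<le>m. norm (TN n h g)) - norm (BPhi m h g)"
  by (induction m) (simp_all add: fun_a_Phi(1)[OF h g])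
qed

text \<open>The functional \<open>beta h\<close> measures the mass lost in the limit of infinitely many perturbations during time \<open>h\<close>.\<close>

definition beta :: "real => 'a L1 => real" where
 "beta h g = lim (\<lambda>N. X.psi (BPhi N h g))"

lemma beta_tendsto:
 assumes h: "0 <= h"
 shows "(\<lambda>N. X.psi (BPhi N h g)) \<longlonglongrightarrow> beta h g"
proof -
 have l: "linear X.psi" by (rule bounded_linear.linear[OF X.bounded_linear_psi])
 have c: "convergent (\<lambda>N. X.psi (BPhi N h g))" if "0 <= g" for g
 proof -
  have "decseq (\<lambda>N. norm (BPhi N h g))" using BPhi_norm(1)[OF h that] by (rule decseq_SucI)
  then have "convergent (\<lambda>N. norm (BPhi N h g))"
   by (intro Bseq_monoseq_convergent decseq_imp_monoseq BseqI'[where K="norm g"]) (use BPhi_norm(2)[OF h that] in auto)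
  then show ?thesis using BPhi_cone[OF h that] by (simp add: X.psi_cone)
 qed
 obtain p n where pn: "0 <= p" "0 <= n" "g = p - n" using X.cone_generating by blast
 have "convergent (\<lambda>N. X.psi (BPhi N h p) - X.psi (BPhi N h n))" by (intro convergent_diff c pn)
 then show ?thesis
  unfolding beta_def by (simp add: pn(3) linear_diff[OF BPhi_linear[OF h]] linear_diff[OF l] convergent_LIMSEQ_iff)
qed

lemma beta_linear:
 assumes h: "0 <= h"
 shows "linear (beta h)"
proof (rule linearI)
 have l: "linear X.psi" by (rule bounded_linear.linear[OF X.bounded_linear_psi])
 fix f g c
 show "beta h (f + g) = beta h f + beta h g"
  using tendsto_add[OF beta_tendsto[OF h, of f] beta_tendsto[OF h, of g]]
  by (intro LIMSEQ_unique[OF beta_tendsto[OF h]]) (simp add: linear_add[OF BPhi_linear[OF h]] linear_add[OF l])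
 show "beta h (c *\<^sub>R g) = c *\<^sub>R beta h g"
  using tendsto_scaleR[OF tendsto_const[of c] beta_tendsto[OF h, of g]]
  by (intro LIMSEQ_unique[OF beta_tendsto[OF h]]) (simp add: linear_cmul[OF BPhi_linear[OF h]] linear_cmul[OF l])
qed

lemma beta_cone:
 assumes h: "0 <= h" and g: "0 <= g"
 shows "(\<lambda>N. norm (BPhi N h g)) \<longlonglongrightarrow> beta h g" "0 <= beta h g" "beta h g <= norm g"
  "(\<lambda>n. fun_a U B (Phi n h g)) sums (norm g - norm (TS h g) - beta h g)" "beta h g <= norm g - norm (TS h g)"
proof -
 show *: "(\<lambda>N. norm (BPhi N h g)) \<longlonglongrightarrow> beta h g"
  using beta_tendsto[OF h, of g] BPhi_cone[OF h g] by (simp add: X.psi_cone)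
 show "0 <= beta h g" by (rule LIMSEQ_le_const[OF *]) auto
 show "beta h g <= norm g" by (rule LIMSEQ_le_const2[OF *]) (use BPhi_norm(2)[OF h g] in auto)
 have "(\<lambda>N. norm g - (\<Sum>n\<le>N. norm (TN n h g)) - norm (BPhi N h g)) \<longlonglongrightarrow> norm g - norm (TS h g) - beta h g"
  using TN_norm_sums[OF h g] by (intro tendsto_diff tendsto_const *) (simp add: sums_def_le)
 then show s: "(\<lambda>n. fun_a U B (Phi n h g)) sums (norm g - norm (TS h g) - beta h g)"
  by (simp add: sums_def_le BPhi_norm(3)[OF h g])
 have "0 <= (\<Sum>n. fun_a U B (Phi n h g))"
  by (rule suminf_nonneg[OF sums_summable[OF s] fun_a_Phi(2)[OF h g]])
 then show "beta h g <= norm g - norm (TS h g)" using sums_unique[OF s] by simp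
qed

lemma beta_bounded_linear:
 assumes h: "0 <= h"
 shows "bounded_linear (beta h)"
proof -
 have "norm (beta h g) <= CX * norm g" for g
  unfolding L1_dec_bound_def
  by (rule X.cone_contraction_bound[OF beta_linear[OF h]]) (use beta_cone[OF h] in simp)
 then show ?thesis
  using beta_linear[OF h] by (auto simp: bounded_linear_def bounded_linear_axioms_def mult.commute[of CX] intro!: exI[of _ CX])
qed

lemma Phi_add:
 assumes h: "0 <= h" and k: "0 <= k"
 shows "Phi N (h + k) f = Phi N h f + (\<Sum>j\<le>N. Phi (N - j) k (TN j h f))"
proof -
 have "Phi N h f + integral {h..h + k} (\<lambda>s. TN N s f) = Phi N (h + k) f"
  unfolding Phi_def
  by (rule Henstock_Kurzweil_Integration.integral_combine[OF _ _ TN_integrable]) (use h k in auto)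
 moreover have "integral {h..h + k} (\<lambda>s. TN N s f) = integral {0..k} (\<lambda>s. TN N (s + h) f)"
  using integral_shift_Icc_real[of 0 k "\<lambda>s. TN N s f" h] by (simp add: o_def add.commute)
 moreover have "\<dots> = integral {0..k} (\<lambda>s. \<Sum>j\<le>N. TN (N - j) s (TN j h f))"
  by (rule integral_cong) (use TN_add h in auto)
 moreover have "\<dots> = (\<Sum>j\<le>N. Phi (N - j) k (TN j h f))"
  unfolding Phi_def by (rule integral_sum) (auto intro: TN_integrable)
 ultimately show ?thesis by simp
qed

text \<open>\<open>Phi N (h + k) f\<close> splits at time \<open>h\<close> by the composition law, and Tannery's theorem passes to the limit in the sum.\<close>

lemma beta_add:
 assumes h: "0 <= h" and k: "0 <= k" and f: "0 <= f"
 shows "beta (h + k) f = beta h f + beta k (TS h f)"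
proof -
 have hk: "0 <= h + k" using h k by simp
 have l: "linear X.psi" by (rule bounded_linear.linear[OF X.bounded_linear_psi])
 have B: "BPhi N (h + k) f = BPhi N h f + (\<Sum>j\<le>N. BPhi (N - j) k (TN j h f))" for N
 proof (rule BPhi_eqI[OF hk Lim_transform_eventually[OF tendsto_add[OF BPhi_tendsto[OF h] tendsto_sum[OF BPhi_tendsto[OF k]]]]])
  show "\<forall>\<^sub>F t in at_right 0. (1 / t) *\<^sub>R TN (Suc 0) t (Phi N h f) + (\<Sum>j\<le>N. (1 / t) *\<^sub>R TN (Suc 0) t (Phi (N - j) k (TN j h f)))
    = (1 / t) *\<^sub>R TN (Suc 0) t (Phi N (h + k) f)"
   using eventually_at_right_less[of 0]
   by eventually_elim (simp add: Phi_add[OF h k] linear_add[OF TN_linear] linear_sum[OF TN_linear] scaleR_add_right scaleR_sum_right)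
 qed
 define a where "a j N = (if j <= N then X.psi (BPhi (N - j) k (TN j h f)) else 0)" for j N
 have lim_a: "a j \<longlonglongrightarrow> beta k (TN j h f)" for j
 proof (rule LIMSEQ_offset[of _ j])
  show "(\<lambda>N. a j (N + j)) \<longlonglongrightarrow> beta k (TN j h f)" using beta_tendsto[OF k, of "TN j h f"] by (simp add: a_def)
 qed
 have bound: "norm (a j N) <= norm (TN j h f)" for j N
  using BPhi_norm(2)[OF k TN_cone(1)[OF h f]] X.abs_psi_le order_trans by (auto simp: a_def) blast
 have "(\<lambda>N. \<Sum>j. a j N) \<longlonglongrightarrow> (\<Sum>j. beta k (TN j h f))"
  using tannerys_theorem[of a "\<lambda>j. beta k (TN j h f)" sequentially "\<lambda>j. norm (TN j h f)"]
   lim_a bound sums_summable[OF TN_norm_sums[OF h f]] by (auto intro: always_eventually)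
 moreover have "(\<Sum>j. a j N) = (\<Sum>j\<le>N. X.psi (BPhi (N - j) k (TN j h f)))" for N
  by (subst suminf_finite[of "{..N}"]) (auto simp: a_def)
 moreover have "(\<Sum>j. beta k (TN j h f)) = beta k (TS h f)"
  using bounded_linear.sums[OF beta_bounded_linear[OF k] TN_sums[OF h, of f]] by (simp add: sums_iff)
 ultimately have "(\<lambda>N. \<Sum>j\<le>N. X.psi (BPhi (N - j) k (TN j h f))) \<longlonglongrightarrow> beta k (TS h f)" by simp
 from tendsto_add[OF beta_tendsto[OF h, of f] this]
 show ?thesis
  by (intro LIMSEQ_unique[OF beta_tendsto[OF hk]]) (simp add: B linear_add[OF l] linear_sum[OF l])
qed

lemma beta_0: "beta 0 f = 0"
proof -
 have "Phi N 0 f = 0" for N by (simp add: Phi_def)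
 then have "BPhi N 0 f = 0" for N
  by (intro BPhi_eqI) (auto intro!: tendsto_eventually eventually_mono[OF eventually_at_right_less[of 0]] simp: linear_0[OF TN_linear])
 then have "(\<lambda>N. X.psi (BPhi N 0 f)) \<longlonglongrightarrow> 0" by (simp add: X.psi_cone)
 then show ?thesis using beta_tendsto[of 0 f] LIMSEQ_unique by blast
qed

text \<open>An increment of \<open>beta\<close> is at most the mass lost by the perturbed semigroup in the same time.\<close>

lemma beta_continuous:
 assumes f: "0 <= f"
 shows "continuous_on {0..} (\<lambda>s. beta s f)"
proof (rule continuous_on_of_modulus[where \<omega>="\<lambda>k. CX * norm (f - TS k f)"])
 have "((\<lambda>k. CX * norm (f - TS k f)) \<longlongrightarrow> CX * norm (f - f)) (at_right 0)"
  by (intro tendsto_mult tendsto_const tendsto_norm tendsto_diff TS_tendsto)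
 then show "((\<lambda>k. CX * norm (f - TS k f)) \<longlongrightarrow> 0) (at_right 0)" by simp
 fix s t :: real assume st: "0 <= s" "s <= t"
 have ts: "0 <= t - s" using st by simp
 have "beta t f - beta s f = beta (t - s) (TS s f)" using beta_add[OF st(1) ts f] by simp
 moreover have "0 <= beta (t - s) (TS s f)" by (rule beta_cone(2)[OF ts TS_cone(1)[OF st(1) f]])
 moreover have "beta (t - s) (TS s f) <= norm (TS s f) - norm (TS (t - s) (TS s f))"
  by (rule beta_cone(5)[OF ts TS_cone(1)[OF st(1) f]])
 moreover have "\<dots> <= norm (TS s f - TS (t - s) (TS s f))" by (rule norm_triangle_ineq2)
 moreover have "TS s f - TS (t - s) (TS s f) = TS s (f - TS (t - s) f)"
  using TS_add[of "t - s" s f] TS_add[of s "t - s" f] st by (simp add: linear_diff[OF TS_linear])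
 ultimately show "norm (beta t f - beta s f) <= CX * norm (f - TS (t - s) f)"
  using TS_bound[OF st(1), of "f - TS (t - s) f"] by simp
qed

text \<open>As \<open>beta h\<close> commutes with the integral and \<open>beta h (TS s f) = beta (s + h) f - beta s f\<close>, all difference quotients are averages of increments of continuous functions of \<open>s\<close>.\<close>

lemma a_hat_integral:
 assumes f: "0 <= f" and t: "0 <= t"
 shows "a_hat U B (integral {0..t} (\<lambda>s. TS s f)) = norm f - norm (TS t f) - beta t f"
proof -
 let ?g = "integral {0..t} (\<lambda>s. TS s f)"
 have l: "linear X.psi" by (rule bounded_linear.linear[OF X.bounded_linear_psi])
 have g: "0 <= ?g" by (rule X.integral_cone) (simp add: TS_cone f)
 have inc: "((\<lambda>h. (1 / h) *\<^sub>R integral {0..t} (\<lambda>s. TS (s + h) f - TS s f)) \<longlongrightarrow> TS t f - TS 0 f) (at_right 0)"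
  by (rule average_increment[where c="t + 1"]) (use t in \<open>auto intro: continuous_on_subset[OF TS_continuous]\<close>)
 have 1: "((\<lambda>h. - X.psi ((1 / h) *\<^sub>R integral {0..t} (\<lambda>s. TS (s + h) f - TS s f))) \<longlongrightarrow> norm f - norm (TS t f)) (at_right 0)"
  using tendsto_minus[OF bounded_linear.tendsto[OF X.bounded_linear_psi inc]] f TS_cone(1)[OF t f]
  by (simp add: TS_0 linear_diff[OF l] X.psi_cone)
 have 2: "((\<lambda>h. (1 / h) *\<^sub>R integral {0..t} (\<lambda>s. beta (s + h) f - beta s f)) \<longlongrightarrow> beta t f - beta 0 f) (at_right 0)"
  by (rule average_increment[where c="t + 1"]) (use t in \<open>auto intro: continuous_on_subset[OF beta_continuous[OF f]]\<close>)
 have "\<forall>\<^sub>F h in at_right 0. - X.psi ((1 / h) *\<^sub>R integral {0..t} (\<lambda>s. TS (s + h) f - TS s f))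
    - (1 / h) *\<^sub>R integral {0..t} (\<lambda>s. beta (s + h) f - beta s f)
   = (1 / h) * (\<Sum>n. fun_a U B (integral {0..h} (\<lambda>s. TN n s ?g)))"
  using eventually_at_right_less[of 0]
 proof eventually_elim
  case (elim h)
  then have h: "0 <= h" by simp
  have TSg: "TS h ?g = integral {0..t} (\<lambda>s. TS (s + h) f)" "(\<lambda>s. TS (s + h) f) integrable_on {0..t}"
  proof -
   note * = integral_bounded_linear[OF TS_integrable[OF order_refl, where g=f and b=t] TS_bounded_linear[OF h]]
   have eq: "TS h (TS s f) = TS (s + h) f" if "s \<in> {0..t}" for s
    using TS_add[OF h, of s f] that by (simp add: add.commute)
   show "TS h ?g = integral {0..t} (\<lambda>s. TS (s + h) f)" unfolding *(1)[symmetric] by (rule integral_cong) (rule eq)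
   show "(\<lambda>s. TS (s + h) f) integrable_on {0..t}" using *(2) eq by (rule integrable_eq)
  qed
  have p1: "norm ?g - norm (TS h ?g) = - X.psi (integral {0..t} (\<lambda>s. TS (s + h) f - TS s f))"
   using g TS_cone(1)[OF h g]
   by (simp add: integral_diff[OF TSg(2) TS_integrable] TSg(1)[symmetric] linear_diff[OF l] X.psi_cone)
  have p2: "beta h ?g = integral {0..t} (\<lambda>s. beta (s + h) f - beta s f)"
   unfolding integral_bounded_linear(1)[OF TS_integrable[OF order_refl] beta_bounded_linear[OF h], symmetric]
   by (rule integral_cong) (use beta_add[OF _ h f] in simp)
  have sm: "(\<Sum>n. fun_a U B (integral {0..h} (\<lambda>s. TN n s ?g))) = norm ?g - norm (TS h ?g) - beta h ?g"
   using sums_unique[OF beta_cone(4)[OF h g]] by (simp add: Phi_def)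
  show ?case unfolding sm p1 p2 linear_cmul[OF l] by (simp add: diff_divide_distrib)
 qed
 with tendsto_diff[OF 1 2]
 have "((\<lambda>h. (1 / h) * (\<Sum>n. fun_a U B (integral {0..h} (\<lambda>s. TN n s ?g)))) \<longlongrightarrow> norm f - norm (TS t f) - (beta t f - beta 0 f)) (at_right 0)"
  by (rule Lim_transform_eventually)
 from tendsto_Lim[OF trivial_limit_at_right_real this] show ?thesis
  unfolding a_hat_def by (simp only: beta_0 diff_zero)
qed

lemma honest_iff_beta:
 "honest_evolution_family U B \<longleftrightarrow> (\<forall>f\<ge>0. \<forall>t\<ge>0. beta t f = 0)"
 unfolding honest_evolution_family_def honest_semigroup_def L1_cone_eq
 by (auto simp: a_hat_integral)

end

section \<open>Pointwise perturbation integrals\<close>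

lemma tendsto_ennreal_close:
 fixes a b c :: "'i => ennreal"
 assumes b: "(b \<longlongrightarrow> ennreal l) F" and c: "(c \<longlongrightarrow> 0) F"
  and le: "\<forall>\<^sub>F k in F. a k <= b k + c k" "\<forall>\<^sub>F k in F. b k <= a k + c k"
 shows "(a \<longlongrightarrow> ennreal l) F"
proof (rule tendsto_sandwich[where f="\<lambda>k. b k - c k" and h="\<lambda>k. b k + c k"])
 show "((\<lambda>k. b k + c k) \<longlongrightarrow> ennreal l) F" using tendsto_add[OF b c] by simp
 show "((\<lambda>k. b k - c k) \<longlongrightarrow> ennreal l) F" using tendsto_diff_ennreal_general[OF b c] by simp
 have "\<forall>\<^sub>F k in F. c k < 1" by (rule order_tendstoD(2)[OF c]) simp
 then show "\<forall>\<^sub>F k in F. b k - c k <= a k"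
  using le(2) by eventually_elim (auto simp: ennreal_minus_le_iff add.commute)
qed (rule le(1))

lemma nn_integral_continuous_interval:
 fixes f :: "real => real"
 assumes f: "continuous_on {a..b} f" "\<And>x. x \<in> {a..b} ==> 0 <= f x"
 shows "(\<integral>\<^sup>+x. ennreal (f x) * indicator {a..b} x \<partial>lborel) = ennreal (integral {a..b} f)"
proof -
 let ?f = "\<lambda>x. if x \<in> {a..b} then f x else 0"
 have "ennreal (integral {a..b} f) = ennreal (integral {a..b} (\<lambda>x. norm (?f x)))"
  by (intro arg_cong[where f=ennreal] integral_cong) (use f(2) in auto)
 also have "\<dots> = (\<integral>\<^sup>+x. ennreal (norm (?f x)) * indicator {a..b} x \<partial>lborel)"
  by (rule bochner_borel_integrable_on(5)[OF bochner_borel_continuous[OF f(1)]])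
 also have "\<dots> = (\<integral>\<^sup>+x. ennreal (f x) * indicator {a..b} x \<partial>lborel)"
  by (intro nn_integral_cong) (use f(2) in \<open>auto simp: indicator_def\<close>)
 finally show ?thesis by simp
qed

text \<open>After a shift only two boundary integrals over intervals of length \<open>k\<close> remain.\<close>

lemma integral_increment_le:
 fixes W :: "real => real"
 assumes W: "continuous_on {a..c} W" "\<And>y. y \<in> {a..c} ==> 0 <= W y \<and> W y <= C" and b: "a <= b" "0 <= k" "b + k <= c"
 shows "integral {a..b} (\<lambda>y. W (y + k) - W y) <= k * C"
proof -
 have i: "W integrable_on {p..q}" if "a <= p" "q <= c" for p q
  by (rule integrable_continuous_real[OF continuous_on_subset[OF W(1)]]) (use that in auto)
 have 1: "integral {a..b} (\<lambda>y. W (y + k)) = integral {a + k..b + k} W"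
  using integral_shift_Icc_real[of a b W k] by (simp add: o_def add.commute)
 have 2: "(\<lambda>y. W (y + k)) integrable_on {a..b}"
  using has_integral_shift_Icc_real[of W k _ a b] i[of "a + k" "b + k"] b
  by (auto simp: integrable_on_def o_def add.commute)
 have 3: "integral {a..a + k} W + integral {a + k..b + k} W = integral {a..b + k} W"
  by (rule Henstock_Kurzweil_Integration.integral_combine[OF _ _ i]) (use b in auto)
 have 4: "integral {a..b} W + integral {b..b + k} W = integral {a..b + k} W"
  by (rule Henstock_Kurzweil_Integration.integral_combine[OF _ _ i]) (use b in auto)
 have 5: "integral {b..b + k} W <= integral {b..b + k} (\<lambda>y. C)"
  by (rule integral_le[OF i integrable_const_ivl]) (use b W(2) in auto)
 have 6: "0 <= integral {a..a + k} W"
  by (rule integral_nonneg[OF i]) (use b W(2) in auto)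
 have ab: "W integrable_on {a..b}" by (rule i) (use b in auto)
 show ?thesis using integral_diff[OF 2 ab] 1 3 4 5 6 b by simp
qed

context substochastic_perturbation
begin

text \<open>The mass picked up by \<open>B\<close> along \<open>V n\<close> between \<open>s\<close> and \<open>t\<close>.\<close>

definition cint :: "nat => real => real => 'a => ennreal" where
 "cint n t s u = (\<integral>\<^sup>+\<tau>. ennreal (norm (B \<tau> (V n \<tau> s u))) \<partial>lebesgue_on {s..t})"

lemma cint_version:
 assumes h: "B_version s T u n h" and t: "t <= T"
 shows "cint n t s u = (\<integral>\<^sup>+\<tau>. ennreal (norm (h \<tau>)) * indicator {s..t} \<tau> \<partial>lborel)"
  "cint n t s u = ennreal (integral {s..t} (\<lambda>\<tau>. norm (h \<tau>)))"
proof -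
 have "cint n t s u = (\<integral>\<^sup>+\<tau>. ennreal (norm (B \<tau> (V n \<tau> s u))) * indicator {s..t} \<tau> \<partial>lborel)"
  unfolding cint_def by (rule nn_integral_lebesgue_on) simp
 also have "\<dots> = (\<integral>\<^sup>+\<tau>. ennreal (norm (h \<tau>)) * indicator {s..t} \<tau> \<partial>lborel)"
  by (rule nn_integral_cong_AE, use B_versionD(4)[OF h] in eventually_elim) (use t in \<open>auto simp: indicator_def\<close>)
 finally show *: "cint n t s u = (\<integral>\<^sup>+\<tau>. ennreal (norm (h \<tau>)) * indicator {s..t} \<tau> \<partial>lborel)" .
 show "cint n t s u = ennreal (integral {s..t} (\<lambda>\<tau>. norm (h \<tau>)))"
  unfolding * by (rule bochner_borel_integrable_on(5)[OF B_versionD(1)[OF h], symmetric])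
qed

lemma cint_Suc:
 assumes s: "0 <= s" "s <= t" and u: "0 <= u"
 shows "cint (Suc n) t s u <= cint n t s u"
proof -
 obtain h where h: "B_version s t u n h" by (rule B_version_ex[OF s u])
 obtain w where w: "B_version s t u (Suc n) w"
  "integral {s..t} (\<lambda>r. norm (w r)) + norm (V (Suc n) t s u) <= integral {s..t} (\<lambda>r. norm (h r))"
  by (rule B_version_Suc[OF s h]) (use V_Suc_eq_R[OF s u h] in auto)
 have "integral {s..t} (\<lambda>r. norm (w r)) <= integral {s..t} (\<lambda>r. norm (h r))"
  using w(2) norm_ge_zero[of "V (Suc n) t s u"] by linarith
 then show ?thesis
  unfolding cint_version(2)[OF h order_refl] cint_version(2)[OF w(1) order_refl] by (rule ennreal_leI)
qed

lemma cint_antimono: "0 <= s ==> s <= t ==> 0 <= u ==> m <= n ==> cint n t s u <= cint m t s u"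
 by (rule lift_Suc_antimono_le[of "\<lambda>n. cint n t s u"]) (use cint_Suc in auto)

lemma cint_le:
 assumes s: "0 <= s" "s <= t" and u: "0 <= u"
 shows "cint n t s u <= ennreal (norm u - norm (U t s u))" "cint n t s u <= ennreal (norm u)"
proof -
 show *: "cint n t s u <= ennreal (norm u - norm (U t s u))"
 proof (rule order_trans[OF cint_antimono[OF s u]])
  show "cint 0 t s u <= ennreal (norm u - norm (U t s u))" using BU_bound[OF s u] by (simp add: cint_def)
 qed simp
 show "cint n t s u <= ennreal (norm u)"
  by (rule order_trans[OF * ennreal_leI]) simp
qed

lemma cint_mono: "t <= t' ==> cint n t s u <= cint n t' s u"
 unfolding cint_def
 by (subst (1 2) nn_integral_lebesgue_on) (auto intro!: nn_integral_mono simp: indicator_def)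

text \<open>With \<open>w\<close> representing \<open>B V\<^sub>n\<close>, the estimate for one step replaces \<open>V\<^sub>1(y + k, y)\<close> applied to \<open>V\<^sub>n(y, r) u\<close> by the integral of \<open>w\<close> over the step, up to errors that are \<open>o(k)\<close> in the mean over \<open>y\<close>. What remains are averages of increments of the primitive \<open>W w\<close> of the norm of \<open>w\<close>.\<close>

lemma cint_as_limit:
 assumes r: "0 <= r" and h: "0 <= h" and u: "0 <= u"
 shows "((\<lambda>k. (\<integral>\<^sup>+y. ennreal (norm (V (Suc 0) (y + k) y (V n y r u))) * indicator {r..r + h} y \<partial>lborel) / ennreal k)
   \<longlongrightarrow> cint n (r + h) r u) (at_right 0)"
  and "0 < k ==> k <= 1 ==>
   (\<integral>\<^sup>+y. ennreal (norm (V (Suc 0) (y + k) y (V n y r u))) * indicator {r..r + h} y \<partial>lborel) / ennreal k <= ennreal (2 * norm u)"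
proof -
 define T where "T = r + h + 1"
 have rT: "r <= T" using h by (simp add: T_def)
 obtain w where w: "B_version r T u n w" by (rule B_version_ex[OF r rT u])
 obtain p where p: "bochner_borel p" "\<And>q. 0 <= p q" "\<And>q. q < 0 ==> p q = 0"
  "\<And>q y. r <= y ==> y <= q ==> q <= T ==> U q y (V n y r u) + R y p q = V n q r u"
  "integral {r..T} (\<lambda>q. norm (p q)) <= norm u"
 proof (cases n)
  case 0
  have "U q y (V n y r u) + R y (\<lambda>q. 0) q = V n q r u" if "r <= y" "y <= q" for q y
   using that r U_compose[of r y q u] conv_zero[OF regular_U, of y q] by (simp add: 0)
  then show thesis by (intro that[of "\<lambda>q. 0"]) (auto simp: bochner_borel_zero)
 next
  case (Suc m)
  obtain v where v: "B_version r T u m v" by (rule B_version_ex[OF r rT u])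
  have "U q y (V n y r u) + R y v q = V n q r u" if "r <= y" "y <= q" "q <= T" for q y
   using that r V_Suc_eq_R[OF r rT u v, of y] V_Suc_eq_R[OF r rT u v, of q] R_split[OF B_versionD(1)[OF v] r, of y q]
   by (simp add: Suc del: dyson.simps)
  moreover have "integral {r..T} (\<lambda>q. norm (v q)) <= norm u"
   using cint_le(2)[OF r rT u, of m] unfolding cint_version(2)[OF v order_refl] by simp
  ultimately show thesis
   using B_versionD(1,2)[OF v] B_versionD(3)[OF v] r by (intro that[of v]) auto
 qed
 note wD = B_versionD[OF w]
 have w_neg: "w q = 0" if "q < 0" for q using wD(3)[of q] that r by simp
 have w_int: "integral {r..T} (\<lambda>q. norm (w q)) <= norm u"
  using cint_le(2)[OF r rT u, of n] unfolding cint_version(2)[OF w order_refl] by simp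
 have st: "norm (V (Suc 0) (y + k) y (V n y r u) - R y w (y + k)) <= err p y (y + k)"
  if y: "y \<in> {r..r + h}" and k: "0 < k" "k <= 1" for y k
 proof -
  have y0: "0 <= y" "y <= y + k" using y r k by auto
  have "AE q in lborel. q \<in> {y..y + k} --> B q (U q y (V n y r u) + R y p q - R y (\<lambda>q. 0) q) = w q"
   using wD(4)
  proof eventually_elim
   case (elim q)
   show ?case
   proof
    assume q: "q \<in> {y..y + k}"
    have "U q y (V n y r u) + R y p q = V n q r u" by (rule p(4)) (use q y k in \<open>auto simp: T_def\<close>)
    then show "B q (U q y (V n y r u) + R y p q - R y (\<lambda>q. 0) q) = w q"
     using elim q y k conv_zero[OF regular_U, of y q] r by (simp add: T_def)
   qed
  qed
  from step(1)[OF y0 p(1,2) bochner_borel_zero _ wD(1,2) this] show ?thesis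
   using err_zero[OF y0(1), of "y + k"] by simp
 qed
 define J where "J k = (\<integral>\<^sup>+y. ennreal (norm (V (Suc 0) (y + k) y (V n y r u))) * indicator {r..r + h} y \<partial>lborel)" for k
 define Er where "Er f k = (\<integral>\<^sup>+y. ennreal (err f y (y + k)) * indicator {r..r + h} y \<partial>lborel)" for f k
 define W where "W f y = integral {r..y} (\<lambda>q. norm (f q))" for f :: "real => 'a" and y
 define I where "I f k = (\<integral>\<^sup>+y. ennreal (W f (y + k) - W f y) * indicator {r..r + h} y \<partial>lborel)" for f k
 have props: "continuous_on {r..T} (W f)"
  "\<And>y k. r <= y ==> 0 <= k ==> W f (y + k) - W f y = integral {y..y + k} (\<lambda>q. norm (f q))"
  "\<And>k. 0 <= k ==> k <= 1 ==> I f k = ennreal (integral {r..r + h} (\<lambda>y. W f (y + k) - W f y))"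
  "\<And>k. 0 < k ==> k <= 1 ==> integral {r..T} (\<lambda>q. norm (f q)) <= norm u ==> I f k / ennreal k <= ennreal (norm u)"
  "((\<lambda>k. Er f k / ennreal k) \<longlongrightarrow> 0) (at_right 0)"
  if f: "bochner_borel f" "\<And>q. 0 <= f q" "\<And>q. q < 0 ==> f q = 0" for f
 proof -
  have fi: "(\<lambda>q. norm (f q)) integrable_on {a..b}" for a b by (rule bochner_borel_integrable_on(3)[OF f(1)])
  show c: "continuous_on {r..T} (W f)" unfolding W_def by (rule indefinite_integral_continuous_1[OF fi])
  have inc: "W f (y + k) - W f y = integral {y..y + k} (\<lambda>q. norm (f q))" if "r <= y" "0 <= k" for y k
   using Henstock_Kurzweil_Integration.integral_combine[of r y "y + k", OF _ _ fi] that by (simp add: W_def)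
  then show "\<And>y k. r <= y ==> 0 <= k ==> W f (y + k) - W f y = integral {y..y + k} (\<lambda>q. norm (f q))" .
  have inc0: "0 <= W f (y + k) - W f y" if "r <= y" "0 <= k" for y k
   unfolding inc[OF that] by (rule integral_nonneg[OF fi]) simp
  show I: "I f k = ennreal (integral {r..r + h} (\<lambda>y. W f (y + k) - W f y))" if k: "0 <= k" "k <= 1" for k
   unfolding I_def
  proof (rule nn_integral_continuous_interval)
   show "continuous_on {r..r + h} (\<lambda>y. W f (y + k) - W f y)"
    by (intro continuous_intros continuous_on_compose2[OF c]) (use k in \<open>auto simp: T_def\<close>)
  qed (use inc0 k in auto)
  show "I f k / ennreal k <= ennreal (norm u)" if k: "0 < k" "k <= 1" and le: "integral {r..T} (\<lambda>q. norm (f q)) <= norm u" for k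
  proof -
   have "0 <= W f y \<and> W f y <= norm u" if y: "y \<in> {r..T}" for y
    using inc0[of r "y - r"] inc0[of y "T - y"] y le by (simp add: W_def)
   then have "integral {r..r + h} (\<lambda>y. W f (y + k) - W f y) <= k * norm u"
    by (intro integral_increment_le[OF c]) (use h k in \<open>auto simp: T_def\<close>)
   then have "I f k <= ennreal (k * norm u)" using I[of k] k by (simp add: ennreal_leI)
   then have "I f k / ennreal k <= ennreal (k * norm u) / ennreal k" by (rule divide_right_mono_ennreal)
   then show ?thesis using k by (simp add: divide_ennreal)
  qed
  show "((\<lambda>k. Er f k / ennreal k) \<longlongrightarrow> 0) (at_right 0)"
  proof (rule tendsto_sandwich[OF _ _ tendsto_const err_mean_tendsto_0[OF f]])
   show "\<forall>\<^sub>F k in at_right 0. Er f k / ennreal k <= err_mean f k"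
    using eventually_at_right_less[of 0]
    by eventually_elim (auto simp: Er_def intro!: divide_right_mono_ennreal nn_err_le[OF f(1,2) r])
  qed simp
 qed
 note pw = props[OF wD(1,2) w_neg] and pp = props[OF p(1,2,3)]
 have Em: "(\<lambda>y. ennreal (err f y (y + k)) * indicator {r..r + h} y) \<in> borel_measurable lborel" if f: "bochner_borel f" "\<And>q. 0 <= f q" for f k
  using nn_err_measurable[OF f r, of k "r + h"] by simp
 have Wm: "(\<lambda>y. ennreal (W f (y + k) - W f y) * indicator {r..r + h} y) \<in> borel_measurable lborel"
  if c: "continuous_on {r..T} (W f)" and k: "0 <= k" "k <= 1" for f k
 proof -
  have "continuous_on {r..r + h} (\<lambda>y. W f (y + k) - W f y)"
   by (intro continuous_intros continuous_on_compose2[OF c]) (use k in \<open>auto simp: T_def\<close>)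
  then have "(\<lambda>y. indicator {r..r + h} y *\<^sub>R (W f (y + k) - W f y)) \<in> borel_measurable borel"
   by (intro borel_measurable_continuous_on_indicator) auto
  then have "(\<lambda>y. ennreal (indicator {r..r + h} y *\<^sub>R (W f (y + k) - W f y))) \<in> borel_measurable borel" by measurable
  moreover have "(\<lambda>y. ennreal (indicator {r..r + h} y *\<^sub>R (W f (y + k) - W f y))) = (\<lambda>y. ennreal (W f (y + k) - W f y) * indicator {r..r + h} y)"
   by (auto simp: fun_eq_iff indicator_def)
  ultimately show ?thesis by simp
 qed
 have bounds: "J k <= I w k + Er p k" "I w k <= J k + (Er w k + Er p k)" "J k <= I w k + I p k" if k: "0 < k" "k <= 1" for k
 proof -
  have y_bounds: "norm (V (Suc 0) (y + k) y (V n y r u)) <= (W w (y + k) - W w y) + err p y (y + k)"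
   "W w (y + k) - W w y <= norm (V (Suc 0) (y + k) y (V n y r u)) + (err w y (y + k) + err p y (y + k))"
   "err p y (y + k) <= W p (y + k) - W p y" "0 <= err p y (y + k)" "0 <= err w y (y + k)" "0 <= W w (y + k) - W w y" "0 <= W p (y + k) - W p y"
   if y: "y \<in> {r..r + h}" for y
  proof -
   have y0: "0 <= y" using y r by simp
   have W_eq: "W w (y + k) - W w y = err w y (y + k) + norm (R y w (y + k))" "W p (y + k) - W p y = err p y (y + k) + norm (R y p (y + k))"
    using pw(2)[of y k] pp(2)[of y k] y k by (simp_all add: err_def)
   have e: "0 <= err p y (y + k)" "0 <= err w y (y + k)" by (rule err_nonneg[OF p(1,2) y0], rule err_nonneg[OF wD(1,2) y0])
   let ?a = "V (Suc 0) (y + k) y (V n y r u)" and ?b = "R y w (y + k)"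
   have ab: "\<bar>norm ?a - norm ?b\<bar> <= err p y (y + k)" using order_trans[OF norm_triangle_ineq3 st[OF y k]] .
   show "norm ?a <= (W w (y + k) - W w y) + err p y (y + k)" using ab e unfolding W_eq by linarith
   show "W w (y + k) - W w y <= norm ?a + (err w y (y + k) + err p y (y + k))" using ab unfolding W_eq by linarith
   show "err p y (y + k) <= W p (y + k) - W p y" unfolding W_eq by simp
   show "0 <= err p y (y + k)" "0 <= err w y (y + k)" by (fact e)+
   show "0 <= W w (y + k) - W w y" "0 <= W p (y + k) - W p y" unfolding W_eq using e by simp_all
  qed
  have k0: "0 <= k" using k by simp
  have "J k <= (\<integral>\<^sup>+y. ennreal (W w (y + k) - W w y) * indicator {r..r + h} y + ennreal (err p y (y + k)) * indicator {r..r + h} y \<partial>lborel)"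
   unfolding J_def
   by (intro nn_integral_mono) (use y_bounds in \<open>auto simp: indicator_def ennreal_plus[symmetric] intro!: ennreal_leI simp del: ennreal_plus dyson.simps\<close>)
  also have "\<dots> = I w k + Er p k"
   unfolding I_def Er_def by (rule nn_integral_add[OF Wm[OF pw(1) k0 k(2)] Em[OF p(1,2)]])
  finally show JI: "J k <= I w k + Er p k" .
  have "Er p k <= I p k"
   unfolding I_def Er_def
   by (intro nn_integral_mono) (use y_bounds in \<open>auto simp: indicator_def intro!: ennreal_leI\<close>)
  with JI show "J k <= I w k + I p k" by (meson add_left_mono order_trans)
  have Jm: "(\<lambda>y. ennreal (norm (V (Suc 0) (y + k) y (V n y r u))) * indicator {r..r + h} y) \<in> borel_measurable lborel"
  proof -
   have "continuous_on {r..r + h} (\<lambda>y. norm (V (Suc 0) (y + k) y (V n y r u)))"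
    by (intro continuous_on_norm regular_apply_continuous[OF regular_V] regular_cont_comp[OF regular_V] continuous_intros)
     (use r k in auto)
   then have "(\<lambda>y. indicator {r..r + h} y *\<^sub>R norm (V (Suc 0) (y + k) y (V n y r u))) \<in> borel_measurable borel"
    by (intro borel_measurable_continuous_on_indicator) auto
   then have "(\<lambda>y. ennreal (indicator {r..r + h} y *\<^sub>R norm (V (Suc 0) (y + k) y (V n y r u)))) \<in> borel_measurable borel" by measurable
   moreover have "(\<lambda>y. ennreal (indicator {r..r + h} y *\<^sub>R norm (V (Suc 0) (y + k) y (V n y r u))))
     = (\<lambda>y. ennreal (norm (V (Suc 0) (y + k) y (V n y r u))) * indicator {r..r + h} y)"
    by (auto simp: fun_eq_iff indicator_def simp del: dyson.simps)
   ultimately have "(\<lambda>y. ennreal (norm (V (Suc 0) (y + k) y (V n y r u))) * indicator {r..r + h} y) \<in> borel_measurable borel"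
    by (simp only:)
   then show ?thesis unfolding measurable_lborel2 .
  qed
  have "I w k <= (\<integral>\<^sup>+y. ennreal (norm (V (Suc 0) (y + k) y (V n y r u))) * indicator {r..r + h} y
    + (ennreal (err w y (y + k)) * indicator {r..r + h} y + ennreal (err p y (y + k)) * indicator {r..r + h} y) \<partial>lborel)"
   unfolding I_def
   by (intro nn_integral_mono) (use y_bounds in \<open>auto simp: indicator_def ennreal_plus[symmetric] intro!: ennreal_leI simp del: ennreal_plus dyson.simps\<close>)
  also have "\<dots> = J k + (\<integral>\<^sup>+y. ennreal (err w y (y + k)) * indicator {r..r + h} y + ennreal (err p y (y + k)) * indicator {r..r + h} y \<partial>lborel)"
   unfolding J_def by (rule nn_integral_add[OF Jm borel_measurable_add[OF Em[OF wD(1,2)] Em[OF p(1,2)]]])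
  also have "\<dots> = J k + (Er w k + Er p k)"
   unfolding Er_def by (subst nn_integral_add[OF Em[OF wD(1,2)] Em[OF p(1,2)]]) simp
  finally show "I w k <= J k + (Er w k + Er p k)" .
 qed
 have ev1: "\<forall>\<^sub>F k in at_right 0. 0 < k \<and> k <= (1::real)"
  unfolding eventually_at_right_field by (intro exI[of _ 1]) auto
 have W0: "W w r = 0" by (simp add: W_def)
 have "((\<lambda>k. (1 / k) *\<^sub>R integral {r..r + h} (\<lambda>y. W w (y + k) - W w y)) \<longlongrightarrow> W w (r + h) - W w r) (at_right 0)"
  by (rule average_increment[OF pw(1)]) (use h in \<open>auto simp: T_def\<close>)
 then have "((\<lambda>k. ennreal ((1 / k) *\<^sub>R integral {r..r + h} (\<lambda>y. W w (y + k) - W w y))) \<longlongrightarrow> ennreal (W w (r + h))) (at_right 0)"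
  by (intro tendsto_ennrealI) (simp add: W0)
 moreover have "\<forall>\<^sub>F k in at_right 0. ennreal ((1 / k) *\<^sub>R integral {r..r + h} (\<lambda>y. W w (y + k) - W w y)) = I w k / ennreal k"
  using ev1
 proof eventually_elim
  case (elim k)
  have "0 <= integral {r..r + h} (\<lambda>y. W w (y + k) - W w y)"
  proof (rule integral_nonneg)
   show "(\<lambda>y. W w (y + k) - W w y) integrable_on {r..r + h}"
    by (intro integrable_continuous_real continuous_intros continuous_on_compose2[OF pw(1)]) (use elim in \<open>auto simp: T_def\<close>)
   show "0 <= W w (y + k) - W w y" if "y \<in> {r..r + h}" for y
    using pw(2)[of y k] that elim integral_nonneg[OF bochner_borel_integrable_on(3)[OF wD(1)], of y "y + k"] by simp
  qed
  then show ?case using pw(3)[of k] elim by (simp add: divide_ennreal)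
 qed
 ultimately have Ilim: "((\<lambda>k. I w k / ennreal k) \<longlongrightarrow> ennreal (W w (r + h))) (at_right 0)" by (rule Lim_transform_eventually)
 have "((\<lambda>k. J k / ennreal k) \<longlongrightarrow> ennreal (W w (r + h))) (at_right 0)"
 proof (rule tendsto_ennreal_close[OF Ilim])
  show "((\<lambda>k. Er w k / ennreal k + Er p k / ennreal k) \<longlongrightarrow> 0) (at_right 0)"
   using tendsto_add[OF pw(5) pp(5)] by simp
  show "\<forall>\<^sub>F k in at_right 0. J k / ennreal k <= I w k / ennreal k + (Er w k / ennreal k + Er p k / ennreal k)"
   using ev1
  proof eventually_elim
   case (elim k)
   have "J k <= I w k + Er p k" using bounds(1)[of k] elim by simp
   also have "\<dots> <= I w k + (Er w k + Er p k)" by (intro add_left_mono add_increasing) simp_all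
   finally show ?case unfolding add_divide_distrib_ennreal[symmetric] by (rule divide_right_mono_ennreal)
  qed
  show "\<forall>\<^sub>F k in at_right 0. I w k / ennreal k <= J k / ennreal k + (Er w k / ennreal k + Er p k / ennreal k)"
   using ev1
   by eventually_elim (unfold add_divide_distrib_ennreal[symmetric], rule divide_right_mono_ennreal, rule bounds(2), auto)
 qed
 moreover have "cint n (r + h) r u = ennreal (W w (r + h))"
  unfolding W_def by (rule cint_version(2)[OF w]) (simp add: T_def)
 ultimately show "((\<lambda>k. (\<integral>\<^sup>+y. ennreal (norm (V (Suc 0) (y + k) y (V n y r u))) * indicator {r..r + h} y \<partial>lborel) / ennreal k)
   \<longlongrightarrow> cint n (r + h) r u) (at_right 0)"
  by (simp only: J_def)
 show "(\<integral>\<^sup>+y. ennreal (norm (V (Suc 0) (y + k) y (V n y r u))) * indicator {r..r + h} y \<partial>lborel) / ennreal k <= ennreal (2 * norm u)"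
  if k: "0 < k" "k <= 1"
 proof -
  have "J k / ennreal k <= I w k / ennreal k + I p k / ennreal k"
   unfolding add_divide_distrib_ennreal[symmetric] by (rule divide_right_mono_ennreal[OF bounds(3)[OF k]])
  also have "\<dots> <= ennreal (norm u) + ennreal (norm u)"
   by (intro add_mono pw(4)[OF _ k w_int] pp(4)[OF _ k p(5)])
  also have "\<dots> = ennreal (2 * norm u)" by (simp flip: ennreal_plus)
  finally show ?thesis by (simp only: J_def)
 qed
qed

section \<open>Honesty\<close>

lemma B_sum:
 assumes t: "0 <= t" and "finite I" "\<And>i. i \<in> I ==> f i \<in> D t"
 shows "(\<Sum>i\<in>I. f i) \<in> D t \<and> B t (\<Sum>i\<in>I. f i) = (\<Sum>i\<in>I. B t (f i))"
 using assms(2,3)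
proof (induction I rule: finite_induct)
 case empty
 have "0 \<in> D t" by (rule subspace_0[OF dom_subspace[OF t]])
 then show ?case using B_scaleR[OF t, of 0 0] by simp
next
 case (insert i I)
 then show ?case using subspace_add[OF dom_subspace[OF t]] B_add[OF t] by simp
qed

lemma V_dom:
 assumes s: "0 <= s" "s <= T" and u: "0 <= u"
 shows "AE \<tau> in lborel. \<tau> \<in> {s..T} --> V n \<tau> s u \<in> D \<tau>"
proof (cases n)
 case 0
 show ?thesis using BU_dom'[OF s(1), of u] by eventually_elim (simp add: 0)
next
 case (Suc m)
 obtain p where p: "B_version s T u m p" by (rule B_version_ex[OF s u])
 obtain w where "AE r in lborel. r \<in> {s..T} --> R s p r \<in> D r \<and> B r (R s p r) = w r"
  by (rule B_conv[OF B_versionD(1,2)[OF p] s]) (rule that)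
 then show ?thesis
  by eventually_elim (use V_Suc_eq_R[OF s u p] in \<open>simp add: Suc del: dyson.simps\<close>)
qed

text \<open>After time \<open>r\<close> the composition law splits \<open>V N \<tau> s u\<close> into terms started at \<open>r\<close>, each of which lies in the domain of \<open>B \<tau>\<close> for almost every \<open>\<tau>\<close>.\<close>

lemma cint_compose:
 assumes s: "0 <= s" "s <= r" "r <= t" and u: "0 <= u"
 shows "cint N t s u <= cint N r s u + (\<Sum>j\<le>N. cint (N - j) t r (V j r s u))"
proof -
 have st: "s <= t" and r: "0 <= r" using s by auto
 have Vr: "0 <= V j r s u" for j by (rule regularD(2)[OF regular_V s(1,2) u])
 obtain h where h: "B_version s t u N h" by (rule B_version_ex[OF s(1) st u])
 define v where "v j = (SOME v. B_version r t (V j r s u) (N - j) v)" for j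
 have v: "B_version r t (V j r s u) (N - j) (v j)" for j
 proof -
  have ex: "\<exists>g. B_version r t (V j r s u) (N - j) g" by (rule B_version_ex[OF r s(3) Vr]) (rule exI)
  show ?thesis unfolding v_def by (rule someI_ex[OF ex])
 qed
 have hm[measurable]: "(\<lambda>\<tau>. norm (h \<tau>)) \<in> borel_measurable borel" by (rule bochner_borelD(3)[OF B_versionD(1)[OF h]])
 have vm[measurable]: "(\<lambda>\<tau>. norm (v j \<tau>)) \<in> borel_measurable borel" for j by (rule bochner_borelD(3)[OF B_versionD(1)[OF v]])
 have "AE \<tau> in lborel. \<forall>j. \<tau> \<in> {r..t} --> V (N - j) \<tau> r (V j r s u) \<in> D \<tau> \<and> B \<tau> (V (N - j) \<tau> r (V j r s u)) = v j \<tau>"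
  unfolding AE_all_countable
 proof
  fix j
  show "AE \<tau> in lborel. \<tau> \<in> {r..t} --> V (N - j) \<tau> r (V j r s u) \<in> D \<tau> \<and> B \<tau> (V (N - j) \<tau> r (V j r s u)) = v j \<tau>"
   using V_dom[OF r s(3) Vr[of j], of "N - j"] B_versionD(4)[OF v[of j]] by eventually_elim blast
 qed
 then have ae: "AE \<tau> in lborel. \<tau> \<in> {r..t} --> h \<tau> = (\<Sum>j\<le>N. v j \<tau>)"
  using B_versionD(4)[OF h]
 proof eventually_elim
  case (elim \<tau>)
  show ?case
  proof
   assume \<tau>: "\<tau> \<in> {r..t}"
   have "h \<tau> = B \<tau> (\<Sum>j\<le>N. V (N - j) \<tau> r (V j r s u))"
    using elim(2) \<tau> s V_compose[OF s(1,2), of \<tau> N u] by simp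
   also have "\<dots> = (\<Sum>j\<le>N. B \<tau> (V (N - j) \<tau> r (V j r s u)))"
    using B_sum[of \<tau> "{..N}" "\<lambda>j. V (N - j) \<tau> r (V j r s u)"] elim(1) \<tau> r by simp
   also have "\<dots> = (\<Sum>j\<le>N. v j \<tau>)" using elim(1) \<tau> by simp
   finally show "h \<tau> = (\<Sum>j\<le>N. v j \<tau>)" .
  qed
 qed
 have "cint N t s u = (\<integral>\<^sup>+\<tau>. ennreal (norm (h \<tau>)) * indicator {s..t} \<tau> \<partial>lborel)"
  by (rule cint_version(1)[OF h order_refl])
 also have "\<dots> <= (\<integral>\<^sup>+\<tau>. ennreal (norm (h \<tau>)) * indicator {s..r} \<tau> + (\<Sum>j\<le>N. ennreal (norm (v j \<tau>)) * indicator {r..t} \<tau>) \<partial>lborel)"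
 proof (rule nn_integral_mono_AE, use ae in eventually_elim)
  fix \<tau> assume eq: "\<tau> \<in> {r..t} --> h \<tau> = (\<Sum>j\<le>N. v j \<tau>)"
  show "ennreal (norm (h \<tau>)) * indicator {s..t} \<tau> <= ennreal (norm (h \<tau>)) * indicator {s..r} \<tau> + (\<Sum>j\<le>N. ennreal (norm (v j \<tau>)) * indicator {r..t} \<tau>)"
  proof (cases "\<tau> \<in> {r..t}")
   case True
   have "ennreal (norm (h \<tau>)) <= ennreal (\<Sum>j\<le>N. norm (v j \<tau>))"
    using eq True by (intro ennreal_leI) (simp add: norm_sum)
   also have "\<dots> = (\<Sum>j\<le>N. ennreal (norm (v j \<tau>)))" by (rule sum_ennreal[symmetric]) simp
   finally show ?thesis using True s by (simp add: indicator_def add_increasing)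
  next
   case False
   then have "indicator {s..t} \<tau> <= (indicator {s..r} \<tau> :: ennreal)" by (auto simp: indicator_def)
   then show ?thesis by (intro add_increasing2 mult_left_mono) auto
  qed
 qed
 also have "\<dots> = (\<integral>\<^sup>+\<tau>. ennreal (norm (h \<tau>)) * indicator {s..r} \<tau> \<partial>lborel) + (\<integral>\<^sup>+\<tau>. (\<Sum>j\<le>N. ennreal (norm (v j \<tau>)) * indicator {r..t} \<tau>) \<partial>lborel)"
  by (rule nn_integral_add) measurable
 also have "(\<integral>\<^sup>+\<tau>. (\<Sum>j\<le>N. ennreal (norm (v j \<tau>)) * indicator {r..t} \<tau>) \<partial>lborel) = (\<Sum>j\<le>N. \<integral>\<^sup>+\<tau>. ennreal (norm (v j \<tau>)) * indicator {r..t} \<tau> \<partial>lborel)"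
  by (rule nn_integral_sum) measurable
 finally show ?thesis
  by (simp only: cint_version(1)[OF h s(3)] cint_version(1)[OF v order_refl])
qed

text \<open>The norm of \<open>BPhi\<close> is the limit of \<open>norm (TN 1 k (Phi n h g)) / k\<close>. By additivity of the norm this is an integral over the time \<open>s\<close> from \<open>0\<close> to \<open>h\<close> and over the starting time \<open>r\<close>; Tonelli's theorem brings the integral over \<open>s\<close> inside, where its limit is known.\<close>

lemma norm_BPhi_eq_cint:
 assumes F: "L1_rep F" "\<And>x. 0 <= F x" and h: "0 <= h"
 shows "(\<lambda>r. cint n (r + h) r (F r) * indicator {0..} r) \<in> borel_measurable borel"
  and "ennreal (norm (BPhi n h (abs_L1 F))) = (\<integral>\<^sup>+r. cint n (r + h) r (F r) * indicator {0..} r \<partial>lborel)"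
proof -
 let ?g = "abs_L1 F" and ?V1 = "V (Suc 0)"
 have g: "0 <= ?g" by (rule abs_L1_nonneg[OF F])
 define Q where "Q k z = norm (?V1 (max 0 (fst z) + max 0 (snd z) + k) (max 0 (fst z) + max 0 (snd z))
   (V n (max 0 (fst z) + max 0 (snd z)) (max 0 (fst z)) (F (fst z))))" for k and z :: "real \<times> real"
 have Qm: "Q k \<in> borel_measurable borel" if k: "0 <= k" for k
  unfolding Q_def[abs_def]
 proof (rule strongly_borel_norm, rule strongly_borel_regular[OF regular_V _ _ _ _ strongly_borel_regular[OF regular_V]])
  show "strongly_borel borel (\<lambda>z::real \<times> real. F (fst z))"
   by (rule strongly_borel_compose[OF bochner_borelD(1)[OF L1_repD(1)[OF F(1)]]]) (intro borel_measurable_continuous_onI continuous_intros)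
 qed (use k in \<open>auto intro!: continuous_intros\<close>)
 define G where "G k r = (\<integral>\<^sup>+s. ennreal (Q k (r, s)) * indicator {0..} r * indicator {0..h} s \<partial>lborel)" for k r
 have m2: "(\<lambda>z. ennreal (Q k z) * indicator {0..} (fst z) * indicator {0..h} (snd z)) \<in> borel_measurable (lborel \<Otimes>\<^sub>M lborel)" if k: "0 <= k" for k
 proof (rule borel_pair_lborel)
  have "(\<lambda>z::real\<times>real. indicator {0..} (fst z) :: ennreal) \<in> borel_measurable borel" "(\<lambda>z::real\<times>real. indicator {0..h} (snd z) :: ennreal) \<in> borel_measurable borel"
   by (rule measurable_compose[of fst _ borel] measurable_compose[of snd _ borel]; auto intro!: borel_measurable_continuous_onI continuous_intros)+
  then show "(\<lambda>z. ennreal (Q k z) * indicator {0..} (fst z) * indicator {0..h} (snd z)) \<in> borel_measurable borel"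
   using Qm[OF k] by measurable
 qed
 have Gm: "G k \<in> borel_measurable lborel" if k: "0 <= k" for k
  unfolding G_def[abs_def]
  by (rule lborel.borel_measurable_nn_integral) (use m2[OF k] in \<open>simp add: case_prod_unfold\<close>)
 have A: "ennreal (norm (TN (Suc 0) k (TN n s ?g))) = (\<integral>\<^sup>+r. ennreal (Q k (r, s)) * indicator {0..} r \<partial>lborel)"
  if k: "0 <= k" and s: "0 <= s" for k s
 proof -
  let ?Z = "shift ?V1 k (shift (V n) s F)"
  have r1: "L1_rep (shift (V n) s F)" by (rule shift_rep[OF admissible_V s F(1)])
  have r2: "L1_rep ?Z" by (rule shift_rep[OF admissible_V k r1])
  have "ennreal (norm (TN (Suc 0) k (TN n s ?g))) = ennreal (norm (abs_L1 ?Z))"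
   by (simp only: TN_abs[OF s F(1)] TN_abs[OF k r1])
  also have "\<dots> = (\<integral>\<^sup>+x. ennreal (norm (?Z x)) \<partial>lborel)" by (rule norm_abs_L1[OF r2])
  also have "\<dots> = (\<integral>\<^sup>+r. ennreal (norm (?Z (r - (- (s + k))))) \<partial>lborel)"
   by (rule nn_integral_translate[symmetric]) (use bochner_borelD(3)[OF L1_repD(1)[OF r2]] in measurable)
  also have "\<dots> = (\<integral>\<^sup>+r. ennreal (Q k (r, s)) * indicator {0..} r \<partial>lborel)"
  proof (rule nn_integral_cong)
   fix r
   have "?V1 (r + (s + k)) (r + s) 0 = 0" if "0 <= r + s"
    by (rule linear_0[OF regularD(1)[OF regular_V]]) (use that k in auto)
   then have "?Z (r + (s + k)) = (if 0 <= r then ?V1 (r + s + k) (r + s) (V n (r + s) r (F r)) else 0)"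
    using k s by (simp add: shift_def algebra_simps del: dyson.simps)
   then show "ennreal (norm (?Z (r - (- (s + k))))) = ennreal (Q k (r, s)) * indicator {0..} r"
    using s by (simp add: Q_def algebra_simps del: dyson.simps)
  qed
  finally show ?thesis .
 qed
 have "ennreal (norm (TN (Suc 0) k (Phi n h ?g))) = (\<integral>\<^sup>+r. G k r \<partial>lborel)" if k: "0 <= k" for k
 proof -
  have int: "TN (Suc 0) k (Phi n h ?g) = integral {0..h} (\<lambda>s. TN (Suc 0) k (TN n s ?g))"
   unfolding Phi_def by (rule integral_bounded_linear(1)[OF TN_integrable[OF order_refl] TN_bounded_linear[OF k], symmetric])
  have "norm (TN (Suc 0) k (Phi n h ?g)) = integral {0..h} (\<lambda>s. norm (TN (Suc 0) k (TN n s ?g)))"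
   unfolding int
   by (rule X.norm_integral_cone[OF integral_bounded_linear(2)[OF TN_integrable[OF order_refl] TN_bounded_linear[OF k]]])
    (use TN_cone(1) g k in auto)
  then have "ennreal (norm (TN (Suc 0) k (Phi n h ?g))) = ennreal (integral {0..h} (\<lambda>s. norm (TN (Suc 0) k (TN n s ?g))))" by simp
  also have "\<dots> = (\<integral>\<^sup>+s. ennreal (norm (TN (Suc 0) k (TN n s ?g))) * indicator {0..h} s \<partial>lborel)"
   by (rule nn_integral_continuous_interval[symmetric])
    (auto intro!: continuous_on_norm bounded_linear.continuous_on[OF TN_bounded_linear[OF k]] continuous_on_subset[OF TN_continuous])
  also have "\<dots> = (\<integral>\<^sup>+s. (\<integral>\<^sup>+r. ennreal (Q k (r, s)) * indicator {0..} r * indicator {0..h} s \<partial>lborel) \<partial>lborel)"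
  proof (rule nn_integral_cong)
   fix s
   show "ennreal (norm (TN (Suc 0) k (TN n s ?g))) * indicator {0..h} s = (\<integral>\<^sup>+r. ennreal (Q k (r, s)) * indicator {0..} r * indicator {0..h} s \<partial>lborel)"
    by (cases "s \<in> {0..h}") (simp_all add: A[OF k])
  qed
  also have "\<dots> = (\<integral>\<^sup>+r. (\<integral>\<^sup>+s. ennreal (Q k (r, s)) * indicator {0..} r * indicator {0..h} s \<partial>lborel) \<partial>lborel)"
   by (rule lborel_pair.Fubini') (use m2[OF k] in \<open>simp add: case_prod_unfold\<close>)
  finally show ?thesis by (simp only: G_def)
 qed
 note norm_G = this
 have G_eq: "G k r = (\<integral>\<^sup>+y. ennreal (norm (?V1 (y + k) y (V n y r (F r)))) * indicator {r..r + h} y \<partial>lborel)"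
  if k: "0 <= k" and r: "0 <= r" for k r
 proof -
  have Qr: "(\<lambda>s. Q k (r, s)) \<in> borel_measurable borel"
   by (rule measurable_compose[OF _ Qm[OF k]]) (intro borel_measurable_continuous_onI continuous_intros)
  have "G k r = (\<integral>\<^sup>+s. ennreal (Q k (r, s)) * indicator {0..h} s \<partial>lborel)" using r by (simp add: G_def)
  also have "\<dots> = (\<integral>\<^sup>+y. ennreal (Q k (r, y - r)) * indicator {0..h} (y - r) \<partial>lborel)"
   by (rule nn_integral_translate[symmetric]) (use Qr in measurable)
  also have "\<dots> = (\<integral>\<^sup>+y. ennreal (norm (?V1 (y + k) y (V n y r (F r)))) * indicator {r..r + h} y \<partial>lborel)"
   by (intro nn_integral_cong) (use r in \<open>auto simp: Q_def indicator_def simp del: dyson.simps\<close>)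
  finally show ?thesis .
 qed
 have G_neg: "G k r = 0" if "\<not> 0 <= r" for k r using that by (simp add: G_def)
 define kn where "kn i = inverse (real (Suc i))" for i
 have kn: "0 < kn i" "kn i <= 1" for i by (auto simp: kn_def field_simps)
 have kn_lim: "filterlim kn (at_right 0) sequentially"
  using LIMSEQ_inverse_real_of_nat kn(1) unfolding kn_def[abs_def]
  by (intro tendsto_imp_filterlim_at_right) auto
 have lim: "(\<lambda>i. G (kn i) r / ennreal (kn i)) \<longlonglongrightarrow> cint n (r + h) r (F r) * indicator {0..} r" for r
 proof (cases "0 <= r")
  case True
  show ?thesis
   using filterlim_compose[OF cint_as_limit(1)[OF True h F(2)[of r], of n] kn_lim] True
   by (simp add: G_eq[OF less_imp_le[OF kn(1)] True] del: dyson.simps)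
 qed (simp add: G_neg)
 have Gd: "(\<lambda>r. G (kn i) r / ennreal (kn i)) \<in> borel_measurable lborel" for i
  using Gm[of "kn i"] kn(1)[of i] by (simp add: divide_ennreal_def)
 show m: "(\<lambda>r. cint n (r + h) r (F r) * indicator {0..} r) \<in> borel_measurable borel"
  using borel_measurable_LIMSEQ_order[OF lim Gd] by simp
 have fin: "(\<integral>\<^sup>+r. ennreal (2 * norm (F r)) \<partial>lborel) < \<infinity>" "(\<lambda>r. ennreal (2 * norm (F r))) \<in> borel_measurable lborel"
  using bochner_borelD(2,3)[OF bochner_borel_linear[OF L1_repD(1)[OF F(1)] bounded_linear_scaleR_right[of 2]]] by simp_all
 have c1: "(\<lambda>i. \<integral>\<^sup>+r. G (kn i) r / ennreal (kn i) \<partial>lborel) \<longlonglongrightarrow> (\<integral>\<^sup>+r. cint n (r + h) r (F r) * indicator {0..} r \<partial>lborel)"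
 proof (rule nn_integral_dominated_convergence[where w="\<lambda>r. ennreal (2 * norm (F r))"])
  show "AE r in lborel. G (kn i) r / ennreal (kn i) <= ennreal (2 * norm (F r))" for i
  proof (rule AE_I2)
   fix r show "G (kn i) r / ennreal (kn i) <= ennreal (2 * norm (F r))"
   proof (cases "0 <= r")
    case True
    show ?thesis
     using cint_as_limit(2)[OF True h F(2)[of r] kn, of i n] unfolding G_eq[OF less_imp_le[OF kn(1)] True] .
   qed (simp add: G_neg)
  qed
 qed (use Gd m fin lim in simp_all)
 have c2: "(\<lambda>i. \<integral>\<^sup>+r. G (kn i) r / ennreal (kn i) \<partial>lborel) = (\<lambda>i. ennreal (norm ((1 / kn i) *\<^sub>R TN (Suc 0) (kn i) (Phi n h ?g))))"
 proof
  fix i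
  have "(\<integral>\<^sup>+r. G (kn i) r / ennreal (kn i) \<partial>lborel) = (\<integral>\<^sup>+r. G (kn i) r \<partial>lborel) / ennreal (kn i)"
   by (rule nn_integral_divide) (use Gm[of "kn i"] kn(1)[of i] in simp)
  also have "\<dots> = ennreal (norm (TN (Suc 0) (kn i) (Phi n h ?g))) / ennreal (kn i)"
   by (simp only: norm_G[OF less_imp_le[OF kn(1)]])
  also have "\<dots> = ennreal (norm (TN (Suc 0) (kn i) (Phi n h ?g)) / kn i)"
   by (rule divide_ennreal[OF norm_ge_zero kn(1)])
  also have "norm (TN (Suc 0) (kn i) (Phi n h ?g)) / kn i = norm ((1 / kn i) *\<^sub>R TN (Suc 0) (kn i) (Phi n h ?g))"
   using kn(1)[of i] by simp
  finally show "(\<integral>\<^sup>+r. G (kn i) r / ennreal (kn i) \<partial>lborel) = ennreal (norm ((1 / kn i) *\<^sub>R TN (Suc 0) (kn i) (Phi n h ?g)))" .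
 qed
 have c3: "(\<lambda>i. ennreal (norm ((1 / kn i) *\<^sub>R TN (Suc 0) (kn i) (Phi n h ?g)))) \<longlonglongrightarrow> ennreal (norm (BPhi n h ?g))"
  by (intro tendsto_ennrealI tendsto_norm filterlim_compose[OF BPhi_tendsto[OF h] kn_lim])
 show "ennreal (norm (BPhi n h ?g)) = (\<integral>\<^sup>+r. cint n (r + h) r (F r) * indicator {0..} r \<partial>lborel)"
  by (rule LIMSEQ_unique[OF c3 c1[unfolded c2]])
qed

lemma beta_eq_0_if:
 assumes lim: "\<And>u s t. 0 <= u ==> 0 <= s ==> s <= t ==> (\<lambda>n. cint n t s u) \<longlonglongrightarrow> 0"
  and f: "0 <= f" and h: "0 <= h"
 shows "beta h f = 0"
proof -
 obtain F where F: "L1_rep F" "f = abs_L1 F" "\<And>x. 0 <= F x" by (rule L1_rep_cone[OF f]) (rule that)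
 note c = norm_BPhi_eq_cint[OF F(1,3) h]
 have "(\<lambda>n. \<integral>\<^sup>+r. cint n (r + h) r (F r) * indicator {0..} r \<partial>lborel) \<longlonglongrightarrow> (\<integral>\<^sup>+(r::real). 0 \<partial>lborel)"
 proof (rule nn_integral_dominated_convergence[where w="\<lambda>r. ennreal (norm (F r))"])
  show "AE r in lborel. cint n (r + h) r (F r) * indicator {0..} r <= ennreal (norm (F r))" for n
   by (intro AE_I2) (use cint_le(2)[OF _ _ F(3)] h in \<open>auto simp: indicator_def\<close>)
  show "AE r in lborel. (\<lambda>n. cint n (r + h) r (F r) * indicator {0..} r) \<longlonglongrightarrow> 0"
  proof (rule AE_I2)
   fix r show "(\<lambda>n. cint n (r + h) r (F r) * indicator {0..} r) \<longlonglongrightarrow> 0"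
    using lim[OF F(3), of r "r + h" r] h by (cases "0 <= r") simp_all
  qed
 qed (use c(1) bochner_borelD(2,3)[OF L1_repD(1)[OF F(1)]] in simp_all)
 then have "(\<lambda>n. ennreal (norm (BPhi n h f))) \<longlonglongrightarrow> ennreal 0" by (simp add: c(2)[symmetric] F(2)[symmetric])
 then have "(\<lambda>n. norm (BPhi n h f)) \<longlonglongrightarrow> 0" by (rule tendsto_ennrealD) (auto intro!: always_eventually)
 then show ?thesis by (rule LIMSEQ_unique[OF beta_cone(1)[OF h f]])
qed

text \<open>The integrals over \<open>r\<close> tend to \<open>0\<close> and the integrands decrease with \<open>n\<close>.\<close>

lemma cint_tendsto_0_AE:
 assumes beta: "\<And>f. 0 <= f ==> beta h f = 0" and h: "0 <= h" and F: "L1_rep F" "\<And>x. 0 <= F x"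
 shows "AE r in lborel. 0 <= r --> (\<lambda>n. cint n (r + h) r (F r)) \<longlonglongrightarrow> 0"
proof -
 note c = norm_BPhi_eq_cint[OF F h]
 have f: "0 <= abs_L1 F" by (rule abs_L1_nonneg[OF F])
 define L where "L r = (INF n. cint n (r + h) r (F r) * indicator {0..} r)" for r
 have Lm: "L \<in> borel_measurable lborel"
  unfolding L_def[abs_def] by (rule borel_measurable_INF) (use c(1) in simp_all)
 have "(\<lambda>n. norm (BPhi n h (abs_L1 F))) \<longlonglongrightarrow> 0" using beta_cone(1)[OF h f] beta[OF f] by simp
 then have "(\<lambda>n. ennreal (norm (BPhi n h (abs_L1 F)))) \<longlonglongrightarrow> ennreal 0" by (rule tendsto_ennrealI)
 then have "(\<integral>\<^sup>+r. L r \<partial>lborel) <= ennreal 0"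
 proof (rule LIMSEQ_le_const, intro exI allI impI)
  show "(\<integral>\<^sup>+r. L r \<partial>lborel) <= ennreal (norm (BPhi n h (abs_L1 F)))" for n
   unfolding c(2) by (intro nn_integral_mono) (auto simp: L_def intro: INF_lower)
 qed
 then have "AE r in lborel. L r = 0" by (simp add: nn_integral_0_iff_AE[OF Lm])
 then show ?thesis
 proof eventually_elim
  case (elim r)
  show ?case
  proof
   assume r: "0 <= r"
   have "decseq (\<lambda>n. cint n (r + h) r (F r))" by (intro decseq_SucI cint_Suc) (use r h F(2) in auto)
   then have "(\<lambda>n. cint n (r + h) r (F r)) \<longlonglongrightarrow> (INF n. cint n (r + h) r (F r))" by (rule LIMSEQ_INF)
   then show "(\<lambda>n. cint n (r + h) r (F r)) \<longlonglongrightarrow> 0" using elim r by (simp add: L_def)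
  qed
 qed
qed

lemma cint_sum_tendsto_0:
 assumes lim: "\<And>j. (\<lambda>n. cint n t r (V j r s u)) \<longlonglongrightarrow> 0" and s: "0 <= s" "s <= r" "r <= t" and u: "0 <= u"
 shows "(\<lambda>N. \<Sum>j\<le>N. cint (N - j) t r (V j r s u)) \<longlonglongrightarrow> 0"
proof -
 have r: "0 <= r" using s by simp
 have Vr: "0 <= V j r s u" for j by (rule regularD(2)[OF regular_V s(1,2) u])
 define c where "c n j = enn2real (cint n t r (V j r s u))" for n j
 have c: "cint n t r (V j r s u) = ennreal (c n j)" "c n j <= norm (V j r s u)" "0 <= c n j" for n j
 proof -
  have le: "cint n t r (V j r s u) <= ennreal (norm (V j r s u))" by (rule cint_le(2)[OF r s(3) Vr])
  then have "cint n t r (V j r s u) < top" by (rule le_less_trans) simp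
  then show eq: "cint n t r (V j r s u) = ennreal (c n j)" by (simp add: c_def)
  show "0 <= c n j" by (simp add: c_def)
  show "c n j <= norm (V j r s u)" using le unfolding eq by simp
 qed
 define a where "a j N = (if j <= N then c (N - j) j else 0)" for j N
 have "a j \<longlonglongrightarrow> 0" for j
 proof (rule LIMSEQ_offset[of _ j])
  have "(\<lambda>N. ennreal (c N j)) \<longlonglongrightarrow> ennreal 0" using lim[of j] by (simp add: c(1))
  then have "(\<lambda>N. c N j) \<longlonglongrightarrow> 0" by (rule tendsto_ennrealD) (auto intro!: always_eventually c(3))
  then show "(\<lambda>N. a j (N + j)) \<longlonglongrightarrow> 0" by (simp add: a_def)
 qed
 moreover have "\<forall>\<^sub>F (j, N) in sequentially \<times>\<^sub>F sequentially. norm (a j N) <= norm (V j r s u)"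
  by (intro always_eventually) (auto simp: a_def c(2,3))
 ultimately have "(\<lambda>N. \<Sum>j. a j N) \<longlonglongrightarrow> (\<Sum>j. 0)"
  using tannerys_theorem[of a "\<lambda>j. 0" sequentially "\<lambda>j. norm (V j r s u)"] V_summable_norm[OF s(1,2), of u]
  by simp
 moreover have "(\<Sum>j. a j N) = (\<Sum>j\<le>N. c (N - j) j)" for N
  by (subst suminf_finite[of "{..N}"]) (auto simp: a_def)
 ultimately have "(\<lambda>N. ennreal (\<Sum>j\<le>N. c (N - j) j)) \<longlonglongrightarrow> ennreal 0" by (intro tendsto_ennrealI) simp
 then show ?thesis by (simp add: c(1) sum_ennreal c(3))
qed

text \<open>Almost every \<open>r\<close> slightly later than \<open>s\<close> is good for all vectors \<open>V j r s u\<close>, as these form integrable functions of \<open>r\<close>. Starting at \<open>s\<close> instead of \<open>r\<close> costs at most the mass \<open>norm u - norm (U r s u)\<close>, which is small by continuity.\<close>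

lemma cint_tendsto_0:
 assumes beta: "\<And>f h. 0 <= f ==> 0 <= h ==> beta h f = 0"
  and u: "0 <= u" and s: "0 <= s" "s < t"
 shows "(\<lambda>n. cint n t s u) \<longlonglongrightarrow> 0"
proof (rule tendsto_ennreal_0I)
 fix e :: real assume e: "0 < e"
 have t: "0 <= t" using s by simp
 have Vr: "0 <= V j r s u" if "s <= r" for j r by (rule regularD(2)[OF regular_V s(1) that u])
 define F where "F j r = (if r \<in> {s..s + 1} then V j r s u else 0)" for j r
 have F: "L1_rep (F j)" "0 <= F j r" for j r
 proof -
  have "bochner_borel (F j)"
   unfolding F_def by (intro bochner_borel_continuous regular_cont_comp[OF regular_V] continuous_intros) (use s in auto)
  then show "L1_rep (F j)" using s by (simp add: L1_rep_def F_def)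
  show "0 <= F j r" using Vr[of r j] by (simp add: F_def)
 qed
 have "AE r in lborel. \<forall>j. 0 <= r --> (\<lambda>n. cint n (r + t) r (F j r)) \<longlonglongrightarrow> 0"
  unfolding AE_all_countable using cint_tendsto_0_AE[OF beta[OF _ t] t F] by blast
 then obtain N where N: "{r \<in> space lborel. \<not> (\<forall>j. 0 <= r --> (\<lambda>n. cint n (r + t) r (F j r)) \<longlonglongrightarrow> 0)} \<subseteq> N" "emeasure lborel N = 0" "N \<in> sets lborel"
  by (rule AE_E)
 have l2: "(\<lambda>i. s + inverse (real (Suc i))) \<longlonglongrightarrow> s + 0" by (intro tendsto_add tendsto_const LIMSEQ_inverse_real_of_nat)
 have "(\<lambda>i. norm u - norm (U (s + inverse (real (Suc i))) s u)) \<longlonglongrightarrow> norm u - norm (U (s + 0) s u)"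
 proof (intro tendsto_diff tendsto_const tendsto_norm)
  have "continuous_on {s..} (\<lambda>r. U r s u)"
   by (intro regular_cont_comp[OF regular_U] continuous_intros) (use s in auto)
  then show "(\<lambda>i. U (s + inverse (real (Suc i))) s u) \<longlonglongrightarrow> U (s + 0) s u"
   by (rule continuous_on_tendsto_compose[OF _ l2]) auto
 qed
 then have lim_s: "(\<lambda>i. norm u - norm (U (s + inverse (real (Suc i))) s u)) \<longlonglongrightarrow> 0" using U_refl[OF s(1)] by simp
 have "\<forall>\<^sub>F i in sequentially. norm u - norm (U (s + inverse (real (Suc i))) s u) < e / 2 \<and> s + inverse (real (Suc i)) < t"
  using order_tendstoD(2)[OF lim_s, of "e / 2"] order_tendstoD(2)[OF l2, of t] e s by (simp add: eventually_conj_iff)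
 then obtain i where i: "norm u - norm (U (s + inverse (real (Suc i))) s u) < e / 2" "s + inverse (real (Suc i)) < t"
  unfolding eventually_sequentially by blast
 let ?b = "s + inverse (real (Suc i))"
 have b1: "inverse (real (Suc i)) <= 1" "0 < inverse (real (Suc i))" by (auto simp: field_simps)
 have "\<exists>r\<in>{s<..<?b}. r \<notin> N"
 proof (rule ccontr)
  assume "\<not> ?thesis"
  then have "emeasure lborel {s<..<?b} <= emeasure lborel N" using N(3) by (intro emeasure_mono) auto
  then show False using N(2) b1(2) by (simp add: ennreal_eq_0_iff del: of_nat_Suc)
 qed
 then obtain r where r: "s < r" "r < ?b" "r \<notin> N" by auto
 have rt: "r <= t" "s <= r" using r i(2) by auto
 have good: "(\<lambda>n. cint n t r (V j r s u)) \<longlonglongrightarrow> 0" for j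
 proof (rule tendsto_sandwich[OF _ _ tendsto_const])
  have "r \<notin> {r \<in> space lborel. \<not> (\<forall>j. 0 <= r --> (\<lambda>n. cint n (r + t) r (F j r)) \<longlonglongrightarrow> 0)}"
   using N(1) r(3) by blast
  then have "\<forall>j. 0 <= r --> (\<lambda>n. cint n (r + t) r (F j r)) \<longlonglongrightarrow> 0" by simp
  then show "(\<lambda>n. cint n (r + t) r (F j r)) \<longlonglongrightarrow> 0" using r(1) s by simp
  have "F j r = V j r s u" using r b1(1) by (simp add: F_def)
  then show "\<forall>\<^sub>F n in sequentially. cint n t r (V j r s u) <= cint n (r + t) r (F j r)"
   using cint_mono[of t "r + t"] s r by (intro always_eventually) simp
 qed simp
 have "\<forall>\<^sub>F n in sequentially. (\<Sum>j\<le>n. cint (n - j) t r (V j r s u)) < ennreal (e / 2)"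
  by (rule order_tendstoD(2)[OF cint_sum_tendsto_0[OF good s(1) rt(2,1) u]]) (use e in simp)
 then show "\<forall>\<^sub>F n in sequentially. cint n t s u <= ennreal e"
 proof eventually_elim
  case (elim n)
  have "cint n t s u <= cint n ?b s u + (\<Sum>j\<le>n. cint (n - j) t r (V j r s u))"
   using order_trans[OF cint_compose[OF s(1) rt(2,1) u, of n] add_right_mono[OF cint_mono[of r ?b n s u]]] r by simp
  also have "\<dots> <= ennreal (norm u - norm (U ?b s u)) + ennreal (e / 2)"
   by (rule add_mono[OF cint_le(1)[OF s(1) _ u] less_imp_le[OF elim]]) (use b1 in simp)
  also have "\<dots> <= ennreal (e / 2) + ennreal (e / 2)" using i(1) by (intro add_mono ennreal_leI) auto
  also have "\<dots> = ennreal e" using e by (simp flip: ennreal_plus)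
  finally show ?case .
 qed
qed

lemma honest_iff:
 "honest_evolution_family U B \<longleftrightarrow> (\<forall>u\<ge>0. \<forall>s\<ge>0. \<forall>t\<ge>s. (\<lambda>n. cint n t s u) \<longlonglongrightarrow> 0)"
 unfolding honest_iff_beta
proof
 assume beta: "\<forall>f\<ge>0. \<forall>t\<ge>0. beta t f = 0"
 show "\<forall>u\<ge>0. \<forall>s\<ge>0. \<forall>t\<ge>s. (\<lambda>n. cint n t s u) \<longlonglongrightarrow> 0"
 proof (intro allI impI)
  fix u :: 'a and s t :: real assume *: "0 <= u" "0 <= s" "s <= t"
  show "(\<lambda>n. cint n t s u) \<longlonglongrightarrow> 0"
  proof (rule tendsto_sandwich[OF _ _ tendsto_const])
   show "(\<lambda>n. cint n (t + 1) s u) \<longlonglongrightarrow> 0" by (rule cint_tendsto_0) (use beta * in auto)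
  qed (auto intro!: always_eventually cint_mono)
 qed
next
 assume "\<forall>u\<ge>0. \<forall>s\<ge>0. \<forall>t\<ge>s. (\<lambda>n. cint n t s u) \<longlonglongrightarrow> 0"
 then show "\<forall>f\<ge>0. \<forall>t\<ge>0. beta t f = 0" by (auto intro: beta_eq_0_if)
qed

end

theorem theorem4p19:
  fixes U :: "real \<Rightarrow> real \<Rightarrow> 'a \<Rightarrow> 'a::{banach, ordered_real_vector}"
    and B :: "real \<Rightarrow> 'a \<Rightarrow> 'a"
    and D :: "real \<Rightarrow> 'a set"
  assumes cone_closed: "closed {u::'a. 0 \<le> u}"
    and cone_generating: "\<And>u::'a. \<exists>v w. 0 \<le> v \<and> 0 \<le> w \<and> u = v - w"
    and norm_additive: "\<And>u v::'a. 0 \<le> u \<Longrightarrow> 0 \<le> v \<Longrightarrow> norm (u + v) = norm u + norm v"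
    and evol: "evolution_family U"
    and dom_subspace: "\<And>t. 0 \<le> t \<Longrightarrow> subspace (D t)"
    and B_add: "\<And>t u v. 0 \<le> t \<Longrightarrow> u \<in> D t \<Longrightarrow> v \<in> D t \<Longrightarrow> B t (u + v) = B t u + B t v"
    and B_scaleR: "\<And>t c u. 0 \<le> t \<Longrightarrow> u \<in> D t \<Longrightarrow> B t (c *\<^sub>R u) = c *\<^sub>R B t u"
    and i: "\<And>t s u. 0 \<le> s \<Longrightarrow> s \<le> t \<Longrightarrow> 0 \<le> u \<Longrightarrow> 0 \<le> U t s u"
    and ii: "\<And>t s u. 0 \<le> s \<Longrightarrow> s \<le> t \<Longrightarrow> 0 \<le> u \<Longrightarrow> norm (U t s u) \<le> norm u"
    and iii: "\<And>t u. 0 \<le> t \<Longrightarrow> u \<in> D t \<Longrightarrow> 0 \<le> u \<Longrightarrow> 0 \<le> B t u"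
    and iv_dom: "\<And>s u. 0 \<le> s \<Longrightarrow> AE t in lebesgue_on {s..}. U t s u \<in> D t"
    and iv_meas: "\<And>s u. 0 \<le> s \<Longrightarrow> strongly_measurable (lebesgue_on {s..}) (\<lambda>t. B t (U t s u))"
    and iv_bound: "\<And>t s u. 0 \<le> s \<Longrightarrow> s \<le> t \<Longrightarrow> 0 \<le> u \<Longrightarrow>
        (\<integral>\<^sup>+\<tau>. ennreal (norm (B \<tau> (U \<tau> s u))) \<partial>lebesgue_on {s..t})
          \<le> ennreal (norm u - norm (U t s u))"
    and v_dom: "\<And>f. bochner_integrable (lebesgue_on {0..}) f \<Longrightarrow>
        AE (t, s) in lebesgue_on {(t, s). 0 \<le> s \<and> s \<le> t}. U t s (f s) \<in> D t"
    and v_meas: "\<And>f. bochner_integrable (lebesgue_on {0..}) f \<Longrightarrow>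
        strongly_measurable (lebesgue_on {(t, s). 0 \<le> s \<and> s \<le> t}) (\<lambda>(t, s). B t (U t s (f s)))"
    and vi: "\<And>t u x. 0 \<le> t \<Longrightarrow> (\<And>n. u n \<in> D t) \<Longrightarrow> (\<And>n. 0 \<le> u n) \<Longrightarrow> incseq u \<Longrightarrow>
        u \<longlonglongrightarrow> x \<Longrightarrow> 0 \<le> x \<Longrightarrow> bdd_above (range (\<lambda>n. norm (B t (u n)))) \<Longrightarrow>
        x \<in> D t \<and> (\<lambda>n. B t (u n)) \<longlonglongrightarrow> B t x"
    and vii_dom: "\<And>f. bochner_integrable (lebesgue_on {(s, r). 0 \<le> r \<and> r \<le> s}) f \<Longrightarrow>
        AE (t, s, r) in lebesgue_on {(t, s, r). 0 \<le> r \<and> r \<le> s \<and> s \<le> t}. U t s (f (s, r)) \<in> D t"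
    and vii_meas: "\<And>f. bochner_integrable (lebesgue_on {(s, r). 0 \<le> r \<and> r \<le> s}) f \<Longrightarrow>
        strongly_measurable (lebesgue_on {(t, s, r). 0 \<le> r \<and> r \<le> s \<and> s \<le> t})
          (\<lambda>(t, s, r). B t (U t s (f (s, r))))"
  shows "honest_evolution_family U B \<longleftrightarrow>
    (\<forall>u\<ge>0. \<forall>s\<ge>0. \<forall>t\<ge>s.
      (\<lambda>n. \<integral>\<^sup>+\<tau>. ennreal (norm (B \<tau> (dyson U B n \<tau> s u))) \<partial>lebesgue_on {s..t}) \<longlonglongrightarrow> 0)"
proof -
  interpret substochastic_perturbation "TYPE('a)" U B D
    by unfold_locales
      (fact cone_closed cone_generating norm_additive evol dom_subspace B_add B_scaleR i ii iii iv_dom iv_meas iv_bound vi)+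
  show ?thesis
    using honest_iff unfolding cint_def .
qed

end
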